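(* Let $n\ge1$, $\hbar>0$ and $f,g\in\mathcal{A}_\hbar$. (i) The $\overline{z}$-Taylor expansion $\Psi:\mathcal{A}_\hbar\to\mathcal{A}_\hbar$, $f\mapsto\Psi_f$, defined by $$\Psi_f(z)=\sum_{I=0}^\infty\frac{1}{I!}\frac{\partial^{|I|}f}{\partial\overline{z}^I}(0)\,\overline{z}^I,$$ is a continuous projection with $\ker\Psi=\mathcal{J}_0$. In fact, $\|\Psi_f\|^{0,\hbar}_{m,\ell,R,S}\le\|f\|^{0,\hbar}_{m,\ell,R,S}$, where equality holds if and only if $f$ is anti-holomorphic. (ii) The quotient $\mathfrak{D}_0=\mathcal{A}_\hbar/\mathcal{J}_0$ is canonically isomorphic as a Fréchet space to the image $\mathfrak{D}=\operatorname{im}\Psi$ of $\Psi$ via $\mathfrak{D}_0\ni[f]\mapsto\Psi_f\in\mathfrak{D}$. In particular, $\|[f]\|^{0,\hbar}_{m,\ell,R,S}=\|\Psi_f\|^{0,\hbar}_{m,\ell,R,S}$. (iii) The space $\mathfrak{D}$ is a dense subspace of the Bargmann-Fock Hilbert space $\mathfrak{H}_{\mathrm{BF}}$. The map $[f]\mapsto\Psi_f$ is an isometry of pre-Hilbert spaces, and the Fréchet topology of $\mathfrak{D}$ is finer than the topology induced from the Hilbert space $\mathfrak{H}_{\mathrm{BF}}$. (iv) The GNS representation on $\mathfrak{D}_0$ induces via $[f]\mapsto\Psi_f$ the Bargmann-Fock representation $\pi$ of $\mathcal{A}_\hbar$ on $\mathfrak{D}$, explicitly given by $$\pi(f)\Psi_g=\sum_{I=0}^\infty\frac{(2\hbar)^{|I|}}{I!}\left(\sum_{J=0}^\infty\frac{1}{J!}\frac{\partial^{|I|+|J|}f}{\partial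 z^I\partial\overline{z}^J}(0)\,\overline{z}^J\right)\frac{\partial^{|I|}\Psi_g}{\partial\overline{z}^I},$$ where both series converge in the topology of $\mathfrak{D}$. (v) The bilinear map $\mathcal{A}_\hbar\times\mathfrak{D}\ni(f,\Psi_g)\mapsto\pi(f)\Psi_g\in\mathfrak{D}$ is continuous with respect to the Fréchet topologies of $\mathcal{A}_\hbar$ and $\mathfrak{D}$, respectively.
   Context: Conventions: $\mathbb{N}=\{0,1,2,\dots\}$; $z=(z^1,\dots,z^n)$ are the standard holomorphic coordinates on $\mathbb{C}^n$; multiindex notation is the usual componentwise one; $\sum_{N=0}^\infty$ means summation over $N\in\mathbb{N}^n$ and $\sum_{I=0}^R$ summation over $I\in\mathbb{N}^n$ with $I\le R$. The seminorm parameters are $m\in\mathbb{N}$, $\ell\in\{0,\dots,2^m-1\}$, $R,S\in\mathbb{N}^n$. For $p\in\mathbb{C}^n$, $f\in C^\infty(\mathbb{C}^n)$ and such $m,\ell,R,S$ define recursively, with values in $[0,+\infty]$, $$h^{p,\hbar}_{0,0,R,S}(f)=\sum_{N=0}^\infty\frac{(2\hbar)^{|R|+|S|+|N|}}{N!}\left|\frac{\partial^{|R|+|S|+|N|}f}{\partial z^R\partial\overline{z}^{N+S}}(p)\right|^2,$$ and for $m\ge1$ $$h^{p,\hbar}_{m,\ell,R,S}(f)=\sum_{N=0}^\infty\frac1{N!}\Big(\sum_{I=0}^R\sum_{J=0}^{N+S}\tbinom{R}{I}\tbinom{N+S}{J}h^{p,\hbar}_{m-1,\ell/2,I,J}(f)\Big)^2\quad(\ell\text{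 even}),$$ $$h^{p,\hbar}_{m,\ell,R,S}(f)=\sum_{N=0}^\infty\frac1{N!}\Big(\sum_{I=0}^R\sum_{J=0}^{N+S}\tbinom{R}{I}\tbinom{N+S}{J}h^{p,\hbar}_{m-1,(\ell-1)/2,J,I}(f)\Big)^2\quad(\ell\text{ odd}).$$ Put $\|f\|^{p,\hbar}_{m,\ell,R,S}=\big(h^{p,\hbar}_{m,\ell,R,S}(f)\big)^{1/2^{m+1}}$ and $\widetilde{\mathcal{A}}_{p,\hbar}=\{f\in C^\infty(\mathbb{C}^n)\mid \|f\|^{p,\hbar}_{m,\ell,R,S}<\infty\text{ for all }m,\ell,R,S\}$. Define $\mathcal{A}_{p,\hbar}=\widetilde{\mathcal{A}}_{p,\hbar}/\{f\in C^\infty(\mathbb{C}^n)\mid \mathsf{j}^\infty_pf=0\}$ (quotient by the functions with vanishing $\infty$-jet at $p$), with the topology induced by all the seminorms; it is a Fréchet space. Every class has a unique real-analytic representative, so $\mathcal{A}_{p,\hbar}$ is identified with a subspace of $C^\omega(\mathbb{C}^n)$. The product $f\star^\hbar_{\mathrm{Wick}}g=\sum_{N=0}^\infty\frac{(2\hbar)^{|N|}}{N!}\frac{\partial^{|N|}f}{\partial z^N}\frac{\partial^{|N|}g}{\partial\overline{z}^N}$ converges absolutely in $\mathcal{A}_{p,\hbar}$ and makes it a Fréchet $^*$-algebra with complex conjugation as involution. As a Fréchet $^*$-algebra, $\mathcal{A}_{p,\hbar}$ does not depend on $p$ and is denoted $\mathcal{A}_\hbar$. GNS data of the positive functional $\delta_0:\mathcal{A}_\hbar\to\mathbb{C}$,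 $\delta_0(f)=f(0)$: the Gel'fand ideal is $\mathcal{J}_0=\{f\mid\delta_0(\overline{f}\star^\hbar_{\mathrm{Wick}}f)=0\}=\{f\in\mathcal{A}_\hbar\mid\frac{\partial^{|I|}f}{\partial\overline{z}^I}(0)=0\ \forall I\}$, a closed subspace; $\mathfrak{D}_0=\mathcal{A}_\hbar/\mathcal{J}_0$ carries the inner product $\langle[f],[g]\rangle=\delta_0(\overline{f}\star^\hbar_{\mathrm{Wick}}g)$ and the quotient Fréchet topology given by the seminorms $\|[f]\|^{0,\hbar}_{m,\ell,R,S}=\inf\{\|f+g\|^{0,\hbar}_{m,\ell,R,S}\mid g\in\mathcal{J}_0\}$; the GNS representation is $f\mapsto([g]\mapsto[f\star^\hbar_{\mathrm{Wick}}g])$. $\mathfrak{D}$ carries the Fréchet topology as a subspace of $\mathcal{A}_\hbar$. The Bargmann-Fock space $\mathfrak{H}_{\mathrm{BF}}$ is the Hilbert space of anti-holomorphic functions on $\mathbb{C}^n$ that are square-integrable for the Gaussian measure $\frac{1}{(2\pi\hbar)^n}\mathrm{e}^{-\overline{z}z/2\hbar}\,\mathrm{d}z\,\mathrm{d}\overline{z}$ ($\mathrm{d}z\,\mathrm{d}\overline z$ = Lebesgue measure), with the $L^2$ inner product (antilinear in the first argument), which equals $\langle\phi,\psi\rangle_{\mathrm{BF}}=\sum_{R}\frac{(2\hbar)^{|R|}}{R!}\overline{\frac{\partial^{|R|}\phi}{\partial\overline{z}^R}(0)}\frac{\partial^{|R|}\psi}{\partial\overline{z}^R}(0)$. *)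

theory Defs
  imports "HOL-Analysis.Analysis" "HOL-Library.Function_Algebras"
begin

text \<open>
  \<open>\<complex>\<^sup>n\<close> is \<^typ>\<open>complex^'n\<close> with \<open>n = CARD('n)\<close>, so \<open>n \<ge> 1\<close> is automatic. Sums, differences
  and the order of multiindices, and sums and differences of functions, are the pointwise ones.
\<close>

type_synonym 'n mindex = "'n \<Rightarrow> nat"
type_synonym 'n cfun = "complex^'n \<Rightarrow> complex"

definition msize :: "'n::finite mindex \<Rightarrow> nat" where
  "msize N = (\<Sum>i\<in>UNIV. N i)"

definition mfact :: "'n::finite mindex \<Rightarrow> nat" where
  "mfact N = (\<Prod>i\<in>UNIV. fact (N i))"

definition mchoose :: "'n::finite mindex \<Rightarrow> 'n mindex \<Rightarrow> nat" where
  "mchoose R I = (\<Prod>i\<in>UNIV. R i choose I i)"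

definition mpow :: "complex^'n \<Rightarrow> 'n::finite mindex \<Rightarrow> complex" where
  "mpow z N = (\<Prod>i\<in>UNIV. (z $ i) ^ N i)"

definition conj_mpow :: "complex^'n \<Rightarrow> 'n::finite mindex \<Rightarrow> complex" where
  "conj_mpow z N = (\<Prod>i\<in>UNIV. cnj (z $ i) ^ N i)"

definition fscale :: "complex \<Rightarrow> 'n::finite cfun \<Rightarrow> 'n cfun" where
  "fscale a f = (\<lambda>z. a * f z)"

definition fconj :: "'n::finite cfun \<Rightarrow> 'n cfun" where
  "fconj f = (\<lambda>z. cnj (f z))"

definition csubspace :: "'n::finite cfun set \<Rightarrow> bool" where
  "csubspace V \<longleftrightarrow> 0 \<in> V \<and> (\<forall>u\<in>V. \<forall>v\<in>V. u + v \<in> V) \<and> (\<forall>a. \<forall>u\<in>V. fscale a u \<in> V)"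

definition clinear_on :: "'n::finite cfun set \<Rightarrow> ('n cfun \<Rightarrow> 'n cfun) \<Rightarrow> bool" where
  "clinear_on V T \<longleftrightarrow>
     (\<forall>u\<in>V. \<forall>v\<in>V. T (u + v) = T u + T v) \<and> (\<forall>a. \<forall>u\<in>V. T (fscale a u) = fscale a (T u))"


subsection \<open>Smooth, real-analytic and anti-holomorphic functions\<close>

primrec Ck :: "nat \<Rightarrow> 'n::finite cfun \<Rightarrow> bool" where
  "Ck 0 f \<longleftrightarrow> continuous_on UNIV f"
| "Ck (Suc k) f \<longleftrightarrow>
     (\<forall>z. f differentiable (at z)) \<and> (\<forall>v. Ck k (\<lambda>z. frechet_derivative f (at z) v))"

definition smooth :: "'n::finite cfun \<Rightarrow> bool" where
  "smooth f \<longleftrightarrow> (\<forall>k. Ck k f)"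

text \<open>
  Wirtinger operators \<open>\<partial>/\<partial>z\<^sup>i = (\<partial>/\<partial>x\<^sup>i - \<i> \<partial>/\<partial>y\<^sup>i)/2\<close> and \<open>\<partial>/\<partial>\<bar>z\<^sup>i = (\<partial>/\<partial>x\<^sup>i + \<i> \<partial>/\<partial>y\<^sup>i)/2\<close>; the Frechet derivative
  is the real one.
\<close>

definition dz :: "'n::finite \<Rightarrow> 'n cfun \<Rightarrow> 'n cfun" where
  "dz i f = (\<lambda>z. (frechet_derivative f (at z) (axis i 1)
                  - \<i> * frechet_derivative f (at z) (axis i \<i>)) / 2)"

definition dzbar :: "'n::finite \<Rightarrow> 'n cfun \<Rightarrow> 'n cfun" where
  "dzbar i f = (\<lambda>z. (frechet_derivative f (at z) (axis i 1)
                     + \<i> * frechet_derivative f (at z) (axis i \<i>)) / 2)"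

text \<open>
  Iterated operators need some order of the coordinates; on smooth functions the operators
  commute, so its choice is irrelevant.
\<close>

definition coords :: "'n::finite list" where
  "coords = (SOME xs. distinct xs \<and> set xs = UNIV)"

definition miter :: "('n::finite \<Rightarrow> 'n cfun \<Rightarrow> 'n cfun) \<Rightarrow> 'n mindex \<Rightarrow> 'n cfun \<Rightarrow> 'n cfun" where
  "miter d N f = foldr (\<lambda>i. d i ^^ N i) coords f"

definition pderivs :: "'n::finite mindex \<Rightarrow> 'n mindex \<Rightarrow> 'n cfun \<Rightarrow> 'n cfun" where
  "pderivs R S f = miter dz R (miter dzbar S f)"

text \<open>
  The Taylor series is written in the variables \<open>z, \<bar>z\<close>; absolute convergence near \<open>a\<close>
  is the same as for the series in real and imaginary parts.
\<close>

definition real_analytic :: "'n::finite cfun \<Rightarrow> bool" where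
  "real_analytic f \<longleftrightarrow> smooth f \<and> (\<forall>a. \<exists>r>0. \<forall>z\<in>ball a r.
     ((\<lambda>(K, L). pderivs K L f a / (of_nat (mfact K) * of_nat (mfact L))
                * mpow (z - a) K * conj_mpow (z - a) L) has_sum f z) UNIV)"

definition antiholomorphic :: "'n::finite cfun \<Rightarrow> bool" where
  "antiholomorphic f \<longleftrightarrow> (\<forall>z. f differentiable (at z) \<and> (\<forall>i. dz i f z = 0))"


subsection \<open>The algebra\<close>

fun wick_h :: "complex^'n \<Rightarrow> real \<Rightarrow> nat \<Rightarrow> nat \<Rightarrow> 'n::finite mindex \<Rightarrow> 'n mindex \<Rightarrow> 'n cfun \<Rightarrow> ennreal"
where
  "wick_h p hb 0 l R S f =
     (\<Sum>\<^sub>\<infinity>N\<in>UNIV. ennreal ((2 * hb) ^ (msize R + msize S + msize N) / real (mfact N)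
                       * (cmod (pderivs R (N + S) f p))\<^sup>2))"
| "wick_h p hb (Suc m) l R S f =
     (if even l
      then \<Sum>\<^sub>\<infinity>N\<in>UNIV. ennreal (1 / real (mfact N)) *
             (\<Sum>I\<in>{..R}. \<Sum>J\<in>{..N + S}.
                of_nat (mchoose R I) * of_nat (mchoose (N + S) J) * wick_h p hb m (l div 2) I J f)\<^sup>2
      else \<Sum>\<^sub>\<infinity>N\<in>UNIV. ennreal (1 / real (mfact N)) *
             (\<Sum>I\<in>{..R}. \<Sum>J\<in>{..N + S}.
                of_nat (mchoose R I) * of_nat (mchoose (N + S) J) * wick_h p hb m ((l - 1) div 2) J I f)\<^sup>2)"

definition wick_norm ::
  "complex^'n \<Rightarrow> real \<Rightarrow> nat \<Rightarrow> nat \<Rightarrow> 'n::finite mindex \<Rightarrow> 'n mindex \<Rightarrow> 'n cfun \<Rightarrow> ennreal" where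
  "wick_norm p hb m l R S f =
     (if wick_h p hb m l R S f = \<infinity> then \<infinity>
      else ennreal (enn2real (wick_h p hb m l R S f) powr (1 / 2 ^ (m + 1))))"

definition pre_wick :: "complex^'n \<Rightarrow> real \<Rightarrow> 'n::finite cfun set" where
  "pre_wick p hb = {f. smooth f \<and> (\<forall>m l R S. l < 2 ^ m \<longrightarrow> wick_norm p hb m l R S f < \<infinity>)}"

text \<open>
  Classes of \<^const>\<open>pre_wick\<close> modulo functions with vanishing jet at \<open>p\<close> are represented by
  their unique real-analytic member. The algebra is independent of \<open>p\<close>; it is taken at
  \<open>p = 0\<close>.
\<close>

definition wick_at :: "complex^'n \<Rightarrow> real \<Rightarrow> 'n::finite cfun set" where
  "wick_at p hb = {f \<in> pre_wick p hb. real_analytic f}"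

definition wick :: "real \<Rightarrow> 'n::finite cfun set" where
  "wick hb = wick_at 0 hb"

text \<open>
  The locally convex topology on \<open>V\<close> given by a set \<open>P\<close> of seminorms, with subbase the open
  seminorm balls; \<open>diff\<close> is the subtraction of \<open>V\<close>.
\<close>

definition seminorm_topology :: "'v set \<Rightarrow> ('v \<Rightarrow> 'v \<Rightarrow> 'v) \<Rightarrow> ('v \<Rightarrow> ennreal) set \<Rightarrow> 'v topology" where
  "seminorm_topology V diff P = topology_generated_by
     {{y \<in> V. q (diff y x) < ennreal e} | q x e. q \<in> P \<and> x \<in> V \<and> 0 < e}"

definition wick_top :: "real \<Rightarrow> 'n::finite cfun topology" where
  "wick_top hb = seminorm_topology (wick hb) (-) {wick_norm 0 hb m l R S | m l R S. l < 2 ^ m}"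

definition series_limit ::
  "'n::finite cfun topology \<Rightarrow> ('i \<Rightarrow> 'n cfun) \<Rightarrow> 'n cfun \<Rightarrow> bool" where
  "series_limit T u s \<longleftrightarrow>
     limitin T (\<lambda>F z. \<Sum>i\<in>F. u i z) s (finite_subsets_at_top UNIV)"

definition star :: "real \<Rightarrow> 'n::finite cfun \<Rightarrow> 'n cfun \<Rightarrow> 'n cfun" where
  "star hb f g = (\<lambda>z. \<Sum>\<^sub>\<infinity>N\<in>UNIV. complex_of_real ((2 * hb) ^ msize N / real (mfact N))
                        * pderivs N 0 f z * pderivs 0 N g z)"


subsection \<open>GNS data of the evaluation functional at the origin\<close>

definition delta0 :: "'n::finite cfun \<Rightarrow> complex" where
  "delta0 f = f 0"

definition gelfand :: "real \<Rightarrow> 'n::finite cfun set" where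
  "gelfand hb = {f \<in> wick hb. delta0 (star hb (fconj f) f) = 0}"

definition gcls :: "real \<Rightarrow> 'n::finite cfun \<Rightarrow> 'n cfun set" where
  "gcls hb f = {f + g | g. g \<in> gelfand hb}"

definition gns_space :: "real \<Rightarrow> 'n::finite cfun set set" where
  "gns_space hb = gcls hb ` wick hb"

text \<open>
  Vector space operations on cosets. In the scaling the Gel'fand ideal is added so that the
  result is a coset also for the scalar 0.
\<close>

definition gns_add :: "'n::finite cfun set \<Rightarrow> 'n cfun set \<Rightarrow> 'n cfun set" where
  "gns_add c d = {u + v | u v. u \<in> c \<and> v \<in> d}"

definition gns_diff :: "'n::finite cfun set \<Rightarrow> 'n cfun set \<Rightarrow> 'n cfun set" where
  "gns_diff c d = {u - v | u v. u \<in> c \<and> v \<in> d}"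

definition gns_scale :: "real \<Rightarrow> complex \<Rightarrow> 'n::finite cfun set \<Rightarrow> 'n cfun set" where
  "gns_scale hb a c = {fscale a u + g | u g. u \<in> c \<and> g \<in> gelfand hb}"

text \<open>
  Maps on cosets defined through representatives use \<^const>\<open>the_elem\<close>, resp. a union of
  cosets, over all representatives.
\<close>

definition gns_inner :: "real \<Rightarrow> 'n::finite cfun set \<Rightarrow> 'n cfun set \<Rightarrow> complex" where
  "gns_inner hb c d = the_elem {delta0 (star hb (fconj u) v) | u v. u \<in> c \<and> v \<in> d}"

definition gns_norm ::
  "real \<Rightarrow> nat \<Rightarrow> nat \<Rightarrow> 'n::finite mindex \<Rightarrow> 'n mindex \<Rightarrow> 'n cfun set \<Rightarrow> ennreal" where
  "gns_norm hb m l R S c = (INF u\<in>c. wick_norm 0 hb m l R S u)"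

definition gns_top :: "real \<Rightarrow> 'n::finite cfun set topology" where
  "gns_top hb = seminorm_topology (gns_space hb) gns_diff {gns_norm hb m l R S | m l R S. l < 2 ^ m}"

definition gns_rep :: "real \<Rightarrow> 'n::finite cfun \<Rightarrow> 'n cfun set \<Rightarrow> 'n cfun set" where
  "gns_rep hb f c = (\<Union>u\<in>c. gcls hb (star hb f u))"


subsection \<open>The anti-holomorphic Taylor expansion and the Bargmann-Fock space\<close>

definition Psi_term :: "'n::finite cfun \<Rightarrow> 'n mindex \<Rightarrow> 'n cfun" where
  "Psi_term f I = (\<lambda>z. 1 / of_nat (mfact I) * pderivs 0 I f 0 * conj_mpow z I)"

definition Psi :: "'n::finite cfun \<Rightarrow> 'n cfun" where
  "Psi f = (\<lambda>z. \<Sum>\<^sub>\<infinity>I\<in>UNIV. Psi_term f I z)"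

definition fock :: "real \<Rightarrow> 'n::finite cfun set" where
  "fock hb = Psi ` wick hb"

definition fock_top :: "real \<Rightarrow> 'n::finite cfun topology" where
  "fock_top hb = subtopology (wick_top hb) (fock hb)"

definition gns_to_fock :: "'n::finite cfun set \<Rightarrow> 'n cfun" where
  "gns_to_fock c = the_elem (Psi ` c)"

definition gauss :: "real \<Rightarrow> (complex^'n::finite) measure" where
  "gauss hb = density lborel
     (\<lambda>z. ennreal (exp (- (\<Sum>i\<in>UNIV. (cmod (z $ i))\<^sup>2) / (2 * hb)) / (2 * pi * hb) ^ CARD('n)))"

definition bf_space :: "real \<Rightarrow> 'n::finite cfun set" where
  "bf_space hb = {\<phi>. antiholomorphic \<phi> \<and> integrable (gauss hb) (\<lambda>z. (cmod (\<phi> z))\<^sup>2)}"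

definition bf_inner :: "real \<Rightarrow> 'n::finite cfun \<Rightarrow> 'n cfun \<Rightarrow> complex" where
  "bf_inner hb \<phi> \<psi> = (LINT z|gauss hb. cnj (\<phi> z) * \<psi> z)"

definition bf_norm :: "real \<Rightarrow> 'n::finite cfun \<Rightarrow> real" where
  "bf_norm hb \<phi> = sqrt (Re (bf_inner hb \<phi> \<phi>))"

definition bf_top :: "real \<Rightarrow> 'n::finite cfun topology" where
  "bf_top hb = seminorm_topology (bf_space hb) (-) {\<lambda>\<phi>. ennreal (bf_norm hb \<phi>)}"

text \<open>The GNS representation transported along \<^const>\<open>gns_to_fock\<close>.\<close>

definition bf_rep :: "real \<Rightarrow> 'n::finite cfun \<Rightarrow> 'n cfun \<Rightarrow> 'n cfun" where
  "bf_rep hb f \<phi> = gns_to_fock (gns_rep hb f (inv_into (gns_space hb) gns_to_fock \<phi>))"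

text \<open>Summands and sum of the inner series of the explicit formula, and the outer summands.\<close>

definition symbol_term :: "'n::finite cfun \<Rightarrow> 'n mindex \<Rightarrow> 'n mindex \<Rightarrow> 'n cfun" where
  "symbol_term f I J = (\<lambda>z. 1 / of_nat (mfact J) * pderivs I J f 0 * conj_mpow z J)"

definition symbol :: "'n::finite cfun \<Rightarrow> 'n mindex \<Rightarrow> 'n cfun" where
  "symbol f I = (\<lambda>z. \<Sum>\<^sub>\<infinity>J\<in>UNIV. symbol_term f I J z)"

definition bf_rep_term :: "real \<Rightarrow> 'n::finite cfun \<Rightarrow> 'n cfun \<Rightarrow> 'n mindex \<Rightarrow> 'n cfun" where
  "bf_rep_term hb f \<phi> I = (\<lambda>z. complex_of_real ((2 * hb) ^ msize I / real (mfact I))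
                               * symbol f I z * pderivs 0 I \<phi> z)"

end

theory Submission
  imports Defs "HOL-Probability.Probability" "HOL-Complex_Analysis.Complex_Analysis"
begin

text \<open>
  Everything is read off the array \<open>c K L\<close> of mixed derivatives at the origin. Finiteness of all seminorms
  makes the Taylor series of \<open>c\<close> entire in \<open>z\<close> and its conjugate, so elements of the algebra are their Taylor
  series, and the map \<open>Psi\<close> sets \<open>c K L\<close> to 0 for \<open>K \<noteq> 0\<close>. The recursion of the seminorms is monotone in the moduli
  \<open>|c K L|\<close> and homogeneous, and it satisfies a Cauchy-Schwarz inequality. Monotonicity gives the estimate for \<open>Psi\<close> and
  hence the quotient norms; Cauchy-Schwarz, applied to the star product, bounds each seminorm of \<open>f \<star> g\<close> by a
  product of a seminorm of \<open>f\<close> and one of \<open>g\<close>, with absolutely convergent series throughout. Finally the Gaussian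
  \<open>L\<^sup>2\<close> norm of an anti-holomorphic function equals its lowest seminorm by Parseval's identity, which gives the
  isometry, the comparison of topologies, and density through truncated series.
\<close>

text \<open>The obstacle is the nesting of the seminorms: each level is an infinite sum of squares
  of binomial sums of the level below, with the two indices possibly exchanged. It is met by putting
  every estimate into a form that one level reproduces: comparison of arrays, convexity with fixed
  weights, the root-free bound \<open>w\<^sup>2 \<le> u * v\<close>, domination with entrywise
  convergence. Only the innermost array then has to be examined.

  The number \<open>l\<close> matters only as a word of swap bits, and all words occur, so levels
  may be appended on the inside. The star product needs this: its coefficients sum over
  \<open>N\<close> in the first slot of the left factor, while the innermost seminorm sums over the
  second slot. Exchanging the slots costs one more swapped level and one more squaring, hence the
  fourth powers and the levels \<open>m + 2\<close> and \<open>m + 1\<close> in the product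
  estimate.

  In Parseval's identity finitely many roots of unity take the place of a torus integral, so that
  only finite sums of invariant integrals occur.\<close>

unbundle no Formal_Power_Series.fps_syntax

section \<open>Multiindices: boxes, binomial identities and summability\<close>

lemma atMost_mindex: "{..R} = PiE UNIV (\<lambda>i. {..R i})" for R :: "'n::finite mindex"
  by (auto simp: le_fun_def PiE_UNIV_domain Pi_iff)

lemma finite_atMost_mindex [simp]: "finite {..R}" for R :: "'n::finite mindex"
  by (simp add: atMost_mindex finite_PiE)

text \<open>The box is a product set, so this is the product theorem for \<open>infsum\<close> over
  \<open>PiE\<close>; the type constraints are those of that theorem. It reduces multiindex binomial
  sums and character sums to one coordinate.\<close>

lemma sum_prod_atMost:
  fixes f :: "'n::finite \<Rightarrow> nat \<Rightarrow> 'a::{banach,real_normed_div_algebra,comm_semiring_1}"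
  shows "(\<Sum>I\<le>R. \<Prod>i\<in>UNIV. f i (I i)) = (\<Prod>i\<in>UNIV. \<Sum>k\<le>R i. f i k)"
proof -
  have "infsum (\<lambda>g. \<Prod>x\<in>UNIV. f x (g x)) (PiE UNIV (\<lambda>i. {..R i}))
      = (\<Prod>x\<in>UNIV. infsum (f x) {..R x})"
    by (rule infsum_prod_PiE_abs) auto
  then show ?thesis
    by (simp add: finite_PiE flip: atMost_mindex)
qed

lemma msize_add [simp]: "msize (M + N) = msize M + msize N"
  by (simp add: msize_def sum.distrib)

lemma msize_0 [simp]: "msize 0 = 0"
  by (simp add: msize_def)

lemma msize_mono: "M \<le> N \<Longrightarrow> msize M \<le> msize N"
  by (auto simp: msize_def le_fun_def intro: sum_mono)

lemma msize_diff: "M \<le> N \<Longrightarrow> msize (N - M) = msize N - msize M"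
  by (simp add: msize_def le_fun_def sum_subtractf_nat)

lemma mfact_pos [simp]: "mfact N > 0"
  by (simp add: mfact_def prod_pos)

lemma mfact_neq_0 [simp]: "mfact N \<noteq> 0"
  using mfact_pos[of N] by linarith

lemma mfact_0 [simp]: "mfact 0 = 1"
  by (simp add: mfact_def)

lemma mpow_0 [simp]: "mpow z 0 = 1"
  by (simp add: mpow_def)

lemma conj_mpow_0 [simp]: "conj_mpow z 0 = 1"
  by (simp add: conj_mpow_def)

lemma mpow_at_0: "mpow 0 N = (if N = 0 then 1 else 0)"
proof (cases "N = 0")
  case False
  then obtain i where "N i \<noteq> 0" by (auto simp: fun_eq_iff)
  then have "\<exists>i\<in>UNIV. (0::complex^'a) $ i ^ N i = 0" by (intro bexI[of _ i]) auto
  then have "(\<Prod>i\<in>UNIV. ((0::complex^'a) $ i) ^ N i) = 0"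
    by (intro prod_zero) auto
  with False show ?thesis by (simp add: mpow_def)
qed simp

lemma mpow_add_index: "mpow z (M + N) = mpow z M * mpow z N"
  by (simp add: mpow_def power_add prod.distrib)

lemma cnj_mpow: "cnj (mpow z N) = conj_mpow z N"
  by (simp add: mpow_def conj_mpow_def)

lemma cnj_conj_mpow: "cnj (conj_mpow z N) = mpow z N"
  by (simp add: mpow_def conj_mpow_def)

lemma power_msize: "x ^ msize N = (\<Prod>i\<in>UNIV. x ^ N i)" for x :: "'a::comm_monoid_mult"
  by (simp add: msize_def power_sum)

lemma norm_mpow_le: "cmod (mpow w N) \<le> norm w ^ msize N"
  unfolding mpow_def power_msize
  by (auto simp: prod_norm[symmetric] norm_power Finite_Cartesian_Product.norm_nth_le intro!: prod_mono power_mono)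

lemma mchoose_mfact: "I \<le> N \<Longrightarrow> mfact I * mfact (N - I) * mchoose N I = mfact N"
  by (simp add: mfact_def mchoose_def le_fun_def binomial_fact_lemma flip: prod.distrib)

lemma of_nat_mchoose:
  "I \<le> N \<Longrightarrow> (of_nat (mchoose N I) :: 'a::field_char_0)
     = of_nat (mfact N) / (of_nat (mfact I) * of_nat (mfact (N - I)))"
  by (simp add: field_simps flip: mchoose_mfact[of I N])

lemma mpow_add: "mpow (z + h) N = (\<Sum>I\<le>N. of_nat (mchoose N I) * mpow z I * mpow h (N - I))"
  by (simp add: mpow_def mchoose_def binomial_ring of_nat_prod flip: prod.distrib sum_prod_atMost)

lemma sum_mchoose_power:
  fixes a b :: real
  shows "(\<Sum>I\<le>N. real (mchoose N I) * a ^ msize I * b ^ msize (N - I)) = (a + b) ^ msize N"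
  by (simp add: power_msize mchoose_def binomial_ring of_nat_prod flip: prod.distrib sum_prod_atMost)

lemma sum_mchoose_power1:
  fixes a :: real
  shows "(\<Sum>I\<le>N. real (mchoose N I) * a ^ msize I) = (a + 1) ^ msize N"
  using sum_mchoose_power[of N a 1] by simp

text \<open>Every finite set of multiindices lies in a box, and the sum over a box factors. Hence
  all partial sums are bounded by the product of the one-dimensional sums.\<close>

lemma summable_on_prod_mindex:
  fixes f :: "'n::finite \<Rightarrow> nat \<Rightarrow> real"
  assumes nn: "\<And>i k. f i k \<ge> 0" and sm: "\<And>i. summable (f i)"
  shows "(\<lambda>N. \<Prod>i\<in>UNIV. f i (N i)) summable_on UNIV"
proof (rule nonneg_bdd_above_summable_on)
  show "bdd_above (sum (\<lambda>N. \<Prod>i\<in>UNIV. f i (N i)) ` {F. F \<subseteq> UNIV \<and> finite F})"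
  proof (rule bdd_aboveI2)
    fix F :: "'n mindex set" assume "F \<in> {F. F \<subseteq> UNIV \<and> finite F}"
    then have fin: "finite F" by simp
    \<comment> \<open>The sum of all members of \<open>F\<close> dominates each of them in every
      coordinate.\<close>
    define R where "R = (\<lambda>i. \<Sum>N\<in>F. N i)"
    have "F \<subseteq> {..R}"
      using fin by (auto simp: R_def le_fun_def intro: member_le_sum)
    then have "(\<Sum>N\<in>F. \<Prod>i\<in>UNIV. f i (N i)) \<le> (\<Sum>N\<le>R. \<Prod>i\<in>UNIV. f i (N i))"
      by (intro sum_mono2) (auto intro: prod_nonneg nn)
    also have "\<dots> = (\<Prod>i\<in>UNIV. \<Sum>k\<le>R i. f i k)" by (rule sum_prod_atMost)
    also have "\<dots> \<le> (\<Prod>i\<in>UNIV. suminf (f i))"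
      by (intro prod_mono conjI sum_nonneg nn sum_le_suminf sm) auto
    finally show "(\<Sum>N\<in>F. \<Prod>i\<in>UNIV. f i (N i)) \<le> (\<Prod>i\<in>UNIV. suminf (f i))" .
  qed
qed (auto intro: prod_nonneg nn)

lemma summable_on_exp_mindex:
  fixes x :: real
  assumes "x \<ge> 0"
  shows "(\<lambda>N::'n::finite mindex. x ^ msize N / real (mfact N)) summable_on UNIV"
proof -
  have "(\<lambda>N::'n mindex. \<Prod>i\<in>UNIV. x ^ N i / fact (N i)) summable_on UNIV"
    using assms summable_exp[of x]
    by (intro summable_on_prod_mindex) (auto simp: divide_inverse mult.commute)
  then show ?thesis
    by (simp add: power_msize mfact_def prod_dividef of_nat_prod)
qed

lemma summable_on_geometric_mindex:
  fixes x :: real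
  assumes "x \<ge> 0" "x < 1"
  shows "(\<lambda>N::'n::finite mindex. x ^ msize N) summable_on UNIV"
  unfolding power_msize using assms
  by (intro summable_on_prod_mindex[of "\<lambda>_. power x"]) auto

text \<open>Regroups pairs \<open>(I, J)\<close> by their total \<open>N = I + J\<close>, the change
  of index in every Cauchy product below.\<close>

lemma bij_betw_split:
  "bij_betw (\<lambda>(N, I). (I, N - I)) (SIGMA N:UNIV. {..N}) (UNIV :: ('n mindex \<times> 'n mindex) set)"
  by (rule bij_betwI[where g = "\<lambda>(I, J). (I + J, I)"])
     (auto simp: le_fun_def fun_eq_iff)

lemma has_sum_split:
  fixes f :: "'n::finite mindex \<times> 'n mindex \<Rightarrow> 'a::{topological_comm_monoid_add,t3_space}"
  assumes "(f has_sum S) UNIV"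
  shows "((\<lambda>N. \<Sum>I\<le>N. f (I, N - I)) has_sum S) UNIV"
proof (rule has_sum_SigmaD)
  show "((\<lambda>x. f ((\<lambda>(N, I). (I, N - I)) x)) has_sum S) (SIGMA N:UNIV. {..N})"
    using assms has_sum_reindex_bij_betw[OF bij_betw_split, of f S] by simp
qed simp

lemma summable_on_split:
  fixes f :: "'n::finite mindex \<times> 'n mindex \<Rightarrow> real"
  assumes "(\<lambda>N. \<Sum>I\<le>N. f (I, N - I)) summable_on UNIV" and "\<And>x. f x \<ge> 0"
  shows "f summable_on UNIV"
proof -
  have "(\<lambda>x. f ((\<lambda>(N, I). (I, N - I)) x)) summable_on (SIGMA N:UNIV. {..N})"
    using assms by (intro summable_on_SigmaI[where g = "\<lambda>N. \<Sum>I\<le>N. f (I, N - I)"]) auto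
  then show ?thesis
    using summable_on_reindex_bij_betw[OF bij_betw_split, of f] by simp
qed


subsection \<open>Power series in several variables\<close>

text \<open>The entries are derivatives at the origin rather than Taylor coefficients, hence the
  factorial. Convergence at every radius says that the series defines an entire function of the
  vector \<open>w\<close>.\<close>

definition ent :: "('k::finite mindex \<Rightarrow> complex) \<Rightarrow> bool" where
  "ent c \<longleftrightarrow> (\<forall>r\<ge>0. (\<lambda>N. cmod (c N) * r ^ msize N / real (mfact N)) summable_on UNIV)"

definition ps :: "('k::finite mindex \<Rightarrow> complex) \<Rightarrow> complex^'k \<Rightarrow> complex" where
  "ps c w = (\<Sum>\<^sub>\<infinity>N. c N / of_nat (mfact N) * mpow w N)"

lemma entD: "ent c \<Longrightarrow> r \<ge> 0 \<Longrightarrow> (\<lambda>N. cmod (c N) * r ^ msize N / real (mfact N)) summable_on UNIV"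
  by (simp add: ent_def)

lemma ent_abs_summable:
  assumes "ent c"
  shows "(\<lambda>N. cmod (c N / of_nat (mfact N) * mpow w N)) summable_on UNIV"
  by (rule Infinite_Sum.abs_summable_on_comparison_test'[OF entD[OF assms norm_ge_zero[of w]]])
     (auto simp: norm_mult norm_divide intro!: divide_right_mono mult_left_mono norm_mpow_le)

lemma ps_has_sum:
  assumes "ent c"
  shows "((\<lambda>N. c N / of_nat (mfact N) * mpow w N) has_sum ps c w) UNIV"
  unfolding ps_def
  by (rule has_sum_infsum) (rule abs_summable_summable[OF ent_abs_summable[OF assms]])

lemma ent_mono:
  assumes "ent d" "\<And>N. cmod (c N) \<le> C * cmod (d N)"
  shows "ent c"
  unfolding ent_def
proof (intro allI impI)
  fix r :: real assume r: "r \<ge> 0"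
  have "(\<lambda>N. C * (cmod (d N) * r ^ msize N / real (mfact N))) summable_on UNIV"
    by (intro summable_on_cmult_right entD assms r)
  then show "(\<lambda>N. cmod (c N) * r ^ msize N / real (mfact N)) summable_on UNIV"
    by (rule summable_on_comparison_test)
       (use r assms(2) in \<open>auto intro!: divide_right_mono mult_right_mono simp flip: mult.assoc\<close>)
qed

text \<open>Expanding \<open>(r + s) ^ msize N\<close> by the binomial theorem distributes the mass
  at \<open>N\<close> over the pairs with \<open>I + J = N\<close>. Summability at radius
  \<open>r + s\<close> therefore pays for recentring at a point of size \<open>r\<close> with
  increments of size \<open>s\<close>.\<close>

lemma summable_on_double:
  fixes a :: "'k::finite mindex \<Rightarrow> real"
  assumes "(\<lambda>N. a N * (r + s) ^ msize N / real (mfact N)) summable_on UNIV"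
    and nn: "\<And>N. a N \<ge> 0" "r \<ge> 0" "s \<ge> 0"
  shows "(\<lambda>(I, J). a (I + J) * r ^ msize I * s ^ msize J / (real (mfact I) * real (mfact J)))
           summable_on UNIV"
proof (rule summable_on_split)
  have "a N * (r + s) ^ msize N / real (mfact N)
      = (\<Sum>I\<le>N. a (I + (N - I)) * r ^ msize I * s ^ msize (N - I)
                 / (real (mfact I) * real (mfact (N - I))))" for N
  proof -
    have [simp]: "I \<le> N \<Longrightarrow> I + (N - I) = N" for I
      by (auto simp: fun_eq_iff le_fun_def)
    show ?thesis
      unfolding sum_mchoose_power[symmetric] sum_distrib_left sum_divide_distrib
      by (intro sum.cong) (auto simp: of_nat_mchoose)
  qed
  then show "(\<lambda>N. \<Sum>I\<le>N. case (I, N - I) of (I, J) \<Rightarrow> a (I + J) * r ^ msize I * s ^ msize J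
               / (real (mfact I) * real (mfact J))) summable_on UNIV"
    using assms(1) by simp
qed (use nn in auto)

text \<open>Recentring at \<open>w\<close>: the array \<open>c (I + J)\<close> belongs to the
  \<open>J\<close>-th derivative. The double family in \<open>(I, J)\<close> is absolutely summable
  with the radii \<open>norm w\<close> and \<open>norm h\<close>, so it may be summed along totals
  \<open>I + J\<close>, which gives \<open>ps c (w + h)\<close>, or along \<open>J\<close>, which
  gives the new series.\<close>

lemma
  assumes c: "ent c"
  shows ps_shift: "((\<lambda>J. ps (\<lambda>I. c (I + J)) w / of_nat (mfact J) * mpow h J) has_sum ps c (w + h)) UNIV"
    and ent_ps_shift: "ent (\<lambda>J. ps (\<lambda>I. c (I + J)) w)"
    and ent_shift: "ent (\<lambda>I. c (I + J))"
proof -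
  have S: "(\<lambda>(I, J). cmod (c (I + J)) * r ^ msize I * s ^ msize J / (real (mfact I) * real (mfact J)))
           summable_on UNIV" if "r \<ge> 0" "s \<ge> 0" for r s
    using that by (intro summable_on_double entD c) auto
  show es: "ent (\<lambda>I. c (I + J))" for J
    unfolding ent_def
  proof (intro allI impI)
    fix r :: real assume r: "r \<ge> 0"
    have "(\<lambda>(J, I). cmod (c (I + J)) * r ^ msize I * 1 ^ msize J / (real (mfact I) * real (mfact J)))
           summable_on UNIV \<times> UNIV"
      using S[of r 1] r by (subst summable_on_swap) (simp add: case_prod_unfold)
    then have "(\<lambda>I. cmod (c (I + J)) * r ^ msize I * 1 ^ msize J / (real (mfact I) * real (mfact J)))
           summable_on UNIV"
      by (rule summable_on_SigmaD1) simp
    then have "(\<lambda>I. (cmod (c (I + J)) * r ^ msize I * 1 ^ msize J / (real (mfact I) * real (mfact J))) * real (mfact J))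
           summable_on UNIV"
      by (rule summable_on_cmult_left)
    then show "(\<lambda>I. cmod (c (I + J)) * r ^ msize I / real (mfact I)) summable_on UNIV"
      by (simp add: field_simps)
  qed
  show "ent (\<lambda>J. ps (\<lambda>I. c (I + J)) w)"
    unfolding ent_def
  proof (intro allI impI)
    fix r :: real assume r: "r \<ge> 0"
    have "(\<lambda>(J, I). cmod (c (I + J)) * norm w ^ msize I * r ^ msize J / (real (mfact I) * real (mfact J)))
           summable_on UNIV \<times> UNIV"
      using S[of "norm w" r] r by (subst summable_on_swap) (simp add: case_prod_unfold)
    then have *: "(\<lambda>J. \<Sum>\<^sub>\<infinity>I. cmod (c (I + J)) * norm w ^ msize I * r ^ msize J / (real (mfact I) * real (mfact J)))
           summable_on UNIV"
      by (rule summable_on_Sigma_banach)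
    show "(\<lambda>J. cmod (ps (\<lambda>I. c (I + J)) w) * r ^ msize J / real (mfact J)) summable_on UNIV"
    proof (rule summable_on_comparison_test[OF *])
      fix J
      have "cmod (ps (\<lambda>I. c (I + J)) w) \<le> (\<Sum>\<^sub>\<infinity>I. cmod (c (I + J)) * norm w ^ msize I / real (mfact I))"
        by (rule norm_infsum_le[OF ps_has_sum[OF es] has_sum_infsum[OF entD[OF es]]])
           (auto simp: norm_mult norm_divide intro!: divide_right_mono mult_left_mono norm_mpow_le)
      then have "cmod (ps (\<lambda>I. c (I + J)) w) * (r ^ msize J / real (mfact J))
         \<le> (\<Sum>\<^sub>\<infinity>I. cmod (c (I + J)) * norm w ^ msize I / real (mfact I)) * (r ^ msize J / real (mfact J))"
        using r by (intro mult_right_mono) auto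
      also have "\<dots> = (\<Sum>\<^sub>\<infinity>I. cmod (c (I + J)) * norm w ^ msize I * r ^ msize J / (real (mfact I) * real (mfact J)))"
        by (subst infsum_cmult_left'[symmetric]) (simp add: field_simps)
      finally show "cmod (ps (\<lambda>I. c (I + J)) w) * r ^ msize J / real (mfact J) \<le> \<dots>" by simp
    qed (use r in auto)
  qed
  define f where "f = (\<lambda>(I, J). c (I + J) / (of_nat (mfact I) * of_nat (mfact J)) * mpow w I * mpow h J)"
  have "(\<lambda>x. cmod (f x)) summable_on UNIV"
  proof (rule Infinite_Sum.abs_summable_on_comparison_test'[OF S[OF norm_ge_zero[of w] norm_ge_zero[of h]]])
    fix x
    have "cmod (mpow w I) * cmod (mpow h J) \<le> norm w ^ msize I * norm h ^ msize J" for I J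
      by (intro mult_mono norm_mpow_le) auto
    then show "cmod (f x) \<le> (case x of (I, J) \<Rightarrow> cmod (c (I + J)) * norm w ^ msize I * norm h ^ msize J
          / (real (mfact I) * real (mfact J)))"
      by (auto simp: f_def norm_mult norm_divide mult.assoc intro!: divide_right_mono mult_left_mono split: prod.split)
  qed
  then have sf: "f summable_on UNIV" by (rule abs_summable_summable)
  then have fs: "(f has_sum infsum f UNIV) UNIV" by simp
  from has_sum_split[OF fs] have "((\<lambda>N. \<Sum>I\<le>N. f (I, N - I)) has_sum infsum f UNIV) UNIV" .
  moreover have "(\<Sum>I\<le>N. f (I, N - I)) = c N / of_nat (mfact N) * mpow (w + h) N" for N
  proof -
    have [simp]: "I \<le> N \<Longrightarrow> I + (N - I) = N" for I
      by (auto simp: fun_eq_iff le_fun_def)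
    show ?thesis
      unfolding mpow_add sum_distrib_left f_def
      by (intro sum.cong) (auto simp: of_nat_mchoose)
  qed
  ultimately have eq: "infsum f UNIV = ps c (w + h)"
    using has_sum_unique[OF _ ps_has_sum[OF c, of "w + h"]] by simp
  have "((\<lambda>(J, I). f (I, J)) has_sum ps c (w + h)) (UNIV \<times> UNIV)"
    using fs unfolding eq by (subst (asm) UNIV_Times_UNIV[symmetric], subst (asm) has_sum_swap) simp
  then show "((\<lambda>J. ps (\<lambda>I. c (I + J)) w / of_nat (mfact J) * mpow h J) has_sum ps c (w + h)) UNIV"
  proof (rule has_sum_SigmaD)
    fix J
    have "((\<lambda>I. (c (I + J) / of_nat (mfact I) * mpow w I) * (mpow h J / of_nat (mfact J)))
        has_sum ps (\<lambda>I. c (I + J)) w * (mpow h J / of_nat (mfact J))) UNIV"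
      by (rule has_sum_cmult_left[OF ps_has_sum[OF es]])
    then show "((\<lambda>I. case (J, I) of (J, I) \<Rightarrow> f (I, J)) has_sum
        ps (\<lambda>I. c (I + J)) w / of_nat (mfact J) * mpow h J) UNIV"
      by (simp add: f_def field_simps)
  qed
qed

text \<open>The Leibniz rule: for entries normalised as derivatives the Cauchy product carries
  binomial weights.\<close>

definition conv :: "('k::finite mindex \<Rightarrow> complex) \<Rightarrow> ('k mindex \<Rightarrow> complex) \<Rightarrow> 'k mindex \<Rightarrow> complex" where
  "conv c d N = (\<Sum>I\<le>N. of_nat (mchoose N I) * c I * d (N - I))"

lemma
  assumes c: "ent c" and d: "ent d"
  shows ps_mult: "ps c w * ps d w = ps (conv c d) w"
    and ent_conv: "ent (conv c d)"
proof -
  have S: "(\<lambda>(I, J). (cmod (c I) * r ^ msize I / real (mfact I)) * (cmod (d J) * r ^ msize J / real (mfact J)))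
         summable_on UNIV \<times> UNIV" if "r \<ge> 0" for r
    using that
    by (intro summable_on_SigmaI[where g = "\<lambda>I. (cmod (c I) * r ^ msize I / real (mfact I)) *
            (\<Sum>\<^sub>\<infinity>J. cmod (d J) * r ^ msize J / real (mfact J))"])
       (auto simp only: prod.case intro!: has_sum_cmult_right has_sum_infsum entD d c summable_on_cmult_left
          mult_nonneg_nonneg divide_nonneg_nonneg zero_le_power norm_ge_zero of_nat_0_le_iff)
  show ec: "ent (conv c d)"
    unfolding ent_def
  proof (intro allI impI)
    fix r :: real assume r: "r \<ge> 0"
    note has_sum_split[OF has_sum_infsum[OF S[OF r, unfolded UNIV_Times_UNIV]]]
    then have "(\<lambda>N. \<Sum>I\<le>N. (cmod (c I) * r ^ msize I / real (mfact I)) *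
        (cmod (d (N - I)) * r ^ msize (N - I) / real (mfact (N - I)))) summable_on UNIV"
      by (auto simp: summable_on_def)
    then show "(\<lambda>N. cmod (conv c d N) * r ^ msize N / real (mfact N)) summable_on UNIV"
    proof (rule summable_on_comparison_test)
      fix N :: "'a mindex"
      have "cmod (conv c d N) \<le> (\<Sum>I\<le>N. real (mchoose N I) * cmod (c I) * cmod (d (N - I)))"
        unfolding conv_def by (rule order_trans[OF norm_sum]) (simp add: norm_mult)
      then have "cmod (conv c d N) * r ^ msize N / real (mfact N)
         \<le> (\<Sum>I\<le>N. real (mchoose N I) * cmod (c I) * cmod (d (N - I))) * r ^ msize N / real (mfact N)"
        using r by (intro divide_right_mono mult_right_mono) auto
      also have "\<dots> = (\<Sum>I\<le>N. (cmod (c I) * r ^ msize I / real (mfact I)) *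
        (cmod (d (N - I)) * r ^ msize (N - I) / real (mfact (N - I))))"
        unfolding sum_distrib_right sum_divide_distrib
      proof (intro sum.cong refl)
        fix I assume "I \<in> {..N}"
        then have I: "I \<le> N" by simp
        then have "r ^ msize N = r ^ msize I * r ^ msize (N - I)"
          using msize_diff[OF I] msize_mono[OF I] by (simp flip: power_add)
        then show "real (mchoose N I) * cmod (c I) * cmod (d (N - I)) * r ^ msize N / real (mfact N)
           = (cmod (c I) * r ^ msize I / real (mfact I)) * (cmod (d (N - I)) * r ^ msize (N - I) / real (mfact (N - I)))"
          using I by (simp add: of_nat_mchoose field_simps)
      qed
      finally show "cmod (conv c d N) * r ^ msize N / real (mfact N) \<le> \<dots>" .
    qed (use r in auto)
  qed
  define f where "f = (\<lambda>(I, J). (c I / of_nat (mfact I) * mpow w I) * (d J / of_nat (mfact J) * mpow w J))"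
  have "(\<lambda>x. cmod (f x)) summable_on UNIV"
  proof (rule Infinite_Sum.abs_summable_on_comparison_test'[OF S[OF norm_ge_zero[of w], unfolded UNIV_Times_UNIV]])
    fix x show "cmod (f x) \<le> (case x of (I, J) \<Rightarrow> (cmod (c I) * norm w ^ msize I / real (mfact I))
        * (cmod (d J) * norm w ^ msize J / real (mfact J)))"
      unfolding f_def case_prod_unfold norm_mult norm_divide norm_of_nat times_divide_eq_left
      by (intro mult_mono divide_right_mono mult_left_mono norm_mpow_le) auto
  qed
  then have sf: "f summable_on UNIV" by (rule abs_summable_summable)
  then have fs: "(f has_sum infsum f UNIV) UNIV" by simp
  from has_sum_split[OF fs] have "((\<lambda>N. \<Sum>I\<le>N. f (I, N - I)) has_sum infsum f UNIV) UNIV" .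
  moreover have "(\<Sum>I\<le>N. f (I, N - I)) = conv c d N / of_nat (mfact N) * mpow w N" for N
  proof -
    have "I \<le> N \<Longrightarrow> mpow w N = mpow w I * mpow w (N - I)" for I
      by (subst mpow_add_index[symmetric], rule arg_cong[where f = "mpow w"])
         (auto simp: fun_eq_iff le_fun_def)
    then show ?thesis
      unfolding conv_def sum_distrib_right sum_divide_distrib f_def
      by (intro sum.cong) (auto simp: of_nat_mchoose)
  qed
  ultimately have eq: "infsum f UNIV = ps (conv c d) w"
    using has_sum_unique[OF _ ps_has_sum[OF ec, of w]] by simp
  have "((\<lambda>I. (c I / of_nat (mfact I) * mpow w I) * ps d w) has_sum infsum f UNIV) UNIV"
  proof (rule has_sum_SigmaD)
    show "(f has_sum infsum f UNIV) (UNIV \<times> UNIV)" using fs by simp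
    show "((\<lambda>J. f (I, J)) has_sum (c I / of_nat (mfact I) * mpow w I) * ps d w) UNIV" for I
      unfolding f_def prod.case by (rule has_sum_cmult_right[OF ps_has_sum[OF d]])
  qed
  moreover have "((\<lambda>I. (c I / of_nat (mfact I) * mpow w I) * ps d w) has_sum ps c w * ps d w) UNIV"
    by (rule has_sum_cmult_left[OF ps_has_sum[OF c]])
  ultimately show "ps c w * ps d w = ps (conv c d) w"
    unfolding eq[symmetric] using has_sum_unique by blast
qed

subsection \<open>Power series in z and its conjugate\<close>

text \<open>
  A series in \<open>z\<close> and its conjugate is a power series in \<open>2n\<close> independent variables, restricted to the
  points \<open>(z, \<bar>z)\<close>.
\<close>

definition jcoef :: "('n mindex \<Rightarrow> 'n mindex \<Rightarrow> complex) \<Rightarrow> ('n + 'n) mindex \<Rightarrow> complex" where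
  "jcoef c N = c (N \<circ> Inl) (N \<circ> Inr)"

definition emb :: "complex^'n \<Rightarrow> complex^('n::finite + 'n)" where
  "emb z = (\<chi> k. case k of Inl i \<Rightarrow> z $ i | Inr i \<Rightarrow> cnj (z $ i))"

definition tay :: "('n::finite mindex \<Rightarrow> 'n mindex \<Rightarrow> complex) \<Rightarrow> 'n cfun" where
  "tay c z = (\<Sum>\<^sub>\<infinity>(K, L). c K L / (of_nat (mfact K) * of_nat (mfact L)) * mpow z K * conj_mpow z L)"

definition ent2 :: "('n::finite mindex \<Rightarrow> 'n mindex \<Rightarrow> complex) \<Rightarrow> bool" where
  "ent2 c \<longleftrightarrow> ent (jcoef c)"

lemma prod_UNIV_Plus:
  "(\<Prod>k\<in>UNIV. f k) = (\<Prod>i\<in>UNIV. f (Inl i)) * (\<Prod>i\<in>UNIV. f (Inr i))"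
  for f :: "'a::finite + 'b::finite \<Rightarrow> 'c::comm_monoid_mult"
  by (subst UNIV_Plus_UNIV[symmetric], subst prod.Plus) auto

lemma sum_UNIV_Plus:
  "(\<Sum>k\<in>UNIV. f k) = (\<Sum>i\<in>UNIV. f (Inl i)) + (\<Sum>i\<in>UNIV. f (Inr i))"
  for f :: "'a::finite + 'b::finite \<Rightarrow> 'c::comm_monoid_add"
  by (subst UNIV_Plus_UNIV[symmetric], subst sum.Plus) auto

lemma msize_case_sum [simp]: "msize (case_sum K L) = msize K + msize L"
  by (simp add: msize_def sum_UNIV_Plus)

lemma mfact_case_sum [simp]: "mfact (case_sum K L) = mfact K * mfact L"
  by (simp add: mfact_def prod_UNIV_Plus)

lemma mchoose_case_sum [simp]: "mchoose (case_sum K L) (case_sum I J) = mchoose K I * mchoose L J"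
  by (simp add: mchoose_def prod_UNIV_Plus)

lemma mpow_emb [simp]: "mpow (emb z) (case_sum K L) = mpow z K * conj_mpow z L"
  by (simp add: mpow_def conj_mpow_def emb_def prod_UNIV_Plus)

lemma case_sum_comp [simp]: "case_sum K L \<circ> Inl = K" "case_sum K L \<circ> Inr = L"
  by auto

lemma case_sum_eta [simp]: "case_sum (N \<circ> Inl) (N \<circ> Inr) = N"
  by (auto simp: fun_eq_iff split: sum.split)

lemma bij_betw_case_sum: "bij_betw (\<lambda>(K, L). case_sum K L) (UNIV :: (('a \<Rightarrow> 'c) \<times> ('b \<Rightarrow> 'c)) set) UNIV"
  by (rule bij_betwI[where g = "\<lambda>N. (N \<circ> Inl, N \<circ> Inr)"]) auto

lemma jcoef_case_sum [simp]: "jcoef c (case_sum K L) = c K L"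
  by (simp add: jcoef_def)

lemma tay_eq_ps: "tay c z = ps (jcoef c) (emb z)"
  unfolding tay_def ps_def
  by (subst infsum_reindex_bij_betw[OF bij_betw_case_sum, symmetric])
     (auto intro!: infsum_cong simp: case_prod_unfold)

lemma emb_add: "emb (z + h) = emb z + emb h"
  by (auto simp: emb_def vec_eq_iff split: sum.split)

lemma norm_emb_le: "norm (emb h) \<le> 2 * norm h"
proof -
  have "norm (emb h) ^ 2 = 2 * norm h ^ 2"
    by (simp add: norm_vec_def L2_set_def sum_UNIV_Plus emb_def sum_nonneg)
  also have "\<dots> \<le> (2 * norm h) ^ 2" by (simp add: power_mult_distrib)
  finally show ?thesis by (rule power2_le_imp_le) simp
qed

lemma ent2_iff:
  "ent2 c \<longleftrightarrow> (\<forall>r\<ge>0. (\<lambda>(K, L). cmod (c K L) * r ^ (msize K + msize L) / (real (mfact K) * real (mfact L)))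
     summable_on UNIV)"
  unfolding ent2_def ent_def
  by (subst summable_on_reindex_bij_betw[OF bij_betw_case_sum, symmetric])
     (simp add: case_prod_unfold)

lemma tay_has_sum:
  assumes "ent2 c"
  shows "((\<lambda>(K, L). c K L / (of_nat (mfact K) * of_nat (mfact L)) * mpow z K * conj_mpow z L)
            has_sum tay c z) UNIV"
proof -
  have "((\<lambda>N. jcoef c N / of_nat (mfact N) * mpow (emb z) N) has_sum tay c z) UNIV"
    using ps_has_sum assms by (auto simp: ent2_def tay_eq_ps)
  then show ?thesis
    by (subst (asm) has_sum_reindex_bij_betw[OF bij_betw_case_sum, symmetric])
       (simp add: case_prod_unfold mult.assoc)
qed

lemma tay_abs_summable:
  assumes "ent2 c"
  shows "(\<lambda>(K, L). cmod (c K L / (of_nat (mfact K) * of_nat (mfact L)) * mpow z K * conj_mpow z L))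
            summable_on UNIV"
proof -
  have "(\<lambda>N. cmod (jcoef c N / of_nat (mfact N) * mpow (emb z) N)) summable_on UNIV"
    using ent_abs_summable assms by (auto simp: ent2_def)
  then show ?thesis
    by (subst (asm) summable_on_reindex_bij_betw[OF bij_betw_case_sum, symmetric])
       (simp add: case_prod_unfold mult.assoc)
qed

lemma ent2_mono:
  assumes "ent2 d" "\<And>K L. cmod (c K L) \<le> C * cmod (d K L)"
  shows "ent2 c"
  using ent_mono[of "jcoef d" "jcoef c" C] assms by (simp add: ent2_def jcoef_def)

lemma jcoef_shift: "jcoef c (N + case_sum K L) = jcoef (\<lambda>I J. c (I + K) (J + L)) N"
  by (simp add: jcoef_def, rule arg_cong2[where f = c]) (auto simp: fun_eq_iff)

lemma ent2_shift: "ent2 c \<Longrightarrow> ent2 (\<lambda>I J. c (I + K) (J + L))"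
  using ent_shift[of "jcoef c" "case_sum K L"] by (simp add: ent2_def jcoef_shift)

lemma
  assumes c: "ent2 c"
  shows tay_shift: "((\<lambda>(K, L). tay (\<lambda>I J. c (I + K) (J + L)) a / (of_nat (mfact K) * of_nat (mfact L))
           * mpow h K * conj_mpow h L) has_sum tay c (a + h)) UNIV"
    and ent2_tay_shift: "ent2 (\<lambda>K L. tay (\<lambda>I J. c (I + K) (J + L)) a)"
    and tay_shift_ps: "tay c (a + h) = ps (jcoef (\<lambda>K L. tay (\<lambda>I J. c (I + K) (J + L)) a)) (emb h)"
proof -
  have e: "ent (jcoef c)" using c by (simp add: ent2_def)
  have eq: "(\<lambda>J. ps (\<lambda>I. jcoef c (I + J)) (emb a)) = jcoef (\<lambda>K L. tay (\<lambda>I J. c (I + K) (J + L)) a)"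
  proof
    fix N :: "('a + 'a) mindex"
    have "ps (\<lambda>I. jcoef c (I + case_sum (N \<circ> Inl) (N \<circ> Inr))) (emb a) = jcoef (\<lambda>K L. tay (\<lambda>I J. c (I + K) (J + L)) a) N"
      unfolding jcoef_shift tay_eq_ps by (simp only: jcoef_def[of "\<lambda>K L. ps (jcoef (\<lambda>I J. c (I + K) (J + L))) (emb a)" N])
    then show "ps (\<lambda>I. jcoef c (I + N)) (emb a) = jcoef (\<lambda>K L. tay (\<lambda>I J. c (I + K) (J + L)) a) N" by simp
  qed
  show e2: "ent2 (\<lambda>K L. tay (\<lambda>I J. c (I + K) (J + L)) a)"
    unfolding ent2_def eq[symmetric] by (rule ent_ps_shift[OF e])
  have *: "((\<lambda>J. ps (\<lambda>I. jcoef c (I + J)) (emb a) / of_nat (mfact J) * mpow (emb h) J) has_sum tay c (a + h)) UNIV"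
    unfolding tay_eq_ps emb_add by (rule ps_shift[OF e])
  have "ps (\<lambda>I. jcoef c (I + J)) (emb a) = jcoef (\<lambda>K L. tay (\<lambda>I J. c (I + K) (J + L)) a) J" for J
    by (rule fun_cong[OF eq])
  with * have *: "((\<lambda>J. jcoef (\<lambda>K L. tay (\<lambda>I J. c (I + K) (J + L)) a) J / of_nat (mfact J) * mpow (emb h) J) has_sum tay c (a + h)) UNIV"
    by simp
  then show "tay c (a + h) = ps (jcoef (\<lambda>K L. tay (\<lambda>I J. c (I + K) (J + L)) a)) (emb h)"
    using ps_has_sum[OF e2[unfolded ent2_def], of "emb h"] has_sum_unique by blast
  from * show "((\<lambda>(K, L). tay (\<lambda>I J. c (I + K) (J + L)) a / (of_nat (mfact K) * of_nat (mfact L))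
           * mpow h K * conj_mpow h L) has_sum tay c (a + h)) UNIV"
    by (subst (asm) has_sum_reindex_bij_betw[OF bij_betw_case_sum, symmetric])
       (simp add: case_prod_unfold mult.assoc)
qed

section \<open>Termwise differentiation of the series in \<open>z\<close> and its conjugate\<close>

definition munit :: "'k \<Rightarrow> 'k mindex" where
  "munit k = (\<lambda>j. if j = k then 1 else 0)"

lemma msize_munit [simp]: "msize (munit k) = 1"
  by (simp add: msize_def munit_def)

lemma mfact_munit [simp]: "mfact (munit k) = 1"
  by (simp add: mfact_def munit_def if_distrib cong: if_cong)

lemma mpow_munit [simp]: "mpow w (munit k) = w $ k"
  by (simp add: mpow_def munit_def if_distrib cong: if_cong)

lemma munit_inj: "munit j = munit k \<longleftrightarrow> j = k"
  by (auto simp: munit_def fun_eq_iff split: if_splits)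

lemma msize_less_2:
  assumes "msize N < 2"
  shows "N = 0 \<or> (\<exists>k. N = munit k)"
proof (cases "N = 0")
  case False
  then obtain k where k: "N k \<noteq> 0" by (auto simp: fun_eq_iff)
  have "msize N = N k + (\<Sum>i\<in>UNIV - {k}. N i)"
    unfolding msize_def by (subst sum.remove[of _ k]) auto
  then have "N k = 1" "(\<Sum>i\<in>UNIV - {k}. N i) = 0" using assms k by linarith+
  then have "N = munit k" by (auto simp: munit_def fun_eq_iff)
  then show ?thesis by blast
qed simp

text \<open>A term of degree at least two is bounded by \<open>(norm w)\<^sup>2\<close> times its
  bound at radius one, and the latter bounds have a sum independent of \<open>w\<close>, which
  serves as \<open>C\<close>. The removed set \<open>?X\<close> contains the indices of degree zero
  and one.\<close>

lemma ps_remainder: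
  assumes d: "ent d"
  shows "\<exists>C. \<forall>w. norm w \<le> 1 \<longrightarrow> cmod (ps d w - d 0 - (\<Sum>k\<in>UNIV. d (munit k) * w $ k)) \<le> C * (norm w)\<^sup>2"
proof (intro exI allI impI)
  fix w :: "complex^'a" assume w: "norm w \<le> 1"
  let ?X = "insert 0 (range (munit :: 'a \<Rightarrow> 'a mindex))"
  let ?t = "\<lambda>N. d N / of_nat (mfact N) * mpow w N"
  have n0: "munit k \<noteq> 0" for k :: 'a
    by (auto simp: munit_def fun_eq_iff)
  have "sum ?t ?X = ?t 0 + sum ?t (range munit)"
    by (rule sum.insert) (use n0 in \<open>auto simp: image_iff dest: sym\<close>)
  also have "sum ?t (range munit) = (\<Sum>k\<in>UNIV. d (munit k) * w $ k)"
    by (subst sum.reindex) (auto simp: inj_on_def munit_inj)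
  finally have eq: "sum ?t ?X = d 0 + (\<Sum>k\<in>UNIV. d (munit k) * w $ k)"
    by (simp del: zero_fun_apply)
  have "(?t has_sum (ps d w - sum ?t ?X)) (UNIV - ?X)"
    by (rule has_sum_Diff[OF ps_has_sum[OF d]]) auto
  moreover have s: "(\<lambda>N. cmod (d N) * 1 ^ msize N / real (mfact N) * (norm w)\<^sup>2) summable_on (UNIV - ?X)"
    by (intro summable_on_cmult_left summable_on_subset_banach[OF entD[OF d]]) auto
  ultimately have "cmod (ps d w - sum ?t ?X)
      \<le> (\<Sum>\<^sub>\<infinity>N\<in>UNIV-?X. cmod (d N) * 1 ^ msize N / real (mfact N) * (norm w)\<^sup>2)"
  proof (rule norm_infsum_le[OF _ has_sum_infsum])
    fix N :: "'a mindex" assume N: "N \<in> UNIV - ?X"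
    then have "msize N \<ge> 2" using msize_less_2[of N] by fastforce
    then have "norm w ^ msize N \<le> (norm w)\<^sup>2" by (intro power_decreasing w) auto
    then have "cmod (mpow w N) \<le> (norm w)\<^sup>2" using norm_mpow_le[of w N] by linarith
    then show "cmod (?t N) \<le> cmod (d N) * 1 ^ msize N / real (mfact N) * (norm w)\<^sup>2"
      by (auto simp: norm_mult norm_divide intro!: divide_right_mono mult_left_mono)
  qed
  also have "\<dots> = (\<Sum>\<^sub>\<infinity>N\<in>UNIV-?X. cmod (d N) * 1 ^ msize N / real (mfact N)) * (norm w)\<^sup>2"
    by (rule infsum_cmult_left') 
  finally show "cmod (ps d w - d 0 - (\<Sum>k\<in>UNIV. d (munit k) * w $ k))
      \<le> (\<Sum>\<^sub>\<infinity>N\<in>UNIV-?X. cmod (d N) * 1 ^ msize N / real (mfact N)) * (norm w)\<^sup>2"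
    unfolding diff_diff_eq eq[symmetric] .
qed

definition shl :: "'n \<Rightarrow> ('n mindex \<Rightarrow> 'n mindex \<Rightarrow> complex) \<Rightarrow> 'n mindex \<Rightarrow> 'n mindex \<Rightarrow> complex" where
  "shl i c K L = c (K + munit i) L"

definition shr :: "'n \<Rightarrow> ('n mindex \<Rightarrow> 'n mindex \<Rightarrow> complex) \<Rightarrow> 'n mindex \<Rightarrow> 'n mindex \<Rightarrow> complex" where
  "shr i c K L = c K (L + munit i)"

lemma ent2_shl: "ent2 c \<Longrightarrow> ent2 (shl i c)" and ent2_shr: "ent2 c \<Longrightarrow> ent2 (shr i c)"
  using ent2_shift[of c "munit i" 0] ent2_shift[of c 0 "munit i"]
  by (simp_all add: shl_def[abs_def] shr_def[abs_def])

lemma munit_comp [simp]: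
  "munit (Inl i) \<circ> Inl = munit i" "munit (Inl i) \<circ> Inr = 0"
  "munit (Inr i) \<circ> Inr = munit i" "munit (Inr i) \<circ> Inl = 0"
  by (auto simp: munit_def fun_eq_iff)

text \<open>The linear part of the series recentred at \<open>a\<close> is given by the first-order
  shifts of \<open>c\<close>, and the quadratic remainder makes it the real derivative. The two
  groups of variables of \<open>emb\<close> contribute the terms in \<open>v\<close> and in
  \<open>cnj v\<close>.\<close>

lemma tay_has_derivative:
  assumes c: "ent2 c"
  shows "(tay c has_derivative (\<lambda>v. \<Sum>i\<in>UNIV. tay (shl i c) a * v $ i + tay (shr i c) a * cnj (v $ i))) (at a)"
    (is "(_ has_derivative ?D) _")
proof -
  let ?d = "jcoef (\<lambda>K L. tay (\<lambda>I J. c (I + K) (J + L)) a)"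
  have bl: "bounded_linear ?D"
    by (intro bounded_linear_sum bounded_linear_add bounded_linear_const_mult
          bounded_linear_compose[OF bounded_linear_cnj] bounded_linear_vec_nth)
  have D: "?D h = (\<Sum>k\<in>UNIV. ?d (munit k) * emb h $ k)" for h
    by (simp add: sum_UNIV_Plus jcoef_def emb_def sum.distrib shl_def[abs_def] shr_def[abs_def])
  have d0: "?d 0 = tay c a"
    by (simp add: jcoef_def comp_def zero_fun_def[symmetric])
  obtain C where C: "\<And>w. norm w \<le> 1 \<Longrightarrow> cmod (ps ?d w - ?d 0 - (\<Sum>k\<in>UNIV. ?d (munit k) * w $ k)) \<le> C * (norm w)\<^sup>2"
    using ps_remainder[of ?d] ent2_tay_shift[OF c, of a] by (auto simp: ent2_def)
  have gen: "norm (x / y) \<le> 4 * \<bar>C\<bar> * y" if "x \<le> 4 * \<bar>C\<bar> * y * y" "x \<ge> 0" "y \<ge> 0" for x y :: real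
    using that by (cases "y = 0") (auto simp: divide_simps)
  have "((\<lambda>h. norm (tay c (a + h) - tay c a - ?D h) / norm h) \<longlongrightarrow> 0) (at 0)"
  proof (rule Lim_null_comparison)
    show "((\<lambda>h::complex^'a. 4 * \<bar>C\<bar> * norm h) \<longlongrightarrow> 0) (at 0)"
      by (auto intro!: tendsto_eq_intros)
    have "eventually (\<lambda>h. h \<in> ball 0 (1/2)) (at (0::complex^'a))"
      by (intro eventually_at_in_open') auto
    then show "eventually (\<lambda>h. norm (norm (tay c (a + h) - tay c a - ?D h) / norm h) \<le> 4 * \<bar>C\<bar> * norm h) (at 0)"
    proof eventually_elim
      case (elim h)
      then have "norm (emb h) \<le> 1" using norm_emb_le[of h] by simp
      from C[OF this] have "norm (tay c (a + h) - tay c a - ?D h) \<le> C * (norm (emb h))\<^sup>2"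
        unfolding tay_shift_ps[OF c] D d0 .
      also have "\<dots> \<le> \<bar>C\<bar> * (2 * norm h)\<^sup>2"
        by (intro mult_mono power_mono norm_emb_le) auto
      also have "\<bar>C\<bar> * (2 * norm h)\<^sup>2 = 4 * \<bar>C\<bar> * norm h * norm h"
        by (simp add: power2_eq_square)
      finally show ?case by (rule gen) auto
    qed
  qed
  then show ?thesis using bl by (simp add: has_derivative_at)
qed

lemma tay_frechet:
  assumes "ent2 c"
  shows "frechet_derivative (tay c) (at a) v = (\<Sum>i\<in>UNIV. tay (shl i c) a * v $ i + tay (shr i c) a * cnj (v $ i))"
  by (rule fun_cong[OF frechet_derivative_at[OF tay_has_derivative[OF assms, of a]], symmetric])

lemma tay_add:
  assumes "ent2 c" "ent2 d"
  shows "tay (\<lambda>K L. c K L + d K L) = (\<lambda>z. tay c z + tay d z)" "ent2 (\<lambda>K L. c K L + d K L)"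
proof -
  show "tay (\<lambda>K L. c K L + d K L) = (\<lambda>z. tay c z + tay d z)"
  proof
    fix z
    have "((\<lambda>(K, L). (c K L + d K L) / (of_nat (mfact K) * of_nat (mfact L)) * mpow z K * conj_mpow z L)
            has_sum tay c z + tay d z) UNIV"
      using has_sum_add[OF tay_has_sum[OF assms(1), of z] tay_has_sum[OF assms(2), of z]]
      by (simp add: case_prod_unfold algebra_simps add_divide_distrib)
    then show "tay (\<lambda>K L. c K L + d K L) z = tay c z + tay d z"
      unfolding tay_def[of "\<lambda>K L. c K L + d K L"] by (rule infsumI)
  qed
  show "ent2 (\<lambda>K L. c K L + d K L)"
    unfolding ent2_iff
  proof (intro allI impI)
    fix r :: real assume r: "r \<ge> 0"
    have "(\<lambda>(K, L). cmod (c K L) * r ^ (msize K + msize L) / (real (mfact K) * real (mfact L))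
       + cmod (d K L) * r ^ (msize K + msize L) / (real (mfact K) * real (mfact L))) summable_on UNIV"
      using summable_on_add[OF assms[unfolded ent2_iff, rule_format, OF r]]
      by (simp add: case_prod_unfold)
    then show "(\<lambda>(K, L). cmod (c K L + d K L) * r ^ (msize K + msize L) / (real (mfact K) * real (mfact L))) summable_on UNIV"
      by (rule summable_on_comparison_test)
        (use r in \<open>auto simp: case_prod_unfold add_divide_distrib[symmetric] distrib_right[symmetric]
           intro!: divide_right_mono mult_right_mono norm_triangle_ineq\<close>)
  qed
qed

lemma tay_scale:
  "tay (\<lambda>K L. a * c K L) = (\<lambda>z. a * tay c z)" "ent2 c \<Longrightarrow> ent2 (\<lambda>K L. a * c K L)"
proof -
  show "tay (\<lambda>K L. a * c K L) = (\<lambda>z. a * tay c z)"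
    unfolding tay_def
    by (subst infsum_cmult_right'[symmetric]) (simp add: case_prod_unfold mult.assoc)
  show "ent2 c \<Longrightarrow> ent2 (\<lambda>K L. a * c K L)"
    by (rule ent2_mono[where C = "cmod a"]) (auto simp: norm_mult)
qed

lemma ent2_0: "ent2 (\<lambda>K L. 0)"
  by (simp add: ent2_iff case_prod_unfold)

lemma tay_0: "tay (\<lambda>K L. 0) = (\<lambda>z. 0)"
  by (simp add: tay_def case_prod_unfold fun_eq_iff)

lemma tay_sum:
  assumes "finite A" "\<And>i. i \<in> A \<Longrightarrow> ent2 (c i)"
  shows "tay (\<lambda>K L. \<Sum>i\<in>A. c i K L) = (\<lambda>z. \<Sum>i\<in>A. tay (c i) z) \<and> ent2 (\<lambda>K L. \<Sum>i\<in>A. c i K L)"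
  using assms by (induction A rule: finite_induct) (auto simp: tay_add tay_0 ent2_0)

lemma dz_tay: "ent2 c \<Longrightarrow> dz i (tay c) = tay (shl i c)"
  and dzbar_tay: "ent2 c \<Longrightarrow> dzbar i (tay c) = tay (shr i c)"
proof -
  assume c: "ent2 c"
  have "(\<Sum>j\<in>UNIV. f j * axis i x $ j + g j * cnj (axis i x $ j)) = f i * x + g i * cnj x"
    for f g :: "'a \<Rightarrow> complex" and x
  proof -
    have "(\<Sum>j\<in>UNIV. f j * axis i x $ j + g j * cnj (axis i x $ j))
      = (\<Sum>j\<in>UNIV. if j = i then f j * x + g j * cnj x else 0)"
      by (rule sum.cong) (auto simp: axis_def)
    then show ?thesis by simp
  qed
  note * = this
  show "dz i (tay c) = tay (shl i c)" "dzbar i (tay c) = tay (shr i c)"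
    unfolding dz_def dzbar_def tay_frechet[OF c] * by (auto simp: algebra_simps)
qed

text \<open>The derivative in a fixed direction is again the series of an array, namely a linear
  combination of shifted arrays. An induction over all arrays at once therefore closes.\<close>

lemma Ck_tay: "ent2 c \<Longrightarrow> Ck k (tay c)"
proof (induction k arbitrary: c)
  case 0
  then have "\<And>a. isCont (tay c) a"
    using tay_has_derivative has_derivative_continuous by blast
  then show ?case by (simp add: continuous_at_imp_continuous_on)
next
  case (Suc k)
  have "Ck k (\<lambda>z. frechet_derivative (tay c) (at z) v)" for v
  proof -
    let ?c = "\<lambda>K L. \<Sum>i\<in>UNIV. v $ i * shl i c K L + cnj (v $ i) * shr i c K L"
    have "tay ?c = (\<lambda>z. \<Sum>i\<in>UNIV. tay (\<lambda>K L. v $ i * shl i c K L + cnj (v $ i) * shr i c K L) z) \<and> ent2 ?c"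
      by (rule tay_sum) (auto intro!: tay_add tay_scale ent2_shl ent2_shr Suc.prems)
    moreover have "tay (\<lambda>K L. v $ i * shl i c K L + cnj (v $ i) * shr i c K L)
        = (\<lambda>z. tay (shl i c) z * v $ i + tay (shr i c) z * cnj (v $ i))" for i
      by (subst tay_add) (auto intro!: tay_scale ent2_shl ent2_shr Suc.prems simp: tay_scale(1) mult.commute)
    ultimately have "(\<lambda>z. frechet_derivative (tay c) (at z) v) = tay ?c" "ent2 ?c"
      by (auto simp: tay_frechet[OF Suc.prems])
    then show ?thesis using Suc.IH by simp
  qed
  then show ?case
    using tay_has_derivative[OF Suc.prems] by (auto simp: differentiable_def)
qed

lemma smooth_tay: "ent2 c \<Longrightarrow> smooth (tay c)"
  by (simp add: smooth_def Ck_tay)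

lemma distinct_coords: "distinct (coords :: 'n::finite list) \<and> set (coords :: 'n list) = UNIV"
  unfolding coords_def by (rule someI_ex) (metis finite finite_distinct_list)

text \<open>Common to \<open>dz\<close> and \<open>dzbar\<close>: \<open>sh i\<close> is the shift
  of arrays induced by one derivative, \<open>S N\<close> the shift by a whole multiindex. Folding
  over a list of distinct coordinates shifts by \<open>N\<close> restricted to that list, and
  \<open>coords\<close> contains every coordinate.\<close>

lemma miter_shift:
  assumes step: "\<And>i c. ent2 c \<Longrightarrow> d i (tay c) = tay (sh i c) \<and> ent2 (sh i c)"
    and sh: "\<And>k i c. (sh i ^^ k) c = S (\<lambda>j. if j = i then k else 0) c"
    and S0: "\<And>c. S 0 c = c" and SS: "\<And>M N c. S M (S N c) = S (M + N) c"
    and c: "ent2 c"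
  shows "miter d N (tay c) = tay (S N c) \<and> ent2 (S N c)"
proof -
  have pw: "(d i ^^ k) (tay c) = tay ((sh i ^^ k) c) \<and> ent2 ((sh i ^^ k) c)" if "ent2 c" for i k c
    using that by (induction k) (auto simp: step)
  have "distinct xs \<Longrightarrow> foldr (\<lambda>i. d i ^^ N i) xs (tay c) = tay (S (\<lambda>j. if j \<in> set xs then N j else 0) c)
      \<and> ent2 (S (\<lambda>j. if j \<in> set xs then N j else 0) c)" for xs
  proof (induction xs)
    case Nil
    then show ?case using S0[unfolded zero_fun_def] c by simp
  next
    case (Cons x xs)
    let ?c = "S (\<lambda>j. if j \<in> set xs then N j else 0) c"
    have "(\<lambda>j. if j = x then N x else 0) + (\<lambda>j. if j \<in> set xs then N j else 0)
       = (\<lambda>j. if j \<in> set (x # xs) then N j else 0)"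
      using Cons.prems by (auto simp: fun_eq_iff)
    then have "(sh x ^^ N x) ?c = S (\<lambda>j. if j \<in> set (x # xs) then N j else 0) c"
      by (simp only: sh SS)
    moreover have "(d x ^^ N x) (tay ?c) = tay ((sh x ^^ N x) ?c) \<and> ent2 ((sh x ^^ N x) ?c)"
      using Cons by (intro pw) auto
    moreover have "foldr (\<lambda>i. d i ^^ N i) (x # xs) (tay c) = (d x ^^ N x) (tay ?c)"
      using Cons by simp
    ultimately show ?case by simp
  qed
  note * = this[OF conjunct1[OF distinct_coords]]
  have eq: "(\<lambda>j. if j \<in> set (coords :: 'a list) then N j else 0) = N"
    using distinct_coords[where 'n = 'a] by (simp add: fun_eq_iff)
  from * show ?thesis
    unfolding eq miter_def .
qed

lemma shl_pow: "(shl i ^^ k) c = (\<lambda>K L. c (K + (\<lambda>j. if j = i then k else 0)) L)"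
proof (induction k)
  case 0
  show ?case by (simp add: zero_fun_def[symmetric])
next
  case (Suc k)
  have "K + munit i + (\<lambda>j. if j = i then k else 0) = K + (\<lambda>j. if j = i then Suc k else 0)" for K
    by (auto simp: munit_def fun_eq_iff)
  with Suc show ?case by (simp add: shl_def[abs_def] del: plus_fun_apply)
qed

lemma shr_pow: "(shr i ^^ k) c = (\<lambda>K L. c K (L + (\<lambda>j. if j = i then k else 0)))"
proof (induction k)
  case 0
  show ?case by (simp add: zero_fun_def[symmetric])
next
  case (Suc k)
  have "K + munit i + (\<lambda>j. if j = i then k else 0) = K + (\<lambda>j. if j = i then Suc k else 0)" for K
    by (auto simp: munit_def fun_eq_iff)
  with Suc show ?case by (simp add: shr_def[abs_def] del: plus_fun_apply)
qed

lemma pderivs_tay: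
  assumes c: "ent2 c"
  shows "pderivs R S (tay c) = tay (\<lambda>K L. c (K + R) (L + S))"
proof -
  have 1: "miter dz N (tay c) = tay (\<lambda>K L. c (K + N) L) \<and> ent2 (\<lambda>K L. c (K + N) L)" if "ent2 c" for N and c :: "'a mindex \<Rightarrow> _"
    by (rule miter_shift[where sh = shl and S = "\<lambda>N c K L. c (K + N) L"])
       (auto simp: dz_tay ent2_shl that shl_pow add.assoc)
  have 2: "miter dzbar N (tay c) = tay (\<lambda>K L. c K (L + N)) \<and> ent2 (\<lambda>K L. c K (L + N))" for N
    by (rule miter_shift[where sh = shr and S = "\<lambda>N c K L. c K (L + N)"])
       (auto simp: dzbar_tay ent2_shr c shr_pow add.assoc)
  show ?thesis
    using 1[of "\<lambda>K L. c K (L + S)" R] 2[of S] by (simp add: pderivs_def)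
qed

lemma tay_at_0: "tay c 0 = c 0 0"
proof -
  have "tay c 0 = (\<Sum>\<^sub>\<infinity>(K, L)\<in>{(0, 0)}. c K L / (of_nat (mfact K) * of_nat (mfact L)) * mpow 0 K * conj_mpow 0 L)"
    unfolding tay_def
    by (rule infsum_cong_neutral) (auto simp: mpow_at_0 cnj_mpow[symmetric] split: if_splits)
  then show ?thesis by simp
qed

lemma pderivs_tay_0: "ent2 c \<Longrightarrow> pderivs R S (tay c) 0 = c R S"
  by (simp add: pderivs_tay tay_at_0)

lemma real_analytic_tay:
  assumes "ent2 c"
  shows "real_analytic (tay c)"
  unfolding real_analytic_def
\<comment> \<open>The recentred series converges everywhere, so the radius is arbitrary; it is taken
  to be one.\<close>
proof (intro conjI allI smooth_tay assms exI[of _ "1::real"] ballI)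
  fix a z
  show "((\<lambda>(K, L). pderivs K L (tay c) a / (of_nat (mfact K) * of_nat (mfact L))
                * mpow (z - a) K * conj_mpow (z - a) L) has_sum tay c z) UNIV"
    using tay_shift[OF assms, of a "z - a"] by (simp add: pderivs_tay[OF assms])
qed simp


subsection \<open>The identity theorem for real-analytic functions\<close>

lemma Ck_lincomb:
  assumes "Ck k f" "Ck k g"
  shows "Ck k (\<lambda>z. a * f z + b * g z)"
  using assms
proof (induction k arbitrary: f g)
  case 0
  then show ?case by (auto intro!: continuous_intros)
next
  case (Suc k)
  have D: "((\<lambda>z. a * f z + b * g z) has_derivative
      (\<lambda>v. a * frechet_derivative f (at z) v + b * frechet_derivative g (at z) v)) (at z)" for z
    using Suc.prems frechet_derivative_works
    by (intro has_derivative_add has_derivative_mult_right) auto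
  have "frechet_derivative (\<lambda>z. a * f z + b * g z) (at z) v =
      a * frechet_derivative f (at z) v + b * frechet_derivative g (at z) v" for z v
    by (rule fun_cong[OF frechet_derivative_at[OF D[of z]], symmetric])
  then show ?case
    using D Suc by (auto simp: differentiable_def)
qed

lemma smooth_dz: "smooth f \<Longrightarrow> smooth (dz i f)" and smooth_dzbar: "smooth f \<Longrightarrow> smooth (dzbar i f)"
proof -
  assume f: "smooth f"
  have F: "Ck k (\<lambda>z. frechet_derivative f (at z) v)" for k v
    using f[unfolded smooth_def, rule_format, of "Suc k"] by simp
  have "dz i f = (\<lambda>z. (1/2) * frechet_derivative f (at z) (axis i 1) + (- \<i> / 2) * frechet_derivative f (at z) (axis i \<i>))"
    "dzbar i f = (\<lambda>z. (1/2) * frechet_derivative f (at z) (axis i 1) + (\<i> / 2) * frechet_derivative f (at z) (axis i \<i>))"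
    by (auto simp: dz_def dzbar_def field_simps)
  then show "smooth (dz i f)" "smooth (dzbar i f)"
    using Ck_lincomb[OF F F] by (simp_all only: smooth_def) auto
qed

lemma foldr_funpow_invariant:
  assumes "\<And>i f. P f \<Longrightarrow> P (d i f)" "P f"
  shows "P (foldr (\<lambda>i. d i ^^ N i) xs f)"
proof (induction xs)
  case (Cons x xs)
  have "P ((d x ^^ k) g)" if "P g" for k g
    using that by (induction k) (auto simp: assms)
  with Cons show ?case by simp
qed (simp add: assms)

lemma smooth_pderivs: "smooth f \<Longrightarrow> smooth (pderivs R S f)"
  unfolding pderivs_def miter_def
  by (rule foldr_funpow_invariant[where P = smooth, OF smooth_dz
        foldr_funpow_invariant[where P = smooth, OF smooth_dzbar]])

lemma frechet_derivative_cong_open: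
  assumes "open U" "z \<in> U" "\<And>x. x \<in> U \<Longrightarrow> f x = g x"
  shows "frechet_derivative f (at z) = frechet_derivative g (at z)"
proof -
  have "(f has_derivative D) (at z) \<longleftrightarrow> (g has_derivative D) (at z)" for D
    using has_derivative_transform_within_open[OF _ assms(1,2), of f D UNIV g]
      has_derivative_transform_within_open[OF _ assms(1,2), of g D UNIV f] assms(3) by auto
  then show ?thesis by (simp add: frechet_derivative_def)
qed

text \<open>Derivatives are local, so agreement on an open set is inherited by one derivative on the
  same set and then by all iterated ones.\<close>

lemma pderivs_cong_open:
  assumes U: "open U" and eq: "\<And>x. x \<in> U \<Longrightarrow> f x = g x" and z: "z \<in> U"
  shows "pderivs R S f z = pderivs R S g z"
proof -
  have d: "(\<forall>x\<in>U. dz i f x = dz i g x) \<and> (\<forall>x\<in>U. dzbar i f x = dzbar i g x)" if "\<forall>x\<in>U. f x = g x" for i f g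
    using frechet_derivative_cong_open[OF U _ that[rule_format]] by (simp add: dz_def dzbar_def)
  have pw: "\<forall>x\<in>U. (D i ^^ k) f x = (D i ^^ k) g x"
    if "\<forall>x\<in>U. f x = g x" "D = dz \<or> D = dzbar" for i k f g and D :: "'a \<Rightarrow> 'a cfun \<Rightarrow> 'a cfun"
    using that by (induction k) (auto simp: d)
  have fd: "\<forall>x\<in>U. foldr (\<lambda>i. D i ^^ N i) xs f x = foldr (\<lambda>i. D i ^^ N i) xs g x"
    if "\<forall>x\<in>U. f x = g x" "D = dz \<or> D = dzbar" for N xs f g and D :: "'a \<Rightarrow> 'a cfun \<Rightarrow> 'a cfun"
    using that
  proof (induction xs)
    case (Cons x xs)
    then have "\<forall>z\<in>U. foldr (\<lambda>i. D i ^^ N i) xs f z = foldr (\<lambda>i. D i ^^ N i) xs g z" by blast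
    from pw[OF this Cons.prems(2)] show ?case by simp
  qed simp
  have 1: "\<forall>x\<in>U. miter dzbar S f x = miter dzbar S g x"
    unfolding miter_def using eq by (intro fd) auto
  have "\<forall>x\<in>U. pderivs R S f x = pderivs R S g x"
    unfolding pderivs_def miter_def[of dz] by (rule fd[OF 1]) simp
  with z show ?thesis by blast
qed

text \<open>The set where all derivatives agree is closed by continuity, open because both functions
  equal their Taylor series near each of its points, and contains the origin. Connectedness makes it
  the whole space.\<close>

lemma real_analytic_eq:
  assumes f: "real_analytic f" and g: "real_analytic g"
    and eq: "\<And>K L. pderivs K L f 0 = pderivs K L g 0"
  shows "f = g"
proof -
  define A where "A = {a. \<forall>K L. pderivs K L f a = pderivs K L g a}"
  have cont: "continuous_on UNIV (pderivs K L h)" if "real_analytic h" for K L and h :: "'a cfun"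
  proof -
    have "Ck 0 (pderivs K L h)"
      using that smooth_pderivs[of h K L] unfolding real_analytic_def smooth_def by blast
    then show ?thesis by simp
  qed
  have "closed A"
    unfolding A_def Collect_all_eq
    by (intro closed_INT ballI closed_Collect_eq cont f g)
  moreover have "open A"
    unfolding open_contains_ball
  proof
    fix a assume a: "a \<in> A"
    obtain r where r: "r > 0" "\<And>z. z \<in> ball a r \<Longrightarrow> ((\<lambda>(K, L). pderivs K L f a / (of_nat (mfact K) * of_nat (mfact L))
                * mpow (z - a) K * conj_mpow (z - a) L) has_sum f z) UNIV"
      using f unfolding real_analytic_def by meson
    obtain s where s: "s > 0" "\<And>z. z \<in> ball a s \<Longrightarrow> ((\<lambda>(K, L). pderivs K L g a / (of_nat (mfact K) * of_nat (mfact L))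
                * mpow (z - a) K * conj_mpow (z - a) L) has_sum g z) UNIV"
      using g unfolding real_analytic_def by meson
    have "f z = g z" if "z \<in> ball a (min r s)" for z
    proof (rule has_sum_unique[OF r(2)])
      have "pderivs K L f a = pderivs K L g a" for K L using a by (simp add: A_def)
      then show "((\<lambda>(K, L). pderivs K L f a / (of_nat (mfact K) * of_nat (mfact L))
                * mpow (z - a) K * conj_mpow (z - a) L) has_sum g z) UNIV"
        using s(2)[of z] that by simp
    qed (use that in simp)
    then have "ball a (min r s) \<subseteq> A"
      unfolding A_def by (auto intro: pderivs_cong_open[of "ball a (min r s)"])
    then show "\<exists>e>0. ball a e \<subseteq> A" using r(1) s(1) by (intro exI[of _ "min r s"]) auto
  qed
  moreover have "0 \<in> A" using eq by (simp add: A_def)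
  ultimately have "A = UNIV" using clopen[of A] by auto
  \<comment> \<open>The derivative of order zero is the function itself, so agreement of all
    derivatives includes agreement of values.\<close>
  moreover have "pderivs 0 0 h = h" for h :: "'a cfun"
  proof -
    have "foldr (\<lambda>i. (D i ^^ 0)) xs f = f" for xs and f :: "'a cfun" and D :: "'a \<Rightarrow> 'a cfun \<Rightarrow> 'a cfun"
      by (induction xs) auto
    then show ?thesis by (simp add: pderivs_def miter_def)
  qed
  ultimately have "f a = g a" for a
    using A_def by (metis (mono_tags, lifting) UNIV_I mem_Collect_eq)
  then show ?thesis by blast
qed

subsection \<open>Sums in the extended nonnegative reals\<close>

lemma summable_ennreal: "f summable_on A" for f :: "'a \<Rightarrow> ennreal"
  by (rule nonneg_summable_on_complete) simp

text \<open>Counting measure is the bridge to integration theory: linearity, Tonelli and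
  Cauchy-Schwarz for \<open>infsum\<close> are taken from there.\<close>

lemma infsum_eq_nn_integral:
  fixes f :: "'a::countable \<Rightarrow> ennreal"
  shows "infsum f A = (\<integral>\<^sup>+x. f x \<partial>count_space A)"
proof (cases "finite A")
  case True
  then show ?thesis by (simp add: nn_integral_count_space_finite)
next
  case False
  have b: "bij_betw (from_nat_into A) UNIV A"
    using False by (intro bij_betw_from_nat_into) auto
  have "infsum f A = (\<Sum>\<^sub>\<infinity>n. f (from_nat_into A n))"
    by (rule infsum_reindex_bij_betw[OF b, symmetric])
  also have "\<dots> = (\<Sum>n. f (from_nat_into A n))"
    using has_sum_imp_sums[OF has_sum_infsum[OF summable_ennreal]] by (simp add: sums_iff)
  also have "\<dots> = (\<integral>\<^sup>+n. f (from_nat_into A n) \<partial>count_space UNIV)"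
    by (rule nn_integral_count_space_nat[symmetric])
  also have "\<dots> = (\<integral>\<^sup>+x. f x \<partial>count_space A)"
    by (rule nn_integral_bij_count_space[OF b])
  finally show ?thesis .
qed

lemma infsum_mono_ennreal:
  fixes f g :: "'a \<Rightarrow> ennreal"
  shows "(\<And>x. x \<in> A \<Longrightarrow> f x \<le> g x) \<Longrightarrow> infsum f A \<le> infsum g A"
  by (rule infsum_mono[OF summable_ennreal summable_ennreal])

lemma infsum_cmult_ennreal:
  fixes f :: "'a::countable \<Rightarrow> ennreal"
  shows "(\<Sum>\<^sub>\<infinity>x\<in>A. c * f x) = c * infsum f A"
  unfolding infsum_eq_nn_integral by (rule nn_integral_cmult) simp

lemma infsum_sum_ennreal:
  fixes f :: "'a::countable \<Rightarrow> 'b \<Rightarrow> ennreal"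
  shows "(\<Sum>\<^sub>\<infinity>x\<in>A. \<Sum>i\<in>I. f x i) = (\<Sum>i\<in>I. \<Sum>\<^sub>\<infinity>x\<in>A. f x i)"
  unfolding infsum_eq_nn_integral by (rule nn_integral_sum) simp

lemma infsum_pair_ennreal:
  fixes f :: "'a::countable \<Rightarrow> 'b::countable \<Rightarrow> ennreal"
  shows "(\<Sum>\<^sub>\<infinity>(x, y). f x y) = (\<Sum>\<^sub>\<infinity>x. \<Sum>\<^sub>\<infinity>y. f x y)"
  unfolding infsum_eq_nn_integral
  using nn_integral_fst_count_space[of "\<lambda>(x, y). f x y"] by simp

lemma sum_le_infsum_ennreal:
  fixes f :: "'a \<Rightarrow> ennreal"
  assumes "finite F" "F \<subseteq> A"
  shows "sum f F \<le> infsum f A"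
  using assms by (subst nonneg_infsum_complete) (auto intro: SUP_upper)

lemma single_le_infsum_ennreal:
  fixes f :: "'a \<Rightarrow> ennreal"
  assumes "x \<in> A"
  shows "f x \<le> infsum f A"
  using sum_le_infsum_ennreal[of "{x}" A f] assms by auto

lemma infsum_ennreal:
  fixes f :: "'a \<Rightarrow> real"
  assumes "f summable_on A" "\<And>x. x \<in> A \<Longrightarrow> f x \<ge> 0"
  shows "(\<Sum>\<^sub>\<infinity>x\<in>A. ennreal (f x)) = ennreal (infsum f A)"
proof -
  have "infsum (ennreal \<circ> f) A = ennreal (infsum f A)"
    using assms by (intro infsum_comm_additive_general)
      (auto intro!: sum_ennreal continuous_on_imp_continuous_within[of UNIV] continuous_on_ennreal simp: subset_iff)
  then show ?thesis by (simp add: comp_def)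
qed

text \<open>Finiteness obtained in the extended reals is turned back into real summability here;
  this is how estimates of seminorms yield convergent series.\<close>

lemma summable_on_iff_ennreal:
  fixes f :: "'a \<Rightarrow> real"
  assumes nn: "\<And>x. x \<in> A \<Longrightarrow> f x \<ge> 0"
  shows "f summable_on A \<longleftrightarrow> (\<Sum>\<^sub>\<infinity>x\<in>A. ennreal (f x)) < \<infinity>"
proof
  assume "(\<Sum>\<^sub>\<infinity>x\<in>A. ennreal (f x)) < \<infinity>"
  then obtain s where s: "(\<Sum>\<^sub>\<infinity>x\<in>A. ennreal (f x)) = ennreal s" "s \<ge> 0"
    by (cases "\<Sum>\<^sub>\<infinity>x\<in>A. ennreal (f x)") auto
  show "f summable_on A"
  proof (rule nonneg_bdd_above_summable_on[OF nn])
    show "bdd_above (sum f ` {F. F \<subseteq> A \<and> finite F})"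
    proof (rule bdd_aboveI2)
      fix F assume F: "F \<in> {F. F \<subseteq> A \<and> finite F}"
      have "ennreal (sum f F) = (\<Sum>x\<in>F. ennreal (f x))"
        using F nn by (intro sum_ennreal[symmetric]) auto
      also have "\<dots> \<le> ennreal s"
        unfolding s(1)[symmetric] using F by (intro sum_le_infsum_ennreal) auto
      finally show "sum f F \<le> s" using s by simp
    qed
  qed
qed (simp add: infsum_ennreal nn)

lemma ennreal_power_le_imp_le:
  fixes x y :: ennreal
  assumes le: "x ^ n \<le> y ^ n" and n: "n > 0"
  shows "x \<le> y"
proof (cases "y = top")
  case False
  then have "x ^ n < top"
    by (intro le_less_trans[OF le]) (simp add: power_less_top_ennreal less_top)
  then have "x < top" using n by (simp add: power_less_top_ennreal)
  with False obtain a b where *: "x = ennreal a" "y = ennreal b" "a \<ge> 0" "b \<ge> 0"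
    by (metis enn2real_nonneg ennreal_enn2real less_top)
  with le have "a ^ n \<le> b ^ n" by (simp add: ennreal_power)
  then have "a \<le> b" using * n by (intro power_le_imp_le_base[of a "n - 1"]) auto
  with * show ?thesis by (simp add: ennreal_leI)
qed simp

text \<open>The root with value \<infinity> at \<infinity>. It serves to rewrite a bound
  \<open>w\<^sup>2 \<le> u * v\<close> as \<open>w \<le> usqrt u * usqrt v\<close>, the shape in
  which the integral inequality applies.\<close>

definition usqrt :: "ennreal \<Rightarrow> ennreal" where
  "usqrt x = (if x = \<infinity> then \<infinity> else ennreal (sqrt (enn2real x)))"

lemma usqrt_power2 [simp]: "(usqrt x)\<^sup>2 = x"
proof (cases x)
  case (real r)
  then show ?thesis by (simp add: usqrt_def ennreal_power)
next
  case top
  then show ?thesis by (simp add: usqrt_def power2_eq_square ennreal_top_mult)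
qed

text \<open>Hypothesis and conclusion have the same shape, a square bounded by a product. This lets
  the inequality pass through any number of nested sums.\<close>

lemma infsum_Cauchy_Schwarz:
  fixes u v w :: "'a::countable \<Rightarrow> ennreal"
  assumes "\<And>x. x \<in> A \<Longrightarrow> (w x)\<^sup>2 \<le> u x * v x"
  shows "(infsum w A)\<^sup>2 \<le> infsum u A * infsum v A"
proof -
  have "w x \<le> usqrt (u x) * usqrt (v x)" if "x \<in> A" for x
    using assms[OF that] by (rule_tac ennreal_power_le_imp_le[where n = 2]) (simp_all add: power_mult_distrib)
  then have "infsum w A \<le> (\<Sum>\<^sub>\<infinity>x\<in>A. usqrt (u x) * usqrt (v x))"
    by (rule infsum_mono_ennreal)
  then have "(infsum w A)\<^sup>2 \<le> (\<Sum>\<^sub>\<infinity>x\<in>A. usqrt (u x) * usqrt (v x))\<^sup>2"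
    by (rule power_mono) simp
  also have "\<dots> \<le> infsum u A * infsum v A"
    unfolding infsum_eq_nn_integral
    using Cauchy_Schwarz_nn_integral[of "\<lambda>x. usqrt (u x)" "count_space A" "\<lambda>x. usqrt (v x)"] by simp
  finally show ?thesis .
qed

lemma sum_Cauchy_Schwarz_ennreal:
  fixes u v w c :: "'a::countable \<Rightarrow> ennreal"
  assumes "finite A" "\<And>x. x \<in> A \<Longrightarrow> (w x)\<^sup>2 \<le> u x * v x"
  shows "(\<Sum>x\<in>A. c x * w x)\<^sup>2 \<le> (\<Sum>x\<in>A. c x * u x) * (\<Sum>x\<in>A. c x * v x)"
proof -
  have "(c x * w x)\<^sup>2 \<le> (c x * u x) * (c x * v x)" if "x \<in> A" for x
    using mult_left_mono[OF assms(2)[OF that], of "(c x)\<^sup>2"]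
    by (simp add: power_mult_distrib power2_eq_square ac_simps)
  from infsum_Cauchy_Schwarz[of A, OF this] show ?thesis
    using assms(1) by simp
qed

text \<open>Dominated convergence for sums along an arbitrary filter; the filter of finite index
  sets, along which series converge, asks for this generality. A finite set \<open>G\<close> carries
  all but less than \<open>r / 2\<close> of the dominating sum, and on \<open>G\<close> the
  entrywise limits suffice.\<close>

lemma infsum_tendsto_0_ennreal:
  fixes g :: "'x \<Rightarrow> 'a \<Rightarrow> ennreal"
  assumes le: "\<And>x i. g x i \<le> d i" and fin: "infsum d UNIV < \<infinity>"
    and lim: "\<And>i. ((\<lambda>x. g x i) \<longlongrightarrow> 0) F"
  shows "((\<lambda>x. infsum (g x) UNIV) \<longlongrightarrow> 0) F"
proof (rule tendsto_zero_ennreal)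
  fix r :: real assume r: "r > 0"
  define e where "e = enn2real \<circ> d"
  have "d i < \<infinity>" for i
    using fin single_le_infsum_ennreal[of i UNIV d] by (auto intro: le_less_trans)
  then have d: "d i = ennreal (e i)" for i
    by (simp add: e_def)
  have e0: "e i \<ge> 0" for i by (simp add: e_def)
  have es: "e summable_on UNIV"
    using fin unfolding d[THEN ext] by (subst summable_on_iff_ennreal) (simp_all add: e0)
  have "\<exists>G. finite G \<and> infsum d UNIV < sum d G + ennreal (r / 2)"
  proof -
    obtain G where G: "finite G" "dist (sum e G) (infsum e UNIV) \<le> r / 3"
      using infsum_finite_approximation[OF es, of "r / 3"] r by auto
    then have "infsum e UNIV < sum e G + r / 2"
      using r unfolding dist_real_def by linarith
    then have "ennreal (infsum e UNIV) < ennreal (sum e G + r / 2)"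
      using r by (intro ennreal_lessI) (auto intro!: add_nonneg_pos sum_nonneg e0)
    also have "ennreal (sum e G + r / 2) = sum d G + ennreal (r / 2)"
      using r by (simp add: d sum_ennreal e0 sum_nonneg)
    also have "ennreal (infsum e UNIV) = infsum d UNIV"
      using infsum_ennreal[OF es e0] unfolding d[THEN ext] by simp
    finally show ?thesis using G by blast
  qed
  then obtain G where G: "finite G" "infsum d UNIV < sum d G + ennreal (r / 2)" by blast
  have split: "infsum f UNIV = sum f G + infsum f (UNIV - G)" for f :: "'a \<Rightarrow> ennreal"
    using infsum_Un_disjoint[of f G "UNIV - G", OF summable_ennreal summable_ennreal] G by (simp add: Un_Diff_cancel)
  have "sum d G < \<infinity>"
    using fin split[of d] by (simp add: ennreal_add_eq_top less_top)
  then have tail: "infsum d (UNIV - G) < ennreal (r / 2)"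
    using G(2) unfolding split[of d] by (simp add: ennreal_add_left_cancel_less)
  have "((\<lambda>x. sum (g x) G) \<longlongrightarrow> (\<Sum>i\<in>G. 0)) F"
    by (intro tendsto_sum lim)
  then have "eventually (\<lambda>x. sum (g x) G < ennreal (r / 2)) F"
    using r by (intro order_tendstoD(2)[where y = 0]) auto
  then show "eventually (\<lambda>x. infsum (g x) UNIV < ennreal r) F"
  proof eventually_elim
    case (elim x)
    have le': "infsum (g x) (UNIV - G) \<le> infsum d (UNIV - G)"
      by (intro infsum_mono_ennreal le)
    have "sum (g x) G + infsum (g x) (UNIV - G) < ennreal (r / 2) + ennreal (r / 2)"
    proof (rule less_le_trans)
      have "sum (g x) G < \<infinity>" using elim by (auto intro: less_trans)
      then show "sum (g x) G + infsum (g x) (UNIV - G) < sum (g x) G + ennreal (r / 2)"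
        using le_less_trans[OF le' tail] by (simp add: ennreal_add_left_cancel_less)
      show "sum (g x) G + ennreal (r / 2) \<le> ennreal (r / 2) + ennreal (r / 2)"
        using elim by (intro add_right_mono) auto
    qed
    then show ?case using r unfolding split[of "g x"] by (simp flip: ennreal_plus)
  qed
qed


subsection \<open>The recursion step of the seminorms\<close>

type_synonym 'n garr = "'n mindex \<Rightarrow> 'n mindex \<Rightarrow> ennreal"

text \<open>The binomial part of one level. Its last argument is the already shifted index
  \<open>N + S\<close>, which \<open>step\<close> supplies; the flag records whether
  \<open>l\<close> is odd at this level.\<close>

definition wsum :: "bool \<Rightarrow> 'n::finite garr \<Rightarrow> 'n garr" where
  "wsum b u R S = (\<Sum>I\<in>{..R}. \<Sum>J\<in>{..S}.
     of_nat (mchoose R I) * of_nat (mchoose S J) * (if b then u J I else u I J))"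

definition step :: "bool \<Rightarrow> 'n::finite garr \<Rightarrow> 'n garr" where
  "step b u R S = (\<Sum>\<^sub>\<infinity>N. ennreal (1 / real (mfact N)) * (wsum b u R (N + S))\<^sup>2)"

text \<open>The head of the list is the outermost level, so a bit appended at the end acts on the
  innermost array.\<close>

primrec tower :: "bool list \<Rightarrow> 'n::finite garr \<Rightarrow> 'n garr" where
  "tower [] u = u"
| "tower (b # bs) u = step b (tower bs u)"

lemma tower_append: "tower (as @ bs) u = tower as (tower bs u)"
  by (induction as) auto

lemma wsum_pair:
  "wsum b u R S = (\<Sum>(I, J)\<in>{..R}\<times>{..S}.
     of_nat (mchoose R I) * of_nat (mchoose S J) * (if b then u J I else u I J))"
  unfolding wsum_def by (rule sum.cartesian_product)

lemma wsum_mono: "(\<And>R S. u R S \<le> v R S) \<Longrightarrow> wsum b u R S \<le> wsum b v R S"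
  unfolding wsum_def by (intro sum_mono mult_left_mono) auto

lemma step_mono: "(\<And>R S. u R S \<le> v R S) \<Longrightarrow> step b u R S \<le> step b v R S"
  unfolding step_def by (intro infsum_mono_ennreal mult_left_mono power_mono wsum_mono) auto

lemma tower_mono: "(\<And>R S. u R S \<le> v R S) \<Longrightarrow> tower bs u R S \<le> tower bs v R S"
  by (induction bs arbitrary: R S) (auto intro: step_mono)

lemma wsum_cmult: "wsum b (\<lambda>R S. c * u R S) R S = c * wsum b u R S"
  unfolding wsum_def sum_distrib_left by (intro sum.cong) (auto simp: ac_simps)

lemma step_cmult: "step b (\<lambda>R S. c * u R S) R S = c\<^sup>2 * step b u R S"
  unfolding step_def wsum_cmult power_mult_distrib
  by (subst infsum_cmult_ennreal[symmetric]) (simp add: ac_simps)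

lemma tower_cmult: "tower bs (\<lambda>R S. c * u R S) R S = c ^ (2 ^ length bs) * tower bs u R S"
proof (induction bs arbitrary: R S)
  case (Cons b bs)
  have "tower (b # bs) (\<lambda>R S. c * u R S) R S = step b (\<lambda>R S. c ^ (2 ^ length bs) * tower bs u R S) R S"
  proof -
    have "tower bs (\<lambda>R S. c * u R S) = (\<lambda>R S. c ^ (2 ^ length bs) * tower bs u R S)"
      by (intro ext Cons.IH)
    then show ?thesis by simp
  qed
  also have "\<dots> = c ^ (2 ^ length (b # bs)) * tower (b # bs) u R S"
    unfolding step_cmult by (simp add: power_mult[symmetric] mult.commute)
  finally show ?case .
qed simp

lemma wsum_Cauchy_Schwarz:
  assumes "\<And>R S. (w R S)\<^sup>2 \<le> u R S * v R S"
  shows "(wsum b w R S)\<^sup>2 \<le> wsum b u R S * wsum b v R S"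
  unfolding wsum_pair case_prod_unfold
  by (rule sum_Cauchy_Schwarz_ennreal) (auto simp: assms)

lemma step_Cauchy_Schwarz:
  assumes "\<And>R S. (w R S)\<^sup>2 \<le> u R S * v R S"
  shows "(step b w R S)\<^sup>2 \<le> step b u R S * step b v R S"
  unfolding step_def
proof (rule infsum_Cauchy_Schwarz)
  fix N :: "'a mindex"
  let ?c = "ennreal (1 / real (mfact N))"
  have "((wsum b w R (N + S))\<^sup>2)\<^sup>2 \<le> (wsum b u R (N + S) * wsum b v R (N + S))\<^sup>2"
    by (intro power_mono wsum_Cauchy_Schwarz assms) auto
  from mult_left_mono[OF this, of "?c\<^sup>2"]
  show "(?c * (wsum b w R (N + S))\<^sup>2)\<^sup>2 \<le> ?c * (wsum b u R (N + S))\<^sup>2 * (?c * (wsum b v R (N + S))\<^sup>2)"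
    by (simp add: power2_eq_square ac_simps)
qed

text \<open>Each level keeps the shape of the hypothesis, so only the innermost arrays need a
  Cauchy-Schwarz bound.\<close>

lemma tower_Cauchy_Schwarz:
  assumes "\<And>R S. (w R S)\<^sup>2 \<le> u R S * v R S"
  shows "(tower bs w R S)\<^sup>2 \<le> tower bs u R S * tower bs v R S"
  by (induction bs arbitrary: R S) (auto intro: assms step_Cauchy_Schwarz)

lemma wsum_power:
  fixes K :: real
  assumes "K \<ge> 0" "c \<ge> 0"
  shows "wsum b (\<lambda>R S. ennreal (c * K ^ (msize R + msize S))) R S = ennreal (c * (K + 1) ^ (msize R + msize S))"
proof -
  have "wsum b (\<lambda>R S. ennreal (c * K ^ (msize R + msize S))) R S
      = (\<Sum>I\<le>R. \<Sum>J\<le>S. ennreal (c * (real (mchoose R I) * K ^ msize I) * (real (mchoose S J) * K ^ msize J)))"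
    unfolding wsum_def using assms
    by (intro sum.cong refl)
       (auto simp: power_add ennreal_of_nat_eq_real_of_nat ac_simps simp flip: ennreal_mult)
  also have "\<dots> = ennreal (\<Sum>I\<le>R. \<Sum>J\<le>S. c * (real (mchoose R I) * K ^ msize I) * (real (mchoose S J) * K ^ msize J))"
    using assms by (subst sum_ennreal[symmetric] | simp add: sum_nonneg)+
  also have "(\<Sum>I\<le>R. \<Sum>J\<le>S. c * (real (mchoose R I) * K ^ msize I) * (real (mchoose S J) * K ^ msize J))
       = c * (K + 1) ^ (msize R + msize S)"
  proof -
    have "(\<Sum>I\<in>A. \<Sum>J\<in>B. c * f I * g J) = c * ((\<Sum>I\<in>A. f I) * (\<Sum>J\<in>B. g J))" for f g :: "'a mindex \<Rightarrow> real" and A B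
      by (simp only: sum_product) (simp add: sum_distrib_left mult.assoc)
    then show ?thesis unfolding power_add sum_mchoose_power1[symmetric] .
  qed
  finally show ?thesis .
qed

text \<open>Bounds of the form \<open>c * K ^ (msize R + msize S)\<close> survive a level: the
  binomial sums turn \<open>K\<close> into \<open>K + 1\<close>, squaring gives the base
  \<open>(K + 1)\<^sup>2\<close> and the constant \<open>c\<^sup>2\<close>, and the sum over
  \<open>N\<close> contributes the exponential series \<open>E\<close> of the new base.\<close>

lemma step_power:
  fixes K :: real
  assumes K: "K \<ge> 0" "c \<ge> 0"
    and u: "\<And>R S. u R S \<le> ennreal (c * K ^ (msize R + msize S))"
  shows "\<exists>c' K'. c' \<ge> 0 \<and> K' \<ge> 0 \<and> (\<forall>R S. step b u R S \<le> ennreal (c' * K' ^ (msize R + msize S)))"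
proof -
  let ?q = "(K + 1)\<^sup>2"
  define E where "E = (\<Sum>\<^sub>\<infinity>N::'a mindex. ?q ^ msize N / real (mfact N))"
  have sm: "(\<lambda>N::'a mindex. ?q ^ msize N / real (mfact N)) summable_on UNIV"
    by (rule summable_on_exp_mindex) simp
  have E0: "E \<ge> 0" unfolding E_def by (rule infsum_nonneg) auto
  have "step b u R S \<le> ennreal (c\<^sup>2 * E * ?q ^ (msize R + msize S))" for R S
  proof -
    have "step b u R S \<le> step b (\<lambda>R S. ennreal (c * K ^ (msize R + msize S))) R S"
      by (rule step_mono) (rule u)
    also have "\<dots> = (\<Sum>\<^sub>\<infinity>N::'a mindex. ennreal (c\<^sup>2 * ?q ^ (msize R + msize S)) * ennreal (?q ^ msize N / real (mfact N)))"
      unfolding step_def wsum_power[OF K]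
    proof (rule infsum_cong)
      fix N :: "'a mindex"
      have "1 / real (mfact N) * (c * (K + 1) ^ (msize R + msize (N + S)))\<^sup>2
          = c\<^sup>2 * ?q ^ (msize R + msize S) * (?q ^ msize N / real (mfact N))"
        by (simp add: power_mult_distrib power_add power2_eq_square)
      then show "ennreal (1 / real (mfact N)) * (ennreal (c * (K + 1) ^ (msize R + msize (N + S))))\<^sup>2
          = ennreal (c\<^sup>2 * ?q ^ (msize R + msize S)) * ennreal (?q ^ msize N / real (mfact N))"
        using K by (simp add: ennreal_power flip: ennreal_mult)
    qed
    also have "\<dots> = ennreal (c\<^sup>2 * ?q ^ (msize R + msize S)) * ennreal E"
      unfolding infsum_cmult_ennreal E_def by (subst infsum_ennreal[OF sm]) auto
    also have "\<dots> = ennreal (c\<^sup>2 * E * ?q ^ (msize R + msize S))"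
      using E0 by (subst ennreal_mult[symmetric]) (auto simp: ac_simps)
    finally show ?thesis .
  qed
  then show ?thesis using E0 by (intro exI[of _ "c\<^sup>2 * E"] exI[of _ ?q]) auto
qed

text \<open>A constant array obeys such a bound with base one. This keeps the constants created by
  Cauchy-Schwarz finite at every level, and it controls arrays of finite support.\<close>

lemma tower_const_finite:
  fixes E :: ennreal
  assumes "E < \<infinity>"
  shows "tower bs (\<lambda>_ _. E) R (S :: 'n::finite mindex) < \<infinity>"
proof -
  have "\<exists>c K. c \<ge> 0 \<and> K \<ge> 0 \<and> (\<forall>R (S :: 'n mindex). tower bs (\<lambda>_ _. E) R S \<le> ennreal (c * K ^ (msize R + msize S)))"
  proof (induction bs)
    case Nil
    show ?case
      using assms by (intro exI[of _ "enn2real E"] exI[of _ 1]) simp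
  next
    case (Cons b bs)
    then show ?case
    proof (elim exE)
      fix c K :: real
      assume *: "c \<ge> 0 \<and> K \<ge> 0 \<and>
        (\<forall>R (S :: 'n mindex). tower bs (\<lambda>_ _. E) R S \<le> ennreal (c * K ^ (msize R + msize S)))"
      show ?thesis
        unfolding tower.simps by (rule step_power[of K c]; use * in blast)
    qed
  qed
  then obtain c K where "tower bs (\<lambda>_ _. E) R S \<le> ennreal (c * K ^ (msize R + msize S))"
    by blast
  then show ?thesis by (rule le_less_trans) simp
qed

lemma mchoose_shift: "mchoose R I \<le> mchoose (R + K) (I + K)"
proof -
  have "n choose k \<le> (n + a) choose (k + a)" for n k a :: nat
  proof (induction a)
    case (Suc a)
    then show ?case using binomial_Suc_Suc[of "n + a" "k + a"] by simp
  qed simp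
  then show ?thesis unfolding mchoose_def by (intro prod_mono) auto
qed

text \<open>Binomial coefficients grow when both entries are shifted, so each summand on the left is
  dominated by the summand on the right with shifted indices. A swap exchanges the roles of
  \<open>K\<close> and \<open>L\<close>.\<close>

lemma wsum_shift:
  assumes "\<And>R S. u R S \<le> v (R + K) (S + L)"
  shows "wsum b u R S \<le> wsum b v (R + (if b then L else K)) (S + (if b then K else L))"
proof -
  let ?A = "if b then L else K" and ?B = "if b then K else L"
  let ?g = "\<lambda>(I, J). (I + ?A, J + ?B)"
  have "wsum b u R S \<le> (\<Sum>(I, J)\<in>{..R}\<times>{..S}.
     of_nat (mchoose (R + ?A) (I + ?A)) * of_nat (mchoose (S + ?B) (J + ?B)) * (if b then v (J + ?B) (I + ?A) else v (I + ?A) (J + ?B)))"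
    unfolding wsum_pair using assms
    by (intro sum_mono) (auto intro!: mult_mono simp: mchoose_shift simp del: plus_fun_apply)
  also have "\<dots> = (\<Sum>(I, J)\<in>?g ` ({..R}\<times>{..S}). of_nat (mchoose (R + ?A) I) * of_nat (mchoose (S + ?B) J) * (if b then v J I else v I J))"
    by (subst sum.reindex) (auto simp: inj_on_def case_prod_unfold simp del: plus_fun_apply intro!: sum.cong)
  also have "\<dots> \<le> wsum b v (R + ?A) (S + ?B)"
    unfolding wsum_pair by (rule sum_mono2) (auto simp: add_right_mono simp del: plus_fun_apply)
  finally show ?thesis .
qed

lemma step_shift:
  assumes "\<And>R S. u R S \<le> v (R + K) (S + L)"
  shows "step b u R S \<le> step b v (R + (if b then L else K)) (S + (if b then K else L))"
  unfolding step_def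
  by (intro infsum_mono_ennreal mult_left_mono power_mono)
     (use wsum_shift[of u v K L b R, OF assms] in \<open>simp_all add: add.assoc[symmetric] del: plus_fun_apply\<close>)

text \<open>The resulting shift is left existential because each swapped level exchanges its two
  components.\<close>

lemma tower_shift:
  assumes "\<And>R S. u R S \<le> v (R + K) (S + L)"
  shows "\<exists>K L. \<forall>R S. tower bs u R S \<le> tower bs v (R + K) (S + L)"
proof (induction bs)
  case Nil
  then show ?case using assms unfolding tower.simps by blast
next
  case (Cons b bs)
  then obtain K' L' where "\<And>R S. tower bs u R S \<le> tower bs v (R + K') (S + L')" by blast
  from step_shift[of "tower bs u" "tower bs v" K' L' b, OF this] show ?case
    unfolding tower.simps by blast
qed

definition tfin :: "'n::finite garr \<Rightarrow> bool" where
  "tfin u \<longleftrightarrow> (\<forall>bs R S. tower bs u R S < \<infinity>)"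

text \<open>Dominated convergence is applied at each level, with the tower over \<open>D\<close> as
  the dominating family.\<close>

lemma tower_tendsto_0:
  assumes D: "tfin D" and le: "\<And>x R S. u x R S \<le> D R S"
    and lim: "\<And>R S. ((\<lambda>x. u x R S) \<longlongrightarrow> 0) F"
  shows "((\<lambda>x. tower bs (u x) R S) \<longlongrightarrow> 0) F"
proof (induction bs arbitrary: R S)
  case (Cons b bs)
  show ?case
    unfolding tower.simps step_def
  proof (rule infsum_tendsto_0_ennreal)
    show "(\<Sum>\<^sub>\<infinity>N. ennreal (1 / real (mfact N)) * (wsum b (tower bs D) R (N + S))\<^sup>2) < \<infinity>"
      using D[unfolded tfin_def, rule_format, of "b # bs" R S] by (simp add: step_def)
    show "ennreal (1 / real (mfact N)) * (wsum b (tower bs (u x)) R (N + S))\<^sup>2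
        \<le> ennreal (1 / real (mfact N)) * (wsum b (tower bs D) R (N + S))\<^sup>2" for x N
      by (intro mult_left_mono power_mono wsum_mono tower_mono le) auto
    fix N
    have "((\<lambda>x. wsum b (tower bs (u x)) R (N + S)) \<longlongrightarrow> (\<Sum>I\<le>R. \<Sum>J\<le>N + S. of_nat (mchoose R I) * of_nat (mchoose (N + S) J) * 0)) F"
      unfolding wsum_def
    proof (intro tendsto_sum)
      fix I J
      show "((\<lambda>x. of_nat (mchoose R I) * of_nat (mchoose (N + S) J) * (if b then tower bs (u x) J I else tower bs (u x) I J))
        \<longlongrightarrow> of_nat (mchoose R I) * of_nat (mchoose (N + S) J) * 0) F"
        using Cons.IH by (cases b; intro tendsto_mult_ennreal tendsto_const)
           (auto simp: ennreal_of_nat_eq_real_of_nat simp flip: ennreal_mult)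
    qed
    then have l: "((\<lambda>x. wsum b (tower bs (u x)) R (N + S)) \<longlongrightarrow> 0) F" by simp
    have "((\<lambda>x. ennreal (1 / real (mfact N)) * (wsum b (tower bs (u x)) R (N + S) * wsum b (tower bs (u x)) R (N + S)))
        \<longlongrightarrow> ennreal (1 / real (mfact N)) * (0 * 0)) F"
      by (intro tendsto_mult_ennreal tendsto_const l) auto
    then show "((\<lambda>x. ennreal (1 / real (mfact N)) * (wsum b (tower bs (u x)) R (N + S))\<^sup>2) \<longlongrightarrow> 0) F"
      by (simp add: power2_eq_square)
  qed
qed (simp add: lim)

section \<open>Convexity of the recursion\<close>

lemma ennreal_convex_power2:
  fixes x y :: ennreal
  assumes s: "0 < s" "s < 1"
  shows "(ennreal s * x + ennreal (1 - s) * y)\<^sup>2 \<le> ennreal s * x\<^sup>2 + ennreal (1 - s) * y\<^sup>2"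
proof (cases x; cases y)
  fix a b assume *: "x = ennreal a" "y = ennreal b" "0 \<le> a" "0 \<le> b"
  have "s * a\<^sup>2 + (1 - s) * b\<^sup>2 - (s * a + (1 - s) * b)\<^sup>2 = s * (1 - s) * (a - b)\<^sup>2"
    by (simp add: power2_eq_square algebra_simps)
  also have "\<dots> \<ge> 0" using s by simp
  finally show ?thesis
    using * s by (simp add: ennreal_power flip: ennreal_mult ennreal_plus)
qed (use s in \<open>auto simp: power2_eq_square ennreal_mult_top\<close>)

text \<open>A level sums squares of nonnegative linear forms with nonnegative weights. It is thus
  monotone and convex, and an inequality with the fixed weights \<open>s\<close> and
  \<open>1 - s\<close> is handed on unchanged to the next level.\<close>

lemma step_convex:
  assumes s: "0 < s" "s < 1"
    and le: "\<And>R S. w R S \<le> ennreal s * u R S + ennreal (1 - s) * v R S"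
  shows "step b w R S \<le> ennreal s * step b u R S + ennreal (1 - s) * step b v R S"
proof -
  have W: "wsum b w R N \<le> ennreal s * wsum b u R N + ennreal (1 - s) * wsum b v R N" for N
  proof -
    have "wsum b w R N \<le> wsum b (\<lambda>R S. ennreal s * u R S + ennreal (1 - s) * v R S) R N"
      by (rule wsum_mono) (rule le)
    also have "\<dots> = ennreal s * wsum b u R N + ennreal (1 - s) * wsum b v R N"
      unfolding wsum_def sum_distrib_left sum.distrib[symmetric]
      by (intro sum.cong) (auto simp: algebra_simps)
    finally show ?thesis .
  qed
  have "step b w R S \<le> (\<Sum>\<^sub>\<infinity>N. ennreal s * (ennreal (1 / real (mfact N)) * (wsum b u R (N + S))\<^sup>2)
      + ennreal (1 - s) * (ennreal (1 / real (mfact N)) * (wsum b v R (N + S))\<^sup>2))"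
    unfolding step_def
  proof (rule infsum_mono_ennreal)
    fix N
    have "(wsum b w R (N + S))\<^sup>2 \<le> ennreal s * (wsum b u R (N + S))\<^sup>2 + ennreal (1 - s) * (wsum b v R (N + S))\<^sup>2"
      by (rule order_trans[OF power_mono[OF W] ennreal_convex_power2[OF s]]) simp
    from mult_left_mono[OF this, of "ennreal (1 / real (mfact N))"]
    show "ennreal (1 / real (mfact N)) * (wsum b w R (N + S))\<^sup>2
        \<le> ennreal s * (ennreal (1 / real (mfact N)) * (wsum b u R (N + S))\<^sup>2)
      + ennreal (1 - s) * (ennreal (1 / real (mfact N)) * (wsum b v R (N + S))\<^sup>2)"
      by (simp add: algebra_simps)
  qed
  also have "\<dots> = ennreal s * step b u R S + ennreal (1 - s) * step b v R S"
    unfolding step_def by (subst infsum_add[OF summable_ennreal summable_ennreal]) (simp add: infsum_cmult_ennreal)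
  finally show ?thesis .
qed

lemma tower_convex:
  assumes s: "0 < s" "s < 1"
    and le: "\<And>R S. w R S \<le> ennreal s * u R S + ennreal (1 - s) * v R S"
  shows "tower bs w R S \<le> ennreal s * tower bs u R S + ennreal (1 - s) * tower bs v R S"
  by (induction bs arbitrary: R S) (auto intro: le step_convex[OF s])

subsection \<open>Seminorms of coefficient arrays\<close>

text \<open>The innermost seminorm, with \<open>t\<close> standing for \<open>2 * hb\<close> and
  \<open>a\<close> for the moduli of the derivatives at the origin.\<close>

definition h0 :: "real \<Rightarrow> 'n::finite garr \<Rightarrow> 'n garr" where
  "h0 t a R S = (\<Sum>\<^sub>\<infinity>N. ennreal (t ^ (msize R + msize S + msize N) / real (mfact N)) * (a R (N + S))\<^sup>2)"

definition cabs :: "('n mindex \<Rightarrow> 'n mindex \<Rightarrow> complex) \<Rightarrow> 'n garr" where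
  "cabs c R S = ennreal (cmod (c R S))"

definition coefs :: "'n::finite cfun \<Rightarrow> 'n mindex \<Rightarrow> 'n mindex \<Rightarrow> complex" where
  "coefs f R S = pderivs R S f 0"

text \<open>
  The binary digits of \<open>l\<close>, lowest first, tell at each level of the recursion of \<^const>\<open>wick_h\<close> whether the
  two multiindices are swapped.
\<close>

primrec wbits :: "nat \<Rightarrow> nat \<Rightarrow> bool list" where
  "wbits 0 l = []"
| "wbits (Suc m) l = odd l # wbits m (l div 2)"

lemma length_wbits [simp]: "length (wbits m l) = m"
  by (induction m arbitrary: l) auto

text \<open>All words of bits occur, so finiteness of all seminorms is finiteness along all words.
  This is what permits bits to be appended freely.\<close>

lemma wbits_surj: "\<exists>l < 2 ^ length bs. bs = wbits (length bs) l"
proof (induction bs)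
  case (Cons b bs)
  then obtain l where l: "l < 2 ^ length bs" "bs = wbits (length bs) l" by blast
  show ?case
    using l by (intro exI[of _ "2 * l + of_bool b"]) auto
qed simp

definition hh :: "real \<Rightarrow> bool list \<Rightarrow> 'n::finite garr \<Rightarrow> 'n garr" where
  "hh t bs a = tower bs (h0 t a)"

lemma wick_h_eq:
  assumes "hb > 0"
  shows "wick_h 0 hb m l R S f = hh (2 * hb) (wbits m l) (cabs (coefs f)) R S"
proof (induction m arbitrary: l R S)
  case 0
  show ?case
    unfolding wick_h.simps wbits.simps hh_def tower.simps h0_def cabs_def coefs_def
    using assms by (intro infsum_cong) (simp add: ennreal_power flip: ennreal_mult)
next
  case (Suc m)
  have "(l - 1) div 2 = l div 2" if "odd l" using that by presburger
  then show ?case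
    unfolding wick_h.simps wbits.simps hh_def tower.simps step_def wsum_def Suc.IH
    by (auto simp: hh_def)
qed

lemma wick_norm_power:
  assumes "hb > 0"
  shows "wick_norm 0 hb m l R S f ^ 2 ^ (m + 1) = wick_h 0 hb m l R S f"
proof (cases "wick_h 0 hb m l R S f = \<infinity>")
  case True
  then show ?thesis by (simp add: wick_norm_def power_eq_top_ennreal_iff)
next
  case False
  let ?x = "enn2real (wick_h 0 hb m l R S f)"
  have "(?x powr (1 / 2 ^ (m + 1))) ^ 2 ^ (m + 1) = ?x"
    by (cases "?x = 0") (simp_all add: powr_realpow[symmetric] powr_powr)
  then have "wick_norm 0 hb m l R S f ^ 2 ^ (m + 1) = ennreal ?x"
    using False by (simp add: wick_norm_def ennreal_power del: power_Suc)
  then show ?thesis using False by (simp add: less_top[symmetric])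
qed

text \<open>Removes the root: bounds on a seminorm are proved as bounds on the value of the
  recursion.\<close>

lemma wick_norm_le_iff:
  assumes "hb > 0" "\<beta> \<ge> 0"
  shows "wick_norm 0 hb m l R S f \<le> ennreal \<beta> \<longleftrightarrow> wick_h 0 hb m l R S f \<le> ennreal (\<beta> ^ 2 ^ (m + 1))"
proof -
  have *: "x \<le> y \<longleftrightarrow> x ^ 2 ^ (m + 1) \<le> y ^ 2 ^ (m + 1)" for x y :: ennreal
    using ennreal_power_le_imp_le[of x "2 ^ (m + 1)" y] power_mono_ennreal[of x y] by auto
  show ?thesis
    unfolding *[of "wick_norm 0 hb m l R S f"] wick_norm_power[OF assms(1)] ennreal_power[OF assms(2)] by (rule refl)
qed

lemma wick_norm_le_wick_norm_iff:
  assumes "hb > 0"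
  shows "wick_norm 0 hb m l R S f \<le> wick_norm 0 hb m l R S g \<longleftrightarrow> wick_h 0 hb m l R S f \<le> wick_h 0 hb m l R S g"
  using ennreal_power_le_imp_le[of "wick_norm 0 hb m l R S f" "2 ^ (m + 1)" "wick_norm 0 hb m l R S g"]
    power_mono_ennreal[of "wick_norm 0 hb m l R S f" "wick_norm 0 hb m l R S g" "2 ^ (m + 1)"]
  unfolding wick_norm_power[OF assms] by auto

lemma wick_norm_finite_iff: "wick_norm 0 hb m l R S f < top \<longleftrightarrow> wick_h 0 hb m l R S f < top"
  by (auto simp: wick_norm_def less_top)

definition hfin :: "real \<Rightarrow> 'n::finite garr \<Rightarrow> bool" where
  "hfin t a \<longleftrightarrow> (\<forall>bs R S. hh t bs a R S < \<infinity>)"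

lemma hfin_tfin: "hfin t a \<longleftrightarrow> tfin (h0 t a)"
  by (simp add: hfin_def tfin_def hh_def)

lemma all_wick_h_iff:
  assumes "hb > 0"
  shows "(\<forall>m l R S. l < 2 ^ m \<longrightarrow> wick_norm 0 hb m l R S f < \<infinity>) \<longleftrightarrow> hfin (2 * hb) (cabs (coefs f))"
proof
  assume *: "\<forall>m l R S. l < 2 ^ m \<longrightarrow> wick_norm 0 hb m l R S f < \<infinity>"
  show "hfin (2 * hb) (cabs (coefs f))"
    unfolding hfin_def
  proof (intro allI)
    fix bs R S
    obtain l where "l < 2 ^ length bs" "bs = wbits (length bs) l" using wbits_surj by blast
    then show "hh (2 * hb) bs (cabs (coefs f)) R S < \<infinity>"
      using *[rule_format, of l "length bs" R S] wick_h_eq[OF assms, of "length bs" l R S f]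
      by (simp add: wick_norm_finite_iff)
  qed
qed (simp add: wick_norm_finite_iff wick_h_eq[OF assms] hfin_def)

lemma pre_wick_iff: "hb > 0 \<Longrightarrow> f \<in> pre_wick 0 hb \<longleftrightarrow> smooth f \<and> hfin (2 * hb) (cabs (coefs f))"
  unfolding pre_wick_def mem_Collect_eq using all_wick_h_iff by blast

lemma h0_mono: "(\<And>R S. a R S \<le> b R S) \<Longrightarrow> h0 t a R S \<le> h0 t b R S"
  unfolding h0_def by (intro infsum_mono_ennreal mult_left_mono power_mono) auto

lemma hh_mono: "(\<And>R S. a R S \<le> b R S) \<Longrightarrow> hh t bs a R S \<le> hh t bs b R S"
  unfolding hh_def by (intro tower_mono h0_mono)

lemma hfin_mono: "hfin t b \<Longrightarrow> (\<And>R S. a R S \<le> b R S) \<Longrightarrow> hfin t a"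
  unfolding hfin_def using hh_mono le_less_trans by metis

lemma h0_cmult: "h0 t (\<lambda>R S. c * a R S) R S = c\<^sup>2 * h0 t a R S"
  unfolding h0_def power_mult_distrib
  by (subst infsum_cmult_ennreal[symmetric]) (simp add: ac_simps)

lemma hh_cmult: "hh t bs (\<lambda>R S. c * a R S) R S = c ^ (2 ^ (length bs + 1)) * hh t bs a R S"
proof -
  have "h0 t (\<lambda>R S. c * a R S) = (\<lambda>R S. c\<^sup>2 * h0 t a R S)"
    by (intro ext h0_cmult)
  then show ?thesis
    unfolding hh_def by (simp add: tower_cmult power_mult[symmetric])
qed

lemma hfin_cmult:
  assumes "hfin t a" "c < \<infinity>"
  shows "hfin t (\<lambda>R S. c * a R S)"
  using assms unfolding hfin_def hh_cmult by (simp add: ennreal_mult_less_top power_less_top_ennreal)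

lemma h0_convex:
  assumes s: "0 < s" "s < 1"
    and le: "\<And>R S. a R S \<le> ennreal s * b R S + ennreal (1 - s) * c R S"
  shows "h0 t a R S \<le> ennreal s * h0 t b R S + ennreal (1 - s) * h0 t c R S"
proof -
  have "h0 t a R S \<le> (\<Sum>\<^sub>\<infinity>N. ennreal s * (ennreal (t ^ (msize R + msize S + msize N) / real (mfact N)) * (b R (N + S))\<^sup>2)
      + ennreal (1 - s) * (ennreal (t ^ (msize R + msize S + msize N) / real (mfact N)) * (c R (N + S))\<^sup>2))"
    unfolding h0_def
  proof (rule infsum_mono_ennreal)
    fix N :: "'a mindex"
    let ?w = "ennreal (t ^ (msize R + msize S + msize N) / real (mfact N))"
    have "(a R (N + S))\<^sup>2 \<le> ennreal s * (b R (N + S))\<^sup>2 + ennreal (1 - s) * (c R (N + S))\<^sup>2"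
      by (rule order_trans[OF power_mono[OF le] ennreal_convex_power2[OF s]]) simp
    from mult_left_mono[OF this, of ?w]
    show "?w * (a R (N + S))\<^sup>2 \<le> ennreal s * (?w * (b R (N + S))\<^sup>2) + ennreal (1 - s) * (?w * (c R (N + S))\<^sup>2)"
      by (simp add: algebra_simps)
  qed
  also have "\<dots> = ennreal s * h0 t b R S + ennreal (1 - s) * h0 t c R S"
    unfolding h0_def by (subst infsum_add[OF summable_ennreal summable_ennreal]) (simp add: infsum_cmult_ennreal)
  finally show ?thesis .
qed

lemma hh_convex:
  assumes "0 < s" "s < 1" "\<And>R S. a R S \<le> ennreal s * b R S + ennreal (1 - s) * c R S"
  shows "hh t bs a R S \<le> ennreal s * hh t bs b R S + ennreal (1 - s) * hh t bs c R S"
  unfolding hh_def using assms by (intro tower_convex h0_convex)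

text \<open>A convex function that is homogeneous of degree \<open>p\<close> has a subadditive \<open>p\<close>-th root.\<close>

lemma hh_triangle:
  assumes le: "\<And>R S. a R S \<le> b R S + c R S"
    and b: "hh t bs b R S \<le> ennreal (\<beta> ^ 2 ^ (length bs + 1))" "\<beta> > 0"
    and c: "hh t bs c R S \<le> ennreal (\<gamma> ^ 2 ^ (length bs + 1))" "\<gamma> > 0"
  shows "hh t bs a R S \<le> ennreal ((\<beta> + \<gamma>) ^ 2 ^ (length bs + 1))"
proof -
  \<comment> \<open>With this weight the rescaled arrays \<open>b / s\<close> and
    \<open>c / (1 - s)\<close> obey the same bound, the one belonging to
    \<open>\<beta> + \<gamma>\<close>.\<close>
  define s where "s = \<beta> / (\<beta> + \<gamma>)"
  let ?p = "2 ^ (length bs + 1) :: nat"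
  have s: "0 < s" "s < 1" and s': "1 - s = \<gamma> / (\<beta> + \<gamma>)"
    using b c by (auto simp: s_def field_simps)
  have inv: "ennreal s * ennreal (1 / s) = 1" "ennreal (1 - s) * ennreal (1 / (1 - s)) = 1"
    using s by (simp_all flip: ennreal_mult)
  have "hh t bs a R S \<le> ennreal s * hh t bs (\<lambda>R S. ennreal (1 / s) * b R S) R S
      + ennreal (1 - s) * hh t bs (\<lambda>R S. ennreal (1 / (1 - s)) * c R S) R S"
    using le by (intro hh_convex s) (simp add: mult.assoc[symmetric] inv)
  also have "\<dots> \<le> ennreal s * (ennreal (1 / s) ^ ?p * ennreal (\<beta> ^ ?p))
      + ennreal (1 - s) * (ennreal (1 / (1 - s)) ^ ?p * ennreal (\<gamma> ^ ?p))"
    unfolding hh_cmult by (intro add_mono mult_left_mono b c) auto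
  also have "ennreal (1 / s) ^ ?p * ennreal (\<beta> ^ ?p) = ennreal ((\<beta> + \<gamma>) ^ ?p)"
    using b c s by (simp add: ennreal_power s_def power_divide flip: ennreal_mult del: power_Suc)
  also have "ennreal (1 / (1 - s)) ^ ?p * ennreal (\<gamma> ^ ?p) = ennreal ((\<beta> + \<gamma>) ^ ?p)"
    using b c s unfolding s' by (simp add: ennreal_power power_divide flip: ennreal_mult del: power_Suc)
  also have "ennreal s * ennreal ((\<beta> + \<gamma>) ^ ?p) + ennreal (1 - s) * ennreal ((\<beta> + \<gamma>) ^ ?p) = ennreal ((\<beta> + \<gamma>) ^ ?p)"
    using s by (simp add: distrib_right[symmetric] flip: ennreal_plus)
  finally show ?thesis .
qed

text \<open>The hypothesis compares moduli of derivatives instead of asking for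
  \<open>k = f + g\<close>, so that the lemma covers sums as well as the three differences in a
  metric triangle inequality.\<close>

lemma wick_norm_triangle:
  fixes f g k :: "'n::finite cfun"
  assumes hb: "hb > 0" and le: "\<And>K L. cmod (coefs k K L) \<le> cmod (coefs f K L) + cmod (coefs g K L)"
  shows "wick_norm 0 hb m l R S k \<le> wick_norm 0 hb m l R S f + wick_norm 0 hb m l R S g"
proof (cases "wick_norm 0 hb m l R S f < \<infinity> \<and> wick_norm 0 hb m l R S g < \<infinity>")
  case True
  then obtain x y where xy: "wick_norm 0 hb m l R S f = ennreal x" "x \<ge> 0" "wick_norm 0 hb m l R S g = ennreal y" "y \<ge> 0"
    by (cases "wick_norm 0 hb m l R S f"; cases "wick_norm 0 hb m l R S g") auto
  \<comment> \<open>The margin \<open>e\<close> makes both bounds strictly positive, as the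
    rescaling by the weights \<open>s\<close> and \<open>1 - s\<close> demands.\<close>
  have "wick_norm 0 hb m l R S k \<le> ennreal (x + y) + ennreal e" if "e > 0" for e
  proof -
    have "wick_norm 0 hb m l R S f \<le> ennreal (x + e / 2)" "wick_norm 0 hb m l R S g \<le> ennreal (y + e / 2)"
      using xy that by (auto intro!: ennreal_leI)
    then have "hh (2 * hb) (wbits m l) (cabs (coefs f)) R S \<le> ennreal ((x + e / 2) ^ 2 ^ (m + 1))"
        "hh (2 * hb) (wbits m l) (cabs (coefs g)) R S \<le> ennreal ((y + e / 2) ^ 2 ^ (m + 1))"
      using xy that wick_norm_le_iff[OF hb, of "x + e / 2" m l R S f] wick_norm_le_iff[OF hb, of "y + e / 2" m l R S g]
      by (simp_all add: wick_h_eq[OF hb] del: power_Suc)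
    then have "hh (2 * hb) (wbits m l) (cabs (coefs k)) R S \<le> ennreal (((x + e / 2) + (y + e / 2)) ^ 2 ^ (length (wbits m l) + 1))"
      using le xy that
      by (intro hh_triangle[of _ "cabs (coefs f)" "cabs (coefs g)" _ _ _ _ "x + e / 2" "y + e / 2"])
         (auto simp add: cabs_def simp del: power_Suc ennreal_plus simp flip: ennreal_plus)
    then have "wick_norm 0 hb m l R S k \<le> ennreal ((x + e / 2) + (y + e / 2))"
      using xy that by (subst wick_norm_le_iff) (simp_all add: hb wick_h_eq del: power_Suc)
    also have "(x + e / 2) + (y + e / 2) = (x + y) + e" by simp
    finally show ?thesis using xy that by simp
  qed
  then have "wick_norm 0 hb m l R S k \<le> ennreal (x + y)"
    by (rule_tac ennreal_le_epsilon) auto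
  then show ?thesis using xy by simp
qed (auto simp: not_less top_unique)

lemma hh_tendsto_0:
  assumes D: "hfin t D" and le: "\<And>x R S. u x R S \<le> D R S"
    and lim: "\<And>R S. ((\<lambda>x. u x R S) \<longlongrightarrow> 0) F"
  shows "((\<lambda>x. hh t bs (u x) R S) \<longlongrightarrow> 0) F"
  unfolding hh_def
proof (rule tower_tendsto_0[where D = "h0 t D"])
  show "tfin (h0 t D)" using D by (simp add: hfin_tfin)
  show "h0 t (u x) R S \<le> h0 t D R S" for x R S by (rule h0_mono) (rule le)
  fix R S
  show "((\<lambda>x. h0 t (u x) R S) \<longlongrightarrow> 0) F"
    unfolding h0_def
  proof (rule infsum_tendsto_0_ennreal)
    show "ennreal (t ^ (msize R + msize S + msize N) / real (mfact N)) * (u x R (N + S))\<^sup>2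
        \<le> ennreal (t ^ (msize R + msize S + msize N) / real (mfact N)) * (D R (N + S))\<^sup>2" for x N
      by (intro mult_left_mono power_mono le) auto
    show "(\<Sum>\<^sub>\<infinity>N. ennreal (t ^ (msize R + msize S + msize N) / real (mfact N)) * (D R (N + S))\<^sup>2) < \<infinity>"
      using D[unfolded hfin_def, rule_format, of "[]" R S] by (simp add: hh_def h0_def)
    fix N
    have "((\<lambda>x. ennreal (t ^ (msize R + msize S + msize N) / real (mfact N)) * (u x R (N + S) * u x R (N + S)))
        \<longlongrightarrow> ennreal (t ^ (msize R + msize S + msize N) / real (mfact N)) * (0 * 0)) F"
      by (intro tendsto_mult_ennreal tendsto_const lim) auto
    then show "((\<lambda>x. ennreal (t ^ (msize R + msize S + msize N) / real (mfact N)) * (u x R (N + S))\<^sup>2) \<longlongrightarrow> 0) F"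
      by (simp add: power2_eq_square)
  qed
qed

section \<open>Exchange of the two indices and the estimate for the star product\<close>

definition exp_const :: "'n::finite itself \<Rightarrow> ennreal" where
  "exp_const _ = (\<Sum>\<^sub>\<infinity>N::'n mindex. ennreal (1 / real (mfact N)))"

lemma exp_const_finite: "exp_const TYPE('n::finite) < \<infinity>"
  using summable_on_exp_mindex[of 1, where 'n = 'n] unfolding exp_const_def
  by (subst summable_on_iff_ennreal[symmetric]) simp_all

text \<open>On the left the summation index \<open>N\<close> stands in the first slot of
  \<open>a\<close>. Up to the weight \<open>1 / mfact N\<close>, the summand is the one with
  \<open>M = 0\<close> in \<open>h0 t a (N + S) R\<close>, and this value is one term of the swapped
  binomial sum. Cauchy-Schwarz against the weights then produces \<open>exp_const\<close>, which is
  the \<open>n\<close>-th power of Euler's number.\<close>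

lemma h0_transpose:
  fixes a :: "'n::finite garr"
  shows "(h0 t (\<lambda>K L. a L K) R S)\<^sup>2 \<le> exp_const TYPE('n) * step True (h0 t a) R S"
  unfolding h0_def[of t "\<lambda>K L. a L K"] exp_const_def step_def
proof (rule infsum_Cauchy_Schwarz)
  fix N :: "'n mindex"
  let ?c = "ennreal (1 / real (mfact N))"
  have "ennreal (t ^ (msize R + msize S + msize N) / real (mfact N)) * (a (N + S) R)\<^sup>2
      = ?c * (ennreal (t ^ (msize R + msize S + msize N)) * (a (N + S) R)\<^sup>2)"
    by (simp add: mult.assoc[symmetric] ennreal_mult'[symmetric])
  also have "\<dots> \<le> ?c * wsum True (h0 t a) R (N + S)"
  proof (rule mult_left_mono)
    have "ennreal (t ^ (msize R + msize S + msize N)) * (a (N + S) R)\<^sup>2 \<le> h0 t a (N + S) R"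
      unfolding h0_def
      using single_le_infsum_ennreal[of 0 UNIV "\<lambda>M. ennreal (t ^ (msize (N + S) + msize R + msize M) / real (mfact M)) * (a (N + S) (M + R))\<^sup>2"]
      by (simp add: ac_simps del: zero_fun_apply plus_fun_apply)
    also have "\<dots> = (\<Sum>(I, J)\<in>{(R, N + S)}. of_nat (mchoose R I) * of_nat (mchoose (N + S) J) * (if True then h0 t a J I else h0 t a I J))"
      by (simp add: mchoose_def)
    also have "\<dots> \<le> wsum True (h0 t a) R (N + S)"
      unfolding wsum_pair by (rule sum_mono2) auto
    finally show "ennreal (t ^ (msize R + msize S + msize N)) * (a (N + S) R)\<^sup>2 \<le> wsum True (h0 t a) R (N + S)" .
  qed simp
  finally have "(ennreal (t ^ (msize R + msize S + msize N) / real (mfact N)) * (a (N + S) R)\<^sup>2)\<^sup>2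
      \<le> (?c * wsum True (h0 t a) R (N + S))\<^sup>2"
    by (rule power_mono) simp
  then show "(ennreal (t ^ (msize R + msize S + msize N) / real (mfact N)) * (a (N + S) R)\<^sup>2)\<^sup>2
      \<le> ?c * (?c * (wsum True (h0 t a) R (N + S))\<^sup>2)"
    by (simp add: power2_eq_square ac_simps)
qed

lemma hh_transpose:
  fixes a :: "'n::finite garr"
  shows "(hh t bs (\<lambda>K L. a L K) R S)\<^sup>2 \<le> tower bs (\<lambda>_ _. exp_const TYPE('n)) R S * hh t (bs @ [True]) a R S"
  unfolding hh_def tower_append by (rule tower_Cauchy_Schwarz) (simp add: h0_transpose)

text \<open>The Leibniz expansion of the derivative of order \<open>(R, S)\<close> of a star product
  at the origin, with each summand replaced by its modulus: \<open>t\<close> is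
  \<open>2 * hb\<close>, and \<open>a\<close>, \<open>b\<close> hold the moduli of the derivatives
  of the factors.\<close>

definition gstar :: "real \<Rightarrow> 'n::finite garr \<Rightarrow> 'n garr \<Rightarrow> 'n garr" where
  "gstar t a b R S = (\<Sum>\<^sub>\<infinity>N. ennreal (t ^ msize N / real (mfact N)) *
     (\<Sum>I\<le>R. \<Sum>J\<le>S. of_nat (mchoose R I) * of_nat (mchoose S J) * a (N + I) J * b (R - I) (N + (S - J))))"

lemma mchoose_sym: "I \<le> R \<Longrightarrow> mchoose R (R - I) = mchoose R I"
  unfolding mchoose_def le_fun_def by (intro prod.cong) (auto simp: binomial_symmetric[symmetric])

lemma wsum_reflect:
  "(\<Sum>(I, J)\<in>{..R}\<times>{..S}. of_nat (mchoose R I) * of_nat (mchoose S J) * u (R - I) (S - J)) = wsum False u R S"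
proof -
  have [simp]: "I \<le> R \<Longrightarrow> R - (R - I) = I" "R - I \<le> R" for R I :: "'a mindex"
    by (auto simp: fun_eq_iff le_fun_def)
  show ?thesis
    unfolding wsum_pair
    by (rule sum.reindex_bij_witness[of _ "\<lambda>(I, J). (R - I, S - J)" "\<lambda>(I, J). (R - I, S - J)"])
       (auto simp: mchoose_sym)
qed

text \<open>Cauchy-Schwarz over \<open>N\<close> for fixed \<open>(I, J)\<close>, and again over
  \<open>(I, J)\<close> with the binomial weights. The power of \<open>t\<close> splits into a part
  of degree \<open>I\<close>, \<open>J\<close> and a part of degree \<open>R - I\<close>,
  \<open>S - J\<close>, one for each \<open>h0\<close> factor. The left factor is transposed because
  its \<open>N\<close> stands in the first slot.\<close>

lemma gstar_bound:
  fixes a b :: "'n::finite garr"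
  assumes t: "t > 0"
  shows "ennreal (t ^ (msize R + msize S)) * (gstar t a b R S)\<^sup>2
     \<le> wsum True (h0 t (\<lambda>K L. a L K)) R S * wsum False (h0 t b) R S"
proof -
  define x where "x = (\<lambda>(I, J). \<Sum>\<^sub>\<infinity>N. ennreal (t ^ msize N / real (mfact N)) * (a (N + I) J * b (R - I) (N + (S - J))))"
  define c where "c = (\<lambda>(I, J). of_nat (mchoose R I) * of_nat (mchoose S J) :: ennreal)"
  \<comment> \<open>A square root of the prefactor, so that it can be moved inside the squared
    sum.\<close>
  define \<sigma> where "\<sigma> = ennreal (sqrt t ^ (msize R + msize S))"
  have \<sigma>2: "\<sigma>\<^sup>2 = ennreal (t ^ (msize R + msize S))"
  proof -
    have "(sqrt t ^ n)\<^sup>2 = t ^ n" for n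
      using t by (simp add: power2_eq_square flip: power_mult_distrib)
    then show ?thesis using t by (simp add: \<sigma>_def ennreal_power)
  qed
  have g: "gstar t a b R S = (\<Sum>z\<in>{..R}\<times>{..S}. c z * x z)"
    unfolding gstar_def sum.cartesian_product sum_distrib_left infsum_sum_ennreal
    by (intro sum.cong refl, simp add: c_def x_def case_prod_unfold, subst infsum_cmult_ennreal[symmetric])
       (simp add: ac_simps)
  have x: "\<sigma>\<^sup>2 * (x z)\<^sup>2 \<le> (case z of (I, J) \<Rightarrow> h0 t (\<lambda>K L. a L K) J I) * (case z of (I, J) \<Rightarrow> h0 t b (R - I) (S - J))"
    if "z \<in> {..R}\<times>{..S}" for z
  proof -
    obtain I J where z: "z = (I, J)" "I \<le> R" "J \<le> S" using \<open>z \<in> _\<close> by auto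
    let ?u = "\<Sum>\<^sub>\<infinity>N. ennreal (t ^ msize N / real (mfact N)) * (a (N + I) J)\<^sup>2"
    let ?v = "\<Sum>\<^sub>\<infinity>N. ennreal (t ^ msize N / real (mfact N)) * (b (R - I) (N + (S - J)))\<^sup>2"
    have "(x z)\<^sup>2 \<le> ?u * ?v"
      unfolding z x_def prod.case
      by (rule infsum_Cauchy_Schwarz) (simp add: power2_eq_square ac_simps)
    then have le: "\<sigma>\<^sup>2 * (x z)\<^sup>2 \<le> \<sigma>\<^sup>2 * (?u * ?v)" by (rule mult_left_mono) simp
    have \<sigma>3: "\<sigma>\<^sup>2 = ennreal (t ^ (msize J + msize I)) * ennreal (t ^ (msize (R - I) + msize (S - J)))"
    proof -
      have "msize R + msize S = (msize J + msize I) + (msize (R - I) + msize (S - J))"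
        using z msize_diff[OF z(2)] msize_diff[OF z(3)] msize_mono[OF z(2)] msize_mono[OF z(3)] by simp
      then show ?thesis using t unfolding \<sigma>2 by (simp add: power_add flip: ennreal_mult)
    qed
    have "\<sigma>\<^sup>2 * (?u * ?v)
        = (ennreal (t ^ (msize J + msize I)) * ?u) * (ennreal (t ^ (msize (R - I) + msize (S - J))) * ?v)"
      unfolding \<sigma>3 by (simp only: ac_simps)
    also have "ennreal (t ^ (msize J + msize I)) * ?u = h0 t (\<lambda>K L. a L K) J I"
      unfolding h0_def using t
      by (subst infsum_cmult_ennreal[symmetric], intro infsum_cong)
         (simp add: power_add mult.assoc[symmetric] ennreal_mult[symmetric] del: plus_fun_apply)
    also have "ennreal (t ^ (msize (R - I) + msize (S - J))) * ?v = h0 t b (R - I) (S - J)"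
      unfolding h0_def using t
      by (subst infsum_cmult_ennreal[symmetric], intro infsum_cong)
         (simp add: power_add mult.assoc[symmetric] ennreal_mult[symmetric] del: plus_fun_apply)
    finally have eq: "\<sigma>\<^sup>2 * (?u * ?v) = h0 t (\<lambda>K L. a L K) J I * h0 t b (R - I) (S - J)" .
    show ?thesis using le unfolding eq unfolding z prod.case .
  qed
  have "ennreal (t ^ (msize R + msize S)) * (gstar t a b R S)\<^sup>2 = (\<Sum>z\<in>{..R}\<times>{..S}. c z * (\<sigma> * x z))\<^sup>2"
    unfolding g \<sigma>2[symmetric] power_mult_distrib[symmetric] sum_distrib_left by (simp add: ac_simps)
  also have "\<dots> \<le> (\<Sum>z\<in>{..R}\<times>{..S}. c z * (case z of (I, J) \<Rightarrow> h0 t (\<lambda>K L. a L K) J I)) *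
      (\<Sum>z\<in>{..R}\<times>{..S}. c z * (case z of (I, J) \<Rightarrow> h0 t b (R - I) (S - J)))"
    by (rule sum_Cauchy_Schwarz_ennreal) (use x in \<open>auto simp: power_mult_distrib\<close>)
  also have "\<dots> = wsum True (h0 t (\<lambda>K L. a L K)) R S * wsum False (h0 t b) R S"
    unfolding wsum_reflect[symmetric] wsum_pair[of True] c_def by (simp add: case_prod_unfold)
  finally show ?thesis .
qed

lemma h0_gstar:
  assumes t: "t > 0"
  shows "(h0 t (gstar t a b) R S)\<^sup>2 \<le> step True (h0 t (\<lambda>K L. a L K)) R S * step False (h0 t b) R S"
proof -
  let ?P = "wsum True (h0 t (\<lambda>K L. a L K))" and ?Q = "wsum False (h0 t b)"
  have "h0 t (gstar t a b) R S \<le> (\<Sum>\<^sub>\<infinity>N. ennreal (1 / real (mfact N)) * (?P R (N + S) * ?Q R (N + S)))"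
    unfolding h0_def[of t "gstar t a b"]
  proof (rule infsum_mono_ennreal)
    fix N
    have "ennreal (t ^ (msize R + msize S + msize N) / real (mfact N)) * (gstar t a b R (N + S))\<^sup>2
       = ennreal (1 / real (mfact N)) * (ennreal (t ^ (msize R + msize (N + S))) * (gstar t a b R (N + S))\<^sup>2)"
      using t by (simp add: mult.assoc[symmetric] ennreal_mult[symmetric] add.commute add.left_commute)
    also have "\<dots> \<le> ennreal (1 / real (mfact N)) * (?P R (N + S) * ?Q R (N + S))"
      by (intro mult_left_mono gstar_bound t) auto
    finally show "ennreal (t ^ (msize R + msize S + msize N) / real (mfact N)) * (gstar t a b R (N + S))\<^sup>2 \<le> \<dots>" .
  qed
  then have "(h0 t (gstar t a b) R S)\<^sup>2 \<le> (\<Sum>\<^sub>\<infinity>N. ennreal (1 / real (mfact N)) * (?P R (N + S) * ?Q R (N + S)))\<^sup>2"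
    by (rule power_mono) simp
  also have "\<dots> \<le> step True (h0 t (\<lambda>K L. a L K)) R S * step False (h0 t b) R S"
    unfolding step_def by (rule infsum_Cauchy_Schwarz) (simp add: power2_eq_square ac_simps)
  finally show ?thesis .
qed

text \<open>The square in the product estimate is squared again, since undoing the transposition of
  the left factor costs another Cauchy-Schwarz. The transposition also accounts for the second
  \<open>True\<close> appended for \<open>a\<close>.\<close>

lemma hh_gstar:
  fixes a b :: "'n::finite garr"
  assumes t: "t > 0"
  shows "(hh t bs (gstar t a b) R S) ^ 4 \<le> tower (bs @ [True]) (\<lambda>_ _. exp_const TYPE('n)) R S
      * hh t (bs @ [True, True]) a R S * (hh t (bs @ [False]) b R S)\<^sup>2"
proof -
  have "(hh t bs (gstar t a b) R S)\<^sup>2 \<le> hh t (bs @ [True]) (\<lambda>K L. a L K) R S * hh t (bs @ [False]) b R S"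
    unfolding hh_def tower_append by (rule tower_Cauchy_Schwarz) (simp add: h0_gstar[OF t])
  then have "((hh t bs (gstar t a b) R S)\<^sup>2)\<^sup>2 \<le> (hh t (bs @ [True]) (\<lambda>K L. a L K) R S * hh t (bs @ [False]) b R S)\<^sup>2"
    by (rule power_mono) simp
  also have "\<dots> = (hh t (bs @ [True]) (\<lambda>K L. a L K) R S)\<^sup>2 * (hh t (bs @ [False]) b R S)\<^sup>2"
    by (rule power_mult_distrib)
  also have "\<dots> \<le> (tower (bs @ [True]) (\<lambda>_ _. exp_const TYPE('n)) R S * hh t ((bs @ [True]) @ [True]) a R S) * (hh t (bs @ [False]) b R S)\<^sup>2"
    by (intro mult_right_mono hh_transpose) auto
  finally show ?thesis by simp
qed

lemma hfin_gstar:
  assumes t: "t > 0" and "hfin t a" "hfin t b"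
  shows "hfin t (gstar t a b)"
  unfolding hfin_def
proof (intro allI)
  fix bs R S
  have "(hh t bs (gstar t a b) R S) ^ 4 < \<infinity>"
    by (rule le_less_trans[OF hh_gstar[OF t]])
       (use assms(2,3) in \<open>simp add: hfin_def tower_const_finite[OF exp_const_finite, simplified]
           ennreal_mult_less_top power_less_top_ennreal\<close>)
  then show "hh t bs (gstar t a b) R S < \<infinity>" by (simp add: power_less_top_ennreal)
qed

text \<open>One swapped level at the origin is enough. It bounds the squares of \<open>h0\<close>
  summed over the first index, and Cauchy-Schwarz against \<open>1 / mfact N\<close> turns this into
  a finite weighted square sum \<open>Y\<close> of the whole array. A second Cauchy-Schwarz, against
  the exponential series \<open>U\<close>, reaches every radius.\<close>

lemma hfin_ent2:
  fixes c :: "'n::finite mindex \<Rightarrow> 'n mindex \<Rightarrow> complex"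
  assumes t: "t > 0" and h: "hfin t (cabs c)"
  shows "ent2 c"
  unfolding ent2_iff
proof (intro allI impI)
  fix r :: real assume r: "r \<ge> 0"
  define X where "X = (\<lambda>N. h0 t (cabs c) N 0)"
  have "(\<Sum>\<^sub>\<infinity>N. ennreal (1 / real (mfact N)) * (X N)\<^sup>2) \<le> hh t [True] (cabs c) 0 0"
    unfolding hh_def tower.simps step_def
  proof (intro infsum_mono_ennreal mult_left_mono power_mono)
    fix N :: "'n mindex"
    have "X N = (\<Sum>(I, J)\<in>{(0, N)}. of_nat (mchoose 0 I) * of_nat (mchoose N J) * (if True then h0 t (cabs c) J I else h0 t (cabs c) I J))"
      by (simp add: X_def mchoose_def)
    also have "\<dots> \<le> wsum True (h0 t (cabs c)) 0 N"
      unfolding wsum_pair by (rule sum_mono2) auto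
    finally show "X N \<le> wsum True (h0 t (cabs c)) 0 (N + 0)" by simp
  qed auto
  also have "\<dots> < \<infinity>" using h by (simp add: hfin_def)
  finally have fin1: "(\<Sum>\<^sub>\<infinity>N. ennreal (1 / real (mfact N)) * (X N)\<^sup>2) < \<infinity>" .
  have "(\<Sum>\<^sub>\<infinity>N. ennreal (1 / real (mfact N)) * X N)\<^sup>2 \<le> exp_const TYPE('n) * (\<Sum>\<^sub>\<infinity>N. ennreal (1 / real (mfact N)) * (X N)\<^sup>2)"
    unfolding exp_const_def by (rule infsum_Cauchy_Schwarz) (simp add: power2_eq_square ac_simps)
  also have "\<dots> < \<infinity>" using fin1 exp_const_finite[where 'n = 'n] by (simp add: ennreal_mult_less_top)
  finally have fin2: "(\<Sum>\<^sub>\<infinity>N. ennreal (1 / real (mfact N)) * X N) < \<infinity>"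
    by (simp add: power_less_top_ennreal)
  define Y where "Y = (\<lambda>(K, L). ennreal (t ^ (msize K + msize L) / (real (mfact K) * real (mfact L))) * (cabs c K L)\<^sup>2)"
  have "infsum Y UNIV = (\<Sum>\<^sub>\<infinity>K. \<Sum>\<^sub>\<infinity>L. ennreal (t ^ (msize K + msize L) / (real (mfact K) * real (mfact L))) * (cabs c K L)\<^sup>2)"
    unfolding Y_def by (rule infsum_pair_ennreal)
  also have "\<dots> = (\<Sum>\<^sub>\<infinity>N. ennreal (1 / real (mfact N)) * X N)"
    unfolding X_def h0_def infsum_cmult_ennreal[symmetric] using t
    by (intro infsum_cong) (simp add: mult.assoc[symmetric] ennreal_mult[symmetric] del: zero_fun_apply plus_fun_apply)
  finally have fin3: "infsum Y UNIV < \<infinity>" using fin2 by simp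
  \<comment> \<open>The base \<open>r\<^sup>2 / t\<close> makes \<open>U * Y\<close> the square of
    the term wanted at radius \<open>r\<close>.\<close>
  define U where "U = (\<lambda>(K :: 'n mindex, L :: 'n mindex). ennreal ((r\<^sup>2 / t) ^ (msize K + msize L) / (real (mfact K) * real (mfact L))))"
  have "infsum U UNIV = (\<Sum>\<^sub>\<infinity>K::'n mindex. ennreal ((r\<^sup>2 / t) ^ msize K / real (mfact K)) * (\<Sum>\<^sub>\<infinity>L::'n mindex. ennreal ((r\<^sup>2 / t) ^ msize L / real (mfact L))))"
    unfolding U_def infsum_pair_ennreal infsum_cmult_ennreal[symmetric] using t
    by (intro infsum_cong) (simp add: power_add ennreal_mult[symmetric])
  also have "\<dots> = (\<Sum>\<^sub>\<infinity>L::'n mindex. ennreal ((r\<^sup>2 / t) ^ msize L / real (mfact L))) * (\<Sum>\<^sub>\<infinity>K::'n mindex. ennreal ((r\<^sup>2 / t) ^ msize K / real (mfact K)))"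
    by (subst infsum_cmult_ennreal[symmetric]) (simp add: mult.commute)
  also have "\<dots> < \<infinity>"
  proof -
    have "(\<Sum>\<^sub>\<infinity>L::'n mindex. ennreal ((r\<^sup>2 / t) ^ msize L / real (mfact L))) < \<infinity>"
      using summable_on_exp_mindex[of "r\<^sup>2 / t", where 'n = 'n] t
      by (subst summable_on_iff_ennreal[symmetric]) simp_all
    then show ?thesis by (simp add: ennreal_mult_less_top)
  qed
  finally have fin4: "infsum U UNIV < \<infinity>" .
  let ?w = "\<lambda>(K, L). cmod (c K L) * r ^ (msize K + msize L) / (real (mfact K) * real (mfact L))"
  have "(\<Sum>\<^sub>\<infinity>z. ennreal (?w z))\<^sup>2 \<le> infsum U UNIV * infsum Y UNIV"
  proof (rule infsum_Cauchy_Schwarz)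
    fix z :: "'n mindex \<times> 'n mindex"
    obtain K L where z: "z = (K, L)" by (cases z)
    have "(cmod (c K L) * r ^ (msize K + msize L) / (real (mfact K) * real (mfact L)))\<^sup>2 =
        (r\<^sup>2 / t) ^ (msize K + msize L) / (real (mfact K) * real (mfact L)) *
        (t ^ (msize K + msize L) / (real (mfact K) * real (mfact L)) * (cmod (c K L))\<^sup>2)"
      using t by (simp add: power2_eq_square field_simps)
    then show "(ennreal (?w z))\<^sup>2 \<le> U z * Y z"
      using r t by (simp add: z U_def Y_def cabs_def ennreal_power flip: ennreal_mult)
  qed
  also have "\<dots> < \<infinity>" using fin3 fin4 by (simp add: ennreal_mult_less_top)
  finally have "(\<Sum>\<^sub>\<infinity>z. ennreal (?w z)) < \<infinity>" by (simp add: power_less_top_ennreal)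
  then show "?w summable_on UNIV"
    by (subst summable_on_iff_ennreal) (use r in auto)
qed

subsection \<open>The algebra in terms of Taylor coefficients\<close>

lemma coefs_tay: "ent2 c \<Longrightarrow> coefs (tay c) = c"
  by (simp add: coefs_def fun_eq_iff pderivs_tay_0)

text \<open>Finite seminorms make the Taylor array entire, so \<open>tay (coefs f)\<close> exists on
  the whole space. It is real-analytic and has the same derivatives at the origin as
  \<open>f\<close>, hence it is \<open>f\<close>.\<close>

lemma
  assumes hb: "hb > 0" and f: "f \<in> wick hb"
  shows wick_hfin: "hfin (2 * hb) (cabs (coefs f))"
    and wick_ent2: "ent2 (coefs f)"
    and wick_tay: "tay (coefs f) = f"
proof -
  show h: "hfin (2 * hb) (cabs (coefs f))"
    using f by (simp add: wick_def wick_at_def pre_wick_iff[OF hb])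
  show e: "ent2 (coefs f)" by (rule hfin_ent2[OF _ h]) (use hb in simp)
  have "real_analytic f" using f by (simp add: wick_def wick_at_def)
  then show "tay (coefs f) = f"
    by (intro real_analytic_eq real_analytic_tay e) (simp_all add: pderivs_tay_0[OF e] coefs_def)
qed

text \<open>The converse: an array with finite seminorms is the derivative array of an element.
  Members of the algebra are constructed through this criterion.\<close>

lemma wick_tayI:
  assumes hb: "hb > 0" and h: "hfin (2 * hb) (cabs c)"
  shows "tay c \<in> wick hb" and "coefs (tay c) = c"
proof -
  have e: "ent2 c" by (rule hfin_ent2[OF _ h]) (use hb in simp)
  then show c: "coefs (tay c) = c" by (rule coefs_tay)
  show "tay c \<in> wick hb"
    using h smooth_tay[OF e] real_analytic_tay[OF e] by (simp add: wick_def wick_at_def c pre_wick_iff[OF hb])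
qed

lemma wick_eqI:
  assumes "hb > 0" "f \<in> wick hb" "g \<in> wick hb" "\<And>K L. coefs f K L = coefs g K L"
  shows "f = g"
proof -
  have "coefs f = coefs g" using assms(4) by (intro ext)
  then show ?thesis using wick_tay[OF assms(1,2)] wick_tay[OF assms(1,3)] by metis
qed

text \<open>Convexity at the midpoint, applied to the doubled arrays, bounds the sum.\<close>

lemma hfin_add:
  assumes a: "hfin t a" and b: "hfin t b"
  shows "hfin t (\<lambda>R S. a R S + b R S)"
  unfolding hfin_def
proof (intro allI)
  fix bs R S
  have 1: "ennreal (1/2) * (2 * x) = x" for x
  proof -
    have "(2::ennreal) = ennreal 2" by simp
    then have "ennreal (1/2) * 2 = 1" by (simp only: ennreal_mult[symmetric]) simp
    then show ?thesis by (simp add: mult.assoc[symmetric])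
  qed
  have "hh t bs (\<lambda>R S. a R S + b R S) R S \<le> ennreal (1/2) * hh t bs (\<lambda>R S. 2 * a R S) R S
      + ennreal (1 - 1/2) * hh t bs (\<lambda>R S. 2 * b R S) R S"
    by (rule hh_convex) (simp_all add: 1 del: ennreal_half)
  also have "\<dots> < \<infinity>"
  proof -
    have "ennreal x * y < top" if "y < top" for x y
      using that by (simp add: ennreal_mult_less_top)
    then show ?thesis
      using hfin_cmult[OF a, of 2] hfin_cmult[OF b, of 2] by (simp add: hfin_def del: ennreal_half)
  qed
  finally show "hh t bs (\<lambda>R S. a R S + b R S) R S < \<infinity>" .
qed

lemma
  assumes hb: "hb > 0" and f: "f \<in> wick hb" and g: "g \<in> wick hb"
  shows wick_add: "f + g \<in> wick hb" and coefs_add: "coefs (f + g) K L = coefs f K L + coefs g K L"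
proof -
  let ?c = "\<lambda>K L. coefs f K L + coefs g K L"
  have "hfin (2 * hb) (cabs ?c)"
    by (rule hfin_mono[OF hfin_add[OF wick_hfin[OF hb f] wick_hfin[OF hb g]]])
       (auto simp: cabs_def norm_triangle_ineq simp flip: ennreal_plus intro!: ennreal_leI)
  from wick_tayI[OF hb this] have *: "tay ?c \<in> wick hb" "coefs (tay ?c) = ?c" .
  have "tay ?c = f + g"
    using tay_add[OF wick_ent2[OF hb f] wick_ent2[OF hb g]] wick_tay[OF hb f] wick_tay[OF hb g]
    by (simp add: plus_fun_def)
  with * show "f + g \<in> wick hb" "coefs (f + g) K L = coefs f K L + coefs g K L" by auto
qed

lemma
  assumes hb: "hb > 0" and f: "f \<in> wick hb"
  shows wick_scale: "fscale a f \<in> wick hb" and coefs_scale: "coefs (fscale a f) K L = a * coefs f K L"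
proof -
  let ?c = "\<lambda>K L. a * coefs f K L"
  have "hfin (2 * hb) (cabs ?c)"
    by (rule hfin_mono[OF hfin_cmult[OF wick_hfin[OF hb f], of "ennreal (cmod a)"]])
       (auto simp: cabs_def norm_mult simp flip: ennreal_mult)
  from wick_tayI[OF hb this] have *: "tay ?c \<in> wick hb" "coefs (tay ?c) = ?c" .
  have "tay ?c = fscale a f"
    using tay_scale(1)[of a "coefs f"] wick_tay[OF hb f] by (simp add: fscale_def)
  with * show "fscale a f \<in> wick hb" "coefs (fscale a f) K L = a * coefs f K L" by auto
qed

lemma diff_eq_fscale: "f - g = f + fscale (- 1) g"
  by (auto simp: fscale_def fun_eq_iff)

lemma
  assumes hb: "hb > 0" and f: "f \<in> wick hb" and g: "g \<in> wick hb"
  shows wick_diff: "f - g \<in> wick hb" and coefs_diff: "coefs (f - g) K L = coefs f K L - coefs g K L"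
  unfolding diff_eq_fscale
  using wick_add[OF hb f wick_scale[OF hb g]] coefs_add[OF hb f wick_scale[OF hb g]] coefs_scale[OF hb g]
  by auto

lemma hfin_0: "hfin t (\<lambda>R S. 0)"
proof -
  have "hh t bs (\<lambda>R S. 0 * 0) R S = 0" for bs R and S :: "'a mindex"
    unfolding hh_cmult by simp
  then show ?thesis by (simp add: hfin_def)
qed

lemma
  assumes hb: "hb > 0"
  shows wick_0: "(0 :: 'n::finite cfun) \<in> wick hb" and coefs_0: "coefs (0 :: 'n::finite cfun) K L = 0"
proof -
  have "hfin (2 * hb) (cabs (\<lambda>K L. 0) :: 'n garr)"
    using hfin_0[of "2 * hb", where 'a = 'n] by (simp add: cabs_def[abs_def])
  from wick_tayI[OF hb this] show "(0 :: 'n cfun) \<in> wick hb" "coefs (0 :: 'n cfun) K L = 0"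
    by (auto simp: tay_0 zero_fun_def)
qed


subsection \<open>The anti-holomorphic part\<close>

definition pc :: "('n mindex \<Rightarrow> 'n mindex \<Rightarrow> complex) \<Rightarrow> 'n mindex \<Rightarrow> 'n mindex \<Rightarrow> complex" where
  "pc c K L = (if K = 0 then c 0 L else 0)"

lemma pc_pc [simp]: "pc (pc c) = pc c"
  by (auto simp: pc_def fun_eq_iff)

lemma ent2_pc: "ent2 c \<Longrightarrow> ent2 (pc c)"
  by (rule ent2_mono[where C = 1]) (auto simp: pc_def)

lemma hfin_pc: "hfin t (cabs c) \<Longrightarrow> hfin t (cabs (pc c))"
  by (rule hfin_mono) (auto simp: pc_def cabs_def)

lemma tay_pc_has_sum:
  assumes "ent2 c"
  shows "((\<lambda>L. 1 / of_nat (mfact L) * c 0 L * conj_mpow z L) has_sum tay (pc c) z) UNIV"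
proof -
  let ?t = "\<lambda>(K, L). pc c K L / (of_nat (mfact K) * of_nat (mfact L)) * mpow z K * conj_mpow z L"
  have "(?t has_sum tay (pc c) z) UNIV"
    by (rule tay_has_sum[OF ent2_pc[OF assms]])
  then have "(?t has_sum tay (pc c) z) (Pair 0 ` UNIV)"
    by (rule has_sum_cong_neutral[THEN iffD1, rotated 3]) (auto simp: pc_def image_iff)
  then have "((?t \<circ> Pair 0) has_sum tay (pc c) z) UNIV"
    by (subst (asm) has_sum_reindex) (auto simp: inj_on_def)
  then show ?thesis
    by (simp add: comp_def pc_def)
qed

lemma
  assumes "ent2 (coefs f)"
  shows Psi_eq: "Psi f = tay (pc (coefs f))"
    and Psi_has_sum: "((\<lambda>I. Psi_term f I z) has_sum Psi f z) UNIV"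
proof -
  have *: "((\<lambda>I. Psi_term f I z) has_sum tay (pc (coefs f)) z) UNIV" for z
    using tay_pc_has_sum[OF assms, of z] by (simp add: Psi_term_def coefs_def)
  then have "Psi f z = tay (pc (coefs f)) z" for z
    unfolding Psi_def by (rule infsumI)
  then show "Psi f = tay (pc (coefs f))" by blast
  then show "((\<lambda>I. Psi_term f I z) has_sum Psi f z) UNIV" using * by simp
qed

lemma
  assumes hb: "hb > 0" and f: "f \<in> wick hb"
  shows Psi_wick: "Psi f \<in> wick hb" and coefs_Psi: "coefs (Psi f) = pc (coefs f)"
  using wick_tayI[OF hb hfin_pc[OF wick_hfin[OF hb f]]] Psi_eq[OF wick_ent2[OF hb f]] by auto

lemma wick_norm_mono:
  assumes hb: "hb > 0" and "\<And>K L. cmod (coefs f K L) \<le> cmod (coefs g K L)"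
  shows "wick_norm 0 hb m l R S f \<le> wick_norm 0 hb m l R S g"
  unfolding wick_norm_le_wick_norm_iff[OF hb] wick_h_eq[OF hb]
  by (rule hh_mono) (auto simp: cabs_def intro!: ennreal_leI assms)

lemma wick_norm_Psi_le:
  assumes hb: "hb > 0" and f: "f \<in> wick hb"
  shows "wick_norm 0 hb m l R S (Psi f) \<le> wick_norm 0 hb m l R S f"
  by (rule wick_norm_mono[OF hb]) (auto simp: coefs_Psi[OF hb f] pc_def)

text \<open>Differentiation in \<open>z\<close> shifts the first index, so antiholomorphy says that
  all arrays shifted in this way vanish. An entry with \<open>K i \<noteq> 0\<close> is an entry of
  the array shifted in direction \<open>i\<close>.\<close>

lemma antiholomorphic_tay:
  fixes c :: "'n::finite mindex \<Rightarrow> 'n mindex \<Rightarrow> complex"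
  assumes c: "ent2 c"
  shows "antiholomorphic (tay c) \<longleftrightarrow> pc c = c"
proof
  assume a: "antiholomorphic (tay c)"
  show "pc c = c"
  proof (intro ext)
    fix K L
    show "pc c K L = c K L"
    proof (cases "K = 0")
      case False
      then obtain i where i: "K i \<noteq> 0" by (auto simp: fun_eq_iff)
      have "tay (shl i c) = (\<lambda>z. 0)"
        using a dz_tay[OF c, of i] unfolding antiholomorphic_def by metis
      then have "tay (shl i c) = tay (\<lambda>K L. 0)" by (simp add: tay_0)
      then have "shl i c = (\<lambda>K L. 0)"
        using coefs_tay[OF ent2_shl[OF c, of i]] coefs_tay[OF ent2_0] by metis
      then have "shl i c (K - munit i) L = 0" by metis
      moreover have "K - munit i + munit i = K"
        using i by (auto simp: fun_eq_iff munit_def)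
      ultimately show ?thesis using False by (simp add: shl_def pc_def del: plus_fun_apply zero_fun_apply)
    qed (simp add: pc_def)
  qed
next
  assume p: "pc c = c"
  have "shl i c = (\<lambda>K L. 0)" for i
  proof (intro ext)
    fix K L
    have "(K + munit i) i \<noteq> 0" by (simp add: munit_def)
    then have "K + munit i \<noteq> 0" by (metis zero_fun_apply)
    then have "pc c (K + munit i) L = 0" unfolding pc_def by (rule if_not_P)
    then show "shl i c K L = 0" unfolding p shl_def .
  qed
  then show "antiholomorphic (tay c)"
    unfolding antiholomorphic_def dz_tay[OF c] differentiable_def
    using tay_has_derivative[OF c] by (auto simp: tay_0)
qed

text \<open>For \<open>K \<noteq> 0\<close> the value on \<open>pc c\<close> is zero, while the
  summand \<open>N = 0\<close> of the value on \<open>c\<close> already contains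
  \<open>c K L\<close>. Equality at the lowest level for all indices is therefore decisive.\<close>

lemma h0_eq_imp_pc:
  fixes c :: "'n::finite mindex \<Rightarrow> 'n mindex \<Rightarrow> complex"
  assumes t: "t > 0" and eq: "\<And>R S. h0 t (cabs (pc c)) R S = h0 t (cabs c) R S"
  shows "pc c = c"
proof (intro ext)
  fix K L
  show "pc c K L = c K L"
  proof (cases "K = 0")
    case False
    have "h0 t (cabs (pc c)) K L = 0"
      using False by (simp add: h0_def cabs_def pc_def del: zero_fun_apply)
    then have "h0 t (cabs c) K L = 0" using eq by simp
    then have "ennreal (t ^ (msize K + msize L + msize 0) / real (mfact (0 :: 'n mindex))) * (cabs c K (0 + L))\<^sup>2 = 0"
      using single_le_infsum_ennreal[of 0 UNIV "\<lambda>N. ennreal (t ^ (msize K + msize L + msize N) / real (mfact N)) * (cabs c K (N + L))\<^sup>2"]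
      unfolding h0_def by (simp del: zero_fun_apply plus_fun_apply)
    then have "c K L = 0" using t by (simp add: cabs_def)
    with False show ?thesis by (simp add: pc_def)
  qed (simp add: pc_def)
qed

lemma Psi_eq_self_iff:
  assumes hb: "hb > 0" and f: "f \<in> wick hb"
  shows "(\<forall>m l R S. l < 2 ^ m \<longrightarrow> wick_norm 0 hb m l R S (Psi f) = wick_norm 0 hb m l R S f)
    \<longleftrightarrow> antiholomorphic f"
proof
  assume *: "\<forall>m l R S. l < 2 ^ m \<longrightarrow> wick_norm 0 hb m l R S (Psi f) = wick_norm 0 hb m l R S f"
  have "h0 (2 * hb) (cabs (pc (coefs f))) R S = h0 (2 * hb) (cabs (coefs f)) R S" for R S
  proof -
    have "wick_norm 0 hb 0 0 R S (Psi f) = wick_norm 0 hb 0 0 R S f" using * by simp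
    then have "wick_h 0 hb 0 0 R S (Psi f) = wick_h 0 hb 0 0 R S f"
      by (metis wick_norm_power[OF hb])
    then show ?thesis
      unfolding wick_h_eq[OF hb] by (simp add: hh_def coefs_Psi[OF hb f])
  qed
  then have "pc (coefs f) = coefs f" using hb by (intro h0_eq_imp_pc[of "2 * hb"]) auto
  then show "antiholomorphic f"
    using antiholomorphic_tay[OF wick_ent2[OF hb f]] wick_tay[OF hb f] by simp
next
  assume "antiholomorphic f"
  then have "pc (coefs f) = coefs f"
    using antiholomorphic_tay[OF wick_ent2[OF hb f]] wick_tay[OF hb f] by simp
  then have "Psi f = f"
    using Psi_eq[OF wick_ent2[OF hb f]] wick_tay[OF hb f] by simp
  then show "\<forall>m l R S. l < 2 ^ m \<longrightarrow> wick_norm 0 hb m l R S (Psi f) = wick_norm 0 hb m l R S f"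
    by simp
qed


subsection \<open>The star product in terms of Taylor coefficients\<close>

text \<open>Fubini for a countable family of series whose coefficients are jointly dominated by an
  entire array \<open>e\<close>. The star product and the representation formula are both summed by
  it.\<close>

lemma
  fixes d :: "'i::countable \<Rightarrow> 'n::finite mindex \<Rightarrow> 'n mindex \<Rightarrow> complex"
  assumes e: "ent2 e" and le: "\<And>K L. (\<Sum>\<^sub>\<infinity>N. ennreal (cmod (d N K L))) \<le> cabs e K L"
  shows tay_infsum: "((\<lambda>N. tay (d N) z) has_sum tay (\<lambda>K L. \<Sum>\<^sub>\<infinity>N. d N K L) z) UNIV"
    and tay_infsum_summable: "(\<lambda>N. d N K L) summable_on UNIV"
    and tay_infsum_le: "cabs (\<lambda>K L. \<Sum>\<^sub>\<infinity>N. d N K L) K L \<le> cabs e K L"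
    and tay_infsum_ent2: "ent2 (d N)"
proof -
  have sm: "(\<lambda>N. cmod (d N K L)) summable_on UNIV" for K L
    by (subst summable_on_iff_ennreal) (use le[of K L] in \<open>auto simp: cabs_def intro: le_less_trans\<close>)
  then show sd: "(\<lambda>N. d N K L) summable_on UNIV" for K L by (rule abs_summable_summable)
  show "cabs (\<lambda>K L. \<Sum>\<^sub>\<infinity>N. d N K L) K L \<le> cabs e K L" for K L
  proof -
    have "ennreal (cmod (\<Sum>\<^sub>\<infinity>N. d N K L)) \<le> ennreal (\<Sum>\<^sub>\<infinity>N. cmod (d N K L))"
      by (intro ennreal_leI norm_infsum_bound sm)
    also have "\<dots> = (\<Sum>\<^sub>\<infinity>N. ennreal (cmod (d N K L)))"
      by (rule infsum_ennreal[symmetric]) (auto simp: sm)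
    finally have "ennreal (cmod (\<Sum>\<^sub>\<infinity>N. d N K L)) \<le> (\<Sum>\<^sub>\<infinity>N. ennreal (cmod (d N K L)))" .
    from order_trans[OF this le] show ?thesis unfolding cabs_def .
  qed
  show ed: "ent2 (d N)" for N
  proof (rule ent2_mono[OF e, where C = 1])
    fix K L
    have "ennreal (cmod (d N K L)) \<le> cabs e K L"
      by (rule order_trans[OF single_le_infsum_ennreal[of N UNIV "\<lambda>N. ennreal (cmod (d N K L))"] le]) simp
    then show "cmod (d N K L) \<le> 1 * cmod (e K L)" by (simp add: cabs_def)
  qed
  define w where "w = (\<lambda>(K, L). mpow z K * conj_mpow z L / (of_nat (mfact K) * of_nat (mfact L)))"
  define f where "f = (\<lambda>(x, N). w x * d N (fst x) (snd x))"
  have "(\<Sum>\<^sub>\<infinity>p. ennreal (cmod (f p))) = (\<Sum>\<^sub>\<infinity>x. \<Sum>\<^sub>\<infinity>N. ennreal (cmod (w x)) * ennreal (cmod (d N (fst x) (snd x))))"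
    unfolding infsum_pair_ennreal[symmetric] by (intro infsum_cong) (auto simp: f_def norm_mult ennreal_mult)
  also have "\<dots> \<le> (\<Sum>\<^sub>\<infinity>x. ennreal (cmod (w x)) * cabs e (fst x) (snd x))"
    unfolding infsum_cmult_ennreal by (intro infsum_mono_ennreal mult_left_mono le) auto
  also have "\<dots> = (\<Sum>\<^sub>\<infinity>x. ennreal (case x of (K, L) \<Rightarrow> cmod (e K L / (of_nat (mfact K) * of_nat (mfact L)) * mpow z K * conj_mpow z L)))"
    by (intro infsum_cong) (auto simp: w_def cabs_def norm_mult norm_divide ac_simps simp flip: ennreal_mult)
  also have "\<dots> < \<infinity>"
    by (subst summable_on_iff_ennreal[symmetric]) (use tay_abs_summable[OF e, of z] in auto)
  finally have "(\<lambda>p. cmod (f p)) summable_on UNIV"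
    by (subst summable_on_iff_ennreal) auto
  then have "f summable_on UNIV" by (rule abs_summable_summable)
  then have hs: "(f has_sum infsum f UNIV) (UNIV \<times> UNIV)" by simp
  have "((\<lambda>x. w x * (\<Sum>\<^sub>\<infinity>N. d N (fst x) (snd x))) has_sum infsum f UNIV) UNIV"
    by (rule has_sum_SigmaD[OF hs]) (simp add: f_def, intro has_sum_cmult_right has_sum_infsum sd)
  then have "((\<lambda>(K, L). (\<Sum>\<^sub>\<infinity>N. d N K L) / (of_nat (mfact K) * of_nat (mfact L)) * mpow z K * conj_mpow z L) has_sum infsum f UNIV) UNIV"
    by (rule has_sum_cong[THEN iffD1, rotated]) (auto simp: w_def)
  then have eq: "tay (\<lambda>K L. \<Sum>\<^sub>\<infinity>N. d N K L) z = infsum f UNIV"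
    unfolding tay_def by (rule infsumI)
  from hs have "((\<lambda>(N, x). f (x, N)) has_sum infsum f UNIV) (UNIV \<times> UNIV)"
    by (subst (asm) has_sum_swap)
  then show "((\<lambda>N. tay (d N) z) has_sum tay (\<lambda>K L. \<Sum>\<^sub>\<infinity>N. d N K L) z) UNIV"
    unfolding eq
  proof (rule has_sum_SigmaD)
    fix N
    show "((\<lambda>x. case (N, x) of (N, x) \<Rightarrow> f (x, N)) has_sum tay (d N) z) UNIV"
      using tay_has_sum[OF ed, of N z]
      by (rule has_sum_cong[THEN iffD1, rotated]) (auto simp: f_def w_def)
  qed
qed

definition conv2 :: "('n::finite mindex \<Rightarrow> 'n mindex \<Rightarrow> complex) \<Rightarrow> ('n mindex \<Rightarrow> 'n mindex \<Rightarrow> complex)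
    \<Rightarrow> 'n mindex \<Rightarrow> 'n mindex \<Rightarrow> complex" where
  "conv2 c d R S = (\<Sum>I\<le>R. \<Sum>J\<le>S. of_nat (mchoose R I) * of_nat (mchoose S J) * c I J * d (R - I) (S - J))"

lemma conv_jcoef: "conv (jcoef c) (jcoef d) = jcoef (conv2 c d)"
proof
  fix N :: "('a + 'a) mindex"
  obtain R S where N: "N = case_sum R S" by (metis case_sum_eta)
  have "conv (jcoef c) (jcoef d) N = (\<Sum>(I, J)\<in>{..R}\<times>{..S}. of_nat (mchoose R I) * of_nat (mchoose S J) * c I J * d (R - I) (S - J))"
    unfolding conv_def N
  proof (rule sum.reindex_bij_witness[of _ "\<lambda>(I, J). case_sum I J" "\<lambda>M. (M \<circ> Inl, M \<circ> Inr)"])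
    fix M assume "M \<in> {..case_sum R S}"
    obtain I J where M: "M = case_sum I J" by (metis case_sum_eta)
    have [simp]: "case_sum R S - case_sum I J = case_sum (R - I) (S - J)"
      by (auto simp: fun_eq_iff split: sum.split)
    show "(case (M \<circ> Inl, M \<circ> Inr) of (I, J) \<Rightarrow> of_nat (mchoose R I) * of_nat (mchoose S J) * c I J * d (R - I) (S - J))
        = complex_of_nat (mchoose (case_sum R S) M) * jcoef c M * jcoef d (case_sum R S - M)"
      unfolding M by simp
  qed (auto simp: le_fun_def split_sum_all)
  also have "\<dots> = jcoef (conv2 c d) N"
    by (simp add: N conv2_def sum.cartesian_product)
  finally show "conv (jcoef c) (jcoef d) N = jcoef (conv2 c d) N" .
qed

lemma tay_mult:
  assumes "ent2 c" "ent2 d"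
  shows "tay c z * tay d z = tay (conv2 c d) z" and "ent2 (conv2 c d)"
  using ps_mult[of "jcoef c" "jcoef d" "emb z"] ent_conv[of "jcoef c" "jcoef d"] assms
  by (simp_all add: ent2_def tay_eq_ps conv_jcoef)

text \<open>The derivatives at the origin of the \<open>N\<close>-th summand of the star product, by
  the Leibniz rule.\<close>

definition dstar :: "real \<Rightarrow> ('n::finite mindex \<Rightarrow> 'n mindex \<Rightarrow> complex) \<Rightarrow> ('n mindex \<Rightarrow> 'n mindex \<Rightarrow> complex)
    \<Rightarrow> 'n mindex \<Rightarrow> 'n mindex \<Rightarrow> 'n mindex \<Rightarrow> complex" where
  "dstar t c d N R S = of_real (t ^ msize N / real (mfact N)) *
     (\<Sum>I\<le>R. \<Sum>J\<le>S. of_nat (mchoose R I) * of_nat (mchoose S J) * c (N + I) J * d (R - I) (N + (S - J)))"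

definition cstar :: "real \<Rightarrow> ('n::finite mindex \<Rightarrow> 'n mindex \<Rightarrow> complex) \<Rightarrow> ('n mindex \<Rightarrow> 'n mindex \<Rightarrow> complex)
    \<Rightarrow> 'n mindex \<Rightarrow> 'n mindex \<Rightarrow> complex" where
  "cstar t c d R S = (\<Sum>\<^sub>\<infinity>N. dstar t c d N R S)"

lemma dstar_le:
  assumes t: "t > 0"
  shows "ennreal (cmod (dstar t c d N R S)) \<le> ennreal (t ^ msize N / real (mfact N)) *
     (\<Sum>I\<le>R. \<Sum>J\<le>S. of_nat (mchoose R I) * of_nat (mchoose S J) * cabs c (N + I) J * cabs d (R - I) (N + (S - J)))"
proof -
  have "cmod (\<Sum>I\<le>R. \<Sum>J\<le>S. of_nat (mchoose R I) * of_nat (mchoose S J) * c (N + I) J * d (R - I) (N + (S - J)))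
     \<le> (\<Sum>I\<le>R. \<Sum>J\<le>S. real (mchoose R I) * real (mchoose S J) * cmod (c (N + I) J) * cmod (d (R - I) (N + (S - J))))"
    (is "cmod ?A \<le> ?B")
    by (intro order_trans[OF norm_sum] sum_mono) (simp add: norm_mult)
  then have "cmod (dstar t c d N R S) \<le> t ^ msize N / real (mfact N) * ?B"
    using t by (auto simp: dstar_def norm_mult norm_divide norm_power intro!: mult_left_mono divide_right_mono)
  then have "ennreal (cmod (dstar t c d N R S)) \<le> ennreal (t ^ msize N / real (mfact N) * ?B)"
    by (rule ennreal_leI)
  also have "\<dots> = ennreal (t ^ msize N / real (mfact N)) * ennreal ?B"
    using t by (intro ennreal_mult) (auto intro!: sum_nonneg)
  also have "ennreal ?B = (\<Sum>I\<le>R. \<Sum>J\<le>S. of_nat (mchoose R I) * of_nat (mchoose S J) * cabs c (N + I) J * cabs d (R - I) (N + (S - J)))"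
  proof -
    have *: "ennreal (\<Sum>I\<in>A. \<Sum>J\<in>B. g I J) = (\<Sum>I\<in>A. \<Sum>J\<in>B. ennreal (g I J))"
      if "\<And>I J. g I J \<ge> 0" for g :: "'a mindex \<Rightarrow> 'a mindex \<Rightarrow> real" and A B
      using that by (simp add: sum_nonneg)
    show ?thesis
      by (subst *) (auto simp: cabs_def ennreal_of_nat_eq_real_of_nat ennreal_mult)
  qed
  finally show ?thesis .
qed

locale star_coefs =
  fixes hb :: real and c d :: "'n::finite mindex \<Rightarrow> 'n mindex \<Rightarrow> complex"
  assumes hb: "hb > 0" and c: "hfin (2 * hb) (cabs c)" and d: "hfin (2 * hb) (cabs d)"
begin

text \<open>\<open>gstar\<close> takes extended values; under the assumptions of the locale they are
  finite, and as a complex array they form a majorant to which the results on entire arrays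
  apply.\<close>

definition bnd :: "'n mindex \<Rightarrow> 'n mindex \<Rightarrow> complex" where
  "bnd R S = of_real (enn2real (gstar (2 * hb) (cabs c) (cabs d) R S))"

lemma hfin_gst: "hfin (2 * hb) (gstar (2 * hb) (cabs c) (cabs d))"
  using hb by (intro hfin_gstar c d) auto

text \<open>Finiteness of each entry is read off the summand \<open>N = 0\<close> of the lowest
  seminorm.\<close>

lemma cabs_bnd: "cabs bnd = gstar (2 * hb) (cabs c) (cabs d)"
proof (intro ext)
  fix R S
  have "ennreal ((2 * hb) ^ (msize R + msize S + msize (0 :: 'n mindex)) / real (mfact (0 :: 'n mindex))) * (gstar (2 * hb) (cabs c) (cabs d) R (0 + S))\<^sup>2
      \<le> hh (2 * hb) [] (gstar (2 * hb) (cabs c) (cabs d)) R S"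
    unfolding hh_def tower.simps h0_def
    by (rule single_le_infsum_ennreal[of 0 UNIV "\<lambda>N. ennreal ((2 * hb) ^ (msize R + msize S + msize N) / real (mfact N)) *
          (gstar (2 * hb) (cabs c) (cabs d) R (N + S))\<^sup>2"]) simp
  also have "\<dots> < \<infinity>" using hfin_gst unfolding hfin_def by blast
  finally have *: "ennreal ((2 * hb) ^ (msize R + msize S + msize (0 :: 'n mindex)) / real (mfact (0 :: 'n mindex)))
      * (gstar (2 * hb) (cabs c) (cabs d) R (0 + S))\<^sup>2 < \<infinity>" .
  have "y < top" if "ennreal a * y\<^sup>2 < \<infinity>" "a > 0" for a y
    using that by (auto simp: ennreal_mult_less_top power_less_top_ennreal)
  from this[OF *] have "gstar (2 * hb) (cabs c) (cabs d) R S < top"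
    using hb by (simp del: zero_fun_apply plus_fun_apply)
  then show "cabs bnd R S = gstar (2 * hb) (cabs c) (cabs d) R S"
    by (simp add: cabs_def bnd_def)
qed

lemma ent2_bnd: "ent2 bnd"
  by (rule hfin_ent2[of "2 * hb"]) (use hb hfin_gst in \<open>auto simp: cabs_bnd\<close>)

lemma dstar_sum_le: "(\<Sum>\<^sub>\<infinity>N. ennreal (cmod (dstar (2 * hb) c d N K L))) \<le> cabs bnd K L"
  unfolding cabs_bnd gstar_def using hb by (intro infsum_mono_ennreal dstar_le) auto

lemmas dstar_summable = tay_infsum_summable[OF ent2_bnd dstar_sum_le]

lemmas cstar_le = tay_infsum_le[OF ent2_bnd dstar_sum_le]

lemmas tay_dstar_has_sum = tay_infsum[OF ent2_bnd dstar_sum_le]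

lemma hfin_cstar: "hfin (2 * hb) (cabs (cstar (2 * hb) c d))"
  by (rule hfin_mono[OF hfin_gst]) (use cstar_le in \<open>simp add: cabs_bnd cstar_def[abs_def]\<close>)

lemma ent2_c: "ent2 c" and ent2_d: "ent2 d"
  using hfin_ent2[OF _ c] hfin_ent2[OF _ d] hb by auto

lemma tay_dstar:
  "tay (dstar (2 * hb) c d N) z = complex_of_real ((2 * hb) ^ msize N / real (mfact N))
      * pderivs N 0 (tay c) z * pderivs 0 N (tay d) z"
proof -
  have A: "pderivs N 0 (tay c) z * pderivs 0 N (tay d) z
      = tay (conv2 (\<lambda>K L. c (K + N) (L + 0)) (\<lambda>K L. d (K + 0) (L + N))) z"
    unfolding pderivs_tay[OF ent2_c] pderivs_tay[OF ent2_d]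
    by (rule tay_mult(1)) (intro ent2_shift ent2_c ent2_d)+
  have B: "dstar (2 * hb) c d N = (\<lambda>K L. complex_of_real ((2 * hb) ^ msize N / real (mfact N))
      * conv2 (\<lambda>K L. c (K + N) (L + 0)) (\<lambda>K L. d (K + 0) (L + N)) K L)"
    by (intro ext) (simp add: dstar_def conv2_def add.commute[of N] del: plus_fun_apply zero_fun_apply)
  show ?thesis
    unfolding B tay_scale(1) A[symmetric] by (rule mult.assoc[symmetric])
qed

lemma star_tay: "star hb (tay c) (tay d) = tay (cstar (2 * hb) c d)"
proof
  fix z
  have "((\<lambda>N. complex_of_real ((2 * hb) ^ msize N / real (mfact N))
      * pderivs N 0 (tay c) z * pderivs 0 N (tay d) z) has_sum tay (cstar (2 * hb) c d) z) UNIV"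
    using tay_dstar_has_sum[of z] by (simp only: tay_dstar cstar_def[abs_def])
  then show "star hb (tay c) (tay d) z = tay (cstar (2 * hb) c d) z"
    unfolding star_def by (rule infsumI)
qed

end

lemma
  assumes hb: "hb > 0" and f: "f \<in> wick hb" and g: "g \<in> wick hb"
  shows star_wick: "star hb f g \<in> wick hb"
    and coefs_star: "coefs (star hb f g) = cstar (2 * hb) (coefs f) (coefs g)"
proof -
  interpret star_coefs hb "coefs f" "coefs g"
    by unfold_locales (use assms wick_hfin in auto)
  show "star hb f g \<in> wick hb" "coefs (star hb f g) = cstar (2 * hb) (coefs f) (coefs g)"
    using wick_tayI[OF hb hfin_cstar] star_tay by (auto simp: wick_tay[OF hb f] wick_tay[OF hb g])
qed

lemma cstar_linear_left:
  assumes hb: "hb > 0" and "hfin (2 * hb) (cabs c)" "hfin (2 * hb) (cabs c')" "hfin (2 * hb) (cabs d)"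
  shows "cstar (2 * hb) (\<lambda>K L. a * c K L + b * c' K L) d R S = a * cstar (2 * hb) c d R S + b * cstar (2 * hb) c' d R S"
proof -
  interpret s1: star_coefs hb c d by unfold_locales (use assms in auto)
  interpret s2: star_coefs hb c' d by unfold_locales (use assms in auto)
  have "dstar (2 * hb) (\<lambda>K L. a * c K L + b * c' K L) d N R S = a * dstar (2 * hb) c d N R S + b * dstar (2 * hb) c' d N R S" for N
    by (simp add: dstar_def sum_distrib_left sum.distrib[symmetric] algebra_simps del: plus_fun_apply)
  then show ?thesis
    unfolding cstar_def
    by (simp add: infsum_add summable_on_cmult_right s1.dstar_summable s2.dstar_summable infsum_cmult_right')
qed

lemma cstar_linear_right:
  assumes hb: "hb > 0" and "hfin (2 * hb) (cabs d)" "hfin (2 * hb) (cabs d')" "hfin (2 * hb) (cabs c)"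
  shows "cstar (2 * hb) c (\<lambda>K L. a * d K L + b * d' K L) R S = a * cstar (2 * hb) c d R S + b * cstar (2 * hb) c d' R S"
proof -
  interpret s1: star_coefs hb c d by unfold_locales (use assms in auto)
  interpret s2: star_coefs hb c d' by unfold_locales (use assms in auto)
  have "dstar (2 * hb) c (\<lambda>K L. a * d K L + b * d' K L) N R S = a * dstar (2 * hb) c d N R S + b * dstar (2 * hb) c d' N R S" for N
    by (simp add: dstar_def sum_distrib_left sum.distrib[symmetric] algebra_simps del: plus_fun_apply)
  then show ?thesis
    unfolding cstar_def
    by (simp add: infsum_add summable_on_cmult_right s1.dstar_summable s2.dstar_summable infsum_cmult_right')
qed

lemma
  assumes hb: "hb > 0" and f: "f \<in> wick hb" and g: "g \<in> wick hb" and k: "k \<in> wick hb"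
  shows star_linear_left: "star hb (fscale a f + fscale b g) k = fscale a (star hb f k) + fscale b (star hb g k)"
    and star_linear_right: "star hb k (fscale a f + fscale b g) = fscale a (star hb k f) + fscale b (star hb k g)"
proof -
  note w = wick_add[OF hb] wick_scale[OF hb] star_wick[OF hb] f g k
  note cf = coefs_add[OF hb] coefs_scale[OF hb] coefs_star[OF hb]
  have *: "coefs (fscale a f + fscale b g) = (\<lambda>K L. a * coefs f K L + b * coefs g K L)"
    by (intro ext) (simp add: cf w del: plus_fun_apply)
  show "star hb (fscale a f + fscale b g) k = fscale a (star hb f k) + fscale b (star hb g k)"
    by (rule wick_eqI[OF hb])
       (simp_all add: w cf * cstar_linear_left[OF hb wick_hfin[OF hb] wick_hfin[OF hb] wick_hfin[OF hb]] del: plus_fun_apply)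
  show "star hb k (fscale a f + fscale b g) = fscale a (star hb k f) + fscale b (star hb k g)"
    by (rule wick_eqI[OF hb])
       (simp_all add: w cf * cstar_linear_right[OF hb wick_hfin[OF hb] wick_hfin[OF hb] wick_hfin[OF hb]] del: plus_fun_apply)
qed

text \<open>At first index zero the Leibniz sum has only \<open>I = 0\<close>, and \<open>d\<close>
  is then evaluated at first index zero. So the antiholomorphic part of a product sees only the
  antiholomorphic part of its right factor, which is the left ideal property behind the
  representation.\<close>

lemma pc_cstar: "pc (cstar t c d) = pc (cstar t c (pc d))"
proof -
  have "{..(0 :: 'a mindex)} = {0}" by (auto simp: le_fun_def fun_eq_iff)
  then have "dstar t c d N 0 S = dstar t c (pc d) N 0 S" for N S
    by (simp add: dstar_def pc_def del: plus_fun_apply zero_fun_apply)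
  then show ?thesis by (intro ext) (simp add: pc_def cstar_def del: plus_fun_apply zero_fun_apply)
qed

lemma Psi_star_Psi:
  assumes hb: "hb > 0" and f: "f \<in> wick hb" and g: "g \<in> wick hb"
  shows "Psi (star hb f (Psi g)) = Psi (star hb f g)"
  unfolding Psi_eq[OF wick_ent2[OF hb star_wick[OF hb f Psi_wick[OF hb g]]]]
    Psi_eq[OF wick_ent2[OF hb star_wick[OF hb f g]]]
    coefs_star[OF hb f Psi_wick[OF hb g]] coefs_star[OF hb f g] coefs_Psi[OF hb g]
  by (rule arg_cong[OF pc_cstar[symmetric]])


subsection \<open>The positive functional\<close>

lemma
  assumes c: "ent2 c"
  shows fconj_tay: "fconj (tay c) = tay (\<lambda>K L. cnj (c L K))"
    and ent2_conj: "ent2 (\<lambda>K L. cnj (c L K))"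
proof -
  show e: "ent2 (\<lambda>K L. cnj (c L K))"
    unfolding ent2_iff
  proof (intro allI impI)
    fix r :: real assume "r \<ge> 0"
    with c have "(\<lambda>(K, L). cmod (c K L) * r ^ (msize K + msize L) / (real (mfact K) * real (mfact L))) summable_on UNIV \<times> UNIV"
      unfolding ent2_iff by simp
    then show "(\<lambda>(K, L). cmod (cnj (c L K)) * r ^ (msize K + msize L) / (real (mfact K) * real (mfact L))) summable_on UNIV"
      by (subst (asm) summable_on_swap) (simp add: case_prod_unfold ac_simps)
  qed
  show "fconj (tay c) = tay (\<lambda>K L. cnj (c L K))"
  proof
    fix z
    have "((\<lambda>x. cnj ((\<lambda>(K, L). c K L / (of_nat (mfact K) * of_nat (mfact L)) * mpow z K * conj_mpow z L) x)) has_sum cnj (tay c z)) (UNIV \<times> UNIV)"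
      unfolding has_sum_cnj_iff using tay_has_sum[OF c, of z] by simp
    then have "((\<lambda>(K, L). cnj (c L K) / (of_nat (mfact K) * of_nat (mfact L)) * mpow z K * conj_mpow z L) has_sum cnj (tay c z)) UNIV"
      by (subst (asm) has_sum_swap) (simp add: case_prod_unfold cnj_mpow cnj_conj_mpow ac_simps)
    then show "fconj (tay c) z = tay (\<lambda>K L. cnj (c L K)) z"
      unfolding fconj_def tay_def by (rule infsumI[symmetric])
  qed
qed

text \<open>Conjugation exchanges the two kinds of derivatives, so at the origin only the
  antiholomorphic derivatives of \<open>f\<close> and of \<open>g\<close> meet.\<close>

lemma delta0_star:
  assumes hb: "hb > 0" and f: "f \<in> wick hb" and g: "g \<in> wick hb"
  shows "delta0 (star hb (fconj f) g)
     = (\<Sum>\<^sub>\<infinity>N. of_real ((2 * hb) ^ msize N / real (mfact N)) * cnj (coefs f 0 N) * coefs g 0 N)"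
proof -
  have "pderivs N 0 (fconj f) 0 = cnj (coefs f 0 N)" for N
    using fconj_tay[OF wick_ent2[OF hb f]] ent2_conj[OF wick_ent2[OF hb f]] wick_tay[OF hb f]
    by (simp add: pderivs_tay_0)
  then show ?thesis by (simp add: delta0_def star_def coefs_def)
qed

lemma h0_summable:
  assumes hb: "hb > 0" and h: "h0 (2 * hb) (cabs c) 0 0 < \<infinity>"
  shows "(\<lambda>N. (2 * hb) ^ msize N / real (mfact N) * (cmod (c 0 N))\<^sup>2) summable_on UNIV"
    and "h0 (2 * hb) (cabs c) 0 0 = ennreal (\<Sum>\<^sub>\<infinity>N. (2 * hb) ^ msize N / real (mfact N) * (cmod (c 0 N))\<^sup>2)"
proof -
  have *: "h0 (2 * hb) (cabs c) 0 0 = (\<Sum>\<^sub>\<infinity>N. ennreal ((2 * hb) ^ msize N / real (mfact N) * (cmod (c 0 N))\<^sup>2))"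
    unfolding h0_def cabs_def using hb
    by (intro infsum_cong) (simp add: ennreal_power flip: ennreal_mult del: zero_fun_apply)
  show s: "(\<lambda>N. (2 * hb) ^ msize N / real (mfact N) * (cmod (c 0 N))\<^sup>2) summable_on UNIV"
    by (subst summable_on_iff_ennreal) (use hb h * in auto)
  show "h0 (2 * hb) (cabs c) 0 0 = ennreal (\<Sum>\<^sub>\<infinity>N. (2 * hb) ^ msize N / real (mfact N) * (cmod (c 0 N))\<^sup>2)"
    unfolding * by (rule infsum_ennreal[OF s]) (use hb in auto)
qed

text \<open>The functional on \<open>f\<close> is a sum of squared moduli of the
  \<open>coefs f 0 N\<close> with positive weights, and such a sum vanishes only termwise.\<close>

lemma gelfand_iff:
  assumes hb: "hb > 0"
  shows "f \<in> gelfand hb \<longleftrightarrow> f \<in> wick hb \<and> (\<forall>N. coefs f 0 N = 0)"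
proof (cases "f \<in> wick hb")
  case True
  let ?t = "\<lambda>N. (2 * hb) ^ msize N / real (mfact N) * (cmod (coefs f 0 N))\<^sup>2"
  have "h0 (2 * hb) (cabs (coefs f)) 0 0 < \<infinity>"
    using wick_hfin[OF hb True, unfolded hfin_def, rule_format, of "[]" 0 0] by (simp add: hh_def)
  note s = h0_summable(1)[OF hb this]
  have "delta0 (star hb (fconj f) f) = (\<Sum>\<^sub>\<infinity>N. complex_of_real (?t N))"
    unfolding delta0_star[OF hb True True]
    by (intro infsum_cong) (simp add: mult.assoc complex_norm_square[symmetric] mult.commute[of "cnj _"])
  also have "\<dots> = complex_of_real (\<Sum>\<^sub>\<infinity>N. ?t N)"
    by (rule infsumI) (rule has_sum_of_real[OF has_sum_infsum[OF s]])
  finally have "delta0 (star hb (fconj f) f) = 0 \<longleftrightarrow> (\<Sum>\<^sub>\<infinity>N. ?t N) = 0" by simp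
  also have "\<dots> \<longleftrightarrow> (\<forall>N. coefs f 0 N = 0)"
  proof
    assume z: "(\<Sum>\<^sub>\<infinity>N. ?t N) = 0"
    show "\<forall>N. coefs f 0 N = 0"
    proof
      fix N
      have "?t N = 0"
        by (rule nonneg_infsum_le_0D[of ?t UNIV]) (use z s hb in auto)
      then show "coefs f 0 N = 0" using hb by simp
    qed
  qed simp
  finally show ?thesis using True by (simp add: gelfand_def)
qed (simp add: gelfand_def)

lemma Psi_eq_iff:
  assumes hb: "hb > 0" and f: "f \<in> wick hb" and g: "g \<in> wick hb"
  shows "Psi f = Psi g \<longleftrightarrow> f - g \<in> gelfand hb"
proof -
  have "Psi f = Psi g \<longleftrightarrow> pc (coefs f) = pc (coefs g)"
    using coefs_Psi[OF hb f] coefs_Psi[OF hb g] Psi_eq[OF wick_ent2[OF hb f]] Psi_eq[OF wick_ent2[OF hb g]] by metis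
  also have "\<dots> \<longleftrightarrow> (\<forall>N. coefs f 0 N = coefs g 0 N)"
    by (auto simp: pc_def fun_eq_iff[of "pc _"] fun_eq_iff[of "pc _ _"])
  finally show ?thesis
    by (simp add: gelfand_iff[OF hb] wick_diff[OF hb f g] coefs_diff[OF hb f g])
qed

subsection \<open>Seminorm topologies\<close>

text \<open>The subtraction is a parameter so that the same results serve functions and cosets,
  where it is \<open>gns_diff\<close>.\<close>

locale seminorms =
  fixes V :: "'v set" and df :: "'v \<Rightarrow> 'v \<Rightarrow> 'v" and P :: "('v \<Rightarrow> ennreal) set"
  assumes nonempty: "P \<noteq> {}"
    and self: "q \<in> P \<Longrightarrow> x \<in> V \<Longrightarrow> q (df x x) = 0"
    and triangle: "q \<in> P \<Longrightarrow> x \<in> V \<Longrightarrow> y \<in> V \<Longrightarrow> z \<in> V \<Longrightarrow> q (df z x) \<le> q (df z y) + q (df y x)"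
begin

abbreviation top where "top \<equiv> seminorm_topology V df P"

definition sball where "sball x F e = {y \<in> V. \<forall>q\<in>F. q (df y x) < ennreal e}"

lemma openin_ball:
  assumes "x \<in> V" "q \<in> P" "e > 0"
  shows "openin top {y \<in> V. q (df y x) < ennreal e}"
  unfolding seminorm_topology_def
  by (rule topology_generated_by_Basis) (use assms in blast)

lemma topspace: "topspace top = V"
proof
  show "topspace top \<subseteq> V"
    unfolding seminorm_topology_def topology_generated_by_topspace by blast
  show "V \<subseteq> topspace top"
  proof
    fix x assume x: "x \<in> V"
    obtain q where q: "q \<in> P" using nonempty by blast
    have "x \<in> {y \<in> V. q (df y x) < ennreal 1}" using x self[OF q x] by simp
    then show "x \<in> topspace top" using openin_ball[OF x q, of 1] openin_subset by fastforce
  qed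
qed

lemma openin_sball:
  assumes "x \<in> V" "finite F" "F \<subseteq> P" "e > 0"
  shows "openin top (sball x F e)"
  using assms(2,3)
proof (induction F rule: finite_induct)
  case empty
  then show ?case using openin_topspace[of top] by (simp add: sball_def topspace)
next
  case (insert q F)
  have "sball x (insert q F) e = {y \<in> V. q (df y x) < ennreal e} \<inter> sball x F e"
    by (auto simp: sball_def)
  then show ?case using insert assms by (auto intro!: openin_Int openin_ball)
qed

lemma sball_mono: "F \<subseteq> G \<Longrightarrow> e \<le> d \<Longrightarrow> sball x G e \<subseteq> sball x F d"
  unfolding sball_def by (auto intro: less_le_trans ennreal_leI)

lemma center_in_sball: "x \<in> V \<Longrightarrow> F \<subseteq> P \<Longrightarrow> e > 0 \<Longrightarrow> x \<in> sball x F e"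
  by (auto simp: sball_def self subset_iff)

definition nbhd where "nbhd x U \<longleftrightarrow> (\<exists>F e. finite F \<and> F \<subseteq> P \<and> e > 0 \<and> sball x F e \<subseteq> U)"

lemma nbhdI: "finite F \<Longrightarrow> F \<subseteq> P \<Longrightarrow> e > 0 \<Longrightarrow> sball x F e \<subseteq> U \<Longrightarrow> nbhd x U"
  unfolding nbhd_def by blast

lemma nbhdE:
  assumes "nbhd x U"
  obtains F e where "finite F" "F \<subseteq> P" "e > 0" "sball x F e \<subseteq> U"
  using assms unfolding nbhd_def by blast

lemma nbhd_mono: "nbhd x U \<Longrightarrow> U \<subseteq> W \<Longrightarrow> nbhd x W"
  by (erule nbhdE, rule nbhdI) auto

lemma nbhd_Int:
  assumes "nbhd x U" "nbhd x W"
  shows "nbhd x (U \<inter> W)"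
proof -
  obtain F e where 1: "finite F" "F \<subseteq> P" "e > 0" "sball x F e \<subseteq> U" using assms(1) by (rule nbhdE)
  obtain G d where 2: "finite G" "G \<subseteq> P" "d > 0" "sball x G d \<subseteq> W" using assms(2) by (rule nbhdE)
  have "sball x (F \<union> G) (min e d) \<subseteq> sball x F e" "sball x (F \<union> G) (min e d) \<subseteq> sball x G d"
    by (intro sball_mono; simp)+
  with 1 2 show ?thesis by (intro nbhdI[of "F \<union> G" "min e d"]) auto
qed

text \<open>The generating sets are balls around arbitrary centres; the triangle inequality fits a
  ball around each of their points into them. Openness can then be tested pointwise with finitely
  many seminorms and one radius.\<close>

lemma openin_iff: "openin top U \<longleftrightarrow> U \<subseteq> V \<and> (\<forall>x\<in>U. nbhd x U)"
proof
  assume U: "openin top U"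
  then have UV: "U \<subseteq> V" by (metis openin_subset topspace)
  have "generate_topology_on {{y \<in> V. q (df y x) < ennreal e} |q x e. q \<in> P \<and> x \<in> V \<and> 0 < e} U"
    using U unfolding seminorm_topology_def openin_topology_generated_by_iff .
  then have "\<forall>x\<in>U. nbhd x U"
  proof (induction rule: generate_topology_on.induct)
    case (Int a b)
    then show ?case by (simp add: nbhd_Int)
  next
    case (UN K)
    show ?case
    proof
      fix x assume "x \<in> \<Union> K"
      then obtain k where k: "k \<in> K" "x \<in> k" by blast
      with UN.IH have "nbhd x k" by blast
      then show "nbhd x (\<Union> K)" by (rule nbhd_mono) (use k in blast)
    qed
  next
    case (Basis s)
    then obtain q x0 e where s: "s = {y \<in> V. q (df y x0) < ennreal e}" "q \<in> P" "x0 \<in> V" "0 < e" by blast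
    show ?case
    proof
      fix x assume x: "x \<in> s"
      then obtain r where r: "q (df x x0) = ennreal r" "r \<ge> 0" "r < e" "x \<in> V"
        unfolding s by (cases "q (df x x0)") (auto simp: ennreal_less_iff)
      have "sball x {q} (e - r) \<subseteq> s"
      proof
        fix y assume y: "y \<in> sball x {q} (e - r)"
        then have yV: "y \<in> V" "q (df y x) < ennreal (e - r)" by (auto simp: sball_def)
        have "q (df y x0) \<le> q (df y x) + ennreal r"
          using triangle[OF s(2,3) r(4) yV(1)] r(1) by simp
        also have "\<dots> < ennreal (e - r) + ennreal r"
          using yV(2) by (simp add: add.commute[of _ "ennreal r"] ennreal_add_left_cancel_less)
        also have "\<dots> = ennreal e" using r by (simp flip: ennreal_plus)
        finally show "y \<in> s" using yV by (simp add: s)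
      qed
      then show "nbhd x s"
        using s(2) r(3) by (intro nbhdI[of "{q}" "e - r"]) auto
    qed
  qed simp
  with UV show "U \<subseteq> V \<and> (\<forall>x\<in>U. nbhd x U)" by blast
next
  assume *: "U \<subseteq> V \<and> (\<forall>x\<in>U. nbhd x U)"
  show "openin top U"
  proof (subst openin_subopen, intro ballI)
    fix x assume x: "x \<in> U"
    then have "nbhd x U" using * by blast
    then obtain F e where F: "finite F" "F \<subseteq> P" "e > 0" "sball x F e \<subseteq> U" by (rule nbhdE)
    have xV: "x \<in> V" using x * by blast
    show "\<exists>T. openin top T \<and> x \<in> T \<and> T \<subseteq> U"
      using F xV openin_sball[OF xV F(1-3)] center_in_sball[OF xV F(2,3)] by blast
  qed
qed

lemma limitin_topI:
  assumes l: "l \<in> V" and u: "\<And>x. u x \<in> V" and lim: "\<And>q. q \<in> P \<Longrightarrow> ((\<lambda>x. q (df (u x) l)) \<longlongrightarrow> 0) G"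
  shows "limitin top u l G"
  unfolding limitin_def topspace
proof (intro conjI allI impI l)
  fix U assume U: "openin top U \<and> l \<in> U"
  then have "nbhd l U" by (simp add: openin_iff)
  then obtain F e where F: "finite F" "F \<subseteq> P" "e > 0" "sball l F e \<subseteq> U" by (rule nbhdE)
  have "eventually (\<lambda>x. \<forall>q\<in>F. q (df (u x) l) < ennreal e) G"
    using F by (intro eventually_ball_finite ballI order_tendstoD(2)[OF lim]) auto
  then show "eventually (\<lambda>x. u x \<in> U) G"
    by eventually_elim (use F u in \<open>auto simp: sball_def\<close>)
qed

lemma sub:
  assumes "W \<subseteq> V"
  shows "seminorms W df P"
proof
  show "P \<noteq> {}" by (rule nonempty)
  show "q (df x x) = 0" if "q \<in> P" "x \<in> W" for q x
    using that assms by (blast intro: self)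
  show "q (df z x) \<le> q (df z y) + q (df y x)" if "q \<in> P" "x \<in> W" "y \<in> W" "z \<in> W" for q x y z
    using that assms by (blast intro: triangle)
qed

text \<open>The balls generating the topology of \<open>W\<close> have their centres in
  \<open>W\<close>, while those of the ambient space need not. The pointwise description of open
  sets removes this difference.\<close>

lemma subtopology:
  assumes W: "W \<subseteq> V"
  shows "subtopology top W = seminorm_topology W df P"
proof (rule topology_eq[THEN iffD2], intro allI)
  fix U
  interpret W: seminorms W df P by (rule sub[OF W])
  have b: "W.sball x F e = sball x F e \<inter> W" for x F e
    unfolding sball_def W.sball_def using W by blast
  show "openin (subtopology top W) U = openin (seminorm_topology W df P) U"
  proof
    assume "openin (subtopology top W) U"
    then obtain T where T: "openin top T" "U = T \<inter> W" by (auto simp: openin_subtopology)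
    show "openin (seminorm_topology W df P) U"
      unfolding W.openin_iff
    proof (intro conjI ballI)
      fix x assume "x \<in> U"
      then have "x \<in> T" using T by blast
      then have "nbhd x T" using T(1) by (simp add: openin_iff)
      then obtain F e where F: "finite F" "F \<subseteq> P" "e > 0" "sball x F e \<subseteq> T" by (rule nbhdE)
      then show "W.nbhd x U"
        using T(2) by (intro W.nbhdI[of F e]) (auto simp: b)
    qed (use T in auto)
  next
    assume "openin (seminorm_topology W df P) U"
    then have U: "U \<subseteq> W" "\<And>x. x \<in> U \<Longrightarrow> W.nbhd x U"
      unfolding W.openin_iff by auto
    show "openin (subtopology top W) U"
    proof (subst openin_subopen, intro ballI)
      fix x assume x: "x \<in> U"
      obtain F e where F: "finite F" "F \<subseteq> P" "e > 0" "W.sball x F e \<subseteq> U" using U(2)[OF x] by (rule W.nbhdE)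
      have "x \<in> V" using x U(1) W by blast
      then have "openin (subtopology top W) (W.sball x F e)"
        unfolding b using F by (intro openin_subtopology_Int openin_sball) auto
      then show "\<exists>T. openin (subtopology top W) T \<and> x \<in> T \<and> T \<subseteq> U"
        using F x U(1) W.center_in_sball[of x F e] by blast
    qed
  qed
qed

end

lemma continuous_map_seminorms:
  assumes 1: "seminorms V d P" and 2: "seminorms W d' Q"
    and img: "\<And>x. x \<in> V \<Longrightarrow> g x \<in> W"
    and le: "\<And>q. q \<in> Q \<Longrightarrow> \<exists>p\<in>P. \<forall>x\<in>V. \<forall>y\<in>V. q (d' (g y) (g x)) \<le> p (d y x)"
  shows "continuous_map (seminorm_topology V d P) (seminorm_topology W d' Q) g"
proof -
  interpret s1: seminorms V d P by fact
  interpret s2: seminorms W d' Q by fact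
  show ?thesis
    unfolding continuous_map_def s1.topspace s2.topspace
  proof (intro conjI allI impI)
    fix U assume U: "openin s2.top U"
    show "openin s1.top {x \<in> V. g x \<in> U}"
      unfolding s1.openin_iff
    proof (intro conjI ballI)
      fix x assume x: "x \<in> {x \<in> V. g x \<in> U}"
      then have "s2.nbhd (g x) U" using U by (simp add: s2.openin_iff)
      then obtain F e where F: "finite F" "F \<subseteq> Q" "e > 0" "s2.sball (g x) F e \<subseteq> U" by (rule s2.nbhdE)
      have "\<forall>q\<in>F. \<exists>p. p \<in> P \<and> (\<forall>x\<in>V. \<forall>y\<in>V. q (d' (g y) (g x)) \<le> p (d y x))"
        using F(2) le by blast
      then obtain p where p: "\<And>q. q \<in> F \<Longrightarrow> p q \<in> P \<and> (\<forall>x\<in>V. \<forall>y\<in>V. q (d' (g y) (g x)) \<le> p q (d y x))"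
        by metis
      have "s1.sball x (p ` F) e \<subseteq> {x \<in> V. g x \<in> U}"
      proof
        fix y assume y: "y \<in> s1.sball x (p ` F) e"
        then have yV: "y \<in> V" by (simp add: s1.sball_def)
        have "q (d' (g y) (g x)) < ennreal e" if "q \<in> F" for q
          using p[OF that] x yV y that by (auto simp: s1.sball_def intro: le_less_trans)
        then have "g y \<in> s2.sball (g x) F e" using img yV by (simp add: s2.sball_def)
        then show "y \<in> {x \<in> V. g x \<in> U}" using F yV by blast
      qed
      then show "s1.nbhd x {x \<in> V. g x \<in> U}"
        using F p by (intro s1.nbhdI[of "p ` F" e]) auto
    qed auto
  qed (use img in auto)
qed


subsection \<open>The topologies of the algebra and of the image of \<^term>\<open>Psi\<close>\<close>

definition sn :: "real \<Rightarrow> ('n::finite cfun \<Rightarrow> ennreal) set" where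
  "sn hb = {wick_norm 0 hb m l R S | m l R S. l < 2 ^ m}"

lemma wick_norm_eq_0:
  assumes "\<And>K L. coefs f K L = 0" "hb > 0"
  shows "wick_norm 0 hb m l R S f = 0"
proof -
  have "wick_h 0 hb m l R S f \<le> hh (2 * hb) (wbits m l) (\<lambda>R S. 0 * 0) R S"
    unfolding wick_h_eq[OF assms(2)] by (rule hh_mono) (simp add: cabs_def assms)
  also have "\<dots> = 0" unfolding hh_cmult by simp
  finally show ?thesis by (simp add: wick_norm_def)
qed

lemma seminorms_wick:
  assumes hb: "hb > 0"
  shows "seminorms (wick hb) (-) (sn hb :: ('n::finite cfun \<Rightarrow> ennreal) set)"
proof
  have "wick_norm 0 hb 0 0 0 0 \<in> (sn hb :: ('n::finite cfun \<Rightarrow> ennreal) set)"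
    unfolding sn_def by (intro CollectI exI[of _ 0]) auto
  then show "sn hb \<noteq> ({} :: ('n cfun \<Rightarrow> ennreal) set)" by blast
next
  fix q :: "'n cfun \<Rightarrow> ennreal" and x :: "'n cfun" assume "q \<in> sn hb" "x \<in> wick hb"
  then show "q (x - x) = 0"
    unfolding sn_def by (auto intro!: wick_norm_eq_0 hb simp: coefs_0[OF hb])
next
  fix q :: "'n cfun \<Rightarrow> ennreal" and x y z :: "'n cfun"
  assume q: "q \<in> sn hb" and w: "x \<in> wick hb" "y \<in> wick hb" "z \<in> wick hb"
  have "cmod (coefs (z - x) K L) \<le> cmod (coefs (z - y) K L) + cmod (coefs (y - x) K L)" for K L
    using w norm_triangle_ineq[of "coefs z K L - coefs y K L" "coefs y K L - coefs x K L"] by (simp add: coefs_diff[OF hb])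
  then show "q (z - x) \<le> q (z - y) + q (y - x)"
    using q unfolding sn_def by (auto intro!: wick_norm_triangle hb)
qed

lemma fock_iff:
  assumes hb: "hb > 0"
  shows "\<phi> \<in> fock hb \<longleftrightarrow> \<phi> \<in> wick hb \<and> pc (coefs \<phi>) = coefs \<phi>"
proof
  assume "\<phi> \<in> fock hb"
  then show "\<phi> \<in> wick hb \<and> pc (coefs \<phi>) = coefs \<phi>"
    unfolding fock_def by (auto simp: Psi_wick[OF hb] coefs_Psi[OF hb])
next
  assume *: "\<phi> \<in> wick hb \<and> pc (coefs \<phi>) = coefs \<phi>"
  then have "Psi \<phi> = \<phi>" by (simp add: Psi_eq[OF wick_ent2[OF hb]] wick_tay[OF hb])
  then show "\<phi> \<in> fock hb" unfolding fock_def using * by (metis image_eqI)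
qed

lemma fock_subset: "hb > 0 \<Longrightarrow> fock hb \<subseteq> wick hb"
  using fock_iff by blast

lemma fock_wick: "hb > 0 \<Longrightarrow> \<phi> \<in> fock hb \<Longrightarrow> \<phi> \<in> wick hb"
  using fock_iff by blast

lemma Psi_fock:
  assumes "hb > 0" "\<phi> \<in> fock hb"
  shows "Psi \<phi> = \<phi>"
  using assms fock_iff[OF assms(1)] Psi_eq[OF wick_ent2[OF assms(1)]] wick_tay[OF assms(1)] by metis

lemma Psi_in_fock: "f \<in> wick hb \<Longrightarrow> Psi f \<in> fock hb"
  by (simp add: fock_def)

lemma fock_top_eq:
  assumes hb: "hb > 0"
  shows "fock_top hb = seminorm_topology (fock hb :: 'n::finite cfun set) (-) (sn hb)"
proof -
  interpret seminorms "wick hb :: 'n cfun set" "(-)" "sn hb" by (rule seminorms_wick[OF hb])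
  show ?thesis
    unfolding fock_top_def wick_top_def sn_def[symmetric] by (rule subtopology[OF fock_subset[OF hb]])
qed

lemma seminorms_fock:
  assumes hb: "hb > 0"
  shows "seminorms (fock hb :: 'n::finite cfun set) (-) (sn hb)"
  by (rule seminorms.sub[OF seminorms_wick[OF hb] fock_subset[OF hb]])

lemma Psi_linear:
  assumes hb: "hb > 0" and f: "f \<in> wick hb" and g: "g \<in> wick hb"
  shows "Psi (f + g) = Psi f + Psi g" "Psi (fscale a f) = fscale a (Psi f)" "Psi (f - g) = Psi f - Psi g"
proof -
  note w = wick_add[OF hb] wick_scale[OF hb] wick_diff[OF hb] Psi_wick[OF hb] f g
  note c = coefs_add[OF hb] coefs_scale[OF hb] coefs_diff[OF hb] coefs_Psi[OF hb] pc_def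
  show "Psi (f + g) = Psi f + Psi g" "Psi (fscale a f) = fscale a (Psi f)" "Psi (f - g) = Psi f - Psi g"
    by (rule wick_eqI[OF hb]; simp add: w c del: plus_fun_apply minus_apply)+
qed

lemma continuous_Psi:
  assumes hb: "hb > 0"
  shows "continuous_map (wick_top hb) (wick_top hb) (Psi :: 'n::finite cfun \<Rightarrow> 'n cfun)"
  unfolding wick_top_def sn_def[symmetric]
proof (rule continuous_map_seminorms[OF seminorms_wick[OF hb] seminorms_wick[OF hb]])
  fix q :: "'n cfun \<Rightarrow> ennreal" assume q: "q \<in> sn hb"
  then have "q (Psi y - Psi x) \<le> q (y - x)" if "x \<in> wick hb" "y \<in> wick hb" for x y
    unfolding Psi_linear(3)[OF hb that(2,1), symmetric] sn_def
    using that by (auto intro!: wick_norm_Psi_le wick_diff hb)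
  then show "\<exists>p\<in>sn hb. \<forall>x\<in>wick hb. \<forall>y\<in>wick hb. q (Psi y - Psi x) \<le> p (y - x)"
    using q by blast
qed (rule Psi_wick[OF hb])


subsection \<open>The quotient by the Gel'fand ideal\<close>

lemma gelfand_wick: "f \<in> gelfand hb \<Longrightarrow> f \<in> wick hb"
  by (simp add: gelfand_def)

text \<open>Cosets are the fibres of \<open>Psi\<close>, so every operation on cosets becomes an
  identity for \<open>Psi\<close>.\<close>

lemma mem_gcls:
  assumes hb: "hb > 0" and f: "f \<in> wick hb"
  shows "u \<in> gcls hb f \<longleftrightarrow> u \<in> wick hb \<and> Psi u = Psi f"
proof
  assume "u \<in> gcls hb f"
  then obtain g where g: "u = f + g" "g \<in> gelfand hb" unfolding gcls_def by blast
  have "u \<in> wick hb" using g wick_add[OF hb f gelfand_wick] by simp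
  moreover have "u - f \<in> gelfand hb" using g by simp
  ultimately show "u \<in> wick hb \<and> Psi u = Psi f" using Psi_eq_iff[OF hb] f by blast
next
  assume u: "u \<in> wick hb \<and> Psi u = Psi f"
  then have "u - f \<in> gelfand hb" using Psi_eq_iff[OF hb] f by blast
  moreover have "u = f + (u - f)" by simp
  ultimately show "u \<in> gcls hb f" unfolding gcls_def by blast
qed

lemma gcls_eq_iff:
  assumes hb: "hb > 0" and f: "f \<in> wick hb" and g: "g \<in> wick hb"
  shows "gcls hb f = gcls hb g \<longleftrightarrow> Psi f = Psi g"
  using mem_gcls[OF hb f] mem_gcls[OF hb g] f by auto

lemma gns_to_fock_gcls:
  assumes hb: "hb > 0" and f: "f \<in> wick hb"
  shows "gns_to_fock (gcls hb f) = Psi f"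
proof -
  have "Psi ` gcls hb f = {Psi f}" using mem_gcls[OF hb f] f by auto
  then show ?thesis by (simp add: gns_to_fock_def)
qed

lemma gcls_Psi: 
  assumes hb: "hb > 0" and f: "f \<in> wick hb"
  shows "gcls hb (Psi f) = gcls hb f"
  unfolding gcls_eq_iff[OF hb Psi_wick[OF hb f] f] by (rule Psi_fock[OF hb Psi_in_fock[OF f]])

lemma gcls_add:
  assumes hb: "hb > 0" and f: "f \<in> wick hb" and g: "g \<in> wick hb"
  shows "gns_add (gcls hb f) (gcls hb g) = gcls hb (f + g)"
proof (intro set_eqI iffI)
  fix u assume "u \<in> gns_add (gcls hb f) (gcls hb g)"
  then obtain x y where "u = x + y" "x \<in> gcls hb f" "y \<in> gcls hb g" unfolding gns_add_def by blast
  then show "u \<in> gcls hb (f + g)"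
    using f g by (auto simp: mem_gcls[OF hb] wick_add[OF hb] Psi_linear[OF hb])
next
  fix u assume "u \<in> gcls hb (f + g)"
  then obtain k where k: "u = f + g + k" "k \<in> gelfand hb" unfolding gcls_def by blast
  have "f \<in> gcls hb f" using mem_gcls[OF hb f] f by blast
  moreover have "g + k \<in> gcls hb g" using k unfolding gcls_def by blast
  moreover have "u = f + (g + k)" using k by (simp add: add.assoc)
  ultimately show "u \<in> gns_add (gcls hb f) (gcls hb g)" unfolding gns_add_def by blast
qed

lemma gcls_diff:
  assumes hb: "hb > 0" and f: "f \<in> wick hb" and g: "g \<in> wick hb"
  shows "gns_diff (gcls hb f) (gcls hb g) = gcls hb (f - g)"
proof (intro set_eqI iffI)
  fix u assume "u \<in> gns_diff (gcls hb f) (gcls hb g)"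
  then obtain x y where "u = x - y" "x \<in> gcls hb f" "y \<in> gcls hb g" unfolding gns_diff_def by blast
  then show "u \<in> gcls hb (f - g)"
    using f g by (auto simp: mem_gcls[OF hb] wick_diff[OF hb] Psi_linear[OF hb])
next
  fix u assume "u \<in> gcls hb (f - g)"
  then obtain k where k: "u = f - g + k" "k \<in> gelfand hb" unfolding gcls_def by blast
  have "g \<in> gcls hb g" using mem_gcls[OF hb g] g by blast
  moreover have "f + k \<in> gcls hb f" using k unfolding gcls_def by blast
  moreover have "u = (f + k) - g" using k by simp
  ultimately show "u \<in> gns_diff (gcls hb f) (gcls hb g)" unfolding gns_diff_def by blast
qed

lemma gcls_scale:
  assumes hb: "hb > 0" and f: "f \<in> wick hb"
  shows "gns_scale hb a (gcls hb f) = gcls hb (fscale a f)"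
proof (intro set_eqI iffI)
  fix u assume "u \<in> gns_scale hb a (gcls hb f)"
  then obtain x g where x: "u = fscale a x + g" "x \<in> gcls hb f" "g \<in> gelfand hb" unfolding gns_scale_def by blast
  then have "x \<in> wick hb" "Psi x = Psi f" using mem_gcls[OF hb f] by auto
  then have "gcls hb (fscale a x) = gcls hb (fscale a f)"
    using f by (simp add: gcls_eq_iff[OF hb] wick_scale[OF hb] Psi_linear[OF hb])
  then show "u \<in> gcls hb (fscale a f)" using x unfolding gcls_def by blast
next
  fix u assume "u \<in> gcls hb (fscale a f)"
  then obtain k where k: "u = fscale a f + k" "k \<in> gelfand hb" unfolding gcls_def by blast
  have "f \<in> gcls hb f" using mem_gcls[OF hb f] f by blast
  then show "u \<in> gns_scale hb a (gcls hb f)" using k unfolding gns_scale_def by blast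
qed

lemma bij_gns_to_fock:
  assumes hb: "hb > 0"
  shows "bij_betw gns_to_fock (gns_space hb :: 'n::finite cfun set set) (fock hb)"
  unfolding bij_betw_def
proof
  show "inj_on gns_to_fock (gns_space hb :: 'n cfun set set)"
    unfolding gns_space_def inj_on_def by (auto simp: gns_to_fock_gcls[OF hb] gcls_eq_iff[OF hb])
  show "gns_to_fock ` (gns_space hb :: 'n cfun set set) = fock hb"
    unfolding gns_space_def fock_def by (auto simp: gns_to_fock_gcls[OF hb] image_image)
qed

text \<open>The infimum is attained at \<open>Psi f\<close>: it lies in the coset, and its seminorms
  are bounded by those of each representative \<open>u\<close>, because
  \<open>Psi u = Psi f\<close>.\<close>

lemma gns_norm_eq:
  assumes hb: "hb > 0" and f: "f \<in> wick hb"
  shows "gns_norm hb m l R S (gcls hb f) = wick_norm 0 hb m l R S (Psi f)"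
proof (rule antisym)
  have "Psi f \<in> gcls hb f"
    using mem_gcls[OF hb f] Psi_wick[OF hb f] Psi_fock[OF hb Psi_in_fock[OF f]] by blast
  then show "gns_norm hb m l R S (gcls hb f) \<le> wick_norm 0 hb m l R S (Psi f)"
    unfolding gns_norm_def by (rule INF_lower)
  show "wick_norm 0 hb m l R S (Psi f) \<le> gns_norm hb m l R S (gcls hb f)"
    unfolding gns_norm_def
  proof (rule INF_greatest)
    fix u assume "u \<in> gcls hb f"
    then show "wick_norm 0 hb m l R S (Psi f) \<le> wick_norm 0 hb m l R S u"
      using wick_norm_Psi_le[OF hb, of u] mem_gcls[OF hb f] by metis
  qed
qed

lemma gns_norm_diff:
  assumes hb: "hb > 0" and f: "f \<in> wick hb" and g: "g \<in> wick hb"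
  shows "gns_norm hb m l R S (gns_diff (gcls hb f) (gcls hb g)) = wick_norm 0 hb m l R S (Psi f - Psi g)"
  by (simp add: gcls_diff[OF assms] gns_norm_eq[OF hb wick_diff[OF assms]] Psi_linear[OF assms])

lemma seminorms_gns:
  assumes hb: "hb > 0"
  shows "seminorms (gns_space hb :: 'n::finite cfun set set) gns_diff {gns_norm hb m l R S | m l R S. l < 2 ^ m}"
proof -
  interpret seminorms "fock hb :: 'n cfun set" "(-)" "sn hb" by (rule seminorms_fock[OF hb])
  show ?thesis
  proof
    have "gns_norm hb 0 0 0 0 \<in> {gns_norm hb m l R (S :: 'n mindex) | m l R S. l < 2 ^ m}"
      by (intro CollectI exI[of _ 0]) auto
    then show "{gns_norm hb m l R (S :: 'n mindex) | m l R S. l < 2 ^ m} \<noteq> {}" by blast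
  next
    fix q :: "'n cfun set \<Rightarrow> ennreal" and x :: "'n cfun set"
    assume "q \<in> {gns_norm hb m l R S | m l R S. l < 2 ^ m}" "x \<in> gns_space hb"
    then obtain m l R S f where "q = gns_norm hb m l R S" "l < 2 ^ m" "x = gcls hb f" "f \<in> wick hb"
      unfolding gns_space_def by blast
    then show "q (gns_diff x x) = 0"
      using self[of "wick_norm 0 hb m l R S" "Psi f"] Psi_in_fock[of f]
      by (auto simp: gns_norm_diff[OF hb] sn_def)
  next
  fix q :: "'n cfun set \<Rightarrow> ennreal" and x y z :: "'n cfun set"
    assume "q \<in> {gns_norm hb m l R S | m l R S. l < 2 ^ m}" "x \<in> gns_space hb" "y \<in> gns_space hb" "z \<in> gns_space hb"
    then obtain m l R S f g k where "q = gns_norm hb m l R S" "l < 2 ^ m"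
        "x = gcls hb f" "f \<in> wick hb" "y = gcls hb g" "g \<in> wick hb" "z = gcls hb k" "k \<in> wick hb"
      unfolding gns_space_def by blast
    then show "q (gns_diff z x) \<le> q (gns_diff z y) + q (gns_diff y x)"
      using triangle[of "wick_norm 0 hb m l R S" "Psi f" "Psi g" "Psi k"] Psi_in_fock
      by (auto simp: gns_norm_diff[OF hb] sn_def)
  qed
qed

text \<open>The inverse is \<open>gcls hb\<close>, and both maps preserve the seminorms of
  differences.\<close>

lemma homeomorphic_gns_to_fock:
  assumes hb: "hb > 0"
  shows "homeomorphic_map (gns_top hb) (fock_top hb) (gns_to_fock :: 'n::finite cfun set \<Rightarrow> 'n cfun)"
proof -
  let ?G = "gns_space hb :: 'n cfun set set" and ?Q = "{gns_norm hb m l R (S :: 'n mindex) | m l R S. l < 2 ^ m}"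
  interpret G: seminorms ?G gns_diff ?Q by (rule seminorms_gns[OF hb])
  interpret F: seminorms "fock hb :: 'n cfun set" "(-)" "sn hb" by (rule seminorms_fock[OF hb])
  have gf: "gns_to_fock x \<in> fock hb" if "x \<in> ?G" for x
    using bij_gns_to_fock[OF hb] that bij_betwE by blast
  have 1: "continuous_map (gns_top hb) (fock_top hb) (gns_to_fock :: 'n cfun set \<Rightarrow> 'n cfun)"
    unfolding gns_top_def fock_top_eq[OF hb]
  proof (rule continuous_map_seminorms[OF seminorms_gns[OF hb] seminorms_fock[OF hb] gf])
    fix q :: "'n cfun \<Rightarrow> ennreal" assume "q \<in> sn hb"
    then obtain m l R S where q: "q = wick_norm 0 hb m l R S" "l < 2 ^ m" unfolding sn_def by blast
    have "q (gns_to_fock y - gns_to_fock x) \<le> gns_norm hb m l R S (gns_diff y x)" if "x \<in> ?G" "y \<in> ?G" for x y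
      using that unfolding gns_space_def by (auto simp: gns_norm_diff[OF hb] gns_to_fock_gcls[OF hb] q)
    then show "\<exists>p\<in>?Q. \<forall>x\<in>?G. \<forall>y\<in>?G. q (gns_to_fock y - gns_to_fock x) \<le> p (gns_diff y x)"
      using q(2) by blast
  qed
  have 2: "continuous_map (fock_top hb) (gns_top hb) (gcls hb :: 'n cfun \<Rightarrow> 'n cfun set)"
    unfolding gns_top_def fock_top_eq[OF hb]
  proof (rule continuous_map_seminorms[OF seminorms_fock[OF hb] seminorms_gns[OF hb]])
    fix q assume "q \<in> ?Q"
    then obtain m l R S where q: "q = gns_norm hb m l R S" "l < 2 ^ m" by blast
    have "q (gns_diff (gcls hb y) (gcls hb x)) \<le> wick_norm 0 hb m l R S (y - x)" if "x \<in> fock hb" "y \<in> fock hb" for x y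
      using that by (simp add: gns_norm_diff[OF hb] Psi_fock[OF hb] fock_wick[OF hb] q)
    then show "\<exists>p\<in>sn hb. \<forall>x\<in>fock hb. \<forall>y\<in>fock hb. q (gns_diff (gcls hb y) (gcls hb x)) \<le> p (y - x)"
      using q(2) unfolding sn_def by blast
  qed (auto simp: gns_space_def fock_wick[OF hb])
  have "homeomorphic_maps (gns_top hb) (fock_top hb) (gns_to_fock :: 'n cfun set \<Rightarrow> 'n cfun) (gcls hb)"
    unfolding homeomorphic_maps_def
  proof (intro conjI ballI 1 2)
    fix x :: "'n cfun set" assume "x \<in> topspace (gns_top hb)"
    then have "x \<in> ?G" unfolding gns_top_def G.topspace .
    then obtain f where f: "f \<in> wick hb" "x = gcls hb f" unfolding gns_space_def by blast
    then show "gcls hb (gns_to_fock x) = x" by (simp add: gns_to_fock_gcls[OF hb] gcls_Psi[OF hb])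
  next
    fix y :: "'n cfun" assume "y \<in> topspace (fock_top hb)"
    then have "y \<in> fock hb" by (simp add: fock_top_eq[OF hb] F.topspace)
    then show "gns_to_fock (gcls hb y) = y"
      by (simp add: gns_to_fock_gcls[OF hb] Psi_fock[OF hb] fock_wick[OF hb])
  qed
  then show ?thesis using homeomorphic_map_maps by blast
qed


subsection \<open>The Bargmann-Fock representation\<close>

lemma fscale_1 [simp]: "fscale 1 f = f"
  by (simp add: fscale_def)

lemma star_add_right:
  "hb > 0 \<Longrightarrow> k \<in> wick hb \<Longrightarrow> f \<in> wick hb \<Longrightarrow> g \<in> wick hb \<Longrightarrow> star hb k (f + g) = star hb k f + star hb k g"
  using star_linear_right[of hb f g k 1 1] by simp

lemma star_add_left:
  "hb > 0 \<Longrightarrow> k \<in> wick hb \<Longrightarrow> f \<in> wick hb \<Longrightarrow> g \<in> wick hb \<Longrightarrow> star hb (f + g) k = star hb f k + star hb g k"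
  using star_linear_left[of hb f g k 1 1] by simp

text \<open>Independence of the representative: the class of a product depends on its right factor
  only through \<open>Psi\<close>.\<close>

lemma gns_rep_gcls:
  assumes hb: "hb > 0" and f: "f \<in> wick hb" and g: "g \<in> wick hb"
  shows "gns_rep hb f (gcls hb g) = gcls hb (star hb f g)"
proof -
  have "gcls hb (star hb f u) = gcls hb (star hb f g)" if u: "u \<in> gcls hb g" for u
  proof -
    have "u \<in> wick hb" "Psi u = Psi g" using u mem_gcls[OF hb g] by auto
    then show ?thesis
      using Psi_star_Psi[OF hb f] g by (metis gcls_eq_iff[OF hb] star_wick[OF hb f])
  qed
  moreover have "g \<in> gcls hb g" using mem_gcls[OF hb g] g by blast
  ultimately show ?thesis unfolding gns_rep_def by blast
qed

lemma bf_rep_eq: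
  assumes hb: "hb > 0" and f: "f \<in> wick hb" and \<phi>: "\<phi> \<in> fock hb"
  shows "bf_rep hb f \<phi> = Psi (star hb f \<phi>)"
proof -
  have w: "\<phi> \<in> wick hb" using \<phi> fock_subset[OF hb] by blast
  have "inv_into (gns_space hb) gns_to_fock (gns_to_fock (gcls hb \<phi>)) = gcls hb \<phi>"
    by (rule inv_into_f_f) (use bij_gns_to_fock[OF hb] w in \<open>auto simp: bij_betw_def gns_space_def\<close>)
  then have "inv_into (gns_space hb) gns_to_fock \<phi> = gcls hb \<phi>"
    by (simp add: gns_to_fock_gcls[OF hb w] Psi_fock[OF hb \<phi>])
  then show ?thesis
    by (simp add: bf_rep_def gns_rep_gcls[OF hb f w] gns_to_fock_gcls[OF hb star_wick[OF hb f w]])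
qed

lemma bf_rep_Psi:
  assumes hb: "hb > 0" and f: "f \<in> wick hb" and g: "g \<in> wick hb"
  shows "bf_rep hb f (Psi g) = Psi (star hb f g)"
  by (simp add: bf_rep_eq[OF hb f Psi_in_fock[OF g]] Psi_star_Psi[OF hb f g])

section \<open>Convergence of the series of the representation formula\<close>

lemma wick_norm_tendsto_0:
  assumes hb: "hb > 0" and "((\<lambda>x. wick_h 0 hb m l R S (u x)) \<longlongrightarrow> 0) F"
  shows "((\<lambda>x. wick_norm 0 hb m l R S (u x)) \<longlongrightarrow> 0) F"
proof (rule tendsto_zero_ennreal)
  fix r :: real assume r: "r > 0"
  \<comment> \<open>Half of \<open>r\<close> leaves room for the strict inequality.\<close>
  have "eventually (\<lambda>x. wick_h 0 hb m l R S (u x) < ennreal ((r / 2) ^ 2 ^ (m + 1))) F"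
    using r by (intro order_tendstoD(2)[OF assms(2)]) simp
  then show "eventually (\<lambda>x. wick_norm 0 hb m l R S (u x) < ennreal r) F"
  proof eventually_elim
    case (elim x)
    then have "wick_norm 0 hb m l R S (u x) \<le> ennreal (r / 2)"
      using r by (subst wick_norm_le_iff[OF hb]) auto
    also have "\<dots> < ennreal r" using r by (intro ennreal_lessI) auto
    finally show ?case .
  qed
qed

lemma pc_eq_self_iff: "pc c = c \<longleftrightarrow> (\<forall>K L. K \<noteq> 0 \<longrightarrow> c K L = 0)" for c :: "'n mindex \<Rightarrow> 'n mindex \<Rightarrow> complex"
proof
  assume p: "pc c = c"
  show "\<forall>K L. K \<noteq> 0 \<longrightarrow> c K L = 0"
  proof (intro allI impI)
    fix K L :: "'n mindex" assume "K \<noteq> 0"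
    then have "pc c K L = 0" unfolding pc_def by (rule if_not_P)
    then show "c K L = 0" unfolding p .
  qed
qed (intro ext, simp add: pc_def)

text \<open>The remainders of the partial sums have coefficients that are dominated by twice
  \<open>e\<close> and tend to zero entrywise, so dominated convergence holds in every
  seminorm.\<close>

lemma series_limit_fock:
  fixes d :: "'i::countable \<Rightarrow> 'n::finite mindex \<Rightarrow> 'n mindex \<Rightarrow> complex"
  assumes hb: "hb > 0" and e: "hfin (2 * hb) (cabs e)"
    and le: "\<And>K L. (\<Sum>\<^sub>\<infinity>i. ennreal (cmod (d i K L))) \<le> cabs e K L"
    and pc: "\<And>i. pc (d i) = d i"
  shows "series_limit (fock_top hb) (\<lambda>i. tay (d i)) (tay (\<lambda>K L. \<Sum>\<^sub>\<infinity>i. d i K L))"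
    (is "series_limit _ _ (tay ?s)")
proof -
  have ee: "ent2 e" by (rule hfin_ent2[OF _ e]) (use hb in simp)
  note ed = tay_infsum_ent2[OF ee le] and sd = tay_infsum_summable[OF ee le] and sle = tay_infsum_le[OF ee le]
  have hs: "hfin (2 * hb) (cabs ?s)" by (rule hfin_mono[OF e sle])
  note s = wick_tayI[OF hb hs]
  have "pc ?s = ?s"
    using pc unfolding pc_eq_self_iff by simp
  then have sf: "tay ?s \<in> fock hb" using s by (simp add: fock_iff[OF hb])
  have leA: "ennreal (cmod (\<Sum>i\<in>A. d i K L)) \<le> cabs e K L" if "finite A" for A K L
  proof -
    have "ennreal (cmod (\<Sum>i\<in>A. d i K L)) \<le> (\<Sum>i\<in>A. ennreal (cmod (d i K L)))"
      by (subst sum_ennreal) (auto intro: ennreal_leI norm_sum)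
    also have "\<dots> \<le> (\<Sum>\<^sub>\<infinity>i. ennreal (cmod (d i K L)))"
      using that by (intro sum_le_infsum_ennreal) auto
    finally show ?thesis using le[of K L] by (rule order_trans)
  qed
  define p where "p A = (\<lambda>K L. \<Sum>i\<in>A. d i K L)" for A
  have p: "tay (p A) \<in> wick hb" "coefs (tay (p A)) = p A" "tay (p A) = (\<lambda>z. \<Sum>i\<in>A. tay (d i) z)" if A: "finite A" for A
  proof -
    have "hfin (2 * hb) (cabs (p A))"
      by (rule hfin_mono[OF e]) (use leA[OF A] in \<open>auto simp: cabs_def p_def\<close>)
    from wick_tayI[OF hb this] show "tay (p A) \<in> wick hb" "coefs (tay (p A)) = p A" .
    show "tay (p A) = (\<lambda>z. \<Sum>i\<in>A. tay (d i) z)"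
      using tay_sum[OF A, of d] ed unfolding p_def by blast
  qed
  have pf: "tay (p A) \<in> fock hb" if "finite A" for A
  proof -
    have "pc (p A) = p A"
      using pc unfolding pc_eq_self_iff by (simp add: p_def)
    then show ?thesis using p[OF that] by (simp add: fock_iff[OF hb])
  qed
  interpret F: seminorms "fock hb :: 'n cfun set" "(-)" "sn hb" by (rule seminorms_fock[OF hb])
  have ev: "eventually finite (finite_subsets_at_top (UNIV :: 'i set))"
    by (rule eventually_finite_subsets_at_top_weakI)
  \<comment> \<open>Infinite index sets receive the value zero, which keeps all values in the space;
    along the filter the sets are eventually finite, so the default does not affect the
    limit.\<close>
  let ?u = "\<lambda>A. if finite A then tay (p A) else 0"
  have "limitin F.top ?u (tay ?s) (finite_subsets_at_top UNIV)"
  proof (rule F.limitin_topI[OF sf])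
    have "(0 :: 'n cfun) \<in> fock hb"
      by (simp add: fock_iff[OF hb] wick_0[OF hb] pc_eq_self_iff coefs_0[OF hb] del: zero_fun_apply)
    then show "?u A \<in> fock hb" for A using pf by simp
    fix q :: "'n cfun \<Rightarrow> ennreal" assume "q \<in> sn hb"
    then obtain m l R S where q: "q = wick_norm 0 hb m l R S" unfolding sn_def by blast
    let ?v = "\<lambda>A K L. if finite A then ennreal (cmod (p A K L - ?s K L)) else 0"
    have lim: "((\<lambda>A. hh (2 * hb) (wbits m l) (?v A) R S) \<longlongrightarrow> 0) (finite_subsets_at_top UNIV)"
    proof (rule hh_tendsto_0)
      show "hfin (2 * hb) (\<lambda>K L. 2 * cabs e K L)" by (rule hfin_cmult[OF e]) simp
      fix A K L
      have "ennreal (cmod (p A K L - ?s K L)) \<le> 2 * cabs e K L" if A: "finite A"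
      proof -
        have "ennreal (cmod (p A K L - ?s K L)) \<le> ennreal (cmod (p A K L)) + ennreal (cmod (?s K L))"
          by (simp add: norm_triangle_ineq4 flip: ennreal_plus)
        also have "\<dots> \<le> cabs e K L + cabs e K L"
          using leA[OF A, of K L] sle[of K L] by (intro add_mono) (auto simp: p_def cabs_def)
        finally show ?thesis by (simp add: mult_2)
      qed
      then show "?v A K L \<le> 2 * cabs e K L" by simp
    next
      fix K L
      have "((\<lambda>A. p A K L) \<longlongrightarrow> ?s K L) (finite_subsets_at_top UNIV)"
        using has_sum_infsum[OF sd[of K L]] unfolding has_sum_def p_def .
      then have "((\<lambda>A. p A K L - ?s K L) \<longlongrightarrow> ?s K L - ?s K L) (finite_subsets_at_top UNIV)"
        by (intro tendsto_diff tendsto_const)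
      then have "((\<lambda>A. ennreal (cmod (p A K L - ?s K L))) \<longlongrightarrow> ennreal (cmod (?s K L - ?s K L))) (finite_subsets_at_top UNIV)"
        by (intro tendsto_ennrealI tendsto_norm)
      then show "((\<lambda>A. ?v A K L) \<longlongrightarrow> 0) (finite_subsets_at_top UNIV)"
      proof (rule Lim_transform_eventually[THEN tendsto_eq_rhs])
        show "eventually (\<lambda>A. ennreal (cmod (p A K L - ?s K L)) = ?v A K L) (finite_subsets_at_top UNIV)"
          using ev by eventually_elim simp
      qed simp
    qed
    have h: "wick_h 0 hb m l R S (?u A - tay ?s) = hh (2 * hb) (wbits m l) (?v A) R S" if "finite A" for A
    proof -
      have "cabs (coefs (tay (p A) - tay ?s)) = ?v A"
        using that by (intro ext) (simp add: cabs_def coefs_diff[OF hb p(1)[OF that] s(1)] p(2)[OF that] s(2))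
      then show ?thesis using that by (simp add: wick_h_eq[OF hb])
    qed
    have "eventually (\<lambda>A. hh (2 * hb) (wbits m l) (?v A) R S = wick_h 0 hb m l R S (?u A - tay ?s)) (finite_subsets_at_top UNIV)"
      using ev by eventually_elim (rule h[symmetric])
    then have "((\<lambda>A. wick_h 0 hb m l R S (?u A - tay ?s)) \<longlongrightarrow> 0) (finite_subsets_at_top UNIV)"
      by (rule Lim_transform_eventually[OF lim])
    then show "((\<lambda>A. q (?u A - tay ?s)) \<longlongrightarrow> 0) (finite_subsets_at_top UNIV)"
      unfolding q by (rule wick_norm_tendsto_0[OF hb])
  qed
  then have "limitin F.top (\<lambda>A z. \<Sum>i\<in>A. tay (d i) z) (tay ?s) (finite_subsets_at_top UNIV)"
    by (rule limitin_transform_eventually[OF eventually_mono[OF ev], rotated]) (simp add: p(3))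
  then show ?thesis unfolding series_limit_def fock_top_eq[OF hb] .
qed

text \<open>Row \<open>I\<close> of \<open>c\<close> is moved to row zero. At the lowest level this
  is an index shift at the cost of the factor \<open>1 / t ^ msize I\<close>, and towers carry index
  shifts along.\<close>

lemma hfin_slice:
  fixes c :: "'n::finite mindex \<Rightarrow> 'n mindex \<Rightarrow> complex"
  assumes t: "t > 0" and c: "hfin t (cabs c)"
  shows "hfin t (cabs (\<lambda>K L. if K = 0 then c I L else 0))"
proof -
  let ?b = "\<lambda>K L. if K = 0 then c I L else 0"
  let ?C = "ennreal (1 / t ^ msize I)"
  have le: "h0 t (cabs ?b) R S \<le> ?C * h0 t (cabs c) (R + I) (S + 0)" for R S
  proof (cases "R = 0")
    case True
    have "h0 t (cabs ?b) R S = (\<Sum>\<^sub>\<infinity>N. ?C * (ennreal (t ^ (msize I + msize S + msize N) / real (mfact N)) * (cabs c I (N + S))\<^sup>2))"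
      unfolding h0_def True
    proof (rule infsum_cong)
      fix N :: "'n mindex"
      have "?C * ennreal (t ^ (msize I + msize S + msize N) / real (mfact N)) = ennreal (t ^ (msize S + msize N) / real (mfact N))"
        using t by (simp add: power_add flip: ennreal_mult)
      then show "ennreal (t ^ (msize (0 :: 'n mindex) + msize S + msize N) / real (mfact N)) * (cabs ?b 0 (N + S))\<^sup>2
         = ?C * (ennreal (t ^ (msize I + msize S + msize N) / real (mfact N)) * (cabs c I (N + S))\<^sup>2)"
        by (simp add: cabs_def mult.assoc[symmetric] del: zero_fun_apply plus_fun_apply)
    qed
    also have "\<dots> = ?C * h0 t (cabs c) I S" unfolding h0_def by (rule infsum_cmult_ennreal)
    finally show ?thesis using True by (simp del: zero_fun_apply plus_fun_apply)
  next
    case False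
    then have "h0 t (cabs ?b) R S = 0" by (simp add: h0_def cabs_def del: zero_fun_apply)
    then show ?thesis by simp
  qed
  show ?thesis
    unfolding hfin_def hh_def
  proof (intro allI)
    fix bs R S
    from tower_shift[of "h0 t (cabs ?b)" "\<lambda>R S. ?C * h0 t (cabs c) R S" I 0 bs, OF le]
    obtain K L where "tower bs (h0 t (cabs ?b)) R S \<le> tower bs (\<lambda>R S. ?C * h0 t (cabs c) R S) (R + K) (S + L)"
      by blast
    also have "\<dots> < \<infinity>"
      unfolding tower_cmult using c
      by (simp add: hfin_def hh_def ennreal_mult_less_top power_less_top_ennreal del: plus_fun_apply)
    finally show "tower bs (h0 t (cabs ?b)) R S < \<infinity>" .
  qed
qed

lemma tay_single:
  "tay (\<lambda>K L. if K = 0 \<and> L = J then a else 0) z = 1 / of_nat (mfact J) * a * conj_mpow z J"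
proof -
  have "tay (\<lambda>K L. if K = 0 \<and> L = J then a else 0) z = (\<Sum>\<^sub>\<infinity>(K, L)\<in>{(0, J)}.
      (if K = 0 \<and> L = J then a else 0) / (of_nat (mfact K) * of_nat (mfact L)) * mpow z K * conj_mpow z L)"
    unfolding tay_def by (rule infsum_cong_neutral) (auto split: if_splits)
  then show ?thesis by (simp del: zero_fun_apply)
qed

lemma infsum_delta:
  fixes g :: "'a \<Rightarrow> 'b::{comm_monoid_add,t2_space}"
  assumes "\<And>j. j \<noteq> l \<Longrightarrow> g j = 0"
  shows "(\<Sum>\<^sub>\<infinity>j. g j) = g l"
proof -
  have "(\<Sum>\<^sub>\<infinity>j. g j) = (\<Sum>\<^sub>\<infinity>j\<in>{l}. g j)"
    by (rule infsum_cong_neutral) (use assms in auto)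
  then show ?thesis by simp
qed

lemma
  fixes f :: "'n::finite cfun"
  assumes hb: "hb > 0" and f: "f \<in> wick hb"
  shows symbol_series: "series_limit (fock_top hb) (symbol_term f I) (symbol f I)"
    and symbol_tay: "symbol f I = tay (\<lambda>K L. if K = 0 then coefs f I L else 0)"
    and ent2_symbol: "ent2 (\<lambda>K L. if K = 0 then coefs f I L else 0)"
proof -
  let ?b = "\<lambda>K L. if K = 0 then coefs f I L else 0"
  let ?d = "\<lambda>J K L. if K = 0 \<and> L = J then coefs f I J else 0"
  have hb2: "hfin (2 * hb) (cabs ?b)" by (rule hfin_slice) (use hb wick_hfin[OF hb f] in auto)
  show e: "ent2 ?b" by (rule hfin_ent2[OF _ hb2]) (use hb in simp)
  have le: "(\<Sum>\<^sub>\<infinity>J. ennreal (cmod (?d J K L))) \<le> cabs ?b K L" for K L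
    by (subst infsum_delta[of L]) (auto simp: cabs_def simp del: zero_fun_apply)
  have s: "(\<lambda>K L. \<Sum>\<^sub>\<infinity>J. ?d J K L) = ?b"
  proof (intro ext)
    fix K L show "(\<Sum>\<^sub>\<infinity>J. ?d J K L) = ?b K L"
      by (subst infsum_delta[of L]) (auto simp del: zero_fun_apply)
  qed
  have st: "symbol_term f I J = tay (?d J)" for J
    by (intro ext) (simp only: tay_single symbol_term_def coefs_def)
  show sy: "symbol f I = tay ?b"
  proof
    fix z
    show "symbol f I z = tay ?b z"
      using tay_infsum[OF e le, of z] unfolding symbol_def st s by (rule infsumI)
  qed
  show "series_limit (fock_top hb) (symbol_term f I) (symbol f I)"
    using series_limit_fock[OF hb hb2 le] unfolding st[abs_def] sy s by (simp add: pc_eq_self_iff st[abs_def] del: zero_fun_apply)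
qed

text \<open>The \<open>I\<close>-th summand of the formula is the antiholomorphic part of the
  \<open>I\<close>-th summand of the star product with right factor \<open>Psi g\<close>: taking
  this part replaces the \<open>z\<close>-derivative of \<open>f\<close> by its symbol. The majorant
  of the star product therefore dominates this series too.\<close>

lemma
  fixes f g :: "'n::finite cfun"
  assumes hb: "hb > 0" and f: "f \<in> wick hb" and g: "g \<in> wick hb"
  shows bf_rep_series: "series_limit (fock_top hb) (bf_rep_term hb f (Psi g)) (bf_rep hb f (Psi g))"
    and bf_rep_pointwise: "bf_rep hb f (Psi g) z = (\<Sum>\<^sub>\<infinity>I. bf_rep_term hb f (Psi g) I z)"
proof -
  interpret star_coefs hb "coefs f" "pc (coefs g)"
    by unfold_locales (use hb wick_hfin[OF hb f] hfin_pc[OF wick_hfin[OF hb g]] in auto)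
  let ?c = "coefs f" and ?d = "pc (coefs g)"
  let ?D = "\<lambda>I. pc (dstar (2 * hb) ?c ?d I)"
  have at0: "{..(0 :: 'n mindex)} = {0}" by (auto simp: le_fun_def fun_eq_iff)
  have Dt: "bf_rep_term hb f (Psi g) I = tay (?D I)" for I
  proof
    fix z
    have ed: "ent2 (\<lambda>K L. ?d (K + 0) (L + I))" by (rule ent2_shift[OF ent2_d])
    have "symbol f I z * pderivs 0 I (Psi g) z
        = tay (conv2 (\<lambda>K L. if K = 0 then ?c I L else 0) (\<lambda>K L. ?d (K + 0) (L + I))) z"
      unfolding symbol_tay[OF hb f] Psi_eq[OF wick_ent2[OF hb g]] pderivs_tay[OF ent2_d]
      by (rule tay_mult(1)[OF ent2_symbol[OF hb f] ed])
    moreover have "?D I = (\<lambda>K L. complex_of_real ((2 * hb) ^ msize I / real (mfact I)) *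
         conv2 (\<lambda>K L. if K = 0 then ?c I L else 0) (\<lambda>K L. ?d (K + 0) (L + I)) K L)"
    proof (intro ext)
      fix K L
      show "?D I K L = complex_of_real ((2 * hb) ^ msize I / real (mfact I)) *
         conv2 (\<lambda>K L. if K = 0 then ?c I L else 0) (\<lambda>K L. ?d (K + 0) (L + I)) K L"
      proof (cases "K = 0")
        case True
        then show ?thesis
          by (simp add: pc_def[of "dstar _ _ _ _"] dstar_def conv2_def at0 add.commute[of I] del: zero_fun_apply plus_fun_apply)
      next
        case False
        \<comment> \<open>As \<open>K \<noteq> 0\<close>, the indices \<open>M\<close> and
          \<open>K - M\<close> are not both zero, and one of the two factors vanishes.\<close>
        have "(if M = 0 then ?c I J else 0) * ?d (K - M + 0) (L - J + I) = 0" for M J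
          using False by (auto simp: pc_def simp del: zero_fun_apply plus_fun_apply minus_apply)
        then have "conv2 (\<lambda>K L. if K = 0 then ?c I L else 0) (\<lambda>K L. ?d (K + 0) (L + I)) K L = 0"
          unfolding conv2_def mult.assoc by (intro sum.neutral ballI) simp
        then show ?thesis using False by (simp add: pc_def[of "dstar _ _ _ _"] del: zero_fun_apply)
      qed
    qed
    ultimately show "bf_rep_term hb f (Psi g) I z = tay (?D I) z"
      by (simp only: bf_rep_term_def tay_scale(1) mult.assoc)
  qed
  have le: "(\<Sum>\<^sub>\<infinity>I. ennreal (cmod (?D I K L))) \<le> cabs bnd K L" for K L
  proof -
    have "(\<Sum>\<^sub>\<infinity>I. ennreal (cmod (?D I K L))) \<le> (\<Sum>\<^sub>\<infinity>I. ennreal (cmod (dstar (2 * hb) ?c ?d I K L)))"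
      by (intro infsum_mono_ennreal ennreal_leI) (auto simp: pc_def simp del: zero_fun_apply)
    then show ?thesis using dstar_sum_le by (rule order_trans)
  qed
  have hbnd: "hfin (2 * hb) (cabs bnd)" unfolding cabs_bnd by (rule hfin_gst)
  have sum: "(\<lambda>K L. \<Sum>\<^sub>\<infinity>I. ?D I K L) = pc (cstar (2 * hb) ?c ?d)"
    by (intro ext) (simp add: pc_def[of "dstar _ _ _ _"] pc_def[of "cstar _ _ _"] cstar_def del: zero_fun_apply)
  have rep: "bf_rep hb f (Psi g) = tay (pc (cstar (2 * hb) ?c ?d))"
    unfolding bf_rep_Psi[OF hb f g] Psi_eq[OF wick_ent2[OF hb star_wick[OF hb f g]]] coefs_star[OF hb f g]
    by (rule arg_cong[OF pc_cstar])
  show "series_limit (fock_top hb) (bf_rep_term hb f (Psi g)) (bf_rep hb f (Psi g))"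
    using series_limit_fock[OF hb hbnd le pc_pc] unfolding rep sum Dt[symmetric] .
  show "bf_rep hb f (Psi g) z = (\<Sum>\<^sub>\<infinity>I. bf_rep_term hb f (Psi g) I z)"
    using tay_infsum[OF ent2_bnd le, of z] unfolding rep sum Dt[symmetric] by (rule infsumI[symmetric])
qed

section \<open>Continuity of the product and of the representation\<close>

lemma star_norm_bound:
  fixes q :: "'n::finite cfun \<Rightarrow> ennreal"
  assumes hb: "hb > 0" and q: "q \<in> sn hb"
  shows "\<exists>q1\<in>sn hb. \<exists>q2\<in>sn hb. \<exists>C\<ge>1. \<forall>f\<in>wick hb. \<forall>g\<in>wick hb. q (star hb f g) \<le> ennreal C * q1 f * q2 g"
proof -
  obtain m l R S where q: "q = wick_norm 0 hb m l R S" using q unfolding sn_def by blast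
  let ?bs = "wbits m l"
  \<comment> \<open>The two words with appended bits belong to seminorms again; \<open>l1\<close>
    and \<open>l2\<close> are the numbers that encode them.\<close>
  obtain l1 where l1: "l1 < 2 ^ (m + 2)" "?bs @ [True, True] = wbits (m + 2) l1"
    using wbits_surj[of "?bs @ [True, True]"] by auto
  obtain l2 where l2: "l2 < 2 ^ (m + 1)" "?bs @ [False] = wbits (m + 1) l2"
    using wbits_surj[of "?bs @ [False]"] by auto
  let ?q1 = "wick_norm 0 hb (m + 2) l1 R S" and ?q2 = "wick_norm 0 hb (m + 1) l2 R S"
  obtain K where K: "tower (?bs @ [True]) (\<lambda>_ _. exp_const TYPE('n)) R S = ennreal K" "K \<ge> 0"
    using tower_const_finite[OF exp_const_finite[where 'n = 'n], of "?bs @ [True]" R S]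
    by (cases "tower (?bs @ [True]) (\<lambda>_ _. exp_const TYPE('n)) R S") auto
  \<comment> \<open>Taken to be at least one, so that \<open>K \<le> C\<close> and
    \<open>C \<le> C ^ ?p\<close>.\<close>
  define C where "C = max 1 K"
  \<comment> \<open>The exponent at which all roots disappear: four times the exponent
    \<open>2 ^ (m + 1)\<close> of \<open>q\<close>, equal to that of \<open>?q1\<close>, and twice
    that of \<open>?q2\<close>.\<close>
  let ?p = "2 ^ (m + 3) :: nat"
  have "q (star hb f g) \<le> ennreal C * ?q1 f * ?q2 g" if f: "f \<in> wick hb" and g: "g \<in> wick hb" for f g
  proof (rule ennreal_power_le_imp_le[of _ ?p])
    interpret star_coefs hb "coefs f" "coefs g"
      by unfold_locales (use hb wick_hfin[OF hb f] wick_hfin[OF hb g] in auto)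
    have e4: "x ^ ?p = (x ^ 2 ^ (m + 1)) ^ 4" and e1: "x ^ ?p = x ^ 2 ^ (m + 2 + 1)" and e2: "x ^ ?p = (x ^ 2 ^ (m + 1 + 1))\<^sup>2" for x :: ennreal
    proof -
      have p: "(2::nat) ^ (m + 3) = 2 ^ (m + 1) * 4" "(2::nat) ^ (m + 3) = 2 ^ (m + 2 + 1)"
        "(2::nat) ^ (m + 3) = 2 ^ (m + 1 + 1) * 2"
        by (simp_all add: power_add)
      show "x ^ ?p = (x ^ 2 ^ (m + 1)) ^ 4" by (simp only: p(1) power_mult)
      show "x ^ ?p = x ^ 2 ^ (m + 2 + 1)" by (simp only: p(2))
      show "x ^ ?p = (x ^ 2 ^ (m + 1 + 1))\<^sup>2" by (simp only: p(3) power_mult)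
    qed
    have "q (star hb f g) ^ ?p = (wick_h 0 hb m l R S (star hb f g)) ^ 4"
      unfolding e4 q wick_norm_power[OF hb] ..
    also have "\<dots> \<le> (hh (2 * hb) ?bs (gstar (2 * hb) (cabs (coefs f)) (cabs (coefs g))) R S) ^ 4"
      unfolding wick_h_eq[OF hb] coefs_star[OF hb f g]
      by (intro power_mono hh_mono) (use cstar_le in \<open>simp_all add: cabs_bnd cstar_def[abs_def]\<close>)
    also have "\<dots> \<le> ennreal K * hh (2 * hb) (?bs @ [True, True]) (cabs (coefs f)) R S * (hh (2 * hb) (?bs @ [False]) (cabs (coefs g)) R S)\<^sup>2"
      using hh_gstar[of "2 * hb" ?bs "cabs (coefs f)" "cabs (coefs g)" R S] hb K(1) by simp
    also have "\<dots> = ennreal K * (?q1 f) ^ ?p * (?q2 g) ^ ?p"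
      unfolding l1 l2 e1[of "?q1 f"] e2[of "?q2 g"] wick_norm_power[OF hb] wick_h_eq[OF hb] ..
    also have "\<dots> \<le> ennreal C ^ ?p * (?q1 f) ^ ?p * (?q2 g) ^ ?p"
    proof (intro mult_right_mono)
      have "K \<le> C" by (simp add: C_def)
      also have "C \<le> C ^ ?p" by (rule self_le_power) (auto simp: C_def)
      finally show "ennreal K \<le> ennreal C ^ ?p"
        by (simp add: ennreal_power C_def del: power_Suc)
    qed auto
    also have "\<dots> = (ennreal C * ?q1 f * ?q2 g) ^ ?p" by (simp only: power_mult_distrib)
    finally show "q (star hb f g) ^ ?p \<le> (ennreal C * ?q1 f * ?q2 g) ^ ?p" .
  qed simp
  moreover have "?q1 \<in> sn hb" "?q2 \<in> sn hb"
    unfolding sn_def using l1(1) l2(1) by blast+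
  moreover have "C \<ge> 1" by (simp add: C_def)
  ultimately show ?thesis by blast
qed

lemma bf_rep_fock: "hb > 0 \<Longrightarrow> f \<in> wick hb \<Longrightarrow> \<phi> \<in> fock hb \<Longrightarrow> bf_rep hb f \<phi> \<in> fock hb"
  using bf_rep_eq[of hb f \<phi>] Psi_in_fock star_wick fock_wick by metis

lemma bf_rep_linear:
  fixes f \<phi> :: "'n::finite cfun"
  assumes hb: "hb > 0"
  shows "f \<in> wick hb \<Longrightarrow> clinear_on (fock hb) (bf_rep hb f)"
    and "\<phi> \<in> fock hb \<Longrightarrow> clinear_on (wick hb) (\<lambda>f. bf_rep hb f \<phi>)"
proof -
  have fa: "u + v \<in> fock hb" "fscale a u \<in> fock hb" if "u \<in> fock hb" "v \<in> fock hb" for u v :: "'n cfun" and a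
    using that fock_wick[OF hb that(1)] fock_wick[OF hb that(2)]
    by (metis Psi_fock[OF hb] Psi_in_fock Psi_linear(1)[OF hb] wick_add[OF hb],
        metis Psi_fock[OF hb] Psi_in_fock Psi_linear(2)[OF hb] wick_scale[OF hb])
  have 0: "fscale 0 u = 0" for u :: "'n cfun"
    by (simp add: fscale_def zero_fun_def)
  have sr: "star hb f (fscale a g) = fscale a (star hb f g)" "star hb (fscale a f) g = fscale a (star hb f g)"
    if "f \<in> wick hb" "g \<in> wick hb" for f g :: "'n cfun" and a
    using star_linear_right[OF hb that(2,2,1), of a 0] star_linear_left[OF hb that(1,1,2), of a 0] by (simp_all add: 0)
  show "clinear_on (fock hb) (bf_rep hb f)" if "f \<in> wick hb"
    unfolding clinear_on_def
    by (intro conjI ballI allI; simp add: bf_rep_eq[OF hb that] fa fock_wick[OF hb] star_add_right[OF hb that] sr[OF that]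
        Psi_linear[OF hb] Psi_linear(2)[OF hb _ wick_0[OF hb]] star_wick[OF hb that])
  show "clinear_on (wick hb) (\<lambda>f. bf_rep hb f \<phi>)" if "\<phi> \<in> fock hb"
    unfolding clinear_on_def
    by (intro conjI ballI allI; simp add: bf_rep_eq[OF hb _ that] wick_add[OF hb] wick_scale[OF hb] star_add_left[OF hb fock_wick[OF hb that]]
        sr fock_wick[OF hb that] Psi_linear[OF hb] Psi_linear(2)[OF hb _ wick_0[OF hb]] star_wick[OF hb])
qed

lemma sn_triangle:
  assumes hb: "hb > 0" and q: "q \<in> sn hb" and f: "f \<in> wick hb" and g: "g \<in> wick hb"
  shows "q (f + g) \<le> q f + q g"
  using q norm_triangle_ineq unfolding sn_def by (auto intro!: wick_norm_triangle hb simp: coefs_add[OF hb f g])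

text \<open>Joint continuity follows from the product bound by expanding
  \<open>f = (f - f0) + f0\<close> and \<open>\<phi> = (\<phi> - \<phi>0) + \<phi>0\<close>; the
  three products that contain a difference are small.\<close>

lemma bf_rep_continuous:
  assumes hb: "hb > 0"
  shows "continuous_map (prod_topology (wick_top hb) (fock_top hb)) (fock_top hb)
        (\<lambda>(f :: 'n::finite cfun, \<phi>). bf_rep hb f \<phi>)"
proof -
  interpret W: seminorms "wick hb :: 'n cfun set" "(-)" "sn hb" by (rule seminorms_wick[OF hb])
  interpret F: seminorms "fock hb :: 'n cfun set" "(-)" "sn hb" by (rule seminorms_fock[OF hb])
  have wt: "wick_top hb = W.top" unfolding wick_top_def sn_def ..
  have ft: "fock_top hb = F.top" by (rule fock_top_eq[OF hb])
  have key: "\<exists>U V. openin W.top U \<and> openin F.top V \<and> f0 \<in> U \<and> \<phi>0 \<in> V \<and>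
      (\<forall>f\<in>U. \<forall>\<phi>\<in>V. q (bf_rep hb f \<phi> - bf_rep hb f0 \<phi>0) < ennreal e)"
    if f0: "f0 \<in> wick hb" and p0: "\<phi>0 \<in> fock hb" and q: "q \<in> sn hb" and e: "e > 0" for f0 \<phi>0 q e
  proof -
    obtain q1 q2 C where q12: "q1 \<in> sn hb" "q2 \<in> sn hb" "C \<ge> 1"
      and le: "\<And>f g :: 'n cfun. f \<in> wick hb \<Longrightarrow> g \<in> wick hb \<Longrightarrow> q (star hb f g) \<le> ennreal C * q1 f * q2 g"
      using star_norm_bound[OF hb q] by metis
    have fin: "q f < top" if "q \<in> sn hb" "f \<in> wick hb" for q and f :: "'n cfun"
    proof -
      obtain m l R S where "q = wick_norm 0 hb m l R S" "l < 2 ^ m" using \<open>q \<in> sn hb\<close> unfolding sn_def by blast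
      then show ?thesis
        using all_wick_h_iff[OF hb, of f] wick_hfin[OF hb that(2)] by (simp add: )
    qed
    have p0w: "\<phi>0 \<in> wick hb" by (rule fock_wick[OF hb p0])
    obtain A where A: "q1 f0 = ennreal A" "A \<ge> 0"
      using fin[OF q12(1) f0] by (cases "q1 f0") auto
    obtain B where B: "q2 \<phi>0 = ennreal B" "B \<ge> 0"
      using fin[OF q12(2) p0w] by (cases "q2 \<phi>0") auto
    \<comment> \<open>The bound \<open>\<delta> \<le> 1\<close> absorbs the quadratic term, and the
      quotient keeps the total \<open>C * (1 + A + B) * \<delta>\<close> below
      \<open>e / 2\<close>.\<close>
    define \<delta> where "\<delta> = min 1 (e / (2 * (C * (1 + A + B))))"
    have CAB: "C * (1 + A + B) > 0" using A B q12(3) by (intro mult_pos_pos) auto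
    then have d: "\<delta> > 0" "\<delta> \<le> 1" "C * (1 + A + B) * \<delta> \<le> e / 2"
    proof -
      have "\<delta> \<le> e / (2 * (C * (1 + A + B)))" by (simp add: \<delta>_def)
      then have "C * (1 + A + B) * \<delta> \<le> C * (1 + A + B) * (e / (2 * (C * (1 + A + B))))"
        using CAB by (intro mult_left_mono) auto
      also have "\<dots> = e / 2" using CAB by (simp add: field_simps)
      finally show "C * (1 + A + B) * \<delta> \<le> e / 2" .
      show "\<delta> > 0" "\<delta> \<le> 1" using CAB e by (simp_all add: \<delta>_def)
    qed
    let ?U = "{f \<in> wick hb. q1 (f - f0) < ennreal \<delta>}" and ?V = "{\<phi> \<in> fock hb. q2 (\<phi> - \<phi>0) < ennreal \<delta>}"
    have "q (bf_rep hb f \<phi> - bf_rep hb f0 \<phi>0) < ennreal e" if U: "f \<in> ?U" and V: "\<phi> \<in> ?V" for f \<phi>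
    proof -
      have w: "f \<in> wick hb" "\<phi> \<in> wick hb" "\<phi> \<in> fock hb" using U V fock_wick[OF hb] by auto
      let ?f = "f - f0" and ?g = "\<phi> - \<phi>0"
      have wd: "?f \<in> wick hb" "?g \<in> wick hb" using w f0 p0w wick_diff[OF hb] by auto
      note sw = star_wick[OF hb]
      have "star hb f \<phi> = star hb (?f + f0) (?g + \<phi>0)" by simp
      also have "\<dots> = star hb ?f ?g + star hb f0 ?g + (star hb ?f \<phi>0 + star hb f0 \<phi>0)"
        using wd f0 p0w by (simp only: star_add_left[OF hb] star_add_right[OF hb] wick_add[OF hb])
      finally have eq: "star hb f \<phi> - star hb f0 \<phi>0 = star hb ?f ?g + (star hb f0 ?g + star hb ?f \<phi>0)"
        by (simp add: algebra_simps)
      have "q (bf_rep hb f \<phi> - bf_rep hb f0 \<phi>0) = q (Psi (star hb f \<phi> - star hb f0 \<phi>0))"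
        using w f0 p0 p0w by (simp add: bf_rep_eq[OF hb] Psi_linear(3)[OF hb] sw)
      also have "\<dots> \<le> q (star hb f \<phi> - star hb f0 \<phi>0)"
        using q w f0 p0w unfolding sn_def by (auto intro!: wick_norm_Psi_le hb wick_diff[OF hb] sw)
      also have "\<dots> \<le> q (star hb ?f ?g) + (q (star hb f0 ?g) + q (star hb ?f \<phi>0))"
        unfolding eq using wd f0 p0w
        by (intro order_trans[OF sn_triangle[OF hb q]] add_left_mono sn_triangle[OF hb q] wick_add[OF hb] sw) auto
      also have "\<dots> \<le> ennreal C * q1 ?f * q2 ?g + (ennreal C * q1 f0 * q2 ?g + ennreal C * q1 ?f * q2 \<phi>0)"
        using wd f0 p0w by (intro add_mono le) auto
      also have "\<dots> \<le> ennreal C * ennreal \<delta> * ennreal \<delta> + (ennreal C * ennreal A * ennreal \<delta> + ennreal C * ennreal \<delta> * ennreal B)"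
        using U V A B by (intro add_mono mult_mono) auto
      also have "\<dots> = ennreal (C * \<delta> * \<delta> + (C * A * \<delta> + C * \<delta> * B))"
        using A B d q12(3) by (simp flip: ennreal_mult ennreal_plus)
      also have "\<dots> \<le> ennreal (C * (1 + A + B) * \<delta>)"
      proof (rule ennreal_leI)
        have "C * \<delta> * \<delta> \<le> C * \<delta> * 1" using d q12(3) by (intro mult_left_mono) auto
        then show "C * \<delta> * \<delta> + (C * A * \<delta> + C * \<delta> * B) \<le> C * (1 + A + B) * \<delta>" by (simp add: algebra_simps)
      qed
      also have "\<dots> < ennreal e" using d(3) e by (intro ennreal_lessI) auto
      finally show ?thesis .
    qed
    moreover have "f0 \<in> ?U" "\<phi>0 \<in> ?V"
      using f0 p0 d W.self[OF q12(1) f0] F.self[OF q12(2) p0] by auto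
    ultimately show ?thesis
      using W.openin_ball[OF f0 q12(1) d(1)] F.openin_ball[OF p0 q12(2) d(1)] by blast
  qed
  have keyF: "\<exists>U V. openin W.top U \<and> openin F.top V \<and> f0 \<in> U \<and> \<phi>0 \<in> V \<and>
      (\<forall>f\<in>U. \<forall>\<phi>\<in>V. bf_rep hb f \<phi> \<in> F.sball (bf_rep hb f0 \<phi>0) G e)"
    if f0: "f0 \<in> wick hb" and p0: "\<phi>0 \<in> fock hb" and G: "finite G" "G \<subseteq> sn hb" and e: "e > 0" for f0 \<phi>0 G e
    using G
  proof (induction G rule: finite_induct)
    case empty
    show ?case
    proof -
      have "openin W.top (wick hb)" using openin_topspace[of W.top] unfolding W.topspace .
      moreover have "openin F.top (fock hb)" using openin_topspace[of F.top] unfolding F.topspace .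
      moreover have "bf_rep hb f \<phi> \<in> F.sball (bf_rep hb f0 \<phi>0) {} e" if "f \<in> wick hb" "\<phi> \<in> fock hb" for f \<phi>
        using that bf_rep_fock[OF hb] by (simp add: F.sball_def)
      ultimately show ?thesis using f0 p0 by blast
    qed
  next
    case (insert q G)
    have sub: "G \<subseteq> sn hb" "q \<in> sn hb" using insert.prems by blast+
    from insert.IH[OF sub(1)] obtain U V where 1: "openin W.top U" "openin F.top V" "f0 \<in> U" "\<phi>0 \<in> V"
      "\<forall>f\<in>U. \<forall>\<phi>\<in>V. bf_rep hb f \<phi> \<in> F.sball (bf_rep hb f0 \<phi>0) G e" by blast
    from key[OF f0 p0 sub(2) e] obtain U' V' where 2: "openin W.top U'" "openin F.top V'" "f0 \<in> U'" "\<phi>0 \<in> V'"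
      "\<forall>f\<in>U'. \<forall>\<phi>\<in>V'. q (bf_rep hb f \<phi> - bf_rep hb f0 \<phi>0) < ennreal e" by blast
    show ?case
      using 1 2 unfolding F.sball_def
      by (intro exI[of _ "U \<inter> U'"] exI[of _ "V \<inter> V'"] conjI openin_Int) blast+
  qed
  have c1: "(\<lambda>(f :: 'n cfun, \<phi>). bf_rep hb f \<phi>) \<in> wick hb \<times> fock hb \<rightarrow> fock hb"
      using bf_rep_fock[OF hb] by auto
  have c2: "openin (prod_topology W.top F.top) {x \<in> wick hb \<times> fock hb. (case x of (f, \<phi>) \<Rightarrow> bf_rep hb f \<phi>) \<in> T}"
    if T: "openin F.top T" for T
    unfolding openin_prod_topology_alt
  proof (intro allI impI)
      fix f0 \<phi>0 assume *: "(f0, \<phi>0) \<in> {x \<in> wick hb \<times> fock hb. (case x of (f, \<phi>) \<Rightarrow> bf_rep hb f \<phi>) \<in> T}"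
      then have fp: "f0 \<in> wick hb" "\<phi>0 \<in> fock hb" "bf_rep hb f0 \<phi>0 \<in> T" by auto
      then have "F.nbhd (bf_rep hb f0 \<phi>0) T" using T[unfolded F.openin_iff] by blast
      then obtain G e where G: "finite G" "G \<subseteq> sn hb" "e > 0" "F.sball (bf_rep hb f0 \<phi>0) G e \<subseteq> T" by (rule F.nbhdE)
      from keyF[OF fp(1,2) G(1-3)] obtain U V where 1: "openin W.top U" "openin F.top V" "f0 \<in> U" "\<phi>0 \<in> V"
        "\<forall>f\<in>U. \<forall>\<phi>\<in>V. bf_rep hb f \<phi> \<in> F.sball (bf_rep hb f0 \<phi>0) G e" by blast
      have UV: "U \<subseteq> wick hb" "V \<subseteq> fock hb"
        using openin_subset[OF 1(1)] openin_subset[OF 1(2)] unfolding W.topspace F.topspace by blast+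
      have "U \<times> V \<subseteq> {x \<in> wick hb \<times> fock hb. (case x of (f, \<phi>) \<Rightarrow> bf_rep hb f \<phi>) \<in> T}"
      proof
        fix x assume "x \<in> U \<times> V"
        then obtain f \<phi> where x: "x = (f, \<phi>)" "f \<in> U" "\<phi> \<in> V" by (rule SigmaE)
        have "bf_rep hb f \<phi> \<in> T" using 1(5)[rule_format, OF x(2,3)] G(4) by (rule rev_subsetD)
        moreover have "f \<in> wick hb" "\<phi> \<in> fock hb" using x UV by blast+
        ultimately show "x \<in> {x \<in> wick hb \<times> fock hb. (case x of (f, \<phi>) \<Rightarrow> bf_rep hb f \<phi>) \<in> T}"
          unfolding x mem_Collect_eq prod.case by (intro conjI SigmaI)
      qed
      then show "\<exists>U V. openin W.top U \<and> openin F.top V \<and> f0 \<in> U \<and> \<phi>0 \<in> V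
          \<and> U \<times> V \<subseteq> {x \<in> wick hb \<times> fock hb. (case x of (f, \<phi>) \<Rightarrow> bf_rep hb f \<phi>) \<in> T}"
        by (intro exI[of _ U] exI[of _ V] conjI 1)
  qed
  show ?thesis
    unfolding continuous_map_def topspace_prod_topology wt ft W.topspace F.topspace
    by (intro conjI allI impI c1 c2)
qed

subsection \<open>Taylor expansion of anti-holomorphic functions\<close>

definition upd :: "complex^'n \<Rightarrow> 'n \<Rightarrow> complex \<Rightarrow> complex^'n::finite" where
  "upd z i w = (\<chi> j. if j = i then w else z $ j)"

text \<open>Continuity is part of the notion: it supplies the bounds on compact sets from which the
  Cauchy estimates start.\<close>

definition sephol :: "'n::finite cfun \<Rightarrow> bool" where
  "sephol \<psi> \<longleftrightarrow> continuous_on UNIV \<psi> \<and> (\<forall>z i. (\<lambda>w. \<psi> (upd z i w)) holomorphic_on UNIV)"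

lemma upd_nth [simp]: "upd z i w $ j = (if j = i then w else z $ j)"
  by (simp add: upd_def)

lemma upd_same [simp]: "upd z i (z $ i) = z"
  by (simp add: vec_eq_iff)

lemma upd_upd [simp]: "upd (upd z i w) i w' = upd z i w'"
  by (simp add: vec_eq_iff)

lemma upd_swap: "i \<noteq> j \<Longrightarrow> upd (upd z i w) j w' = upd (upd z j w') i w"
  by (simp add: vec_eq_iff)

lemma add_axis: "z + axis i h = upd z i (z $ i + h)"
  by (simp add: vec_eq_iff axis_def)

lemma norm_axis_complex: "norm (axis i (w :: complex)) = cmod w"
  by (simp add: norm_eq_sqrt_inner inner_axis_axis)

lemma continuous_upd [continuous_intros]:
  "continuous_on S f \<Longrightarrow> continuous_on S g \<Longrightarrow> continuous_on S (\<lambda>x. upd (f x) i (g x))"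
  unfolding upd_def
proof (rule continuous_on_vec_lambda)
  fix j assume "continuous_on S f" "continuous_on S g"
  then show "continuous_on S (\<lambda>x. if j = i then g x else f x $ j)"
    by (cases "j = i") (auto intro!: continuous_intros)
qed

lemma sephol_continuous: "sephol \<psi> \<Longrightarrow> continuous_on S \<psi>"
  unfolding sephol_def by (blast intro: continuous_on_subset)

lemma sephol_holomorphic: "sephol \<psi> \<Longrightarrow> (\<lambda>w. \<psi> (upd z i w)) holomorphic_on S"
  unfolding sephol_def by (blast intro: holomorphic_on_subset)

lemma sephol_bounded:
  fixes \<psi> :: "'n::finite cfun"
  assumes "sephol \<psi>"
  shows "\<exists>M\<ge>0. \<forall>z. norm z \<le> r \<longrightarrow> cmod (\<psi> z) \<le> M"
proof -
  have "compact (\<psi> ` cball 0 r)"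
    by (intro compact_continuous_image sephol_continuous assms) auto
  then obtain M where "\<forall>y\<in>\<psi> ` cball 0 r. cmod y \<le> M"
    by (meson bounded_iff compact_imp_bounded)
  then show ?thesis
    by (intro exI[of _ "max 0 M"]) (auto simp: le_max_iff_disj)
qed

definition pd :: "'n::finite \<Rightarrow> 'n cfun \<Rightarrow> 'n cfun" where
  "pd i \<psi> z = deriv (\<lambda>w. \<psi> (upd z i w)) (z $ i)"

text \<open>Cauchy's inequality on circles of radius one bounds the second derivative in direction
  \<open>i\<close> by \<open>2 * M\<close>; Taylor's formula turns this into a rate of convergence
  of the difference quotients that is uniform on balls.\<close>

lemma pd_estimate:
  fixes \<psi> :: "'n::finite cfun"
  assumes s: "sephol \<psi>"
  shows "\<exists>B\<ge>0. \<forall>z h. norm z \<le> r \<longrightarrow> h \<noteq> 0 \<longrightarrow> cmod h \<le> 1 \<longrightarrow>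
     cmod ((\<psi> (z + axis i h) - \<psi> z) / h - pd i \<psi> z) \<le> B * cmod h"
proof -
  \<comment> \<open>The enlarged radius leaves room for a displacement of length one and a Cauchy
    circle of radius one around it.\<close>
  obtain M where M: "M \<ge> 0" "\<And>z. norm z \<le> r + 2 \<Longrightarrow> cmod (\<psi> z) \<le> M"
    using sephol_bounded[OF s, of "r + 2"] by blast
  have "cmod ((\<psi> (z + axis i h) - \<psi> z) / h - pd i \<psi> z) \<le> 2 * M * cmod h"
    if z: "norm z \<le> r" and h: "h \<noteq> 0" "cmod h \<le> 1" for z h
  proof -
    define f where "f w = \<psi> (z + axis i w)" for w
    have f_eq: "f = (\<lambda>w. \<psi> (upd z i w)) \<circ> (\<lambda>w. z $ i + w)"
      by (auto simp: f_def add_axis)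
    have hf: "f holomorphic_on UNIV"
      unfolding f_eq by (intro holomorphic_on_compose holomorphic_intros sephol_holomorphic s)
    have f0: "deriv f 0 = pd i \<psi> z"
      unfolding f_eq pd_def by (rule deriv_shift_0[symmetric])
    have bd: "cmod ((deriv ^^ Suc 1) f x) \<le> 2 * M" if x: "x \<in> cball 0 1" for x
    proof -
      have "cmod ((deriv ^^ 2) f x) \<le> fact 2 * M / 1 ^ 2"
      proof (rule Cauchy_inequality)
        show "f holomorphic_on ball x 1" by (rule holomorphic_on_subset[OF hf]) simp
        show "continuous_on (cball x 1) f"
          by (rule continuous_on_subset[OF holomorphic_on_imp_continuous_on[OF hf]]) simp
        fix y assume "cmod (x - y) = 1"
        then have "cmod y \<le> 2" using x norm_triangle_ineq2[of y x] by (simp add: norm_minus_commute)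
        then have "norm (z + axis i y) \<le> r + 2"
          using z norm_triangle_ineq[of z "axis i y"] by (simp add: norm_axis_complex)
        then show "cmod (f y) \<le> M" unfolding f_def by (rule M)
      qed simp
      then show ?thesis by (simp add: numeral_2_eq_2)
    qed
    have "cmod ((deriv ^^ 0) f h - (\<Sum>k\<le>1. (deriv ^^ k) f 0 * (h - 0) ^ k / fact k)) \<le> 2 * M * cmod (h - 0) ^ Suc 1 / fact 1"
    proof (rule complex_Taylor[where S = "cball 0 1"])
      fix k x assume "x \<in> cball (0::complex) 1"
      have "(deriv ^^ k) f holomorphic_on UNIV" using hf by (intro holomorphic_higher_deriv) auto
      then have "((deriv ^^ k) f has_field_derivative deriv ((deriv ^^ k) f) x) (at x)"
        by (intro holomorphic_derivI[of _ UNIV]) auto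
      then show "((deriv ^^ k) f has_field_derivative (deriv ^^ Suc k) f x) (at x within cball 0 1)"
        by (simp add: has_field_derivative_at_within)
    qed (use bd h in auto)
    then have "cmod (f h - f 0 - pd i \<psi> z * h) \<le> 2 * M * (cmod h * cmod h)"
      by (simp add: f0 diff_diff_eq)
    then have "cmod (f h - f 0 - pd i \<psi> z * h) / cmod h \<le> 2 * M * cmod h"
      using h by (simp add: divide_le_eq mult.assoc)
    also have "cmod (f h - f 0 - pd i \<psi> z * h) / cmod h = cmod ((f h - f 0) / h - pd i \<psi> z)"
      using h by (subst norm_divide[symmetric]) (simp add: diff_divide_distrib)
    also have "f 0 = \<psi> z" by (simp add: f_def axis_def vec_eq_iff zero_vec_def[symmetric])
    finally show ?thesis by (simp add: f_def)
  qed
  then show ?thesis using M(1) by (intro exI[of _ "2 * M"]) auto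
qed

lemma sephol_translate:
  assumes s: "sephol \<psi>"
  shows "sephol (\<lambda>z. \<psi> (z + axis i h))"
  unfolding sephol_def
proof (intro conjI allI)
  show "continuous_on UNIV (\<lambda>z. \<psi> (z + axis i h))"
    by (rule continuous_on_compose2[OF sephol_continuous[OF s, of UNIV]]) (auto intro!: continuous_intros)
  fix z j
  have "upd z j w + axis i h = upd (z + axis i h) j (w + (if j = i then h else 0))" for w
    by (auto simp: vec_eq_iff axis_def)
  then have "(\<lambda>w. \<psi> (upd z j w + axis i h)) = (\<lambda>w. \<psi> (upd (z + axis i h) j w)) \<circ> (\<lambda>w. w + (if j = i then h else 0))"
    by auto
  then show "(\<lambda>w. \<psi> (upd z j w + axis i h)) holomorphic_on UNIV"
    by (simp only:) (intro holomorphic_on_compose holomorphic_intros sephol_holomorphic s)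
qed

lemma sephol_lincomb:
  assumes "sephol \<psi>" "sephol \<phi>"
  shows "sephol (\<lambda>z. a * \<psi> z + b * \<phi> z)"
  using assms unfolding sephol_def by (auto intro!: continuous_intros holomorphic_intros)

text \<open>Difference quotients with steps \<open>1 / Suc n\<close> inherit both properties and
  converge uniformly on balls. The uniform limit is continuous, and holomorphic in each variable by
  Weierstrass' theorem.\<close>

lemma sephol_pd:
  fixes \<psi> :: "'n::finite cfun"
  assumes s: "sephol \<psi>"
  shows "sephol (pd i \<psi>)"
proof -
  define h where "h n = complex_of_real (1 / real (Suc n))" for n
  define Q where "Q n z = (\<psi> (z + axis i (h n)) - \<psi> z) / h n" for n z
  have h: "h n \<noteq> 0" "cmod (h n) \<le> 1" for n by (simp_all add: h_def norm_divide del: of_nat_Suc)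
  have h0: "(\<lambda>n. cmod (h n)) \<longlonglongrightarrow> 0"
    using LIMSEQ_inverse_real_of_nat by (simp add: h_def norm_divide inverse_eq_divide del: of_nat_Suc)
  have Qs: "sephol (Q n)" for n
    using sephol_lincomb[OF sephol_translate[OF s, of i "h n"] s, of "1 / h n" "- 1 / h n"]
    by (simp add: Q_def[abs_def] diff_divide_distrib)
  have ul: "uniform_limit (cball 0 r) Q (pd i \<psi>) sequentially" for r
  proof -
    obtain B where B: "B \<ge> 0" "\<And>z h. norm z \<le> r \<Longrightarrow> h \<noteq> 0 \<Longrightarrow> cmod h \<le> 1 \<Longrightarrow>
        cmod ((\<psi> (z + axis i h) - \<psi> z) / h - pd i \<psi> z) \<le> B * cmod h"
      using pd_estimate[OF s, of r i] by blast
    show ?thesis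
    proof (rule uniform_limitI)
      fix e :: real assume e: "e > 0"
      have "(\<lambda>n. B * cmod (h n)) \<longlonglongrightarrow> B * 0" by (intro tendsto_mult tendsto_const h0)
      then have "eventually (\<lambda>n. B * cmod (h n) < e) sequentially"
        using e by (intro order_tendstoD(2)) auto
      then show "eventually (\<lambda>n. \<forall>z\<in>cball 0 r. dist (Q n z) (pd i \<psi> z) < e) sequentially"
      proof eventually_elim
        case (elim n)
        show ?case
        proof
          fix z :: "complex^'n" assume "z \<in> cball 0 r"
          then show "dist (Q n z) (pd i \<psi> z) < e"
            using B(2)[of z "h n"] h[of n] elim by (simp add: Q_def dist_norm)
        qed
      qed
    qed
  qed
  show ?thesis
    unfolding sephol_def
  proof (intro conjI allI)
    have "continuous_on (cball 0 r) (pd i \<psi>)" for r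
      by (rule uniform_limit_theorem[OF _ ul]) (auto intro!: always_eventually sephol_continuous Qs)
    from continuous_on_subset[OF this ball_subset_cball]
    have "continuous_on (ball 0 r) (pd i \<psi>)" for r .
    then have "isCont (pd i \<psi>) z" for z
      using continuous_on_eq_continuous_at[of "ball 0 (norm z + 1)" "pd i \<psi>"] by auto
    then show "continuous_on UNIV (pd i \<psi>)" by (simp add: continuous_at_imp_continuous_on)
  next
    fix z j
    show "(\<lambda>w. pd i \<psi> (upd z j w)) holomorphic_on UNIV"
    proof (rule holomorphic_uniform_sequence)
      show "(\<lambda>w. Q n (upd z j w)) holomorphic_on UNIV" for n by (rule sephol_holomorphic[OF Qs])
      fix x :: complex
      have "compact ((\<lambda>w. upd z j w) ` cball x 1)"
        by (intro compact_continuous_image continuous_intros) auto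
      then have "bounded ((\<lambda>w. upd z j w) ` cball x 1)" by (rule compact_imp_bounded)
      then obtain r where "\<forall>y\<in>(\<lambda>w. upd z j w) ` cball x 1. norm y \<le> r"
        unfolding bounded_iff by (elim exE)
      then have "(\<lambda>w. upd z j w) ` cball x 1 \<subseteq> cball 0 r" by auto
      then have "uniform_limit ((\<lambda>w. upd z j w) ` cball x 1) Q (pd i \<psi>) sequentially"
        by (rule uniform_limit_on_subset[OF ul])
      then have "uniform_limit (cball x 1) (\<lambda>n w. Q n (upd z j w)) (\<lambda>w. pd i \<psi> (upd z j w)) sequentially"
        unfolding uniform_limit_iff by simp
      then show "\<exists>d>0. cball x d \<subseteq> UNIV \<and> uniform_limit (cball x d) (\<lambda>n w. Q n (upd z j w)) (\<lambda>w. pd i \<psi> (upd z j w)) sequentially"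
        by (intro exI[of _ 1]) auto
    qed auto
  qed
qed

lemma sephol_pd_pow: "sephol \<psi> \<Longrightarrow> sephol ((pd i ^^ k) \<psi>)"
  by (induction k) (auto intro: sephol_pd)

lemma deriv_pow_pd: "(deriv ^^ k) (\<lambda>w. \<psi> (upd z i w)) = (\<lambda>w. (pd i ^^ k) \<psi> (upd z i w))"
proof (induction k)
  case (Suc k)
  show ?case
    using Suc by (auto simp: pd_def)
qed simp

lemma sephol_upd:
  assumes s: "sephol \<psi>"
  shows "sephol (\<lambda>z. \<psi> (upd z i a))"
  unfolding sephol_def
proof (intro conjI allI)
  show "continuous_on UNIV (\<lambda>z. \<psi> (upd z i a))"
    by (rule continuous_on_compose2[OF sephol_continuous[OF s, of UNIV]]) (auto intro!: continuous_intros)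
  fix z j
  show "(\<lambda>w. \<psi> (upd (upd z j w) i a)) holomorphic_on UNIV"
  proof (cases "i = j")
    case False
    then show ?thesis
      using sephol_holomorphic[OF s, of "upd z i a" j UNIV] by (simp add: upd_swap[of j i])
  qed simp
qed

text \<open>A polydisc rather than a ball: one coordinate may be moved freely within radius
  \<open>r\<close>, as Cauchy's inequality in a single variable requires.\<close>

definition polydisc :: "real \<Rightarrow> (complex^'n::finite) set" where
  "polydisc r = {z. \<forall>j. cmod (z $ j) \<le> r}"

definition msupp :: "'n mindex \<Rightarrow> 'n set" where
  "msupp N = {i. N i \<noteq> 0}"

lemma msupp_bij:
  assumes "i \<notin> A"
  shows "bij_betw (\<lambda>(k, N). N(i := k)) (UNIV \<times> {N. msupp N \<subseteq> A}) {N. msupp N \<subseteq> insert i A}"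
  by (rule bij_betwI[where g = "\<lambda>N. (N i, N(i := 0))"])
     (use assms in \<open>auto simp: msupp_def fun_eq_iff split: if_splits\<close>)

text \<open>One coordinate is expanded at a time; the bound makes the resulting iterated series summable.\<close>

lemma sephol_expand:
  fixes \<psi> :: "'n::finite cfun"
  assumes "finite A" "sephol \<psi>"
  shows "\<exists>a. (\<forall>z. ((\<lambda>N. a N z * mpow z N) has_sum \<psi> z) {N. msupp N \<subseteq> A})
     \<and> (\<forall>N z w. (\<forall>j. j \<notin> A \<longrightarrow> z $ j = w $ j) \<longrightarrow> a N z = a N w)
     \<and> (\<forall>r M N z. r > 0 \<longrightarrow> (\<forall>w\<in>polydisc r. cmod (\<psi> w) \<le> M) \<longrightarrow> z \<in> polydisc r \<longrightarrow> cmod (a N z) \<le> M / r ^ msize N)"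
  using assms
proof (induction A arbitrary: \<psi> rule: finite_induct)
  case empty
  have "{N. msupp N \<subseteq> {}} = {0 :: 'n mindex}" by (auto simp: msupp_def fun_eq_iff)
  moreover have "cmod (if N = 0 then \<psi> z else 0) \<le> M / r ^ msize N"
    if "r > 0" "\<forall>w\<in>polydisc r. cmod (\<psi> w) \<le> M" "z \<in> polydisc r" for N :: "'n mindex" and z r M
  proof -
    have "cmod (\<psi> z) \<le> M" using that by blast
    then show ?thesis using that(1) order_trans[OF norm_ge_zero \<open>cmod (\<psi> z) \<le> M\<close>] by (auto simp del: zero_fun_apply)
  qed
  ultimately show ?case
    by (intro exI[of _ "\<lambda>N z. if N = 0 then \<psi> z else 0"])
       (auto intro!: has_sum_finiteI arg_cong[of _ _ \<psi>] simp: vec_eq_iff simp del: zero_fun_apply)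
next
  case (insert i A)
  \<comment> \<open>The \<open>k\<close>-th Taylor coefficient in coordinate \<open>i\<close>, as a
    function of the other coordinates. The summand \<open>0 * \<psi> z\<close> only gives it the
    form of a linear combination of two functions.\<close>
  define \<psi>k where "\<psi>k k z = 1 / fact k * (pd i ^^ k) \<psi> (upd z i 0) + 0 * \<psi> z" for k z
  have sk: "sephol (\<psi>k k)" for k
    unfolding \<psi>k_def[abs_def] by (intro sephol_lincomb sephol_upd sephol_pd_pow insert.prems)
  have ku: "\<psi>k k (upd z i w) = \<psi>k k z" for k z w by (simp add: \<psi>k_def)
  have bk: "cmod (\<psi>k k w) \<le> M / r ^ k" if r: "r > 0" and M: "\<forall>w\<in>polydisc r. cmod (\<psi> w) \<le> M" and w: "w \<in> polydisc r" for r M w k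
  proof -
    let ?f = "\<lambda>x. \<psi> (upd w i x)"
    have "cmod ((deriv ^^ k) ?f 0) \<le> fact k * M / r ^ k"
    proof (rule Cauchy_inequality)
      show "?f holomorphic_on ball 0 r" by (rule sephol_holomorphic[OF insert.prems])
      show "continuous_on (cball 0 r) ?f"
        by (intro holomorphic_on_imp_continuous_on sephol_holomorphic insert.prems)
      show "cmod (?f x) \<le> M" if "cmod (0 - x) = r" for x
        using that w by (intro M[rule_format]) (auto simp: polydisc_def)
    qed (rule r)
    then show ?thesis
      by (simp add: \<psi>k_def deriv_pow_pd norm_divide divide_le_eq field_simps)
  qed
  have "\<forall>k. \<exists>a. (\<forall>z. ((\<lambda>N. a N z * mpow z N) has_sum \<psi>k k z) {N. msupp N \<subseteq> A})
     \<and> (\<forall>N z w. (\<forall>j. j \<notin> A \<longrightarrow> z $ j = w $ j) \<longrightarrow> a N z = a N w)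
     \<and> (\<forall>r M N z. r > 0 \<longrightarrow> (\<forall>w\<in>polydisc r. cmod (\<psi>k k w) \<le> M) \<longrightarrow> z \<in> polydisc r \<longrightarrow> cmod (a N z) \<le> M / r ^ msize N)"
    using insert.IH[OF sk] by blast
  from choice[OF this] obtain a where A: "\<forall>k. (\<forall>z. ((\<lambda>N. a k N z * mpow z N) has_sum \<psi>k k z) {N. msupp N \<subseteq> A})
     \<and> (\<forall>N z w. (\<forall>j. j \<notin> A \<longrightarrow> z $ j = w $ j) \<longrightarrow> a k N z = a k N w)
     \<and> (\<forall>r M N z. r > 0 \<longrightarrow> (\<forall>w\<in>polydisc r. cmod (\<psi>k k w) \<le> M) \<longrightarrow> z \<in> polydisc r \<longrightarrow> cmod (a k N z) \<le> M / r ^ msize N)" ..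
  note A1 = A[THEN spec, THEN conjunct1, THEN spec]
  note A2 = A[THEN spec, THEN conjunct2, THEN conjunct1, THEN spec, THEN spec, THEN spec, THEN mp]
  note A3 = A[THEN spec, THEN conjunct2, THEN conjunct2, THEN spec, THEN spec, THEN spec, THEN spec, THEN mp, THEN mp, THEN mp]
  \<comment> \<open>For a combined index the exponent of \<open>i\<close> selects the Taylor
    coefficient, and the remaining exponents select a coefficient of its expansion.\<close>
  define b where "b N z = a (N i) (N(i := 0)) (upd z i 0)" for N z
  have ms: "msize N = N i + msize (N(i := 0))" for N :: "'n mindex"
    unfolding msize_def by (subst (1 2) sum.remove[of UNIV i]) (auto intro!: sum.cong)
  have bound: "cmod (b N z) \<le> M / r ^ msize N"
    if r: "r > 0" and M: "\<forall>w\<in>polydisc r. cmod (\<psi> w) \<le> M" and z: "z \<in> polydisc r" for r M N z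
  proof -
    have "\<forall>w\<in>polydisc r. cmod (\<psi>k (N i) w) \<le> M / r ^ N i" using bk[OF r M] by blast
    moreover have "upd z i 0 \<in> polydisc r" using z r by (auto simp: polydisc_def)
    ultimately have "cmod (b N z) \<le> M / r ^ N i / r ^ msize (N(i := 0))"
      unfolding b_def by (rule A3[OF r])
    then show ?thesis unfolding ms[of N] by (simp add: power_add)
  qed
  have indep: "b N z = b N w" if "\<forall>j. j \<notin> insert i A \<longrightarrow> z $ j = w $ j" for N z w
    unfolding b_def by (rule A2) (use that in auto)
  have hs: "((\<lambda>N. b N z * mpow z N) has_sum \<psi> z) {N. msupp N \<subseteq> insert i A}" for z
  proof -
    \<comment> \<open>Each coordinate of \<open>z\<close> has modulus at most \<open>r / 2\<close>,
      so the terms at \<open>z\<close> decay like \<open>(1 / 2) ^ msize N\<close>.\<close>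
    define r where "r = 2 * (norm z + 1)"
    have r: "r > 0" by (simp add: r_def add_nonneg_pos)
    have zr: "cmod (z $ j) \<le> r / 2" for j
      using Finite_Cartesian_Product.norm_nth_le[of z j] by (simp add: r_def)
    have zp: "z \<in> polydisc r"
      unfolding polydisc_def
    proof (intro CollectI allI)
      show "cmod (z $ j) \<le> r" for j using zr[of j] r by linarith
    qed
    have "polydisc r \<subseteq> cball (0 :: complex^'n) (real CARD('n) * r)"
    proof
      fix w :: "complex^'n" assume w: "w \<in> polydisc r"
      have "norm w \<le> (\<Sum>j\<in>UNIV. cmod (w $ j))"
        unfolding norm_vec_def by (rule L2_set_le_sum) simp
      also have "\<dots> \<le> (\<Sum>j\<in>(UNIV :: 'n set). r)" using w by (intro sum_mono) (auto simp: polydisc_def)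
      finally show "w \<in> cball 0 (real CARD('n) * r)" by simp
    qed
    then obtain M where M: "M \<ge> 0" "\<forall>w\<in>polydisc r. cmod (\<psi> w) \<le> M"
      using sephol_bounded[OF insert.prems, of "real CARD('n) * r"] by (auto simp: subset_iff)
    have term_le: "cmod (b N z * mpow z N) \<le> M * (1 / 2) ^ msize N" for N
    proof -
      have "cmod (mpow z N) \<le> (\<Prod>j\<in>UNIV. (r / 2) ^ N j)"
        unfolding mpow_def prod_norm[symmetric] norm_power
        by (intro prod_mono conjI power_mono zr) auto
      also have "\<dots> = (r / 2) ^ msize N" by (simp add: power_msize)
      finally have "cmod (b N z) * cmod (mpow z N) \<le> M / r ^ msize N * (r / 2) ^ msize N"
        using M r by (intro mult_mono bound zp) auto
      also have "\<dots> = M * (1 / 2) ^ msize N" using r by (simp add: power_divide)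
      finally show ?thesis by (simp add: norm_mult)
    qed
    have "(\<lambda>N. M * (1 / 2) ^ msize N) summable_on (UNIV :: 'n mindex set)"
      by (intro summable_on_cmult_right summable_on_geometric_mindex) auto
    then have "(\<lambda>N. cmod (b N z * mpow z N)) summable_on UNIV"
      by (rule Infinite_Sum.abs_summable_on_comparison_test'[OF _ term_le])
    then have sm: "(\<lambda>N. b N z * mpow z N) summable_on {N. msupp N \<subseteq> insert i A}"
      by (rule summable_on_subset_banach[OF abs_summable_summable]) simp
    have "((\<lambda>(k, N). b (N(i := k)) z * mpow z (N(i := k))) has_sum infsum (\<lambda>N. b N z * mpow z N) {N. msupp N \<subseteq> insert i A})
        (UNIV \<times> {N. msupp N \<subseteq> A})"
      using has_sum_reindex_bij_betw[OF msupp_bij[OF insert.hyps(2)], of "\<lambda>N. b N z * mpow z N"] has_sum_infsum[OF sm]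
      by (simp add: case_prod_unfold)
    then have S: "((\<lambda>k. \<psi>k k z * z $ i ^ k) has_sum infsum (\<lambda>N. b N z * mpow z N) {N. msupp N \<subseteq> insert i A}) UNIV"
    proof (rule has_sum_SigmaD)
      fix k
      have "((\<lambda>N. a k N (upd z i 0) * mpow (upd z i 0) N * z $ i ^ k) has_sum \<psi>k k (upd z i 0) * z $ i ^ k) {N. msupp N \<subseteq> A}"
        by (rule has_sum_cmult_left[OF A1])
      moreover have "b (N(i := k)) z * mpow z (N(i := k)) = a k N (upd z i 0) * mpow (upd z i 0) N * z $ i ^ k"
        if "N \<in> {N. msupp N \<subseteq> A}" for N
      proof -
        have Ni: "N i = 0" using that insert.hyps(2) by (auto simp: msupp_def)
        then have "N(i := 0) = N" by auto
        moreover have "mpow z (N(i := k)) = mpow (upd z i 0) N * z $ i ^ k"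
          unfolding mpow_def by (subst (1 2) prod.remove[of UNIV i]) (auto simp: Ni mult.commute intro!: prod.cong)
        ultimately show ?thesis by (simp add: b_def)
      qed
      ultimately show "((\<lambda>N. case (k, N) of (k, N) \<Rightarrow> b (N(i := k)) z * mpow z (N(i := k))) has_sum \<psi>k k z * z $ i ^ k) {N. msupp N \<subseteq> A}"
        unfolding ku prod.case by (subst has_sum_cong)
    qed
    \<comment> \<open>The one-variable power series in coordinate \<open>i\<close> identifies the
      value of the rearranged sum as \<open>\<psi> z\<close>.\<close>
    have "(\<lambda>n. (deriv ^^ n) (\<lambda>x. \<psi> (upd z i x)) 0 / fact n * (z $ i - 0) ^ n) sums \<psi> (upd z i (z $ i))"
      by (rule holomorphic_power_series[where r = "norm z + 1"])
         (use Finite_Cartesian_Product.norm_nth_le[of z i] in \<open>auto intro!: sephol_holomorphic insert.prems simp: less_le_trans add_pos_nonneg\<close>)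
    then have "(\<lambda>k. \<psi>k k z * z $ i ^ k) sums \<psi> z"
      by (simp add: deriv_pow_pd \<psi>k_def)
    with has_sum_imp_sums[OF S] have "infsum (\<lambda>N. b N z * mpow z N) {N. msupp N \<subseteq> insert i A} = \<psi> z"
      by (rule sums_unique2)
    then show ?thesis using has_sum_infsum[OF sm] by simp
  qed
  show ?case
  proof (intro exI[of _ b] conjI allI impI)
    show "((\<lambda>N. b N z * mpow z N) has_sum \<psi> z) {N. msupp N \<subseteq> insert i A}" for z by (rule hs)
    show "b N z = b N w" if "\<forall>j. j \<notin> insert i A \<longrightarrow> z $ j = w $ j" for N z w by (rule indep[OF that])
    show "cmod (b N z) \<le> M / r ^ msize N"
      if "r > 0" "\<forall>w\<in>polydisc r. cmod (\<psi> w) \<le> M" "z \<in> polydisc r" for r M N z by (rule bound[OF that])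
  qed
qed

definition cnjv :: "complex^'n \<Rightarrow> complex^'n::finite" where
  "cnjv z = (\<chi> i. cnj (z $ i))"

text \<open>Conjugation of the argument turns the condition \<open>dz i \<phi> = 0\<close> into the
  Cauchy-Riemann equation in each variable.\<close>

lemma antiholomorphic_sephol:
  fixes \<phi> :: "'n::finite cfun"
  assumes a: "antiholomorphic \<phi>"
  shows "sephol (\<lambda>z. \<phi> (cnjv z))"
  unfolding sephol_def
proof (intro conjI allI)
  have "continuous_on UNIV \<phi>"
    using a by (intro continuous_at_imp_continuous_on ballI differentiable_imp_continuous_within) (auto simp: antiholomorphic_def)
  moreover have "continuous_on UNIV (cnjv :: complex^'n \<Rightarrow> complex^'n)"
    unfolding cnjv_def by (intro continuous_intros)
  ultimately show "continuous_on UNIV (\<lambda>z. \<phi> (cnjv z))"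
    by (rule continuous_on_compose2) simp
next
  fix z :: "complex^'n" and i
  show "(\<lambda>w. \<phi> (cnjv (upd z i w))) holomorphic_on UNIV"
    unfolding holomorphic_on_def field_differentiable_def
  proof (intro ballI)
    fix w :: complex
    let ?p = "cnjv (upd z i w)"
    define D where "D = frechet_derivative \<phi> (at ?p)"
    have D: "(\<phi> has_derivative D) (at ?p)"
      unfolding D_def using a frechet_derivative_works by (auto simp: antiholomorphic_def)
    then have lin: "linear D" by (rule has_derivative_linear)
    have "dz i \<phi> ?p = 0" using a by (simp add: antiholomorphic_def)
    then have e: "D (axis i 1) = \<i> * D (axis i \<i>)" by (simp add: dz_def D_def)
    \<comment> \<open>On the axis \<open>i\<close> the derivative is conjugate-linear, so it is
      complex-linear in \<open>h\<close> after conjugation.\<close>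
    have Dax: "D (axis i (cnj h)) = D (axis i 1) * h" for h
    proof -
      have "axis i (cnj h) = Re h *\<^sub>R axis i 1 + (- Im h) *\<^sub>R axis i \<i>"
        by (auto simp: vec_eq_iff axis_def complex_eq_iff)
      then have "D (axis i (cnj h)) = Re h *\<^sub>R D (axis i 1) + (- Im h) *\<^sub>R D (axis i \<i>)"
        using lin by (simp only: linear_add linear_scale)
      also have "D (axis i \<i>) = - \<i> * D (axis i 1)" unfolding e by simp
      also have "Re h *\<^sub>R D (axis i 1) + (- Im h) *\<^sub>R (- \<i> * D (axis i 1)) = D (axis i 1) * h"
        by (simp add: complex_eq_iff)
      finally show ?thesis .
    qed
    have g: "((\<lambda>w. cnjv (upd z i w)) has_derivative (\<lambda>h. axis i (cnj h))) (at w)"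
    proof -
      have eq: "(\<lambda>w. cnjv (upd z i w)) = (\<lambda>w. cnjv (upd z i 0) + axis i (cnj w))"
        by (auto simp: cnjv_def vec_eq_iff axis_def)
      have "bounded_linear (\<lambda>h. axis i (cnj h) :: complex^'n)"
      proof (rule bounded_linear_intro[where K = 1])
        show "axis i (cnj (x + y)) = axis i (cnj x) + (axis i (cnj y) :: complex^'n)" for x y
          by (simp add: vec_eq_iff axis_def)
        show "axis i (cnj (r *\<^sub>R x)) = r *\<^sub>R (axis i (cnj x) :: complex^'n)" for r x
          by (simp add: vec_eq_iff axis_def)
      qed (simp add: norm_axis_complex)
      then show ?thesis
        unfolding eq by (intro has_derivative_eq_rhs[OF has_derivative_add[OF has_derivative_const bounded_linear_imp_has_derivative]]) auto
    qed
    have "((\<lambda>w. \<phi> (cnjv (upd z i w))) has_derivative (\<lambda>h. D (axis i (cnj h)))) (at w)"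
      by (rule has_derivative_compose[OF g D])
    then have "((\<lambda>w. \<phi> (cnjv (upd z i w))) has_field_derivative D (axis i 1)) (at w)"
      unfolding Dax has_field_derivative_def .
    then show "\<exists>f'. ((\<lambda>w. \<phi> (cnjv (upd z i w))) has_field_derivative f') (at w within UNIV)" by auto
  qed
qed

text \<open>Once all coordinates are expanded the coefficients no longer depend on \<open>z\<close>.
  Their Cauchy bounds hold on every polydisc and give an entire array supported on
  \<open>K = 0\<close>.\<close>

lemma antiholomorphic_tay_ex:
  fixes \<phi> :: "'n::finite cfun"
  assumes a: "antiholomorphic \<phi>"
  shows "\<exists>c. ent2 c \<and> pc c = c \<and> \<phi> = tay c"
proof -
  let ?\<psi> = "\<lambda>z. \<phi> (cnjv z)"
  have s: "sephol ?\<psi>" by (rule antiholomorphic_sephol[OF a])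
  from sephol_expand[OF finite[of UNIV] s] obtain a where
    A: "(\<forall>z. ((\<lambda>N. a N z * mpow z N) has_sum ?\<psi> z) {N. msupp N \<subseteq> UNIV})
     \<and> (\<forall>N z w. (\<forall>j. j \<notin> UNIV \<longrightarrow> z $ j = w $ j) \<longrightarrow> a N z = a N w)
     \<and> (\<forall>r M N z. r > 0 \<longrightarrow> (\<forall>w\<in>polydisc r. cmod (?\<psi> w) \<le> M) \<longrightarrow> z \<in> polydisc r \<longrightarrow> cmod (a N z) \<le> M / r ^ msize N)" ..
  note A1 = A[THEN conjunct1, THEN spec]
  note A2 = A[THEN conjunct2, THEN conjunct1, THEN spec, THEN spec, THEN spec, THEN mp]
  note A3 = A[THEN conjunct2, THEN conjunct2, THEN spec, THEN spec, THEN spec, THEN spec, THEN mp, THEN mp, THEN mp]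
  define b where "b N = a N 0" for N
  have ab: "a N z = b N" for N z unfolding b_def by (rule A2) simp
  have hs: "((\<lambda>N. b N * mpow z N) has_sum ?\<psi> z) UNIV" for z using A1[of z] by (simp add: ab)
  define c where "c K L = (if K = 0 then of_nat (mfact L) * b L else 0)" for K L :: "'n mindex"
  have pc: "pc c = c" by (simp add: pc_eq_self_iff c_def del: zero_fun_apply)
  have e: "ent2 c"
    unfolding ent2_iff
  proof (intro allI impI)
    fix r :: real assume r: "r \<ge> 0"
    \<comment> \<open>Here \<open>r \<le> \<rho> / 2\<close>, so the Cauchy bound beats
      \<open>r ^ msize N\<close> geometrically; the added one keeps \<open>\<rho>\<close>
      positive.\<close>
    define \<rho> where "\<rho> = 2 * (r + 1)"
    have "polydisc \<rho> \<subseteq> cball (0 :: complex^'n) (real CARD('n) * \<rho>)"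
    proof
      fix w :: "complex^'n" assume w: "w \<in> polydisc \<rho>"
      have "norm w \<le> (\<Sum>j\<in>UNIV. cmod (w $ j))"
        unfolding norm_vec_def by (rule L2_set_le_sum) simp
      also have "\<dots> \<le> (\<Sum>j\<in>(UNIV :: 'n set). \<rho>)" using w by (intro sum_mono) (auto simp: polydisc_def)
      finally show "w \<in> cball 0 (real CARD('n) * \<rho>)" by simp
    qed
    then obtain M where M: "M \<ge> 0" "\<forall>w\<in>polydisc \<rho>. cmod (?\<psi> w) \<le> M"
      using sephol_bounded[OF s, of "real CARD('n) * \<rho>"] by (auto simp: subset_iff)
    have bb: "cmod (b N) * r ^ msize N \<le> M * (1 / 2) ^ msize N" for N
    proof -
      have "cmod (b N) \<le> M / \<rho> ^ msize N"
        unfolding ab[symmetric, of N 0] using r M(2) by (intro A3) (auto simp: \<rho>_def polydisc_def)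
      then have "cmod (b N) * r ^ msize N \<le> M / \<rho> ^ msize N * (\<rho> / 2) ^ msize N"
        using r M by (intro mult_mono power_mono) (auto simp: \<rho>_def)
      also have "\<dots> = M * (1 / 2) ^ msize N" using r by (simp add: power_divide \<rho>_def)
      finally show ?thesis .
    qed
    have "(\<lambda>N. M * (1 / 2) ^ msize N) summable_on (UNIV :: 'n mindex set)"
      by (intro summable_on_cmult_right summable_on_geometric_mindex) auto
    then have "(\<lambda>N. cmod (b N) * r ^ msize N) summable_on UNIV"
      by (rule summable_on_comparison_test) (use bb r in auto)
    then have "(\<lambda>(K, L). cmod (c K L) * r ^ (msize K + msize L) / (real (mfact K) * real (mfact L))) summable_on (Pair 0 ` UNIV)"
      by (subst summable_on_reindex) (auto simp: inj_on_def comp_def c_def norm_mult)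
    then show "(\<lambda>(K, L). cmod (c K L) * r ^ (msize K + msize L) / (real (mfact K) * real (mfact L))) summable_on UNIV"
      by (rule summable_on_cong_neutral[THEN iffD1, rotated 3]) (auto simp: c_def image_iff)
  qed
  have "\<phi> z = tay c z" for z
  proof -
    have "((\<lambda>L. 1 / of_nat (mfact L) * c 0 L * conj_mpow z L) has_sum tay c z) UNIV"
      using tay_pc_has_sum[OF e, of z] unfolding pc .
    moreover have "mpow (cnjv z) L = conj_mpow z L" for L
      by (simp add: mpow_def conj_mpow_def cnjv_def)
    moreover have "cnjv (cnjv z) = z" by (simp add: cnjv_def vec_eq_iff)
    ultimately show ?thesis
      using hs[of "cnjv z"] has_sum_unique by (simp add: c_def)
  qed
  then show ?thesis using e pc by blast
qed

subsection \<open>Lebesgue measure on complex space\<close>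

lemma borel_Complex [measurable]: "(\<lambda>(x, y). Complex x y) \<in> borel_measurable (borel \<Otimes>\<^sub>M borel)"
proof -
  have "(\<lambda>p. Complex (fst p) (snd p)) = (\<lambda>p. of_real (fst p) + \<i> * of_real (snd p))"
    by (auto simp: complex_eq_iff)
  then have "continuous_on UNIV (\<lambda>p. Complex (fst p) (snd p))"
    by (simp only:) (intro continuous_intros)
  then show ?thesis
    by (simp add: borel_prod case_prod_unfold borel_measurable_continuous_onI)
qed

lemma lborel_complex_eq: "(lborel :: complex measure) = distr (lborel \<Otimes>\<^sub>M lborel) borel (\<lambda>(x, y). Complex x y)"
proof (rule lborel_eqI)
  fix l u :: complex
  assume le: "\<And>b. b \<in> Basis \<Longrightarrow> l \<bullet> b \<le> u \<bullet> b"
  have le': "Re l \<le> Re u" "Im l \<le> Im u"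
    using le[of 1] le[of \<i>] by (auto simp: Basis_complex_def)
  have box: "box l u = {z. Re l < Re z \<and> Re z < Re u \<and> Im l < Im z \<and> Im z < Im u}"
    by (auto simp: box_def Basis_complex_def)
  have "(\<lambda>(x, y). Complex x y) -` box l u \<inter> space (lborel \<Otimes>\<^sub>M lborel) = {Re l <..< Re u} \<times> {Im l <..< Im u}"
    unfolding space_pair_measure box by auto
  then have "emeasure (distr (lborel \<Otimes>\<^sub>M lborel) borel (\<lambda>(x, y). Complex x y)) (box l u)
      = emeasure lborel {Re l <..< Re u} * emeasure lborel {Im l <..< Im u}"
    by (subst emeasure_distr) (auto simp: lborel.emeasure_pair_measure_Times)
  also have "\<dots> = ennreal (Re u - Re l) * ennreal (Im u - Im l)"
    using le' by simp
  also have "\<dots> = ennreal (\<Prod>b\<in>Basis. (u - l) \<bullet> b)"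
    using le' by (simp add: Basis_complex_def ennreal_mult)
  finally show "emeasure (distr (lborel \<Otimes>\<^sub>M lborel) borel (\<lambda>(x, y). Complex x y)) (box l u) = ennreal (\<Prod>b\<in>Basis. (u - l) \<bullet> b)" .
qed simp

lemma
  fixes f :: "complex \<Rightarrow> ennreal"
  assumes [measurable]: "f \<in> borel_measurable borel"
  shows nn_lborel_complex1: "(\<integral>\<^sup>+z. f z \<partial>lborel) = (\<integral>\<^sup>+x. \<integral>\<^sup>+y. f (Complex x y) \<partial>lborel \<partial>lborel)"
    and nn_lborel_complex2: "(\<integral>\<^sup>+z. f z \<partial>lborel) = (\<integral>\<^sup>+y. \<integral>\<^sup>+x. f (Complex x y) \<partial>lborel \<partial>lborel)"
proof -
  have m: "(\<lambda>p. f (case p of (x, y) \<Rightarrow> Complex x y)) \<in> borel_measurable (lborel \<Otimes>\<^sub>M lborel)"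
    by measurable
  have "(\<integral>\<^sup>+z. f z \<partial>lborel) = (\<integral>\<^sup>+p. f (case p of (x, y) \<Rightarrow> Complex x y) \<partial>(lborel \<Otimes>\<^sub>M lborel))"
    unfolding lborel_complex_eq by (subst nn_integral_distr) auto
  then show "(\<integral>\<^sup>+z. f z \<partial>lborel) = (\<integral>\<^sup>+x. \<integral>\<^sup>+y. f (Complex x y) \<partial>lborel \<partial>lborel)"
    "(\<integral>\<^sup>+z. f z \<partial>lborel) = (\<integral>\<^sup>+y. \<integral>\<^sup>+x. f (Complex x y) \<partial>lborel \<partial>lborel)"
    using lborel.nn_integral_fst[OF m] lborel_pair.nn_integral_snd[OF m] by simp_all
qed

lemma nn_lborel_translate:
  fixes f :: "real \<Rightarrow> ennreal"
  assumes "f \<in> borel_measurable borel"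
  shows "(\<integral>\<^sup>+x. f (x + t) \<partial>lborel) = (\<integral>\<^sup>+x. f x \<partial>lborel)"
  using nn_integral_real_affine[OF assms, of 1 t] by (simp add: add.commute)

text \<open>For a fixed imaginary part the shear is a translation of the real part.\<close>

lemma nn_lborel_shear_Re:
  fixes f :: "complex \<Rightarrow> ennreal"
  assumes [measurable]: "f \<in> borel_measurable borel"
  shows "(\<integral>\<^sup>+z. f (Complex (Re z + s * Im z) (Im z)) \<partial>lborel) = (\<integral>\<^sup>+z. f z \<partial>lborel)"
proof -
  have m: "(\<lambda>z. f (Complex (Re z + s * Im z) (Im z))) \<in> borel_measurable borel"
    unfolding Complex_eq
    by (intro measurable_compose[OF _ assms] borel_measurable_continuous_onI continuous_intros)
  have mc: "(\<lambda>x. f (Complex x y)) \<in> borel_measurable borel" for y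
    unfolding Complex_eq
    by (intro measurable_compose[OF _ assms] borel_measurable_continuous_onI continuous_intros)
  show ?thesis
    unfolding nn_lborel_complex2[OF m] nn_lborel_complex2[OF assms]
    using nn_lborel_translate[OF mc] by simp
qed

lemma nn_lborel_shear_Im:
  fixes f :: "complex \<Rightarrow> ennreal"
  assumes [measurable]: "f \<in> borel_measurable borel"
  shows "(\<integral>\<^sup>+z. f (Complex (Re z) (Im z + s * Re z)) \<partial>lborel) = (\<integral>\<^sup>+z. f z \<partial>lborel)"
proof -
  have m: "(\<lambda>z. f (Complex (Re z) (Im z + s * Re z))) \<in> borel_measurable borel"
    unfolding Complex_eq
    by (intro measurable_compose[OF _ assms] borel_measurable_continuous_onI continuous_intros)
  have mc: "(\<lambda>y. f (Complex x y)) \<in> borel_measurable borel" for x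
    unfolding Complex_eq
    by (intro measurable_compose[OF _ assms] borel_measurable_continuous_onI continuous_intros)
  show ?thesis
    unfolding nn_lborel_complex1[OF m] nn_lborel_complex1[OF assms]
    using nn_lborel_translate[OF mc] by simp
qed

text \<open>A rotation is a product of three shears, unless it is the half turn.\<close>

lemma nn_lborel_rotate:
  fixes f :: "complex \<Rightarrow> ennreal"
  assumes f: "f \<in> borel_measurable borel" and u: "cmod u = 1"
  shows "(\<integral>\<^sup>+z. f (u * z) \<partial>lborel) = (\<integral>\<^sup>+z. f z \<partial>lborel)"
proof -
  have meas: "(\<lambda>z. g (v * z)) \<in> borel_measurable borel" if "g \<in> borel_measurable borel" for g :: "complex \<Rightarrow> ennreal" and v
    using that by measurable
  have main: "(\<integral>\<^sup>+z. f (v * z) \<partial>lborel) = (\<integral>\<^sup>+z. f z \<partial>lborel)"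
    if f: "f \<in> borel_measurable borel" and v: "cmod v = 1" "v \<noteq> - 1" for f :: "complex \<Rightarrow> ennreal" and v
  proof -
    define b where "b = Im v"
    \<comment> \<open>For \<open>v\<close> of angle \<open>\<theta>\<close> this is
      \<open>- tan (\<theta> / 2)\<close>, the parameter of the two outer shears; the middle one has
      parameter \<open>sin \<theta>\<close>. The formula breaks down at the half turn.\<close>
    define a where "a = - b / (1 + Re v)"
    have sq: "(Re v)\<^sup>2 + b\<^sup>2 = 1" using v(1) by (simp add: b_def cmod_def)
    have ne: "1 + Re v \<noteq> 0"
    proof
      assume "1 + Re v = 0"
      then have "Re v = - 1" by linarith
      with sq have "b = 0" by simp
      with \<open>Re v = - 1\<close> v(2) show False by (simp add: b_def complex_eq_iff)
    qed
    define X where "X z = Complex (Re z + a * Im z) (Im z)" for z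
    define Y where "Y z = Complex (Re z) (Im z + b * Re z)" for z
    have ab: "a * b = Re v - 1"
    proof -
      have "a * b * (1 + Re v) = - b\<^sup>2" using ne by (simp add: a_def power2_eq_square)
      also have "\<dots> = (Re v)\<^sup>2 - 1" using sq by simp
      also have "\<dots> = (Re v - 1) * (1 + Re v)" by (simp add: power2_eq_square algebra_simps)
      finally show ?thesis using ne by simp
    qed
    have a2: "2 * a + a * (a * b) = - b"
    proof -
      have "2 * a + a * (a * b) = a * (1 + Re v)" unfolding ab by (simp add: algebra_simps)
      also have "\<dots> = - b" using ne by (simp add: a_def)
      finally show ?thesis .
    qed
    have XYX: "X (Y (X z)) = v * z" for z
    proof (rule complex_eqI)
      have "Re (X (Y (X z))) = Re z * (1 + a * b) + Im z * (2 * a + a * (a * b))"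
        by (simp add: X_def Y_def algebra_simps)
      then show "Re (X (Y (X z))) = Re (v * z)" unfolding a2 unfolding ab by (simp add: b_def algebra_simps)
      have "Im (X (Y (X z))) = b * Re z + Im z * (1 + a * b)"
        by (simp add: X_def Y_def algebra_simps)
      then show "Im (X (Y (X z))) = Im (v * z)" unfolding ab by (simp add: b_def algebra_simps)
    qed
    have mX: "X \<in> borel_measurable borel" and mY: "Y \<in> borel_measurable borel"
      unfolding X_def[abs_def] Y_def[abs_def] Complex_eq
      by (intro borel_measurable_continuous_onI continuous_intros)+
    have fX: "(\<lambda>z. f (X z)) \<in> borel_measurable borel" by (rule measurable_compose[OF mX f])
    have fXY: "(\<lambda>z. f (X (Y z))) \<in> borel_measurable borel" by (rule measurable_compose[OF mY fX])
    have "(\<integral>\<^sup>+z. f (v * z) \<partial>lborel) = (\<integral>\<^sup>+z. f (X (Y (X z))) \<partial>lborel)" by (simp add: XYX)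
    also have "\<dots> = (\<integral>\<^sup>+z. f (X (Y z)) \<partial>lborel)"
      unfolding X_def[of "_ :: complex"] using nn_lborel_shear_Re[OF fXY, of a] by (simp add: X_def)
    also have "\<dots> = (\<integral>\<^sup>+z. f (X z) \<partial>lborel)"
      using nn_lborel_shear_Im[OF fX, of b] by (simp add: Y_def)
    also have "\<dots> = (\<integral>\<^sup>+z. f z \<partial>lborel)"
      using nn_lborel_shear_Re[OF f, of a] by (simp add: X_def)
    finally show ?thesis .
  qed
  show ?thesis
  proof (cases "u = - 1")
    case True
    \<comment> \<open>The half turn is performed as two quarter turns.\<close>
    have i: "cmod \<i> = 1" "\<i> \<noteq> - 1" by (auto simp: complex_eq_iff)
    have "(\<integral>\<^sup>+z. f (u * z) \<partial>lborel) = (\<integral>\<^sup>+z. f (\<i> * (\<i> * z)) \<partial>lborel)"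
      by (simp add: True mult.assoc[symmetric])
    also have "\<dots> = (\<integral>\<^sup>+z. f z \<partial>lborel)"
      using main[OF meas[OF f, of \<i>] i] main[OF f i] by simp
    finally show ?thesis .
  qed (use main f u in auto)
qed

text \<open>Takes the place of polar coordinates: a disc of radius \<open>sqrt t\<close> has area
  \<open>pi * t\<close>, so the squared modulus pushes Lebesgue measure to \<open>pi\<close> times
  Lebesgue measure on the half line.\<close>

lemma distr_cmod_power2:
  "distr lborel borel (\<lambda>z::complex. (cmod z)\<^sup>2) = density lborel (\<lambda>t. ennreal pi * indicator {0..} t)"
proof (rule measure_eqI_generator_eq[where E = "range (\<lambda>t::real. {..t})" and \<Omega> = UNIV and A = "\<lambda>n. {..real n}"])
  show "Int_stable (range (\<lambda>t::real. {..t}))"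
    by (auto simp: Int_stable_def image_iff intro: exI[of _ "min _ _"])
  show "sets (distr lborel borel (\<lambda>z::complex. (cmod z)\<^sup>2)) = sigma_sets UNIV (range (\<lambda>t::real. {..t}))"
    "sets (density lborel (\<lambda>t. ennreal pi * indicator {0..} t)) = sigma_sets UNIV (range (\<lambda>t::real. {..t}))"
    by (simp_all add: borel_eq_atMost)
  have *: "emeasure (distr lborel borel (\<lambda>z::complex. (cmod z)\<^sup>2)) {..t} = (if t \<ge> 0 then ennreal (pi * t) else 0)" for t
  proof -
    have "emeasure (distr lborel borel (\<lambda>z::complex. (cmod z)\<^sup>2)) {..t} = emeasure lborel {z :: complex. (cmod z)\<^sup>2 \<le> t}"
      by (subst emeasure_distr) (auto simp: vimage_def)
    also have "\<dots> = (if t \<ge> 0 then ennreal (pi * t) else 0)"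
    proof (cases "t \<ge> 0")
      case True
      then have "{z :: complex. (cmod z)\<^sup>2 \<le> t} = cball 0 (sqrt t)"
        by (auto simp: real_le_rsqrt dest: real_sqrt_le_mono) (metis abs_norm_cancel norm_ge_zero power_mono real_sqrt_pow2)
      then show ?thesis using True by (simp add: emeasure_cball unit_ball_vol_2)
    next
      case False
      then have "{z :: complex. (cmod z)\<^sup>2 \<le> t} = {}" by (auto simp: not_le intro: less_le_trans)
      then show ?thesis using False by simp
    qed
    finally show ?thesis .
  qed
  fix X :: "real set" assume "X \<in> range (\<lambda>t. {..t})"
  then obtain t where t: "X = {..t}" by blast
  have "emeasure (density lborel (\<lambda>t. ennreal pi * indicator {0..} t)) {..t} = (\<integral>\<^sup>+x. ennreal pi * indicator {0..t} x \<partial>lborel)"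
    by (subst emeasure_density) (auto intro!: nn_integral_cong split: split_indicator)
  also have "\<dots> = ennreal pi * emeasure lborel {0..t}" by (simp add: nn_integral_cmult)
  also have "\<dots> = (if t \<ge> 0 then ennreal (pi * t) else 0)" by (auto simp: ennreal_mult)
  finally show "emeasure (distr lborel borel (\<lambda>z::complex. (cmod z)\<^sup>2)) X = emeasure (density lborel (\<lambda>t. ennreal pi * indicator {0..} t)) X"
    unfolding t * by simp
next
  show "emeasure (distr lborel borel (\<lambda>z::complex. (cmod z)\<^sup>2)) {..real n} \<noteq> \<infinity>" for n
  proof -
    have "{z :: complex. (cmod z)\<^sup>2 \<le> real n} \<subseteq> cball 0 (sqrt (real n))"
      by (auto simp: real_le_rsqrt)
    then have "emeasure lborel {z :: complex. (cmod z)\<^sup>2 \<le> real n} \<le> emeasure lborel (cball (0 :: complex) (sqrt (real n)))"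
      by (rule emeasure_mono) simp
    also have "\<dots> < \<infinity>" by (simp add: emeasure_cball)
    finally show ?thesis by (subst emeasure_distr) (auto simp: vimage_def)
  qed
  show "(\<Union>i. {..real i}) = UNIV" by (auto intro: real_arch_simple)
qed auto

text \<open>In the variable \<open>(cmod z)\<^sup>2\<close>, rescaled by \<open>s\<close>, this is
  the integral of \<open>x ^ a * exp (- x)\<close> over the half line, which equals
  \<open>fact a\<close>.\<close>

lemma nn_gauss_moment:
  assumes s: "s > 0"
  shows "(\<integral>\<^sup>+(z::complex). ennreal (cmod z ^ (2 * a) * exp (- (cmod z)\<^sup>2 / s) / (pi * s)) \<partial>lborel) = ennreal (s ^ a * fact a)"
proof -
  let ?g = "\<lambda>t. ennreal (t ^ a * exp (- t / s) / (pi * s))"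
  have "(\<integral>\<^sup>+(z::complex). ennreal (cmod z ^ (2 * a) * exp (- (cmod z)\<^sup>2 / s) / (pi * s)) \<partial>lborel)
      = (\<integral>\<^sup>+(z::complex). ?g ((cmod z)\<^sup>2) \<partial>lborel)"
    by (simp add: power_mult)
  also have "\<dots> = (\<integral>\<^sup>+t. ?g t \<partial>distr lborel borel (\<lambda>z::complex. (cmod z)\<^sup>2))"
    by (subst nn_integral_distr) auto
  also have "\<dots> = (\<integral>\<^sup>+t. ennreal pi * indicator {0..} t * ?g t \<partial>lborel)"
    unfolding distr_cmod_power2 by (subst nn_integral_density) auto
  also have "\<dots> = ennreal s * (\<integral>\<^sup>+x. ennreal pi * indicator {0..} (s * x) * ?g (s * x) \<partial>lborel)"
    using nn_integral_real_affine[of "\<lambda>t. ennreal pi * indicator {0..} t * ?g t" s 0] s by simp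
  also have "(\<integral>\<^sup>+x. ennreal pi * indicator {0..} (s * x) * ?g (s * x) \<partial>lborel)
     = (\<integral>\<^sup>+x. ennreal (s ^ a / s) * (ennreal (x ^ a * exp (- x)) * indicator {0..} x) \<partial>lborel)"
  proof (rule nn_integral_cong)
    fix x :: real
    show "ennreal pi * indicator {0..} (s * x) * ?g (s * x) = ennreal (s ^ a / s) * (ennreal (x ^ a * exp (- x)) * indicator {0..} x)"
      using s by (auto simp: zero_le_mult_iff power_mult_distrib field_simps split: split_indicator simp flip: ennreal_mult)
  qed
  also have "\<dots> = ennreal (s ^ a / s) * ennreal (fact a)"
    by (subst nn_integral_cmult) (simp_all add: nn_intergal_power_times_exp_Ici)
  also have "ennreal s * (ennreal (s ^ a / s) * ennreal (fact a)) = ennreal (s ^ a * fact a)"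
    using s by (simp flip: ennreal_mult)
  finally show ?thesis .
qed

section \<open>Lebesgue measure on vectors as a product measure\<close>

definition vecf :: "('n::finite \<Rightarrow> complex) \<Rightarrow> complex^'n" where
  "vecf f = (\<chi> i. f i)"

lemma borel_vecf [measurable]: "vecf \<in> borel_measurable (PiM UNIV (\<lambda>_. lborel))"
proof (subst borel_measurable_euclidean_space, intro ballI)
  fix b :: "complex^'n" assume "b \<in> Basis"
  then obtain i c where b: "b = axis i c" unfolding Basis_vec_def by auto
  have "(\<lambda>f. f i) \<in> borel_measurable (PiM UNIV (\<lambda>_::'n. lborel :: complex measure))"
    using measurable_component_singleton[of i UNIV "\<lambda>_. lborel :: complex measure"] by simp
  then show "(\<lambda>f. vecf f \<bullet> b) \<in> borel_measurable (PiM UNIV (\<lambda>_. lborel))"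
    unfolding b inner_axis vecf_def by simp
qed

interpretation lborelC: product_sigma_finite "\<lambda>_::'n::finite. lborel :: complex measure"
  by standard

lemma prod_Basis_vec: "(\<Prod>b\<in>(Basis :: (complex^'n::finite) set). g b) = (\<Prod>i\<in>UNIV. \<Prod>c\<in>Basis. g (axis i c))"
  for g :: "complex^'n \<Rightarrow> 'b::comm_monoid_mult"
proof -
  have eq: "(Basis :: (complex^'n) set) = (\<lambda>(i, c). axis i c) ` (UNIV \<times> Basis)"
    unfolding Basis_vec_def by auto
  have inj: "inj_on (\<lambda>(i, c). axis i c :: complex^'n) (UNIV \<times> Basis)"
    by (auto simp: inj_on_def axis_eq_axis)
  show ?thesis
    unfolding eq prod.reindex[OF inj] by (simp add: prod.cartesian_product case_prod_unfold o_def)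
qed

lemma lborel_vec_eq: "(lborel :: (complex^'n::finite) measure) = distr (PiM UNIV (\<lambda>_. lborel)) borel vecf"
proof (rule lborel_eqI)
  fix l u :: "complex^'n"
  assume le: "\<And>b. b \<in> Basis \<Longrightarrow> l \<bullet> b \<le> u \<bullet> b"
  have le': "l $ i \<bullet> c \<le> u $ i \<bullet> c" if "c \<in> Basis" for i c
    using le[of "axis i c"] that by (auto simp: inner_axis Basis_vec_def)
  have "vecf -` box l u \<inter> space (PiM UNIV (\<lambda>_. lborel)) = PiE UNIV (\<lambda>i. box (l $ i) (u $ i))"
    by (auto simp: vecf_def space_PiM PiE_UNIV_domain box_def Basis_vec_def inner_axis Pi_iff)
  then have "emeasure (distr (PiM UNIV (\<lambda>_. lborel)) borel vecf) (box l u)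
      = emeasure (PiM UNIV (\<lambda>_. lborel)) (PiE UNIV (\<lambda>i. box (l $ i) (u $ i)))"
    by (subst emeasure_distr) auto
  also have "\<dots> = (\<Prod>i\<in>UNIV. emeasure lborel (box (l $ i) (u $ i)))"
    by (rule lborelC.emeasure_PiM) auto
  also have "\<dots> = (\<Prod>i\<in>UNIV. ennreal (\<Prod>c\<in>Basis. (u $ i - l $ i) \<bullet> c))"
    using le' by (intro prod.cong refl emeasure_lborel_box) auto
  also have "\<dots> = ennreal (\<Prod>i\<in>UNIV. \<Prod>c\<in>Basis. (u $ i - l $ i) \<bullet> c)"
    using le' by (intro prod_ennreal prod_nonneg) (auto simp: inner_diff_left)
  also have "(\<Prod>i\<in>UNIV. \<Prod>c\<in>Basis. (u $ i - l $ i) \<bullet> c) = (\<Prod>b\<in>Basis. (u - l) \<bullet> b)"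
    unfolding prod_Basis_vec by (simp add: inner_axis)
  finally show "emeasure (distr (PiM UNIV (\<lambda>_. lborel)) borel vecf) (box l u) = ennreal (\<Prod>b\<in>Basis. (u - l) \<bullet> b)" .
qed simp

lemma nn_lborel_vec:
  fixes f :: "complex^'n::finite \<Rightarrow> ennreal"
  assumes "f \<in> borel_measurable borel"
  shows "(\<integral>\<^sup>+z. f z \<partial>lborel) = (\<integral>\<^sup>+x. f (vecf x) \<partial>PiM UNIV (\<lambda>_. lborel))"
  unfolding lborel_vec_eq using assms by (subst nn_integral_distr) auto

definition rot :: "('n \<Rightarrow> complex) \<Rightarrow> complex^'n \<Rightarrow> complex^'n::finite" where
  "rot u z = (\<chi> i. u i * z $ i)"

lemma continuous_rot: "continuous_on UNIV (rot u)"
  unfolding rot_def by (intro continuous_intros)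

text \<open>On products of measurable sets the claim splits into rotations of single coordinates,
  and such sets determine the product measure.\<close>

lemma nn_lborel_rot:
  fixes f :: "complex^'n::finite \<Rightarrow> ennreal"
  assumes f: "f \<in> borel_measurable borel" and u: "\<And>i. cmod (u i) = 1"
  shows "(\<integral>\<^sup>+z. f (rot u z) \<partial>lborel) = (\<integral>\<^sup>+z. f z \<partial>lborel)"
proof -
  let ?P = "PiM UNIV (\<lambda>_::'n. lborel :: complex measure)"
  let ?r = "\<lambda>x i. u i * x i"
  have mr: "?r \<in> measurable ?P ?P"
  proof (rule measurable_PiM_single')
    fix i :: 'n
    have "(\<lambda>f. f i) \<in> borel_measurable ?P"
      using measurable_component_singleton[of i UNIV "\<lambda>_. lborel :: complex measure"] by simp
    then show "(\<lambda>x. u i * x i) \<in> measurable ?P lborel" by simp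
  qed (auto simp: space_PiM PiE_UNIV_domain)
  have eq: "distr ?P ?P ?r = ?P"
  proof (rule lborelC.PiM_eqI)
    fix A :: "'n \<Rightarrow> complex set" assume A: "\<And>i. i \<in> UNIV \<Longrightarrow> A i \<in> sets lborel"
    have B: "(\<lambda>z. u i * z) -` A i \<in> sets lborel" for i
    proof -
      have "(\<lambda>z. u i * z) \<in> borel_measurable (borel :: complex measure)" by simp
      from measurable_sets[OF this, of "A i"] A show ?thesis by simp
    qed
    have "?r -` PiE UNIV A \<inter> space ?P = PiE UNIV (\<lambda>i. (\<lambda>z. u i * z) -` A i)"
      by (auto simp: space_PiM PiE_UNIV_domain Pi_iff)
    moreover have "PiE UNIV A \<in> sets ?P" using A by (intro sets_PiM_I_finite) auto
    ultimately have "emeasure (distr ?P ?P ?r) (PiE UNIV A) = emeasure ?P (PiE UNIV (\<lambda>i. (\<lambda>z. u i * z) -` A i))"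
      by (subst emeasure_distr[OF mr]) auto
    also have "\<dots> = (\<Prod>i\<in>UNIV. emeasure lborel ((\<lambda>z. u i * z) -` A i))"
      by (rule lborelC.emeasure_PiM) (use B in auto)
    also have "\<dots> = (\<Prod>i\<in>UNIV. emeasure lborel (A i))"
    proof (rule prod.cong[OF refl])
      fix i
      have "emeasure lborel ((\<lambda>z. u i * z) -` A i) = (\<integral>\<^sup>+z. indicator ((\<lambda>z. u i * z) -` A i) z \<partial>lborel)"
        by (rule nn_integral_indicator[symmetric]) (rule B)
      also have "\<dots> = (\<integral>\<^sup>+z. indicator (A i) (u i * z) \<partial>lborel)"
        by (intro nn_integral_cong) (auto split: split_indicator)
      also have "\<dots> = (\<integral>\<^sup>+z. indicator (A i) z \<partial>lborel)"
        using A[of i] u by (intro nn_lborel_rotate) auto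
      finally show "emeasure lborel ((\<lambda>z. u i * z) -` A i) = emeasure lborel (A i)" using A[of i] by simp
    qed
    finally show "emeasure (distr ?P ?P ?r) (PiE UNIV A) = (\<Prod>i\<in>UNIV. emeasure lborel (A i))" .
  qed simp_all
  have mf: "(\<lambda>z. f (rot u z)) \<in> borel_measurable borel"
    by (rule measurable_compose[OF borel_measurable_continuous_onI[OF continuous_rot] f])
  have mv: "(\<lambda>x. f (vecf x)) \<in> borel_measurable ?P" by (rule measurable_compose[OF borel_vecf f])
  have "(\<integral>\<^sup>+z. f (rot u z) \<partial>lborel) = (\<integral>\<^sup>+x. f (vecf (?r x)) \<partial>?P)"
    unfolding nn_lborel_vec[OF mf] by (simp add: rot_def vecf_def)
  also have "\<dots> = (\<integral>\<^sup>+x. f (vecf x) \<partial>distr ?P ?P ?r)"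
    by (subst nn_integral_distr[OF mr]) (use mv in auto)
  also have "\<dots> = (\<integral>\<^sup>+z. f z \<partial>lborel)" unfolding eq nn_lborel_vec[OF f] ..
  finally show ?thesis .
qed


subsection \<open>The Gaussian measure\<close>

lemma sets_gauss [simp, measurable_cong]: "sets (gauss hb) = sets borel"
  by (simp add: gauss_def)

lemma space_gauss [simp]: "space (gauss hb) = UNIV"
  by (simp add: gauss_def)

lemma continuous_gauss_density:
  "continuous_on UNIV (\<lambda>z::complex^'n::finite. exp (- (\<Sum>i\<in>UNIV. (cmod (z $ i))\<^sup>2) / (2 * hb)) / (2 * pi * hb) ^ CARD('n))"
  by (cases "hb = 0") (auto intro!: continuous_intros)

lemma nn_gauss:
  fixes f :: "complex^'n::finite \<Rightarrow> ennreal"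
  assumes "f \<in> borel_measurable borel"
  shows "(\<integral>\<^sup>+z. f z \<partial>gauss hb) = (\<integral>\<^sup>+z. ennreal (exp (- (\<Sum>i\<in>UNIV. (cmod (z $ i))\<^sup>2) / (2 * hb)) / (2 * pi * hb) ^ CARD('n)) * f z \<partial>lborel)"
  unfolding gauss_def
  using assms borel_measurable_continuous_onI[OF continuous_gauss_density[of hb, where 'n = 'n]]
  by (subst nn_integral_density) auto

lemma nn_gauss_rot:
  fixes f :: "complex^'n::finite \<Rightarrow> ennreal"
  assumes f: "f \<in> borel_measurable borel" and u: "\<And>i. cmod (u i) = 1"
  shows "(\<integral>\<^sup>+z. f (rot u z) \<partial>gauss hb) = (\<integral>\<^sup>+z. f z \<partial>gauss hb)"
proof -
  let ?d = "\<lambda>z::complex^'n. ennreal (exp (- (\<Sum>i\<in>UNIV. (cmod (z $ i))\<^sup>2) / (2 * hb)) / (2 * pi * hb) ^ CARD('n))"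
  have mf: "(\<lambda>z. f (rot u z)) \<in> borel_measurable borel"
    by (rule measurable_compose[OF borel_measurable_continuous_onI[OF continuous_rot] f])
  have md: "(\<lambda>z. ?d z * f z) \<in> borel_measurable borel"
    using borel_measurable_continuous_onI[OF continuous_gauss_density[of hb, where 'n = 'n]] f by auto
  have "?d (rot u z) = ?d z" for z by (simp add: rot_def norm_mult u)
  then show ?thesis
    unfolding nn_gauss[OF mf] nn_gauss[OF f] using nn_lborel_rot[of _ u, OF md u] by simp
qed

lemma nn_gauss_mpow:
  fixes N :: "'n::finite mindex"
  assumes hb: "hb > 0"
  shows "(\<integral>\<^sup>+z. ennreal ((cmod (mpow z N))\<^sup>2) \<partial>gauss hb) = ennreal ((2 * hb) ^ msize N * real (mfact N))"
proof -
  let ?s = "2 * hb"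
  let ?g = "\<lambda>i x. ennreal (cmod x ^ (2 * N i) * exp (- (cmod x)\<^sup>2 / ?s) / (pi * ?s))"
  have m: "(\<lambda>z. ennreal ((cmod (mpow z N))\<^sup>2)) \<in> borel_measurable borel"
    unfolding mpow_def by (intro measurable_compose[OF _ measurable_ennreal] borel_measurable_continuous_onI continuous_intros)
  have eq: "ennreal (exp (- (\<Sum>i\<in>UNIV. (cmod (z $ i))\<^sup>2) / ?s) / (2 * pi * hb) ^ CARD('n)) * ennreal ((cmod (mpow z N))\<^sup>2)
      = (\<Prod>i\<in>UNIV. ?g i (z $ i))" for z :: "complex^'n"
  proof -
    have "exp (- (\<Sum>i\<in>UNIV. (cmod (z $ i))\<^sup>2) / ?s) = (\<Prod>i\<in>UNIV. exp (- (cmod (z $ i))\<^sup>2 / ?s))"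
      by (simp add: exp_sum[symmetric] sum_divide_distrib sum_negf)
    moreover have "(cmod (mpow z N))\<^sup>2 = (\<Prod>i\<in>UNIV. cmod (z $ i) ^ (2 * N i))"
      by (simp add: mpow_def prod_norm[symmetric] norm_power power_mult[symmetric] mult.commute prod_power_distrib)
    moreover have "(2 * pi * hb) ^ CARD('n) = (\<Prod>i\<in>(UNIV :: 'n set). pi * ?s)"
      by (simp add: ac_simps)
    ultimately have "exp (- (\<Sum>i\<in>UNIV. (cmod (z $ i))\<^sup>2) / ?s) / (2 * pi * hb) ^ CARD('n) * (cmod (mpow z N))\<^sup>2
       = (\<Prod>i\<in>UNIV. cmod (z $ i) ^ (2 * N i) * exp (- (cmod (z $ i))\<^sup>2 / ?s) / (pi * ?s))"
      by (simp only: prod.distrib prod_dividef times_divide_eq_left times_divide_eq_right mult.commute)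
    then show ?thesis
      using hb by (simp add: prod_ennreal flip: ennreal_mult)
  qed
  have mg: "?g i \<in> borel_measurable lborel" for i by measurable
  have "(\<integral>\<^sup>+z. ennreal ((cmod (mpow z N))\<^sup>2) \<partial>gauss hb) = (\<integral>\<^sup>+z. (\<Prod>i\<in>UNIV. ?g i (z $ i)) \<partial>lborel)"
    unfolding nn_gauss[OF m] by (simp only: eq)
  also have "\<dots> = (\<integral>\<^sup>+x. (\<Prod>i\<in>UNIV. ?g i (x i)) \<partial>PiM UNIV (\<lambda>_. lborel))"
  proof (subst nn_lborel_vec)
    have "(\<lambda>z::complex^'n. z $ i) \<in> borel_measurable borel" for i
      by (intro borel_measurable_continuous_onI continuous_intros)
    moreover have "?g i \<in> borel_measurable borel" for i using mg[of i] by simp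
    ultimately have "(\<lambda>z::complex^'n. ?g i (z $ i)) \<in> borel_measurable borel" for i
      by (rule measurable_compose)
    then show "(\<lambda>z. \<Prod>i\<in>UNIV. ?g i (z $ i)) \<in> borel_measurable borel" by (rule borel_measurable_prod_ennreal)
  qed (simp add: vecf_def)
  also have "\<dots> = (\<Prod>i\<in>UNIV. integral\<^sup>N lborel (?g i))"
    by (rule lborelC.product_nn_integral_prod) (use mg in auto)
  also have "\<dots> = (\<Prod>i\<in>UNIV. ennreal (?s ^ N i * fact (N i)))"
    using nn_gauss_moment[of ?s] hb by simp
  also have "\<dots> = ennreal (?s ^ msize N * real (mfact N))"
    using hb by (simp add: prod_ennreal power_msize mfact_def prod.distrib of_nat_prod)
  finally show ?thesis .
qed

subsection \<open>Parseval's identity for the Gaussian measure\<close>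

text \<open>
  Averaging \<open>|\<phi>|\<^sup>2\<close> over the rotations by roots of unity kills the mixed terms of the squared power
  series in the limit, and by invariance of the measure it does not change the integral.
\<close>

definition uroot :: "nat \<Rightarrow> complex" where
  "uroot m = exp (2 * of_real pi * \<i> / of_nat (Suc m))"

lemma uroot_power: "uroot m ^ k = exp (2 * of_real pi * \<i> * of_nat k / of_nat (Suc m))"
  unfolding uroot_def exp_of_nat_mult[symmetric] by (simp add: field_simps)

lemma norm_uroot [simp]: "cmod (uroot m) = 1"
  unfolding uroot_def by (simp add: norm_exp_eq_Re del: of_nat_Suc)

text \<open>The factor that the monomial of index \<open>N\<close> acquires when each coordinate
  \<open>i\<close> is rotated by \<open>uroot m ^ k i\<close>.\<close>

definition uchar :: "nat \<Rightarrow> 'n::finite mindex \<Rightarrow> 'n mindex \<Rightarrow> complex" where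
  "uchar m N k = (\<Prod>i\<in>UNIV. (uroot m ^ k i) ^ N i)"

definition uavg :: "nat \<Rightarrow> 'n::finite mindex \<Rightarrow> 'n mindex \<Rightarrow> complex" where
  "uavg m M N = (\<Sum>k\<le>(\<lambda>_. m). uchar m M k * cnj (uchar m N k)) / of_nat (Suc m ^ CARD('n))"

lemma norm_uchar [simp]: "cmod (uchar m N k) = 1"
  unfolding uchar_def by (simp add: norm_power flip: prod_norm)

lemma card_atMost_const: "card {..(\<lambda>_::'n::finite. m)} = Suc m ^ CARD('n)"
  by (simp add: atMost_mindex card_PiE)

lemma norm_uavg_le: "cmod (uavg m M N) \<le> 1" for M :: "'n::finite mindex"
proof -
  have "cmod (\<Sum>k\<le>(\<lambda>_::'n. m). uchar m M k * cnj (uchar m N k)) \<le> (\<Sum>k\<le>(\<lambda>_::'n. m). 1)"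
    by (rule order_trans[OF norm_sum]) (simp add: norm_mult)
  then show ?thesis
    by (simp add: uavg_def norm_divide card_atMost_const norm_power divide_le_eq del: of_nat_Suc of_nat_power)
qed

lemma uavg_same: "uavg m N N = 1" for N :: "'n::finite mindex"
  unfolding uavg_def complex_norm_square[symmetric]
  by (simp add: card_atMost_const del: of_nat_Suc)

text \<open>A geometric sum whose ratio differs from one, as \<open>a\<close> and \<open>b\<close>
  are distinct residues modulo \<open>Suc m\<close>, and has \<open>Suc m\<close>-th power
  one.\<close>

lemma sum_uroot:
  assumes "a \<le> m" "b \<le> m" "a \<noteq> b"
  shows "(\<Sum>j\<le>m. (uroot m ^ j) ^ a * cnj ((uroot m ^ j) ^ b)) = 0"
proof -
  let ?q = "uroot m ^ a * cnj (uroot m ^ b)"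
  have unit: "uroot m ^ b * cnj (uroot m ^ b) = 1"
    unfolding complex_norm_square[symmetric] by (simp add: norm_power)
  have 1: "?q \<noteq> 1"
  proof
    assume "?q = 1"
    then have "uroot m ^ a = uroot m ^ b"
      using unit by (metis mult.left_commute mult.right_neutral)
    then have "a mod Suc m = b mod Suc m"
      unfolding uroot_power by (subst (asm) complex_root_unity_eq) auto
    then show False using assms by simp
  qed
  have "uroot m ^ Suc m = 1"
    unfolding uroot_power using complex_root_unity_eq[of "Suc m" "Suc m" 0] by (simp del: of_nat_Suc)
  then have "?q ^ Suc m = 1"
    by (simp only: power_mult_distrib power_mult[symmetric] mult.commute[of _ "Suc m"] complex_cnj_power[symmetric])
       (simp only: power_mult power_one complex_cnj_one mult_1)
  then have "(1 - ?q) * (\<Sum>j<Suc m. ?q ^ j) = 0"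
    by (simp only: one_diff_power_eq[symmetric] diff_self)
  then have "(\<Sum>j<Suc m. ?q ^ j) = 0" using 1 by simp
  moreover have "(uroot m ^ j) ^ a * cnj ((uroot m ^ j) ^ b) = ?q ^ j" for j
    by (simp add: power_mult_distrib power_mult[symmetric] mult.commute)
  ultimately show ?thesis by (simp add: lessThan_Suc_atMost)
qed

text \<open>Orthogonality is exact while no exponent exceeds \<open>m\<close>: roots of order
  \<open>Suc m\<close> tell the exponents from zero to \<open>m\<close> apart, but identify larger
  ones with them.\<close>

lemma uavg_eq:
  fixes M N :: "'n::finite mindex"
  assumes "\<And>i. M i \<le> m" "\<And>i. N i \<le> m"
  shows "uavg m M N = (if M = N then 1 else 0)"
proof (cases "M = N")
  case False
  then obtain i where i: "M i \<noteq> N i" by auto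
  have "(\<Sum>k\<le>(\<lambda>_. m). uchar m M k * cnj (uchar m N k))
      = (\<Sum>k\<le>(\<lambda>_. m). \<Prod>i\<in>UNIV. (uroot m ^ k i) ^ M i * cnj ((uroot m ^ k i) ^ N i))"
    by (simp add: uchar_def prod.distrib)
  also have "\<dots> = (\<Prod>i\<in>UNIV. \<Sum>j\<le>m. (uroot m ^ j) ^ M i * cnj ((uroot m ^ j) ^ N i))"
    by (rule sum_prod_atMost)
  also have "\<dots> = 0"
    using sum_uroot[OF assms i] by (intro prod_zero) auto
  finally show ?thesis using False by (simp add: uavg_def)
qed (simp add: uavg_same)

lemma has_sum_finite_sum:
  fixes f :: "'i \<Rightarrow> 'a \<Rightarrow> 'b::topological_comm_monoid_add"
  assumes "finite I" "\<And>i. i \<in> I \<Longrightarrow> (f i has_sum s i) A"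
  shows "((\<lambda>x. \<Sum>i\<in>I. f i x) has_sum (\<Sum>i\<in>I. s i)) A"
  using assms by (induction I rule: finite_induct) (auto intro: has_sum_add)

lemma summable_on_square:
  fixes a :: "'i \<Rightarrow> complex"
  assumes a: "(\<lambda>N. cmod (a N)) summable_on UNIV"
  shows "(\<lambda>N. (cmod (a N))\<^sup>2) summable_on UNIV"
proof (rule summable_on_comparison_test[OF summable_on_cmult_right[OF a, of "\<Sum>\<^sub>\<infinity>N. cmod (a N)"]])
  fix N
  have "cmod (a N) \<le> (\<Sum>\<^sub>\<infinity>N. cmod (a N))"
    using finite_sum_le_infsum[OF a, of "{N}"] by simp
  then show "(cmod (a N))\<^sup>2 \<le> (\<Sum>\<^sub>\<infinity>N. cmod (a N)) * cmod (a N)"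
    unfolding power2_eq_square by (rule mult_right_mono) simp
qed simp

definition sqavg :: "('n::finite mindex \<Rightarrow> complex) \<Rightarrow> nat \<Rightarrow> real" where
  "sqavg a m = (\<Sum>k\<le>(\<lambda>_. m). (cmod (\<Sum>\<^sub>\<infinity>N. a N * uchar m N k))\<^sup>2) / real (Suc m ^ CARD('n))"

text \<open>The squared modulus expands into a double series with weights \<open>uavg\<close>. Its
  difference from the diagonal is dominated by \<open>2 * cmod (a M) * cmod (a N)\<close> and
  vanishes for each pair once \<open>m\<close> bounds both indices, so dominated convergence gives
  the limit. For support in the box of size \<open>m\<close> all differences vanish at once.\<close>

lemma
  fixes a :: "'n::finite mindex \<Rightarrow> complex"
  assumes a: "(\<lambda>N. cmod (a N)) summable_on UNIV"
  shows sqavg_tendsto: "sqavg a \<longlonglongrightarrow> (\<Sum>\<^sub>\<infinity>N. (cmod (a N))\<^sup>2)"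
    and sqavg_exact: "(\<And>N. a N \<noteq> 0 \<Longrightarrow> N \<le> (\<lambda>_. m)) \<Longrightarrow> sqavg a m = (\<Sum>\<^sub>\<infinity>N. (cmod (a N))\<^sup>2)"
proof -
  let ?p = "\<lambda>(M, N). a M * cnj (a N)"
  let ?n = "\<lambda>(M, N). cmod (a M) * cmod (a N)"
  have n: "?n summable_on UNIV \<times> UNIV"
    by (intro summable_on_SigmaI[where g = "\<lambda>M. cmod (a M) * (\<Sum>\<^sub>\<infinity>N. cmod (a N))"])
       (auto simp only: prod.case intro!: has_sum_cmult_right has_sum_infsum a summable_on_cmult_left
          mult_nonneg_nonneg norm_ge_zero)
  have weak: "(\<lambda>(M, N). a M * cnj (a N) * w M N) summable_on UNIV \<times> UNIV" if "\<And>M N. cmod (w M N) \<le> 1" for w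
  proof (rule abs_summable_summable, rule Infinite_Sum.abs_summable_on_comparison_test'[OF n])
    fix x :: "'n mindex \<times> 'n mindex"
    show "norm (case x of (M, N) \<Rightarrow> a M * cnj (a N) * w M N) \<le> (case x of (M, N) \<Rightarrow> cmod (a M) * cmod (a N))"
      using that by (cases x) (auto simp: norm_mult intro!: mult_left_le)
  qed
  have pairs: "(\<Sum>\<^sub>\<infinity>(M, N). a M * cnj (a N) * (u M * cnj (u N))) = of_real ((cmod (\<Sum>\<^sub>\<infinity>N. a N * u N))\<^sup>2)"
    if u: "\<And>N. cmod (u N) = 1" for u
  proof -
    have su: "(\<lambda>N. a N * u N) summable_on UNIV"
      by (rule abs_summable_summable) (use a u in \<open>simp add: norm_mult\<close>)
    have "(\<Sum>\<^sub>\<infinity>(M, N). a M * cnj (a N) * (u M * cnj (u N))) = (\<Sum>\<^sub>\<infinity>(M, N)\<in>UNIV\<times>UNIV. a M * cnj (a N) * (u M * cnj (u N)))"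
      by simp
    also have "\<dots> = (\<Sum>\<^sub>\<infinity>M. \<Sum>\<^sub>\<infinity>N. a M * cnj (a N) * (u M * cnj (u N)))"
      by (rule infsum_Sigma'_banach[symmetric]) (use weak[of "\<lambda>M N. u M * cnj (u N)"] u in \<open>simp add: norm_mult\<close>)
    also have "\<dots> = (\<Sum>\<^sub>\<infinity>M. (a M * u M) * (\<Sum>\<^sub>\<infinity>N. cnj (a N * u N)))"
    proof (rule infsum_cong)
      fix M
      have "(\<lambda>N. cnj (a N * u N)) summable_on UNIV" using su by (simp only: summable_on_cnj_iff)
      then have "(\<Sum>\<^sub>\<infinity>N. (a M * u M) * cnj (a N * u N)) = (a M * u M) * (\<Sum>\<^sub>\<infinity>N. cnj (a N * u N))"
        by (rule infsum_cmult_right)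
      then show "(\<Sum>\<^sub>\<infinity>N. a M * cnj (a N) * (u M * cnj (u N))) = (a M * u M) * (\<Sum>\<^sub>\<infinity>N. cnj (a N * u N))"
        by (simp add: ac_simps)
    qed
    also have "\<dots> = (\<Sum>\<^sub>\<infinity>M. a M * u M) * (\<Sum>\<^sub>\<infinity>N. cnj (a N * u N))"
      by (rule infsum_cmult_left) (use su in simp)
    also have "\<dots> = (\<Sum>\<^sub>\<infinity>M. a M * u M) * cnj (\<Sum>\<^sub>\<infinity>N. a N * u N)"
      by (simp only: infsum_cnj)
    also have "\<dots> = of_real ((cmod (\<Sum>\<^sub>\<infinity>N. a N * u N))\<^sup>2)"
      by (simp only: complex_norm_square)
    finally show ?thesis .
  qed
  have sq: "of_real (sqavg a m) = (\<Sum>\<^sub>\<infinity>(M, N). a M * cnj (a N) * uavg m M N)" for m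
  proof -
    let ?c = "complex_of_nat (Suc m ^ CARD('n))"
    have s: "(\<lambda>(M, N). a M * cnj (a N) * (uchar m M k * cnj (uchar m N k))) summable_on UNIV" for k
      using weak[of "\<lambda>M N. uchar m M k * cnj (uchar m N k)"] by (simp add: norm_mult)
    have "((\<lambda>x. \<Sum>k\<le>(\<lambda>_. m). case x of (M, N) \<Rightarrow> a M * cnj (a N) * (uchar m M k * cnj (uchar m N k))) has_sum
       (\<Sum>k\<le>(\<lambda>_. m). \<Sum>\<^sub>\<infinity>(M, N). a M * cnj (a N) * (uchar m M k * cnj (uchar m N k)))) UNIV"
      by (rule has_sum_finite_sum) (use s in auto)
    note infsumI[OF has_sum_cmult_right[OF this, of "1 / ?c"], symmetric]
    moreover have "of_real (sqavg a m) = 1 / ?c * (\<Sum>k\<le>(\<lambda>_. m). \<Sum>\<^sub>\<infinity>(M, N). a M * cnj (a N) * (uchar m M k * cnj (uchar m N k)))"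
      unfolding sqavg_def by (simp add: pairs)
    ultimately have "of_real (sqavg a m) = (\<Sum>\<^sub>\<infinity>x. 1 / ?c * (\<Sum>k\<le>(\<lambda>_. m). case x of (M, N) \<Rightarrow> a M * cnj (a N) * (uchar m M k * cnj (uchar m N k))))"
      by (rule trans[rotated])
    also have "\<dots> = (\<Sum>\<^sub>\<infinity>(M, N). a M * cnj (a N) * uavg m M N)"
      by (rule infsum_cong) (auto simp: uavg_def sum_distrib_left sum_divide_distrib)
    finally show ?thesis .
  qed
  have diag: "complex_of_real (\<Sum>\<^sub>\<infinity>N. (cmod (a N))\<^sup>2) = (\<Sum>\<^sub>\<infinity>(M, N). a M * cnj (a N) * (if M = N then 1 else 0))"
  proof -
    have "(\<Sum>\<^sub>\<infinity>(M, N). a M * cnj (a N) * (if M = N then 1 else 0)) = (\<Sum>\<^sub>\<infinity>(M, N)\<in>UNIV\<times>UNIV. a M * cnj (a N) * (if M = N then 1 else 0))"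
      by simp
    also have "\<dots> = (\<Sum>\<^sub>\<infinity>M. \<Sum>\<^sub>\<infinity>N. a M * cnj (a N) * (if M = N then 1 else 0))"
      by (rule infsum_Sigma'_banach[symmetric]) (use weak[of "\<lambda>M N. if M = N then 1 else 0"] in simp)
    also have "\<dots> = (\<Sum>\<^sub>\<infinity>M. of_real ((cmod (a M))\<^sup>2))"
    proof (rule infsum_cong)
      fix M
      have "(\<Sum>\<^sub>\<infinity>N. a M * cnj (a N) * (if M = N then 1 else 0)) = a M * cnj (a M) * (if M = M then 1 else 0)"
        by (rule infsum_delta) auto
      then show "(\<Sum>\<^sub>\<infinity>N. a M * cnj (a N) * (if M = N then 1 else 0)) = of_real ((cmod (a M))\<^sup>2)"
        by (simp only: complex_norm_square simp_thms if_True mult_1_right)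
    qed
    also have "\<dots> = of_real (\<Sum>\<^sub>\<infinity>N. (cmod (a N))\<^sup>2)" by (rule infsumI[OF has_sum_of_real[OF has_sum_infsum[OF summable_on_square[OF a]]]])
    finally show ?thesis by simp
  qed
  have diff: "ennreal \<bar>sqavg a m - (\<Sum>\<^sub>\<infinity>N. (cmod (a N))\<^sup>2)\<bar>
      \<le> (\<Sum>\<^sub>\<infinity>(M, N). ennreal (cmod (a M) * cmod (a N) * cmod (uavg m M N - (if M = N then 1 else 0))))" for m
  proof -
    let ?d = "\<lambda>(M, N). a M * cnj (a N) * (uavg m M N - (if M = N then 1 else 0))"
    have s1: "(\<lambda>(M, N). a M * cnj (a N) * uavg m M N) summable_on UNIV"
      and s2: "(\<lambda>(M, N). a M * cnj (a N) * (if M = N then 1 else 0)) summable_on UNIV"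
      using weak[of "uavg m", OF norm_uavg_le] weak[of "\<lambda>M N. if M = N then 1 else 0"] by simp_all
    have dd: "?d = (\<lambda>x. (case x of (M, N) \<Rightarrow> a M * cnj (a N) * uavg m M N) - (case x of (M, N) \<Rightarrow> a M * cnj (a N) * (if M = N then 1 else 0)))"
      by (auto simp: fun_eq_iff right_diff_distrib)
    have h: "(?d has_sum infsum (\<lambda>(M, N). a M * cnj (a N) * uavg m M N) UNIV
        - infsum (\<lambda>(M, N). a M * cnj (a N) * (if M = N then 1 else 0)) UNIV) UNIV"
      unfolding dd unfolding diff_conv_add_uminus
      by (intro has_sum_add has_sum_infsum s1) (simp only: has_sum_uminus s2 has_sum_infsum minus_minus)
    have d: "of_real (sqavg a m - (\<Sum>\<^sub>\<infinity>N. (cmod (a N))\<^sup>2)) = infsum ?d UNIV"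
      unfolding of_real_diff sq diag by (rule infsumI[OF h, symmetric])
    have "?d summable_on UNIV" using h by (rule has_sum_imp_summable)
    then have sd: "(\<lambda>x. cmod (?d x)) summable_on UNIV" by (simp only: summable_on_iff_abs_summable_on_complex)
    have "\<bar>sqavg a m - (\<Sum>\<^sub>\<infinity>N. (cmod (a N))\<^sup>2)\<bar> = cmod (infsum ?d UNIV)"
      unfolding d[symmetric] by (simp only: norm_of_real)
    also have "\<dots> \<le> (\<Sum>\<^sub>\<infinity>x. cmod (?d x))" by (rule norm_infsum_bound[OF sd])
    finally have "ennreal \<bar>sqavg a m - (\<Sum>\<^sub>\<infinity>N. (cmod (a N))\<^sup>2)\<bar> \<le> ennreal (\<Sum>\<^sub>\<infinity>x. cmod (?d x))"
      by (rule ennreal_leI)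
    also have "\<dots> = (\<Sum>\<^sub>\<infinity>x. ennreal (cmod (?d x)))" by (rule infsum_ennreal[OF sd, symmetric]) simp
    also have "\<dots> = (\<Sum>\<^sub>\<infinity>(M, N). ennreal (cmod (a M) * cmod (a N) * cmod (uavg m M N - (if M = N then 1 else 0))))"
      by (rule infsum_cong) (simp add: case_prod_unfold norm_mult)
    finally show ?thesis .
  qed
  have "((\<lambda>m. \<Sum>\<^sub>\<infinity>(M, N). ennreal (cmod (a M) * cmod (a N) * cmod (uavg m M N - (if M = N then 1 else 0)))) \<longlongrightarrow> 0) sequentially"
  proof (rule infsum_tendsto_0_ennreal)
    show "(case x of (M, N) \<Rightarrow> ennreal (cmod (a M) * cmod (a N) * cmod (uavg m M N - (if M = N then 1 else 0))))
       \<le> 2 * ennreal (?n x)" for m x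
    proof (cases x)
      case (Pair M N)
      have "cmod (uavg m M N - (if M = N then 1 else 0)) \<le> 2"
        using norm_triangle_ineq4[of "uavg m M N" "if M = N then 1 else 0"] norm_uavg_le[of m M N] by (auto split: if_splits)
      then have "cmod (a M) * cmod (a N) * cmod (uavg m M N - (if M = N then 1 else 0)) \<le> cmod (a M) * cmod (a N) * 2"
        by (intro mult_left_mono) auto
      then have "ennreal (cmod (a M) * cmod (a N) * cmod (uavg m M N - (if M = N then 1 else 0))) \<le> ennreal (2 * (cmod (a M) * cmod (a N)))"
        by (intro ennreal_leI) linarith
      then show ?thesis by (simp add: Pair ennreal_mult)
    qed
    have "(\<Sum>\<^sub>\<infinity>x. ennreal (?n x)) < \<infinity>"
      using n by (subst summable_on_iff_ennreal[symmetric]) auto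
    then show "(\<Sum>\<^sub>\<infinity>x. 2 * ennreal (?n x)) < \<infinity>"
      unfolding infsum_cmult_ennreal by (simp add: ennreal_mult_less_top)
    fix x :: "'n mindex \<times> 'n mindex"
    obtain M N where x: "x = (M, N)" by (cases x)
    have "\<forall>\<^sub>F m in sequentially. \<forall>i. M i \<le> m \<and> N i \<le> m"
    proof (rule eventually_sequentiallyI)
      fix m assume m: "Max (range M) + Max (range N) \<le> m"
      show "\<forall>i. M i \<le> m \<and> N i \<le> m"
      proof
        fix i
        have "M i \<le> Max (range M)" "N i \<le> Max (range N)" by (simp_all add: finite_range_imageI)
        then show "M i \<le> m \<and> N i \<le> m" using m by linarith
      qed
    qed
    then have "\<forall>\<^sub>F m in sequentially. (case x of (M, N) \<Rightarrow> ennreal (cmod (a M) * cmod (a N) * cmod (uavg m M N - (if M = N then 1 else 0)))) = 0"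
      by eventually_elim (simp add: x uavg_eq)
    then show "((\<lambda>m. case x of (M, N) \<Rightarrow> ennreal (cmod (a M) * cmod (a N) * cmod (uavg m M N - (if M = N then 1 else 0)))) \<longlongrightarrow> 0) sequentially"
      by (rule tendsto_eventually)
  qed
  then have "(\<lambda>m. ennreal \<bar>sqavg a m - (\<Sum>\<^sub>\<infinity>N. (cmod (a N))\<^sup>2)\<bar>) \<longlonglongrightarrow> 0"
    by (rule tendsto_sandwich[OF _ _ tendsto_const, rotated 2]) (use diff in auto)
  then have "(\<lambda>m. \<bar>sqavg a m - (\<Sum>\<^sub>\<infinity>N. (cmod (a N))\<^sup>2)\<bar>) \<longlonglongrightarrow> 0"
    by (simp flip: ennreal_0)
  then show "sqavg a \<longlonglongrightarrow> (\<Sum>\<^sub>\<infinity>N. (cmod (a N))\<^sup>2)"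
    by (simp only: tendsto_rabs_zero_iff LIM_zero_iff)
  show "sqavg a m = (\<Sum>\<^sub>\<infinity>N. (cmod (a N))\<^sup>2)" if supp: "\<And>N. a N \<noteq> 0 \<Longrightarrow> N \<le> (\<lambda>_. m)"
  proof -
    have "(case x of (M, N) \<Rightarrow> ennreal (cmod (a M) * cmod (a N) * cmod (uavg m M N - (if M = N then 1 else 0)))) = 0" for x
    proof (cases x)
      case (Pair M N)
      show ?thesis
      proof (cases "a M = 0 \<or> a N = 0")
        case False
        then have "M \<le> (\<lambda>_. m)" "N \<le> (\<lambda>_. m)" using supp by auto
        then show ?thesis by (simp add: Pair uavg_eq le_fun_def)
      qed (auto simp: Pair)
    qed
    then show ?thesis using diff[of m] by (simp add: infsum_0)
  qed
qed

section \<open>From averages over roots of unity to Gaussian integrals\<close>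

lemma continuous_tay: "ent2 c \<Longrightarrow> continuous_on UNIV (tay c)"
  using Ck_tay[of c 0] by simp

lemma borel_tay: "ent2 c \<Longrightarrow> (\<lambda>z. ennreal ((cmod (tay c z))\<^sup>2)) \<in> borel_measurable borel"
  by (intro measurable_compose[OF _ measurable_ennreal] borel_measurable_continuous_onI
      continuous_on_power continuous_on_norm continuous_tay)

lemma conj_mpow_rot: "conj_mpow (rot u z) N = (\<Prod>i\<in>UNIV. cnj (u i) ^ N i) * conj_mpow z N"
  by (simp add: conj_mpow_def rot_def power_mult_distrib prod.distrib)

definition bterm :: "('n::finite mindex \<Rightarrow> 'n mindex \<Rightarrow> complex) \<Rightarrow> complex^'n \<Rightarrow> 'n mindex \<Rightarrow> complex" where
  "bterm c z N = 1 / of_nat (mfact N) * c 0 N * conj_mpow z N"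

lemma bterm_has_sum: "ent2 c \<Longrightarrow> pc c = c \<Longrightarrow> (bterm c z has_sum tay c z) UNIV"
  using tay_pc_has_sum[of c z] by (simp add: bterm_def[abs_def])

lemma bterm_abs_summable: "ent2 c \<Longrightarrow> pc c = c \<Longrightarrow> (\<lambda>N. cmod (bterm c z N)) summable_on UNIV"
  by (simp only: summable_on_iff_abs_summable_on_complex[symmetric] has_sum_imp_summable[OF bterm_has_sum])

text \<open>Tonelli and the Gaussian moments: \<open>(2 * hb) ^ msize N * mfact N\<close> divided by
  the squared factorial leaves the weight of the lowest seminorm.\<close>

lemma nn_gauss_bterm:
  fixes c :: "'n::finite mindex \<Rightarrow> 'n mindex \<Rightarrow> complex"
  assumes hb: "hb > 0" and c: "ent2 c" "pc c = c"
  shows "(\<integral>\<^sup>+z. ennreal (\<Sum>\<^sub>\<infinity>N. (cmod (bterm c z N))\<^sup>2) \<partial>gauss hb) = h0 (2 * hb) (cabs c) 0 0"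
proof -
  have b: "(\<lambda>z::complex^'n. ennreal ((cmod (mpow z N))\<^sup>2)) \<in> borel_measurable (gauss hb)" for N
    unfolding mpow_def
    by (intro measurable_compose[OF _ measurable_ennreal], subst measurable_cong_sets[OF sets_gauss refl])
       (intro borel_measurable_continuous_onI continuous_intros)
  have m: "ennreal ((cmod (bterm c z N))\<^sup>2) = ennreal ((cmod (c 0 N))\<^sup>2 / (real (mfact N))\<^sup>2) * ennreal ((cmod (mpow z N))\<^sup>2)" for z N
    unfolding bterm_def cnj_mpow[symmetric]
    by (simp add: norm_mult norm_divide power_mult_distrib power_divide flip: ennreal_mult)
  have "ennreal (\<Sum>\<^sub>\<infinity>N. (cmod (bterm c z N))\<^sup>2) = (\<integral>\<^sup>+N. ennreal ((cmod (bterm c z N))\<^sup>2) \<partial>count_space UNIV)" for z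
  proof -
    have "(\<lambda>N. (cmod (bterm c z N))\<^sup>2) summable_on UNIV"
      by (rule summable_on_square[OF bterm_abs_summable[OF c]])
    then show ?thesis
      unfolding infsum_eq_nn_integral[symmetric] by (intro infsum_ennreal[symmetric]) auto
  qed
  then have "(\<integral>\<^sup>+z. ennreal (\<Sum>\<^sub>\<infinity>N. (cmod (bterm c z N))\<^sup>2) \<partial>gauss hb)
     = (\<integral>\<^sup>+z. \<integral>\<^sup>+N. ennreal ((cmod (bterm c z N))\<^sup>2) \<partial>count_space UNIV \<partial>gauss hb)" by simp
  also have "\<dots> = (\<integral>\<^sup>+N. \<integral>\<^sup>+z. ennreal ((cmod (bterm c z N))\<^sup>2) \<partial>gauss hb \<partial>count_space UNIV)"
    by (rule nn_integral_count_space_nn_integral) (use b in \<open>auto simp: m intro!: borel_measurable_times_ennreal\<close>)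
  also have "\<dots> = (\<integral>\<^sup>+N. ennreal ((2 * hb) ^ msize N / real (mfact N)) * (cabs c 0 N)\<^sup>2 \<partial>count_space UNIV)"
  proof (rule nn_integral_cong)
    fix N
    have "(\<integral>\<^sup>+z. ennreal ((cmod (bterm c z N))\<^sup>2) \<partial>gauss hb)
       = ennreal ((cmod (c 0 N))\<^sup>2 / (real (mfact N))\<^sup>2) * (\<integral>\<^sup>+z. ennreal ((cmod (mpow z N))\<^sup>2) \<partial>gauss hb)"
      unfolding m using b by (rule nn_integral_cmult)
    also have "\<dots> = ennreal ((2 * hb) ^ msize N / real (mfact N)) * (cabs c 0 N)\<^sup>2"
      unfolding nn_gauss_mpow[OF hb] cabs_def using hb
      by (simp add: ennreal_power power2_eq_square flip: ennreal_mult)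
    finally show "(\<integral>\<^sup>+z. ennreal ((cmod (bterm c z N))\<^sup>2) \<partial>gauss hb) = ennreal ((2 * hb) ^ msize N / real (mfact N)) * (cabs c 0 N)\<^sup>2" .
  qed
  also have "\<dots> = h0 (2 * hb) (cabs c) 0 0"
    unfolding h0_def infsum_eq_nn_integral by simp
  finally show ?thesis .
qed

text \<open>The rotation is by conjugate roots because the monomials are in the conjugate variables;
  the factor acquired is then \<open>uchar\<close> itself.\<close>

lemma rot_sum:
  fixes c :: "'n::finite mindex \<Rightarrow> 'n mindex \<Rightarrow> complex"
  assumes c: "ent2 c" "pc c = c"
  shows "tay c (rot (\<lambda>i. cnj (uroot m ^ k i)) z) = (\<Sum>\<^sub>\<infinity>N. bterm c z N * uchar m N k)"
proof -
  have eq: "bterm c (rot (\<lambda>i. cnj (uroot m ^ k i)) z) N = bterm c z N * uchar m N k" for N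
    by (simp add: bterm_def conj_mpow_rot uchar_def)
  show ?thesis
    unfolding eq[symmetric] by (rule infsumI[OF bterm_has_sum[OF c], symmetric])
qed

lemma
  fixes c :: "'n::finite mindex \<Rightarrow> 'n mindex \<Rightarrow> complex"
  assumes c: "ent2 c" "pc c = c"
  shows borel_sqavg: "(\<lambda>z. ennreal (sqavg (bterm c z) m)) \<in> borel_measurable borel"
    and nn_gauss_sqavg: "(\<integral>\<^sup>+z. ennreal (sqavg (bterm c z) m) \<partial>gauss hb) = (\<integral>\<^sup>+z. ennreal ((cmod (tay c z))\<^sup>2) \<partial>gauss hb)"
proof -
  let ?u = "\<lambda>k::'n mindex. \<lambda>i. cnj (uroot m ^ k i)"
  let ?f = "\<lambda>z. ennreal ((cmod (tay c z))\<^sup>2)"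
  let ?w = "ennreal (1 / real (Suc m ^ CARD('n)))"
  have eq: "ennreal (sqavg (bterm c z) m) = ?w * (\<Sum>k\<le>(\<lambda>_. m). ?f (rot (?u k) z))" for z
  proof -
    have "sqavg (bterm c z) m = 1 / real (Suc m ^ CARD('n)) * (\<Sum>k\<le>(\<lambda>_. m). (cmod (tay c (rot (?u k) z)))\<^sup>2)"
      unfolding sqavg_def rot_sum[OF c] by (simp del: of_nat_Suc)
    then have "ennreal (sqavg (bterm c z) m) = ?w * ennreal (\<Sum>k\<le>(\<lambda>_. m). (cmod (tay c (rot (?u k) z)))\<^sup>2)"
      by (simp only:) (rule ennreal_mult, auto intro: sum_nonneg)
    then show ?thesis by (simp only: sum_ennreal zero_le_power2)
  qed
  have bf: "(\<lambda>z. ?f (rot u z)) \<in> borel_measurable borel" for u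
    by (rule measurable_compose[OF borel_measurable_continuous_onI[OF continuous_rot] borel_tay[OF c(1)]])
  then show "(\<lambda>z. ennreal (sqavg (bterm c z) m)) \<in> borel_measurable borel"
    unfolding eq by (intro borel_measurable_times_ennreal borel_measurable_sum) auto
  have bg: "(\<lambda>z. ?f (rot u z)) \<in> borel_measurable (gauss hb)" for u
    using bf by (subst measurable_cong_sets[OF sets_gauss refl])
  have "(\<integral>\<^sup>+z. ennreal (sqavg (bterm c z) m) \<partial>gauss hb) = ?w * (\<Sum>k\<le>(\<lambda>_. m). \<integral>\<^sup>+z. ?f (rot (?u k) z) \<partial>gauss hb)"
    unfolding eq by (subst nn_integral_cmult, intro borel_measurable_sum bg, subst nn_integral_sum) (intro bg, rule refl)
  also have "\<dots> = ?w * (\<Sum>k\<le>(\<lambda>_::'n. m). \<integral>\<^sup>+z. ?f z \<partial>gauss hb)"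
    using nn_gauss_rot[OF borel_tay[OF c(1)], of "?u _"] by (simp add: norm_power)
  also have "\<dots> = (?w * of_nat (Suc m ^ CARD('n))) * (\<integral>\<^sup>+z. ?f z \<partial>gauss hb)"
    by (simp add: card_atMost_const mult.assoc del: of_nat_Suc)
  also have "?w * of_nat (Suc m ^ CARD('n)) = 1"
    unfolding ennreal_of_nat_eq_real_of_nat by (simp flip: ennreal_mult del: of_nat_Suc)
  finally show "(\<integral>\<^sup>+z. ennreal (sqavg (bterm c z) m) \<partial>gauss hb) = (\<integral>\<^sup>+z. ?f z \<partial>gauss hb)" by simp
qed

text \<open>Arrays of this kind give polynomials in the conjugate variables. The box matches the
  range of exponents on which averaging over \<open>k + 1\<close> roots is exact.\<close>

definition trunc :: "nat \<Rightarrow> ('n::finite mindex \<Rightarrow> 'n mindex \<Rightarrow> complex) \<Rightarrow> 'n mindex \<Rightarrow> 'n mindex \<Rightarrow> complex" where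
  "trunc k c K L = (if K = 0 \<and> L \<le> (\<lambda>_. k) then c 0 L else 0)"

lemma pc_trunc [simp]: "pc (trunc k c) = trunc k c"
  by (auto simp: pc_def trunc_def fun_eq_iff)

lemma ent2_trunc: "ent2 c \<Longrightarrow> ent2 (trunc k c)"
  by (rule ent2_mono[of c _ 1]) (auto simp: trunc_def)

lemma filterlim_atMost_const:
  "filterlim (\<lambda>k. {..(\<lambda>_::'n::finite. k)}) (finite_subsets_at_top UNIV) sequentially"
  unfolding filterlim_finite_subsets_at_top
proof (intro allI impI)
  fix X :: "'n mindex set" assume X: "finite X \<and> X \<subseteq> UNIV"
  define B where "B = (\<Sum>N\<in>X. msize N)"
  show "\<forall>\<^sub>F k in sequentially. finite {..(\<lambda>_::'n. k)} \<and> X \<subseteq> {..(\<lambda>_. k)} \<and> {..(\<lambda>_::'n. k)} \<subseteq> UNIV"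
  proof (rule eventually_sequentiallyI)
    fix k assume k: "B \<le> k"
    have "N i \<le> k" if "N \<in> X" for N i
    proof -
      have "N i \<le> msize N" unfolding msize_def by (rule member_le_sum) auto
      also have "\<dots> \<le> B" unfolding B_def using X that by (intro member_le_sum) auto
      finally show ?thesis using k by simp
    qed
    then show "finite {..(\<lambda>_::'n. k)} \<and> X \<subseteq> {..(\<lambda>_. k)} \<and> {..(\<lambda>_::'n. k)} \<subseteq> UNIV"
      by (auto simp: le_fun_def)
  qed
qed

lemma tay_trunc_tendsto:
  fixes c :: "'n::finite mindex \<Rightarrow> 'n mindex \<Rightarrow> complex"
  assumes c: "ent2 c" "pc c = c"
  shows "(\<lambda>k. tay (trunc k c) z) \<longlonglongrightarrow> tay c z"
proof -
  have *: "tay (trunc k c) z = (\<Sum>N\<le>(\<lambda>_. k). bterm c z N)" for k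
  proof (rule has_sum_unique)
    show "(bterm (trunc k c) z has_sum tay (trunc k c) z) UNIV"
      using c by (intro bterm_has_sum ent2_trunc) auto
    have "(bterm c z has_sum (\<Sum>N\<le>(\<lambda>_. k). bterm c z N)) {..(\<lambda>_. k)}" by (rule has_sum_finite) simp
    then show "(bterm (trunc k c) z has_sum (\<Sum>N\<le>(\<lambda>_. k). bterm c z N)) UNIV"
      by (subst (asm) has_sum_cong_neutral[where T = UNIV and g = "bterm (trunc k c) z"]) (auto simp: bterm_def trunc_def)
  qed
  show "(\<lambda>k. tay (trunc k c) z) \<longlonglongrightarrow> tay c z"
    unfolding * using filterlim_compose[OF _ filterlim_atMost_const] bterm_has_sum[OF c, of z, unfolded has_sum_def] by blast
qed

text \<open>Fatou's lemma is used once for each inequality. The averages all have the integral of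
  the squared modulus and converge to the diagonal sum. The truncations converge to the function,
  and as their averages are exact, their integrals stay below the full sum. Both sides may be
  infinite.\<close>

lemma parseval:
  fixes c :: "'n::finite mindex \<Rightarrow> 'n mindex \<Rightarrow> complex"
  assumes hb: "hb > 0" and c: "ent2 c" "pc c = c"
  shows "(\<integral>\<^sup>+z. ennreal ((cmod (tay c z))\<^sup>2) \<partial>gauss hb) = h0 (2 * hb) (cabs c) 0 0"
proof (rule antisym)
  have bg: "f \<in> borel_measurable (gauss hb)" if "f \<in> borel_measurable borel" for f :: "complex^'n \<Rightarrow> ennreal"
    using that by (subst measurable_cong_sets[OF sets_gauss refl])
  have "h0 (2 * hb) (cabs c) 0 0 = (\<integral>\<^sup>+z. liminf (\<lambda>m. ennreal (sqavg (bterm c z) m)) \<partial>gauss hb)"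
    unfolding nn_gauss_bterm[OF hb c, symmetric]
  proof (rule nn_integral_cong)
    fix z
    have "(\<lambda>m. ennreal (sqavg (bterm c z) m)) \<longlonglongrightarrow> ennreal (\<Sum>\<^sub>\<infinity>N. (cmod (bterm c z N))\<^sup>2)"
      using sqavg_tendsto[OF bterm_abs_summable[OF c]] by (rule tendsto_ennrealI)
    then show "ennreal (\<Sum>\<^sub>\<infinity>N. (cmod (bterm c z N))\<^sup>2) = liminf (\<lambda>m. ennreal (sqavg (bterm c z) m))"
      by (rule lim_imp_Liminf[OF sequentially_bot, symmetric])
  qed
  also have "\<dots> \<le> liminf (\<lambda>m. \<integral>\<^sup>+z. ennreal (sqavg (bterm c z) m) \<partial>gauss hb)"
    by (rule nn_integral_liminf) (intro bg borel_sqavg c)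
  also have "\<dots> = (\<integral>\<^sup>+z. ennreal ((cmod (tay c z))\<^sup>2) \<partial>gauss hb)"
    unfolding nn_gauss_sqavg[OF c] by (simp add: Liminf_const)
  finally show "h0 (2 * hb) (cabs c) 0 0 \<le> (\<integral>\<^sup>+z. ennreal ((cmod (tay c z))\<^sup>2) \<partial>gauss hb)" .
  have tr: "(\<integral>\<^sup>+z. ennreal ((cmod (tay (trunc k c) z))\<^sup>2) \<partial>gauss hb) \<le> h0 (2 * hb) (cabs c) 0 0" for k
  proof -
    have t: "ent2 (trunc k c)" "pc (trunc k c) = trunc k c" using c by (auto intro: ent2_trunc)
    have "(\<integral>\<^sup>+z. ennreal ((cmod (tay (trunc k c) z))\<^sup>2) \<partial>gauss hb) = (\<integral>\<^sup>+z. ennreal (sqavg (bterm (trunc k c) z) k) \<partial>gauss hb)"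
      by (rule nn_gauss_sqavg[OF t, symmetric])
    also have "\<dots> = (\<integral>\<^sup>+z. ennreal (\<Sum>\<^sub>\<infinity>N. (cmod (bterm (trunc k c) z N))\<^sup>2) \<partial>gauss hb)"
      by (intro nn_integral_cong arg_cong[of _ _ ennreal] sqavg_exact bterm_abs_summable t)
         (auto simp: bterm_def trunc_def split: if_splits)
    also have "\<dots> = h0 (2 * hb) (cabs (trunc k c)) 0 0" by (rule nn_gauss_bterm[OF hb t])
    also have "\<dots> \<le> h0 (2 * hb) (cabs c) 0 0" by (rule h0_mono) (auto simp: cabs_def trunc_def)
    finally show ?thesis .
  qed
  have "(\<integral>\<^sup>+z. ennreal ((cmod (tay c z))\<^sup>2) \<partial>gauss hb) = (\<integral>\<^sup>+z. liminf (\<lambda>k. ennreal ((cmod (tay (trunc k c) z))\<^sup>2)) \<partial>gauss hb)"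
  proof (rule nn_integral_cong)
    fix z
    have "(\<lambda>k. ennreal ((cmod (tay (trunc k c) z))\<^sup>2)) \<longlonglongrightarrow> ennreal ((cmod (tay c z))\<^sup>2)"
      by (intro tendsto_ennrealI tendsto_power tendsto_norm tay_trunc_tendsto c)
    then show "ennreal ((cmod (tay c z))\<^sup>2) = liminf (\<lambda>k. ennreal ((cmod (tay (trunc k c) z))\<^sup>2))"
      by (rule lim_imp_Liminf[OF sequentially_bot, symmetric])
  qed
  also have "\<dots> \<le> liminf (\<lambda>k. \<integral>\<^sup>+z. ennreal ((cmod (tay (trunc k c) z))\<^sup>2) \<partial>gauss hb)"
    by (rule nn_integral_liminf) (intro bg borel_tay ent2_trunc c)
  also have "\<dots> \<le> liminf (\<lambda>k::nat. h0 (2 * hb) (cabs c) 0 0)"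
    by (intro Liminf_mono always_eventually allI tr)
  also have "\<dots> = h0 (2 * hb) (cabs c) 0 0" by (simp add: Liminf_const)
  finally show "(\<integral>\<^sup>+z. ennreal ((cmod (tay c z))\<^sup>2) \<partial>gauss hb) \<le> h0 (2 * hb) (cabs c) 0 0" .
qed

subsection \<open>The Bargmann-Fock space\<close>

text \<open>Elements of the Hilbert space are only known to have this one seminorm finite, so
  closure under linear combinations rests on convexity at the lowest level.\<close>

lemma h0_lincomb:
  assumes c: "h0 t (cabs c) R S < \<infinity>" and d: "h0 t (cabs d) R S < \<infinity>"
  shows "h0 t (cabs (\<lambda>K L. c K L + a * d K L)) R S < \<infinity>"
proof -
  have "h0 t (cabs (\<lambda>K L. c K L + a * d K L)) R S
      \<le> ennreal (1/2) * h0 t (\<lambda>K L. 2 * cabs c K L) R S + ennreal (1 - 1/2) * h0 t (\<lambda>K L. ennreal (2 * cmod a) * cabs d K L) R S"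
  proof (rule h0_convex)
    fix K L
    have "cmod (c K L + a * d K L) \<le> 1/2 * (2 * cmod (c K L)) + (1 - 1/2) * (2 * cmod a * cmod (d K L))"
      using norm_triangle_ineq[of "c K L" "a * d K L"] by (simp add: norm_mult)
    then have "ennreal (cmod (c K L + a * d K L)) \<le> ennreal (1/2 * (2 * cmod (c K L)) + (1 - 1/2) * (2 * cmod a * cmod (d K L)))"
      by (rule ennreal_leI)
    also have "\<dots> = ennreal (1/2) * (ennreal 2 * ennreal (cmod (c K L))) + ennreal (1 - 1/2) * (ennreal (2 * cmod a) * ennreal (cmod (d K L)))"
      by (simp only: ennreal_plus[symmetric] ennreal_mult[symmetric] mult_nonneg_nonneg norm_ge_zero zero_le_numeral
          divide_nonneg_nonneg zero_le_one diff_ge_0_iff_ge half_bounded_equal)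
    finally show "cabs (\<lambda>K L. c K L + a * d K L) K L
       \<le> ennreal (1/2) * (2 * cabs c K L) + ennreal (1 - 1/2) * (ennreal (2 * cmod a) * cabs d K L)"
      by (simp only: cabs_def ennreal_numeral)
  qed simp_all
  also have "\<dots> < \<infinity>"
    unfolding h0_cmult using c d ennreal_less_top[of "1/2"] by (simp add: ennreal_mult_less_top power_less_top_ennreal)
  finally show ?thesis .
qed

lemma borel_gauss: "f \<in> borel_measurable borel \<Longrightarrow> f \<in> borel_measurable (gauss hb)"
  by (subst measurable_cong_sets[OF sets_gauss refl])

lemma borel_tay_norm: "ent2 c \<Longrightarrow> (\<lambda>z. (cmod (tay c z))\<^sup>2) \<in> borel_measurable (gauss hb)"
  by (intro borel_gauss borel_measurable_continuous_onI continuous_on_power continuous_on_norm continuous_tay)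

lemma tay_bf_space_iff:
  assumes hb: "hb > 0" and c: "ent2 c" "pc c = c"
  shows "tay c \<in> bf_space hb \<longleftrightarrow> h0 (2 * hb) (cabs c) 0 0 < \<infinity>"
  using antiholomorphic_tay[OF c(1)] c(2) borel_tay_norm[OF c(1), of hb] parseval[OF hb c]
  by (simp add: bf_space_def integrable_iff_bounded)

lemma bf_spaceD:
  assumes hb: "hb > 0" and \<phi>: "\<phi> \<in> bf_space hb"
  shows "ent2 (coefs \<phi>)" "pc (coefs \<phi>) = coefs \<phi>" "tay (coefs \<phi>) = \<phi>" "h0 (2 * hb) (cabs (coefs \<phi>)) 0 0 < \<infinity>"
proof -
  from \<phi> have "antiholomorphic \<phi>" by (simp add: bf_space_def)
  from antiholomorphic_tay_ex[OF this] obtain c where c: "ent2 c" "pc c = c" "\<phi> = tay c" by blast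
  then have "coefs \<phi> = c" by (simp add: coefs_tay)
  with c \<phi> tay_bf_space_iff[OF hb c(1,2)] 
  show "ent2 (coefs \<phi>)" "pc (coefs \<phi>) = coefs \<phi>" "tay (coefs \<phi>) = \<phi>" "h0 (2 * hb) (cabs (coefs \<phi>)) 0 0 < \<infinity>"
    by simp_all
qed

lemma fock_bf_space: "hb > 0 \<Longrightarrow> \<phi> \<in> fock hb \<Longrightarrow> \<phi> \<in> bf_space hb"
  using tay_bf_space_iff[of hb "coefs \<phi>"] fock_iff[of hb \<phi>] wick_ent2[of hb \<phi>] wick_tay[of hb \<phi>] wick_hfin[of hb \<phi>]
  by (auto simp: hfin_def hh_def dest: spec[of _ "[]"])

lemma bf_lincomb:
  assumes hb: "hb > 0" and \<phi>: "\<phi> \<in> bf_space hb" and \<psi>: "\<psi> \<in> bf_space hb"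
  shows "\<phi> + fscale a \<psi> \<in> bf_space hb" and "coefs (\<phi> + fscale a \<psi>) K L = coefs \<phi> K L + a * coefs \<psi> K L"
proof -
  note p = bf_spaceD[OF hb \<phi>] and q = bf_spaceD[OF hb \<psi>]
  let ?c = "\<lambda>K L. coefs \<phi> K L + a * coefs \<psi> K L"
  have c: "ent2 ?c" by (intro tay_add tay_scale p q)
  have "tay ?c = (\<lambda>z. tay (coefs \<phi>) z + a * tay (coefs \<psi>) z)"
    by (simp only: tay_add(1)[OF p(1) tay_scale(2)[OF q(1)]] tay_scale(1))
  then have eq: "tay ?c = \<phi> + fscale a \<psi>" by (simp add: p q fscale_def fun_eq_iff)
  have "pc ?c = ?c" using p(2) q(2) unfolding pc_eq_self_iff by simp
  with c h0_lincomb[OF p(4) q(4)] show "\<phi> + fscale a \<psi> \<in> bf_space hb"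
    unfolding eq[symmetric] by (simp only: tay_bf_space_iff[OF hb])
  show "coefs (\<phi> + fscale a \<psi>) K L = ?c K L" unfolding eq[symmetric] coefs_tay[OF c] ..
qed

lemma
  assumes hb: "hb > 0" and \<phi>: "\<phi> \<in> bf_space hb"
  shows bf_integrable: "integrable (gauss hb) (\<lambda>z. (cmod (\<phi> z))\<^sup>2)"
    and bf_integral: "(LINT z|gauss hb. (cmod (\<phi> z))\<^sup>2) = (\<Sum>\<^sub>\<infinity>N. (2 * hb) ^ msize N / real (mfact N) * (cmod (coefs \<phi> 0 N))\<^sup>2)"
proof -
  show "integrable (gauss hb) (\<lambda>z. (cmod (\<phi> z))\<^sup>2)" using \<phi> by (simp add: bf_space_def)
  note p = bf_spaceD[OF hb \<phi>]
  have "(LINT z|gauss hb. (cmod (\<phi> z))\<^sup>2) = enn2real (h0 (2 * hb) (cabs (coefs \<phi>)) 0 0)"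
    using parseval[OF hb p(1,2)] borel_tay_norm[OF p(1), of hb] by (subst integral_eq_nn_integral) (simp_all add: p(3))
  also have "\<dots> = (\<Sum>\<^sub>\<infinity>N. (2 * hb) ^ msize N / real (mfact N) * (cmod (coefs \<phi> 0 N))\<^sup>2)"
    unfolding h0_summable(2)[OF hb p(4)] using hb by (intro enn2real_ennreal infsum_nonneg) simp
  finally show "(LINT z|gauss hb. (cmod (\<phi> z))\<^sup>2) = (\<Sum>\<^sub>\<infinity>N. (2 * hb) ^ msize N / real (mfact N) * (cmod (coefs \<phi> 0 N))\<^sup>2)" .
qed

lemma polarization:
  "cnj x * y = (of_real ((cmod (x + 1 * y))\<^sup>2) - of_real ((cmod (x + (- 1) * y))\<^sup>2)
     - \<i> * of_real ((cmod (x + \<i> * y))\<^sup>2) + \<i> * of_real ((cmod (x + (- \<i>) * y))\<^sup>2)) / 4"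
  by (simp only: complex_norm_square) (simp add: field_simps)

text \<open>Polarization: the integral and the weighted sum of coefficients are both assembled from
  the four functions \<open>\<phi> + a * \<psi>\<close> with \<open>a\<close> a fourth root of
  unity, for which the identity of norms is known.\<close>

lemma bf_inner_eq:
  assumes hb: "hb > 0" and \<phi>: "\<phi> \<in> bf_space hb" and \<psi>: "\<psi> \<in> bf_space hb"
  shows "bf_inner hb \<phi> \<psi> = (\<Sum>\<^sub>\<infinity>N. of_real ((2 * hb) ^ msize N / real (mfact N)) * cnj (coefs \<phi> 0 N) * coefs \<psi> 0 N)"
proof -
  let ?w = "\<lambda>N. (2 * hb) ^ msize N / real (mfact N)"
  let ?c = "coefs \<phi> 0" and ?d = "coefs \<psi> 0"
  define I where "I a = (LINT z|gauss hb. (cmod (\<phi> z + a * \<psi> z))\<^sup>2)" for a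
  note lc = bf_lincomb[OF hb \<phi> \<psi>]
  have int: "has_bochner_integral (gauss hb) (\<lambda>z. complex_of_real ((cmod (\<phi> z + a * \<psi> z))\<^sup>2)) (of_real (I a))" for a
    using bf_integrable[OF hb lc(1)[of a]]
    by (intro has_bochner_integral_of_real) (simp add: I_def fscale_def has_bochner_integral_iff)
  have sum: "((\<lambda>N. complex_of_real (?w N) * of_real ((cmod (?c N + a * ?d N))\<^sup>2)) has_sum of_real (I a)) UNIV" for a
  proof -
    have "(\<lambda>N. ?w N * (cmod (?c N + a * ?d N))\<^sup>2) summable_on UNIV"
      using h0_summable(1)[OF hb bf_spaceD(4)[OF hb lc(1)[of a]]] by (simp add: lc(2))
    moreover have "I a = (\<Sum>\<^sub>\<infinity>N. ?w N * (cmod (?c N + a * ?d N))\<^sup>2)"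
      using bf_integral[OF hb lc(1)[of a]] unfolding I_def lc(2) by (simp add: fscale_def)
    ultimately have "((\<lambda>N. ?w N * (cmod (?c N + a * ?d N))\<^sup>2) has_sum I a) UNIV" by simp
    from has_sum_of_real[OF this, where 'a = complex] show ?thesis by (simp only: of_real_mult)
  qed
  let ?J = "(complex_of_real (I 1) - of_real (I (- 1)) - \<i> * of_real (I \<i>) + \<i> * of_real (I (- \<i>))) / 4"
  have "has_bochner_integral (gauss hb) (\<lambda>z. cnj (\<phi> z) * \<psi> z) ?J"
    unfolding polarization
    by (intro has_bochner_integral_divide_zero has_bochner_integral_add has_bochner_integral_diff
        has_bochner_integral_mult_right int)
  then have 1: "bf_inner hb \<phi> \<psi> = ?J"
    unfolding bf_inner_def by (rule has_bochner_integral_integral_eq)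
  have "((\<lambda>N. of_real (?w N) * (cnj (?c N) * ?d N)) has_sum ?J) UNIV"
  proof -
    have "((\<lambda>N. 1 / 4 * (of_real (?w N) * of_real ((cmod (?c N + 1 * ?d N))\<^sup>2)
       + (- 1) * (of_real (?w N) * of_real ((cmod (?c N + (- 1) * ?d N))\<^sup>2))
       + (- \<i>) * (of_real (?w N) * of_real ((cmod (?c N + \<i> * ?d N))\<^sup>2))
       + \<i> * (of_real (?w N) * of_real ((cmod (?c N + (- \<i>) * ?d N))\<^sup>2))))
      has_sum 1 / 4 * (complex_of_real (I 1) + (- 1) * of_real (I (- 1)) + (- \<i>) * of_real (I \<i>) + \<i> * of_real (I (- \<i>)))) UNIV"
      by (rule has_sum_cmult_right, rule has_sum_add, rule has_sum_add, rule has_sum_add)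
         (rule sum has_sum_cmult_right, (rule sum)?)+
    then show ?thesis unfolding polarization by (simp add: algebra_simps add_divide_distrib diff_divide_distrib)
  qed
  from infsumI[OF this] show ?thesis unfolding 1 by (simp only: mult.assoc)
qed

lemma bf_norm_eq:
  assumes hb: "hb > 0" and \<phi>: "\<phi> \<in> bf_space hb"
  shows "ennreal (bf_norm hb \<phi>) = wick_norm 0 hb 0 0 0 0 \<phi>"
proof -
  note p = bf_spaceD[OF hb \<phi>]
  let ?w = "\<lambda>N. (2 * hb) ^ msize N / real (mfact N)"
  have s: "(\<Sum>\<^sub>\<infinity>N. ?w N * (cmod (coefs \<phi> 0 N))\<^sup>2) \<ge> 0" using hb by (intro infsum_nonneg) simp
  have "bf_inner hb \<phi> \<phi> = (\<Sum>\<^sub>\<infinity>N. of_real (?w N * (cmod (coefs \<phi> 0 N))\<^sup>2))"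
    unfolding bf_inner_eq[OF hb \<phi> \<phi>] of_real_mult complex_norm_square by (simp only: ac_simps)
  also have "\<dots> = of_real (\<Sum>\<^sub>\<infinity>N. ?w N * (cmod (coefs \<phi> 0 N))\<^sup>2)"
    by (rule infsumI[OF has_sum_of_real[OF has_sum_infsum[OF h0_summable(1)[OF hb p(4)]]]])
  finally have "bf_norm hb \<phi> = sqrt (\<Sum>\<^sub>\<infinity>N. ?w N * (cmod (coefs \<phi> 0 N))\<^sup>2)"
    by (simp only: bf_norm_def Re_complex_of_real)
  moreover have "wick_h 0 hb 0 0 0 0 \<phi> = ennreal (\<Sum>\<^sub>\<infinity>N. ?w N * (cmod (coefs \<phi> 0 N))\<^sup>2)"
    unfolding wick_h_eq[OF hb] by (simp add: hh_def h0_summable(2)[OF hb p(4)])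
  ultimately show ?thesis
    using s by (simp add: wick_norm_def powr_half_sqrt)
qed

lemma bf_diff:
  assumes hb: "hb > 0" and "\<phi> \<in> bf_space hb" "\<psi> \<in> bf_space hb"
  shows "\<phi> - \<psi> \<in> bf_space hb" and "coefs (\<phi> - \<psi>) K L = coefs \<phi> K L - coefs \<psi> K L"
  using bf_lincomb[OF assms, of "- 1"] by (simp_all add: diff_eq_fscale)

lemma seminorms_bf:
  assumes hb: "hb > 0"
  shows "seminorms (bf_space hb :: 'n::finite cfun set) (-) {\<lambda>\<phi>. ennreal (bf_norm hb \<phi>)}"
proof (unfold_locales, goal_cases)
  case (2 q x)
  then have "q (x - x) = wick_norm 0 hb 0 0 0 0 (x - x)"
    using bf_norm_eq[OF hb bf_diff(1)[OF hb 2(2) 2(2)]] by (simp del: diff_self cancel_comm_monoid_add_class.diff_cancel)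
  also have "\<dots> = 0"
    by (rule wick_norm_eq_0[OF _ hb]) (subst bf_diff(2)[OF hb 2(2) 2(2)], rule diff_self)
  finally show ?case .
next
  case (3 q x y z)
  have "cmod (coefs z K L - coefs x K L) \<le> cmod (coefs z K L - coefs y K L) + cmod (coefs y K L - coefs x K L)" for K L
    using norm_triangle_ineq[of "coefs z K L - coefs y K L" "coefs y K L - coefs x K L"] by simp
  then have "wick_norm 0 hb 0 0 0 0 (z - x) \<le> wick_norm 0 hb 0 0 0 0 (z - y) + wick_norm 0 hb 0 0 0 0 (y - x)"
    using 3 by (intro wick_norm_triangle[OF hb]) (simp only: bf_diff(2)[OF hb])
  then show ?case using 3 by (simp add: bf_norm_eq[OF hb bf_diff(1)[OF hb]])
qed simp

text \<open>Finite support bounds \<open>h0\<close> by a constant, the sum of its finitely many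
  possibly nonzero values, and towers over a constant are finite at every index.\<close>

lemma hfin_trunc:
  fixes c :: "'n::finite mindex \<Rightarrow> 'n mindex \<Rightarrow> complex"
  shows "hfin t (cabs (trunc k c))"
proof -
  let ?a = "cabs (trunc k c)" and ?F = "{..(\<lambda>_::'n. k)}"
  define E where "E = (\<Sum>S\<in>?F. h0 t ?a 0 S)"
  have z: "?a R (N + S) = 0" if "R \<noteq> 0 \<or> \<not> N \<le> (\<lambda>_. k) \<or> \<not> S \<le> (\<lambda>_. k)" for R N S
    using that by (auto simp: cabs_def trunc_def le_fun_def dest: add_leD1 add_leD2)
  have "h0 t ?a 0 S < \<infinity>" for S
  proof -
    have "h0 t ?a 0 S = (\<Sum>\<^sub>\<infinity>N\<in>?F. ennreal (t ^ (msize (0 :: 'n mindex) + msize S + msize N) / real (mfact N)) * (?a 0 (N + S))\<^sup>2)"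
      unfolding h0_def by (rule infsum_cong_neutral) (auto simp: z)
    also have "\<dots> < \<infinity>"
      by (subst infsum_finite) (auto simp: cabs_def ennreal_mult_less_top power_less_top_ennreal)
    finally show ?thesis .
  qed
  then have "E < \<infinity>" unfolding E_def by simp
  moreover have "h0 t ?a R S \<le> E" for R S
  proof (cases "R = 0 \<and> S \<le> (\<lambda>_. k)")
    case True
    then show ?thesis unfolding E_def by (auto intro!: member_le_sum)
  next
    case False
    then have "h0 t ?a R S = 0" unfolding h0_def by (intro infsum_0) (auto simp: z)
    then show ?thesis by simp
  qed
  ultimately show ?thesis
    unfolding hfin_def hh_def
    by (intro allI le_less_trans[OF tower_mono tower_const_finite[of E]])
qed

lemma trunc_fock:
  assumes hb: "hb > 0"
  shows "tay (trunc k c) \<in> fock hb"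
  using wick_tayI[OF hb hfin_trunc[of "2 * hb" k c]] by (simp add: fock_iff[OF hb])

lemma bf_closure_fock:
  assumes hb: "hb > 0"
  shows "bf_top hb closure_of fock hb = (bf_space hb :: 'n::finite cfun set)"
proof
  interpret B: seminorms "bf_space hb :: 'n cfun set" "(-)" "{\<lambda>\<phi>. ennreal (bf_norm hb \<phi>)}"
    by (rule seminorms_bf[OF hb])
  show "bf_top hb closure_of fock hb \<subseteq> (bf_space hb :: 'n cfun set)"
    using closure_of_subset_topspace[of "bf_top hb" "fock hb :: 'n cfun set"] B.topspace by (simp add: bf_top_def)
  show "(bf_space hb :: 'n cfun set) \<subseteq> bf_top hb closure_of fock hb"
  proof
    fix \<phi> :: "'n cfun" assume \<phi>: "\<phi> \<in> bf_space hb"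
    let ?c = "coefs \<phi>"
    note p = bf_spaceD[OF hb \<phi>]
    let ?u = "\<lambda>k. tay (trunc k ?c)"
    have u: "?u k \<in> bf_space hb" for k by (intro fock_bf_space[OF hb] trunc_fock[OF hb])
    have cf: "coefs (?u k - \<phi>) K L = trunc k ?c K L - ?c K L" for k K L
      by (simp add: bf_diff(2)[OF hb u \<phi>] coefs_tay[OF ent2_trunc[OF p(1)]])
    have "limitin B.top ?u \<phi> sequentially"
    proof (rule B.limitin_topI[OF \<phi> u])
      fix q :: "'n cfun \<Rightarrow> ennreal" assume "q \<in> {\<lambda>\<phi>. ennreal (bf_norm hb \<phi>)}"
      then have "q (?u k - \<phi>) = wick_norm 0 hb 0 0 0 0 (?u k - \<phi>)" for k
        using bf_norm_eq[OF hb bf_diff(1)[OF hb u \<phi>]] by simp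
      moreover have "(\<lambda>k. wick_norm 0 hb 0 0 0 0 (?u k - \<phi>)) \<longlonglongrightarrow> 0"
      proof (rule wick_norm_tendsto_0[OF hb])
        let ?g = "\<lambda>k N. ennreal ((2 * hb) ^ (msize (0 :: 'n mindex) + msize (0 :: 'n mindex) + msize N) / real (mfact N)) * (cabs (coefs (?u k - \<phi>)) 0 (N + 0))\<^sup>2"
        let ?d = "\<lambda>N. ennreal ((2 * hb) ^ (msize (0 :: 'n mindex) + msize (0 :: 'n mindex) + msize N) / real (mfact N)) * (cabs ?c 0 (N + 0))\<^sup>2"
        have "(\<lambda>k. infsum (?g k) UNIV) \<longlonglongrightarrow> 0"
        \<comment> \<open>Truncation only removes coefficients, so the summands of the norm of
          \<open>\<phi>\<close> itself dominate those of the difference.\<close>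
        proof (rule infsum_tendsto_0_ennreal)
          show "?g k N \<le> ?d N" for k N
            by (intro mult_left_mono power_mono) (auto simp: cabs_def cf trunc_def)
          show "infsum ?d UNIV < \<infinity>" using p(4) by (simp only: h0_def)
          show "(\<lambda>k. ?g k N) \<longlonglongrightarrow> 0" for N
          proof (rule tendsto_eventually, rule eventually_sequentiallyI)
            fix k assume k: "msize N \<le> k"
            have "N i \<le> k" for i using member_le_sum[of i UNIV N] k by (simp add: msize_def)
            then have "N \<le> (\<lambda>_. k)" by (simp add: le_fun_def)
            then show "?g k N = 0" by (simp add: cabs_def cf trunc_def)
          qed
        qed
        then show "(\<lambda>k. wick_h 0 hb 0 0 0 0 (?u k - \<phi>)) \<longlonglongrightarrow> 0"
          unfolding wick_h_eq[OF hb] hh_def wbits.simps tower.simps h0_def .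
      qed
      ultimately show "(\<lambda>k. q (?u k - \<phi>)) \<longlonglongrightarrow> 0" by simp
    qed
    then have lim: "\<phi> \<in> topspace B.top" "\<And>T. openin B.top T \<Longrightarrow> \<phi> \<in> T \<Longrightarrow> \<forall>\<^sub>F k in sequentially. ?u k \<in> T"
      unfolding limitin_def by auto
    show "\<phi> \<in> bf_top hb closure_of fock hb"
      unfolding in_closure_of bf_top_def
    proof (intro conjI allI impI)
      show "\<phi> \<in> topspace B.top" by (rule lim)
      fix T assume T: "\<phi> \<in> T \<and> openin B.top T"
      then have "\<forall>\<^sub>F k in sequentially. ?u k \<in> T" by (intro lim) auto
      then obtain k where "?u k \<in> T" by (auto simp: eventually_sequentially)
      then show "\<exists>y. y \<in> fock hb \<and> y \<in> T" using trunc_fock[OF hb] by blast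
    qed
  qed
qed

text \<open>The comparison is continuity of the identity map; on the image of \<open>Psi\<close> the
  Hilbert norm is the member of \<open>sn hb\<close> with all indices zero.\<close>

lemma fock_top_finer:
  assumes hb: "hb > 0" and U: "openin (subtopology (bf_top hb) (fock hb)) (U :: 'n::finite cfun set)"
  shows "openin (fock_top hb) U"
proof -
  have sub: "(fock hb :: 'n cfun set) \<subseteq> bf_space hb" using fock_bf_space[OF hb] by blast
  note B = seminorms_bf[OF hb, where 'n = 'n]
  note sB = seminorms.sub[OF B sub]
  have "continuous_map (fock_top hb) (subtopology (bf_top hb) (fock hb)) (\<lambda>\<phi> :: 'n cfun. \<phi>)"
    unfolding fock_top_eq[OF hb] bf_top_def seminorms.subtopology[OF B sub]
  proof (rule continuous_map_seminorms[OF seminorms_fock[OF hb] sB])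
    fix q :: "'n cfun \<Rightarrow> ennreal" assume "q \<in> {\<lambda>\<phi>. ennreal (bf_norm hb \<phi>)}"
    then have "q (y - x) = wick_norm 0 hb 0 0 0 0 (y - x)" if "x \<in> fock hb" "y \<in> fock hb" for x y
      using bf_norm_eq[OF hb bf_diff(1)[OF hb]] sub that by blast
    moreover have "wick_norm 0 hb 0 0 0 0 \<in> (sn hb :: ('n cfun \<Rightarrow> ennreal) set)"
      unfolding sn_def by (auto intro!: exI[of _ "0 :: nat"])
    ultimately show "\<exists>p\<in>sn hb. \<forall>x\<in>fock hb. \<forall>y\<in>fock hb. q (y - x) \<le> p (y - x)"
      by (metis order_refl)
  qed
  from openin_continuous_map_preimage[OF this U]
  have "openin (fock_top hb) {x \<in> topspace (fock_top hb). x \<in> U}" .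
  moreover have "U \<subseteq> topspace (fock_top hb)"
    using openin_subset[OF U] seminorms.topspace[OF seminorms_fock[OF hb, where 'n = 'n]] by (auto simp: fock_top_eq[OF hb])
  ultimately show ?thesis by (simp add: Collect_conj_eq Int_absorb1)
qed

lemma csubspace_fock: "hb > 0 \<Longrightarrow> csubspace (fock hb)"
  unfolding csubspace_def
  by (simp add: fock_iff pc_eq_self_iff wick_0 wick_add wick_scale coefs_0 coefs_add coefs_scale)

text \<open>Only the derivatives \<open>coefs u 0 N\<close> and \<open>coefs v 0 N\<close> enter,
  and these are constant on cosets.\<close>

lemma gns_inner_gcls:
  assumes hb: "hb > 0" and f: "f \<in> wick hb" and g: "g \<in> wick hb"
  shows "gns_inner hb (gcls hb f) (gcls hb g) = delta0 (star hb (fconj f) g)"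
proof -
  have c: "u \<in> wick hb \<and> (\<forall>N. coefs u 0 N = coefs f 0 N)" if "u \<in> gcls hb f" "f \<in> wick hb" for u f
  proof -
    have u: "u \<in> wick hb" "Psi u = Psi f" using that mem_gcls[OF hb that(2)] by auto
    have "pc (coefs u) 0 N = pc (coefs f) 0 N" for N
      using coefs_Psi[OF hb u(1)] coefs_Psi[OF hb that(2)] u(2) by simp
    then show ?thesis using u(1) by (simp add: pc_def)
  qed
  have "delta0 (star hb (fconj u) v) = delta0 (star hb (fconj f) g)" if "u \<in> gcls hb f" "v \<in> gcls hb g" for u v
    using c[OF that(1) f] c[OF that(2) g] by (simp add: delta0_star[OF hb] f g)
  moreover have "f \<in> gcls hb f" "g \<in> gcls hb g" using mem_gcls[OF hb] f g by auto
  ultimately have "{delta0 (star hb (fconj u) v) | u v. u \<in> gcls hb f \<and> v \<in> gcls hb g} = {delta0 (star hb (fconj f) g)}"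
    by blast
  then show ?thesis by (simp add: gns_inner_def)
qed

lemma bf_inner_Psi:
  assumes hb: "hb > 0" and f: "f \<in> wick hb" and g: "g \<in> wick hb"
  shows "bf_inner hb (Psi f) (Psi g) = delta0 (star hb (fconj f) g)"
  using bf_inner_eq[OF hb fock_bf_space[OF hb Psi_in_fock[OF f]] fock_bf_space[OF hb Psi_in_fock[OF g]]]
  by (simp add: delta0_star[OF hb f g] coefs_Psi[OF hb f] coefs_Psi[OF hb g] pc_def)

theorem theorem6p2:
  fixes hb :: real
  assumes hb: "hb > 0"
  shows
    "\<comment> \<open>(i)\<close>
     (Psi ` (wick hb :: 'n::finite cfun set) \<subseteq> wick hb \<and>
      (\<forall>f \<in> (wick hb :: 'n cfun set). \<forall>z. ((\<lambda>I. Psi_term f I z) has_sum Psi f z) UNIV) \<and>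
      clinear_on (wick hb :: 'n cfun set) Psi \<and>
      (\<forall>f \<in> (wick hb :: 'n cfun set). Psi (Psi f) = Psi f) \<and>
      continuous_map (wick_top hb) (wick_top hb) (Psi :: 'n cfun \<Rightarrow> 'n cfun) \<and>
      {f \<in> (wick hb :: 'n cfun set). Psi f = 0} = gelfand hb \<and>
      (\<forall>f \<in> (wick hb :: 'n cfun set). \<forall>m l R S. l < 2 ^ m \<longrightarrow>
         wick_norm 0 hb m l R S (Psi f) \<le> wick_norm 0 hb m l R S f) \<and>
      (\<forall>f \<in> (wick hb :: 'n cfun set).
         (\<forall>m l R S. l < 2 ^ m \<longrightarrow>
            wick_norm 0 hb m l R S (Psi f) = wick_norm 0 hb m l R S f) \<longleftrightarrow> antiholomorphic f))
     \<and>
     \<comment> \<open>(ii)\<close>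
     ((\<forall>f \<in> (wick hb :: 'n cfun set). gns_to_fock (gcls hb f) = Psi f) \<and>
      (\<forall>c \<in> (gns_space hb :: 'n cfun set set). \<forall>d \<in> gns_space hb.
         gns_to_fock (gns_add c d) = gns_to_fock c + gns_to_fock d) \<and>
      (\<forall>a. \<forall>c \<in> (gns_space hb :: 'n cfun set set).
         gns_to_fock (gns_scale hb a c) = fscale a (gns_to_fock c)) \<and>
      bij_betw gns_to_fock (gns_space hb :: 'n cfun set set) (fock hb) \<and>
      homeomorphic_map (gns_top hb) (fock_top hb) (gns_to_fock :: 'n cfun set \<Rightarrow> 'n cfun) \<and>
      (\<forall>f \<in> (wick hb :: 'n cfun set). \<forall>m l R S. l < 2 ^ m \<longrightarrow>
         gns_norm hb m l R S (gcls hb f) = wick_norm 0 hb m l R S (Psi f)))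
     \<and>
     \<comment> \<open>(iii)\<close>
     (csubspace (fock hb :: 'n cfun set) \<and>
      fock hb \<subseteq> (bf_space hb :: 'n cfun set) \<and>
      bf_top hb closure_of fock hb = (bf_space hb :: 'n cfun set) \<and>
      (\<forall>f \<in> (wick hb :: 'n cfun set). \<forall>g \<in> wick hb.
         bf_inner hb (Psi f) (Psi g) = gns_inner hb (gcls hb f) (gcls hb g) \<and>
         gns_inner hb (gcls hb f) (gcls hb g) = delta0 (star hb (fconj f) g)) \<and>
      (\<forall>U :: 'n cfun set. openin (subtopology (bf_top hb) (fock hb)) U \<longrightarrow>
         openin (fock_top hb) U))
     \<and>
     \<comment> \<open>(iv)\<close>
     ((\<forall>f \<in> (wick hb :: 'n cfun set). \<forall>c \<in> gns_space hb.
         gns_rep hb f c \<in> gns_space hb \<and>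
         gns_to_fock (gns_rep hb f c) = bf_rep hb f (gns_to_fock c)) \<and>
      (\<forall>f \<in> (wick hb :: 'n cfun set). \<forall>g \<in> wick hb.
         gns_rep hb f (gcls hb g) = gcls hb (star hb f g) \<and>
         (\<forall>I. series_limit (fock_top hb) (symbol_term f I) (symbol f I)) \<and>
         series_limit (fock_top hb) (bf_rep_term hb f (Psi g)) (bf_rep hb f (Psi g)) \<and>
         (\<forall>z. bf_rep hb f (Psi g) z = (\<Sum>\<^sub>\<infinity>I\<in>UNIV. bf_rep_term hb f (Psi g) I z))))
     \<and>
     \<comment> \<open>(v)\<close>
     ((\<forall>f \<in> (wick hb :: 'n cfun set). clinear_on (fock hb) (bf_rep hb f)) \<and>
      (\<forall>\<phi> \<in> (fock hb :: 'n cfun set). clinear_on (wick hb) (\<lambda>f. bf_rep hb f \<phi>)) \<and>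
      continuous_map (prod_topology (wick_top hb) (fock_top hb)) (fock_top hb)
        (\<lambda>(f :: 'n cfun, \<phi>). bf_rep hb f \<phi>))"
proof -
  have wick_Psi: "Psi f \<in> wick hb" if "f \<in> wick hb" for f :: "'n cfun"
    by (rule Psi_wick[OF hb that])
  have Psi0: "Psi (0 :: 'n cfun) = 0"
    using Psi_fock[OF hb] csubspace_fock[OF hb] by (auto simp: csubspace_def)
  have kernel: "{f \<in> (wick hb :: 'n cfun set). Psi f = 0} = gelfand hb"
    using Psi_eq_iff[OF hb _ wick_0[OF hb]] gelfand_wick by (auto simp: Psi0)
  have "Psi ` (wick hb :: 'n cfun set) \<subseteq> wick hb" using wick_Psi by blast
  moreover have "\<forall>f \<in> (wick hb :: 'n cfun set). \<forall>z. ((\<lambda>I. Psi_term f I z) has_sum Psi f z) UNIV"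
    using Psi_has_sum[OF wick_ent2[OF hb]] by blast
  moreover have "clinear_on (wick hb :: 'n cfun set) Psi"
    unfolding clinear_on_def using Psi_linear(1)[OF hb] Psi_linear(2)[OF hb] by blast
  moreover have "\<forall>f \<in> (wick hb :: 'n cfun set). Psi (Psi f) = Psi f"
    using Psi_fock[OF hb Psi_in_fock] by blast
  moreover note continuous_Psi[OF hb, where 'n = 'n] kernel
  moreover have "\<forall>f \<in> (wick hb :: 'n cfun set). \<forall>m l R S. l < 2 ^ m \<longrightarrow>
      wick_norm 0 hb m l R S (Psi f) \<le> wick_norm 0 hb m l R S f"
    using wick_norm_Psi_le[OF hb] by blast
  moreover have "\<forall>f \<in> (wick hb :: 'n cfun set). (\<forall>m l R S. l < 2 ^ m \<longrightarrow>
      wick_norm 0 hb m l R S (Psi f) = wick_norm 0 hb m l R S f) \<longleftrightarrow> antiholomorphic f"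
    by (intro ballI Psi_eq_self_iff[OF hb])
  moreover have "\<forall>f \<in> (wick hb :: 'n cfun set). gns_to_fock (gcls hb f) = Psi f"
    using gns_to_fock_gcls[OF hb] by blast
  moreover have "\<forall>c \<in> (gns_space hb :: 'n cfun set set). \<forall>d \<in> gns_space hb.
      gns_to_fock (gns_add c d) = gns_to_fock c + gns_to_fock d"
    by (auto simp: gns_space_def gcls_add[OF hb] gns_to_fock_gcls[OF hb] wick_add[OF hb] Psi_linear(1)[OF hb]
        simp del: plus_fun_apply)
  moreover have "\<forall>a. \<forall>c \<in> (gns_space hb :: 'n cfun set set).
      gns_to_fock (gns_scale hb a c) = fscale a (gns_to_fock c)"
    by (auto simp: gns_space_def gcls_scale[OF hb] gns_to_fock_gcls[OF hb] wick_scale[OF hb] Psi_linear(2)[OF hb])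
  moreover note bij_gns_to_fock[OF hb, where 'n = 'n] homeomorphic_gns_to_fock[OF hb, where 'n = 'n]
  moreover have "\<forall>f \<in> (wick hb :: 'n cfun set). \<forall>m l R S. l < 2 ^ m \<longrightarrow>
      gns_norm hb m l R S (gcls hb f) = wick_norm 0 hb m l R S (Psi f)"
    using gns_norm_eq[OF hb] by blast
  moreover have "csubspace (fock hb :: 'n cfun set)" by (rule csubspace_fock[OF hb])
  moreover have "fock hb \<subseteq> (bf_space hb :: 'n cfun set)" using fock_bf_space[OF hb] by blast
  moreover note bf_closure_fock[OF hb, where 'n = 'n]
  moreover have "\<forall>f \<in> (wick hb :: 'n cfun set). \<forall>g \<in> wick hb.
      bf_inner hb (Psi f) (Psi g) = gns_inner hb (gcls hb f) (gcls hb g) \<and>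
      gns_inner hb (gcls hb f) (gcls hb g) = delta0 (star hb (fconj f) g)"
    by (simp add: bf_inner_Psi[OF hb] gns_inner_gcls[OF hb])
  moreover have "\<forall>U :: 'n cfun set. openin (subtopology (bf_top hb) (fock hb)) U \<longrightarrow> openin (fock_top hb) U"
    using fock_top_finer[OF hb] by blast
  moreover have "\<forall>f \<in> (wick hb :: 'n cfun set). \<forall>c \<in> gns_space hb. gns_rep hb f c \<in> gns_space hb \<and>
      gns_to_fock (gns_rep hb f c) = bf_rep hb f (gns_to_fock c)"
    by (auto simp: gns_space_def gns_rep_gcls[OF hb] star_wick[OF hb] gns_to_fock_gcls[OF hb] bf_rep_Psi[OF hb])
  moreover have "\<forall>f \<in> (wick hb :: 'n cfun set). \<forall>g \<in> wick hb.
      gns_rep hb f (gcls hb g) = gcls hb (star hb f g) \<and>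
      (\<forall>I. series_limit (fock_top hb) (symbol_term f I) (symbol f I)) \<and>
      series_limit (fock_top hb) (bf_rep_term hb f (Psi g)) (bf_rep hb f (Psi g)) \<and>
      (\<forall>z. bf_rep hb f (Psi g) z = (\<Sum>\<^sub>\<infinity>I\<in>UNIV. bf_rep_term hb f (Psi g) I z))"
    using gns_rep_gcls[OF hb] symbol_series[OF hb] bf_rep_series[OF hb] bf_rep_pointwise[OF hb] by blast
  moreover have "\<forall>f \<in> (wick hb :: 'n cfun set). clinear_on (fock hb) (bf_rep hb f)"
    and "\<forall>\<phi> \<in> (fock hb :: 'n cfun set). clinear_on (wick hb) (\<lambda>f. bf_rep hb f \<phi>)"
    using bf_rep_linear[OF hb] by blast+
  moreover note bf_rep_continuous[OF hb, where 'n = 'n]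
  ultimately show ?thesis by (intro conjI)
qed

end
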